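(* Let $L$ be a lattice of signature $(2,n)$ with $n\ge3$, let $\Gamma$ be a finite-index subgroup of $\mathrm O^+(L)$, let $J\subset L$ be a primitive isotropic sublattice of rank $2$, let $\lambda=(\lambda_1\ge\cdots\ge\lambda_n\ge0)$ be a partition with ${}^t\lambda_1+{}^t\lambda_2\le n$ and $\lambda\neq\det$, let $k\in\mathbb Z$ and let $m>0$ be an integer. Then $J_{\lambda,k,m}(\Gamma(J)_{\mathbb Z})=0$ when $k+\lambda_1<n/2-1$.
   Context: Basic setting. A lattice is a free $\mathbb Z$-module of finite rank with a nondegenerate symmetric bilinear form with values in $\mathbb Z$; $L_F=L\otimes_{\mathbb Z}F$. $\mathcal D$ is a fixed connected component of $\{[\omega]\in\mathbb P(L_{\mathbb C}) : (\omega,\omega)=0,\ (\omega,\bar\omega)>0\}$; $\mathrm O^+(L)$ is the subgroup of $\mathrm O(L)$ preserving $\mathcal D$. Over $\mathcal D$: $\mathcal L\subset L_{\mathbb C}\otimes\mathcal O_{\mathcal D}$ is the tautological line bundle (fiber $\mathbb C\omega$) and $\mathcal E=\mathcal L^\perp/\mathcal L$ with its induced quadratic form. For a partition $\lambda$ as in the claim, $d=|\lambda|$ and an $n$-dimensional complex quadratic space $V$, $V^{[d]}\subset V^{\otimes d}$ is the intersection of the kernels of all contractions and $V_\lambda=c_\lambda\cdot V^{[d]}$ with $c_\lambda=b_\lambda a_\lambda$ the Young symmetrizer of the column canonical tableau ($a_\lambda$ the sum over the row subgroup, $b_\lambda$ the signed sum over the column subgroup). $\det$ corresponds to $(1^n)$.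 Applied fiberwise to $\mathcal E$ this gives $\mathcal E_\lambda$; $\mathcal E_{\lambda,k}=\mathcal E_\lambda\otimes\mathcal L^{\otimes k}$. $I$-trivialization and tube domain. For a primitive isotropic $I\subset L$ of rank $1$, put $V(I)=(I^\perp/I)_{\mathbb C}$. The pairing with $I_{\mathbb C}$ gives $\mathcal L\simeq I_{\mathbb C}^\vee\otimes\mathcal O_{\mathcal D}$, and $I_{\mathbb C}^\perp/I_{\mathbb C}\leftarrow I_{\mathbb C}^\perp\cap\omega^\perp\to\omega^\perp/\mathbb C\omega$ give $\mathcal E\simeq V(I)\otimes\mathcal O_{\mathcal D}$; hence $\mathcal E_{\lambda,k}\simeq V(I)_{\lambda,k}\otimes\mathcal O_{\mathcal D}$, $V(I)_{\lambda,k}=V(I)_\lambda\otimes(I_{\mathbb C}^\vee)^{\otimes k}$. Let $U(I)_F=(I^\perp/I)_F\otimes I_F$ (generators of $I$ given norm $1$). Choose a rank $1$ isotropic $I'\subset L$ with $(I,I')\ne0$; with $e$ a generator of $I$, $e'\in I'_{\mathbb Q}$, $(e,e')=1$ and $V(I)=(I\oplus I')_{\mathbb C}^\perp$, the map $z\otimes e\mapsto[e'+z-\frac12(z,z)e]$ identifies $\{Z\in U(I)_{\mathbb C}:\mathrm{Im}(Z)\in\mathcal C_I\}$ with $\mathcal D$, for one component $\mathcal C_I$ of $\{v\in U(I)_{\mathbb R}:(v,v)>0\}$. The $J$-cusp. For $F=\mathbb Q,\mathbb R$, $\Gamma(J)_F$ is the group of isometries of $L_F$ preserving $J_F$ and acting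 trivially on $\wedge^2J_F$ and $(J^\perp/J)_F$; $U(J)_F\subset\Gamma(J)_F$ is the subgroup acting trivially on $J_F^\perp$ ($\simeq\wedge^2J_F$, central). $\Gamma(J)_{\mathbb Z}=\Gamma(J)_{\mathbb Q}\cap\Gamma$, $U(J)_{\mathbb Z}=U(J)_{\mathbb Q}\cap\Gamma\simeq\mathbb Z$, $\overline{\Gamma(J)}_{\mathbb Z}=\Gamma(J)_{\mathbb Z}/U(J)_{\mathbb Z}$. The projection $\mathbb PL_{\mathbb C}\dashrightarrow\mathbb P(L/J)_{\mathbb C}$ restricts to $\mathcal D\to\mathcal V_J$ (onto its image), a bundle of upper half planes on whose fibers $U(J)_{\mathbb R}$ acts by real translations. $\mathcal X(J)=\mathcal D/U(J)_{\mathbb Z}$ is a punctured disc bundle over $\mathcal V_J$; $\overline{\mathcal X(J)}$ is the disc bundle obtained by filling in the origins, $\Delta_J\simeq\mathcal V_J$ its boundary divisor and $\Theta_J$ the conormal bundle of $\Delta_J$. For $I\subset J$ the $I$-trivialization descends to $\mathcal X(J)$ and $\mathcal E_{\lambda,k}$ is extended over $\overline{\mathcal X(J)}$ so that it becomes $V(I)_{\lambda,k}\otimes\mathcal O_{\overline{\mathcal X(J)}}$ (independent of $I\subset J$); $\overline{\Gamma(J)}_{\mathbb Z}$ acts on it and on $\Theta_J$. Jacobi forms. Let $I\subset J$ be primitive of rank $1$. Then $U(J)_F=(J/I)_F\otimes I_F$ is an isotropic line in $U(I)_F$ and $\mathcal D\to\mathcal V_J$ is the restriction of $U(I)_{\mathbb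 C}\to U(I)_{\mathbb C}/U(J)_{\mathbb C}$, so $\Delta_J\subset U(I)_{\mathbb C}/U(J)_{\mathbb C}$. Let $v_{J,\Gamma}$ be the generator of $U(J)_{\mathbb Z}$ lying in $\overline{\mathcal C_I}$ and choose an isotropic $l_{J,\Gamma}\in U(I)_{\mathbb Q}$ with $(v_{J,\Gamma},l_{J,\Gamma})=1$. The function $\omega_J=\exp(2\pi i(l_{J,\Gamma},Z))$ descends to $\mathcal X(J)$ and extends to a generator of the ideal sheaf of $\Delta_J$; together with the $I$-trivialization it gives $\mathcal E_{\lambda,k}|_{\Delta_J}\otimes\Theta_J^{\otimes m}\simeq V(I)_{\lambda,k}\otimes\mathcal O_{\Delta_J}$. A $\overline{\Gamma(J)}_{\mathbb Z}$-invariant holomorphic section $\phi$ of $\mathcal E_{\lambda,k}|_{\Delta_J}\otimes\Theta_J^{\otimes m}$ over $\Delta_J$ then has a Fourier expansion $\sum_l a(l)\exp(2\pi i(l,Z))$ with $l$ in a full lattice of $U(J)_{\mathbb Q}^\perp\subset U(I)_{\mathbb Q}$; it is holomorphic at the $I$-cusp if $a(l)\ne0$ only when $(ml_{J,\Gamma}+l,ml_{J,\Gamma}+l)\ge0$ (independent of $I',l_{J,\Gamma}$). $J_{\lambda,k,m}(\Gamma(J)_{\mathbb Z})$ is the space of such $\phi$ that are holomorphic at every cusp $I\subset J$. *)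

theory Defs
  imports "HOL-Analysis.Analysis" "HOL-Algebra.Coset"
begin

text \<open>
  Lattices. After the choice of a basis a lattice \<open>L\<close> of rank \<open>N\<close> is \<open>\<int>\<^sup>N\<close> with an integral Gram
  matrix \<open>G\<close>. All of \<open>L\<close>, \<open>L_\<rat>\<close>, \<open>L_\<real>\<close>, \<open>L_\<complex>\<close> live in the type \<open>complex^'N\<close>, as the sets
  \<open>coords F\<close> of vectors with coordinates in \<open>F = \<int>, \<rat>, \<real>, UNIV\<close>.
\<close>

definition bil :: "int^'N^'N \<Rightarrow> 'a::comm_ring_1^'N \<Rightarrow> 'a^'N \<Rightarrow> 'a" where
  "bil G x y = (\<Sum>i\<in>UNIV. \<Sum>j\<in>UNIV. x $ i * of_int (G $ i $ j) * y $ j)"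

definition is_lattice :: "int^'N^'N \<Rightarrow> bool" where
  "is_lattice G \<longleftrightarrow> transpose G = G \<and> det G \<noteq> 0"

definition has_signature :: "int^'N^'N \<Rightarrow> nat \<Rightarrow> nat \<Rightarrow> bool" where
  "has_signature G p q \<longleftrightarrow> p + q = CARD('N) \<and>
     (\<exists>(P :: (real^'N) set) (M :: (real^'N) set). subspace P \<and> subspace M \<and> dim P = p \<and> dim M = q \<and>
        (\<forall>x\<in>P. x \<noteq> 0 \<longrightarrow> bil G x x > 0) \<and> (\<forall>x\<in>M. x \<noteq> 0 \<longrightarrow> bil G x x < 0))"

definition coords :: "complex set \<Rightarrow> (complex^'N) set" where
  "coords F = {x. \<forall>i. x $ i \<in> F}"

definition span_over :: "complex set \<Rightarrow> (complex^'N) set \<Rightarrow> (complex^'N) set" where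
  "span_over F S = {(\<Sum>x\<in>T. c x *s x) | T c. finite T \<and> T \<subseteq> S \<and> c ` T \<subseteq> F}"

text \<open>The rank of a subgroup of \<open>\<int>\<^sup>N\<close> is the dimension of its complex span.\<close>

definition primitive_isotropic :: "int^'N^'N \<Rightarrow> (complex^'N) set \<Rightarrow> nat \<Rightarrow> bool" where
  "primitive_isotropic G K r \<longleftrightarrow>
     K \<subseteq> coords \<int> \<and> 0 \<in> K \<and> (\<forall>x\<in>K. \<forall>y\<in>K. x - y \<in> K) \<and>
     (\<forall>x\<in>coords \<int>. \<forall>a::int. a \<noteq> 0 \<longrightarrow> of_int a *s x \<in> K \<longrightarrow> x \<in> K) \<and>
     (\<forall>x\<in>K. \<forall>y\<in>K. bil G x y = 0) \<and>
     vec.dim K = r"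

text \<open>
  The period domain. Subsets of projective space are represented by their affine cones. As
  nonzero scalars form a connected group, the connected components of the cone below are the
  cones over the two connected components of its image in projective space; \<open>\<D>\<close> is one of them.
\<close>

definition conj_vec :: "complex^'N \<Rightarrow> complex^'N" where
  "conj_vec w = (\<chi> i. cnj (w $ i))"

definition period_cone :: "int^'N^'N \<Rightarrow> (complex^'N) set" where
  "period_cone G = {w. bil G w w = 0 \<and> Re (bil G w (conj_vec w)) > 0}"

text \<open>Isometries of \<open>L_F\<close>. For \<open>F = \<int>\<close> they are invertible over \<open>\<int>\<close>, since \<open>det G \<noteq> 0\<close>.\<close>

definition isometries :: "int^'N^'N \<Rightarrow> complex set \<Rightarrow> (complex^'N^'N) set" where
  "isometries G F = {g. (\<forall>i j. g $ i $ j \<in> F) \<and> (\<forall>x y. bil G (g *v x) (g *v y) = bil G x y)}"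

definition Oplus :: "int^'N^'N \<Rightarrow> (complex^'N) set \<Rightarrow> (complex^'N^'N) monoid" where
  "Oplus G D =
     \<lparr>carrier = {g \<in> isometries G \<int>. (\<lambda>w. g *v w) ` D = D}, monoid.mult = (**), one = mat 1\<rparr>"


subsection \<open>Partitions, tensors, orthogonal Schur functors\<close>

text \<open>\<open>conj_part lam j\<close> is the \<open>j\<close>-th part (\<open>j \<ge> 1\<close>) of the transposed partition.\<close>

definition conj_part :: "nat list \<Rightarrow> nat \<Rightarrow> nat" where
  "conj_part lam j = card {i. i < length lam \<and> j \<le> lam ! i}"

text \<open>
  The column canonical tableau: the boxes are numbered down the first column, then down the
  second one, and so on. Rows, columns and entries are counted from \<open>0\<close>.
\<close>

definition tableau :: "nat list \<Rightarrow> nat \<Rightarrow> nat \<Rightarrow> nat" where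
  "tableau lam r c = (\<Sum>j=1..c. conj_part lam j) + r"

definition row_group :: "nat list \<Rightarrow> (nat \<Rightarrow> nat) set" where
  "row_group lam = {s. s permutes {..<sum_list lam} \<and>
     (\<forall>r<length lam. s ` {tableau lam r c | c. c < lam ! r} = {tableau lam r c | c. c < lam ! r})}"

definition column_group :: "nat list \<Rightarrow> (nat \<Rightarrow> nat) set" where
  "column_group lam = {s. s permutes {..<sum_list lam} \<and>
     (\<forall>c. s ` {tableau lam r c | r. r < conj_part lam (Suc c)} =
              {tableau lam r c | r. r < conj_part lam (Suc c)})}"

text \<open>
  An element of \<open>(\<complex>\<^sup>N)\<^bsup>\<otimes>d\<^esup>\<close> is the function giving its coordinates, indexed by the lists of
  length \<open>d\<close> of indices, and extended by \<open>0\<close> to lists of other lengths.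
\<close>

type_synonym 'N tensor = "'N list \<Rightarrow> complex"

definition pure_tensor :: "(complex^'N) list \<Rightarrow> 'N tensor" where
  "pure_tensor vs = (\<lambda>is. if length is = length vs then \<Prod>j<length vs. (vs ! j) $ (is ! j) else 0)"

definition tensor_power :: "nat \<Rightarrow> (complex^'N) set \<Rightarrow> 'N tensor set" where
  "tensor_power d V =
     {(\<lambda>is. \<Sum>t\<in>S. c t * t is) | S c.
        finite S \<and> S \<subseteq> pure_tensor ` {vs. length vs = d \<and> set vs \<subseteq> V}}"

definition tensor_map :: "nat \<Rightarrow> (complex^'N \<Rightarrow> complex^'N) \<Rightarrow> 'N tensor \<Rightarrow> 'N tensor" where
  "tensor_map d f T = (\<lambda>is. if length is = d
     then \<Sum>js | length js = d. (\<Prod>p<d. f (axis (js ! p) 1) $ (is ! p)) * T js else 0)"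

text \<open>
  \<open>V\<^bsup>[d]\<^esup>\<close>, for the quadratic form induced by \<open>G\<close> on a subspace \<open>V\<close> of \<open>\<complex>\<^sup>N\<close>: the contraction in
  the positions \<open>length xs\<close> and \<open>length xs + 1 + length ys\<close> has the coordinate below at the
  index \<open>xs @ ys @ zs\<close>.
\<close>

definition traceless :: "int^'N^'N \<Rightarrow> nat \<Rightarrow> (complex^'N) set \<Rightarrow> 'N tensor set" where
  "traceless G d V = {T \<in> tensor_power d V.
     \<forall>xs ys zs. length xs + length ys + length zs + 2 = d \<longrightarrow>
       (\<Sum>i\<in>UNIV. \<Sum>j\<in>UNIV. of_int (G $ i $ j) * T (xs @ i # ys @ j # zs)) = 0}"

text \<open>The left action, which moves the factor in position \<open>j\<close> to position \<open>s j\<close>.\<close>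

definition perm_act :: "nat \<Rightarrow> (nat \<Rightarrow> nat) \<Rightarrow> 'N tensor \<Rightarrow> 'N tensor" where
  "perm_act d s T = (\<lambda>is. if length is = d then T (map (\<lambda>j. is ! s j) [0..<d]) else 0)"

definition young_a :: "nat list \<Rightarrow> 'N tensor \<Rightarrow> 'N tensor" where
  "young_a lam T = (\<lambda>is. \<Sum>s\<in>row_group lam. perm_act (sum_list lam) s T is)"

definition young_b :: "nat list \<Rightarrow> 'N tensor \<Rightarrow> 'N tensor" where
  "young_b lam T = (\<lambda>is. \<Sum>s\<in>column_group lam. of_int (sign s) * perm_act (sum_list lam) s T is)"

definition schur :: "int^'N^'N \<Rightarrow> nat list \<Rightarrow> (complex^'N) set \<Rightarrow> 'N tensor set" where
  "schur G lam V = (\<lambda>T. young_b lam (young_a lam T)) ` traceless G (sum_list lam) V"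


subsection \<open>The groups attached to a primitive isotropic plane\<close>

definition perp :: "int^'N^'N \<Rightarrow> complex set \<Rightarrow> (complex^'N) set \<Rightarrow> (complex^'N) set" where
  "perp G F K = {x \<in> coords F. \<forall>y\<in>K. bil G x y = 0}"

definition wedge :: "complex^'N \<Rightarrow> complex^'N \<Rightarrow> complex^'N^'N" where
  "wedge x y = (\<chi> i j. x $ i * y $ j - x $ j * y $ i)"

definition GamJ :: "int^'N^'N \<Rightarrow> (complex^'N) set \<Rightarrow> complex set \<Rightarrow> (complex^'N^'N) set" where
  "GamJ G J F = {g \<in> isometries G F.
     (\<lambda>x. g *v x) ` span_over F J = span_over F J \<and>
     (\<forall>x\<in>span_over F J. \<forall>y\<in>span_over F J. wedge (g *v x) (g *v y) = wedge x y) \<and>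
     (\<forall>x\<in>perp G F J. g *v x - x \<in> span_over F J)}"

definition UJ :: "int^'N^'N \<Rightarrow> (complex^'N) set \<Rightarrow> complex set \<Rightarrow> (complex^'N^'N) set" where
  "UJ G J F = {g \<in> GamJ G J F. \<forall>x\<in>perp G F J. g *v x = x}"

definition GamJ_Z ::
    "int^'N^'N \<Rightarrow> (complex^'N^'N) set \<Rightarrow> (complex^'N) set \<Rightarrow> (complex^'N^'N) set" where
  "GamJ_Z G Gam J = GamJ G J \<rat> \<inter> Gam"

definition UJ_Z ::
    "int^'N^'N \<Rightarrow> (complex^'N^'N) set \<Rightarrow> (complex^'N) set \<Rightarrow> (complex^'N^'N) set" where
  "UJ_Z G Gam J = UJ G J \<rat> \<inter> Gam"

text \<open>
  A point of \<open>\<P>(L/J)_\<complex>\<close> is represented by the subspace of \<open>L_\<complex>\<close> containing \<open>J_\<complex>\<close> which is the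
  preimage of the line in \<open>L_\<complex>/J_\<complex>\<close>. The boundary divisor \<open>\<Delta>_J\<close> is identified with \<open>\<V>_J\<close>.
\<close>

definition projJ :: "(complex^'N) set \<Rightarrow> complex^'N \<Rightarrow> (complex^'N) set" where
  "projJ J w = vec.span (insert w J)"

definition VJ :: "(complex^'N) set \<Rightarrow> (complex^'N) set \<Rightarrow> (complex^'N) set set" where
  "VJ D J = projJ J ` D"


subsection \<open>The tube domain realization and the trivializations at a cusp\<close>

text \<open>
  The choices made at a cusp \<open>I \<subset> J\<close>: a generator \<open>gen\<close> of \<open>I\<close> (written \<open>e\<close>), the vector \<open>opp\<close>
  of \<open>I'_\<rat>\<close> with \<open>(e, opp) = 1\<close> (written \<open>e'\<close>), and \<open>lvec\<close> with \<open>lvec \<otimes> e = l_{J,\<Gamma>}\<close>. The space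
  \<open>V(I) = (I\<^sup>\<perp>/I)_\<complex>\<close> is realized as \<open>(I \<oplus> I')_\<complex>\<^sup>\<perp>\<close>, and an element \<open>z \<otimes> e\<close> of \<open>U(I)_\<complex>\<close>, whose
  norm is \<open>(z,z)\<close>, is represented by \<open>z \<in> V(I)\<close>. An element \<open>T \<otimes> (e\<^sup>\<or>)\<^bsup>\<otimes>k\<^esup>\<close> of \<open>V(I)_{\<lambda>,k}\<close>, where
  \<open>e\<^sup>\<or>\<close> is the dual generator of \<open>I\<^sup>\<or>\<close>, is represented by \<open>T \<in> V(I)_\<lambda>\<close>.
\<close>

record ('N::finite) cusp =
  gen :: "complex^'N"
  opp :: "complex^'N"
  lvec :: "complex^'N"

definition VI :: "int^'N^'N \<Rightarrow> 'N cusp \<Rightarrow> (complex^'N) set" where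
  "VI G c = {x. bil G x (gen c) = 0 \<and> bil G x (opp c) = 0}"

definition tube_point :: "int^'N^'N \<Rightarrow> 'N cusp \<Rightarrow> complex^'N \<Rightarrow> complex^'N" where
  "tube_point G c z = opp c + z - (bil G z z / 2) *s gen c"

definition tube_domain ::
    "int^'N^'N \<Rightarrow> (complex^'N) set \<Rightarrow> 'N cusp \<Rightarrow> (complex^'N) set" where
  "tube_domain G D c = {z \<in> VI G c. tube_point G c z \<in> D}"

text \<open>On \<open>D\<close>, the inverse of \<open>tube_point\<close> modulo scalars.\<close>

definition tube_coord :: "int^'N^'N \<Rightarrow> 'N cusp \<Rightarrow> complex^'N \<Rightarrow> complex^'N" where
  "tube_coord G c w =
     (let x = (1 / bil G w (gen c)) *s w in x - opp c - bil G x (opp c) *s gen c)"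

text \<open>The cone \<open>\<C>_I\<close>: the imaginary parts of the points of the tube domain.\<close>

definition cone_I :: "int^'N^'N \<Rightarrow> (complex^'N) set \<Rightarrow> 'N cusp \<Rightarrow> (complex^'N) set" where
  "cone_I G D c = (\<lambda>z. \<chi> i. complex_of_real (Im (z $ i))) ` tube_domain G D c"

text \<open>
  The isometry of \<open>L_\<complex>\<close> attached to \<open>v \<otimes> e \<in> U(I)_\<complex>\<close>. It acts on the tube domain as the
  translation by \<open>v \<otimes> e\<close>, and this identifies the line \<open>(J/I)_F \<otimes> I_F\<close> in \<open>U(I)_F\<close> with the
  group \<open>U(J)_F\<close>.
\<close>

definition translation :: "int^'N^'N \<Rightarrow> complex^'N \<Rightarrow> complex^'N \<Rightarrow> complex^'N^'N" where
  "translation G e v = matrix (\<lambda>x.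
     x - bil G v x *s e + bil G e x *s v - (bil G v v / 2 * bil G e x) *s e)"

text \<open>
  \<open>UJ_line\<close> is \<open>U(J)_\<rat> = (J/I)_\<rat> \<otimes> I_\<rat>\<close>, each class in \<open>(J/I)_\<rat>\<close> being represented by its
  unique vector in \<open>(I \<oplus> I')\<^sup>\<perp>\<close>. The vector \<open>v_{J,\<Gamma>}\<close> is the \<open>v\<close> satisfying \<open>is_vJ\<close>.
\<close>

definition UJ_line :: "int^'N^'N \<Rightarrow> (complex^'N) set \<Rightarrow> 'N cusp \<Rightarrow> (complex^'N) set" where
  "UJ_line G J c = VI G c \<inter> span_over \<rat> J"

definition UJ_perp :: "int^'N^'N \<Rightarrow> (complex^'N) set \<Rightarrow> 'N cusp \<Rightarrow> (complex^'N) set" where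
  "UJ_perp G J c = VI G c \<inter> perp G \<rat> (UJ_line G J c)"

definition is_vJ :: "int^'N^'N \<Rightarrow> (complex^'N) set \<Rightarrow> (complex^'N^'N) set \<Rightarrow> (complex^'N) set \<Rightarrow>
    'N cusp \<Rightarrow> complex^'N \<Rightarrow> bool" where
  "is_vJ G D Gam J c v \<longleftrightarrow> v \<in> UJ_line G J c \<and>
     UJ_Z G Gam J = {translation G (gen c) (of_int s *s v) | s. True} \<and>
     v \<in> closure (cone_I G D c)"

definition cusps :: "int^'N^'N \<Rightarrow> (complex^'N) set \<Rightarrow> (complex^'N^'N) set \<Rightarrow> (complex^'N) set \<Rightarrow>
    'N cusp set" where
  "cusps G D Gam J = {c.
     primitive_isotropic G (span_over \<int> {gen c}) 1 \<and> gen c \<in> J \<and>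
     opp c \<in> coords \<rat> \<and> bil G (opp c) (opp c) = 0 \<and> bil G (gen c) (opp c) = 1 \<and>
     lvec c \<in> VI G c \<inter> coords \<rat> \<and> bil G (lvec c) (lvec c) = 0 \<and>
     (\<exists>v. is_vJ G D Gam J c v \<and> bil G v (lvec c) = 1)}"

text \<open>
  The \<open>I\<close>-trivialization of \<open>\<E>\<close> at \<open>\<complex>w \<in> \<D>\<close>. A class in \<open>w\<^sup>\<perp>/\<complex>w\<close> is represented by a vector
  \<open>x \<in> w\<^sup>\<perp>\<close>; there is a unique \<open>y \<in> x + \<complex>w\<close> in \<open>I_\<complex>\<^sup>\<perp> \<inter> w\<^sup>\<perp>\<close>, and the class of \<open>y\<close> in
  \<open>I_\<complex>\<^sup>\<perp>/I_\<complex>\<close> is the image. Conversely \<open>lift_E\<close> maps \<open>v \<in> V(I)\<close> to the vector of \<open>v + I_\<complex>\<close>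
  in \<open>I_\<complex>\<^sup>\<perp> \<inter> w\<^sup>\<perp>\<close>.
\<close>

definition triv_E :: "int^'N^'N \<Rightarrow> 'N cusp \<Rightarrow> complex^'N \<Rightarrow> complex^'N \<Rightarrow> complex^'N" where
  "triv_E G c w x =
     (let y = x - (bil G x (gen c) / bil G w (gen c)) *s w in y - bil G y (opp c) *s gen c)"

definition lift_E :: "int^'N^'N \<Rightarrow> 'N cusp \<Rightarrow> complex^'N \<Rightarrow> complex^'N \<Rightarrow> complex^'N" where
  "lift_E G c w v = v - (bil G v w / bil G (gen c) w) *s gen c"

definition omegaJ :: "int^'N^'N \<Rightarrow> 'N cusp \<Rightarrow> complex^'N \<Rightarrow> complex" where
  "omegaJ G c w = exp (2 * of_real pi * \<i> * bil G (lvec c) (tube_coord G c w))"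

text \<open>
  For an isometry \<open>g\<close> the action \<open>g: \<E>_{\<lambda>,k} \<otimes> \<Theta>_J\<^bsup>\<otimes>m\<^esup> \<rightarrow> \<E>_{\<lambda>,k} \<otimes> \<Theta>_J\<^bsup>\<otimes>m\<^esup>\<close> from the fiber over \<open>p\<close> to
  the fiber over \<open>gp\<close> (\<open>p \<in> \<Delta>_J\<close>), written with respect to the trivializations of source and
  target given by \<open>c1\<close> and \<open>c2\<close>. For \<open>g = 1\<close> this is the change of trivialization.

  In the \<open>I\<close>-trivialization the vector \<open>w\<close> of the line \<open>\<L>\<close> over \<open>\<complex>w\<close> is \<open>(w, e) e\<^sup>\<or>\<close>, which gives the
  factor with exponent \<open>k\<close>. As \<open>g\<close> sends a function \<open>f\<close> to \<open>f \<circ> g\<^bsup>-1\<^esup>\<close>, the generator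
  \<open>omegaJ c1\<close> of the conormal bundle is sent to the multiple of \<open>omegaJ c2\<close> whose coefficient at \<open>gw\<close> is
  \<open>omegaJ c1 w / omegaJ c2 (gw)\<close>. The formula is in terms of a point \<open>w\<close> of \<open>D\<close> lying over \<open>p\<close>.
  It is constant on the fibers of \<open>\<D> \<rightarrow> \<V>_J\<close> because \<open>g\<close> centralizes \<open>U(J)\<close> and the translations
  by \<open>U(J)\<close> preserve the trivializations and multiply \<open>omegaJ c1\<close>, \<open>omegaJ c2\<close> by the same
  scalar; hence its extension to \<open>\<Delta>_J\<close> has at \<open>p\<close> this same value.
\<close>

definition transition :: "int^'N^'N \<Rightarrow> nat list \<Rightarrow> int \<Rightarrow> nat \<Rightarrow> 'N cusp \<Rightarrow> 'N cusp \<Rightarrow>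
    complex^'N^'N \<Rightarrow> complex^'N \<Rightarrow> 'N tensor \<Rightarrow> 'N tensor" where
  "transition G lam k m c1 c2 g w T = (\<lambda>is.
     (bil G (g *v w) (gen c2) / bil G w (gen c1)) powi k *
     (omegaJ G c1 w / omegaJ G c2 (g *v w)) ^ m *
     tensor_map (sum_list lam) (\<lambda>v. triv_E G c2 (g *v w) (g *v lift_E G c1 w v)) T is)"


subsection \<open>Jacobi forms\<close>

text \<open>Holomorphic functions on a relatively open subset \<open>S\<close> of a complex linear subspace.\<close>

definition holomorphic_fun :: "(complex^'N) set \<Rightarrow> (complex^'N \<Rightarrow> complex) \<Rightarrow> bool" where
  "holomorphic_fun S f \<longleftrightarrow>
     (\<forall>z\<in>S. \<exists>f'. (f has_derivative f') (at z within S) \<and> (\<forall>a x. f' (a *s x) = a * f' x))"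

text \<open>
  A section of \<open>\<E>_{\<lambda>,k} \<otimes> \<Theta>_J\<^bsup>\<otimes>m\<^esup>\<close> over \<open>\<Delta>_J\<close> is the family \<open>\<phi>\<close> of its expressions \<open>\<phi> c\<close> in the
  trivializations by \<open>V(I)_{\<lambda>,k}\<close>, compatible with the changes of trivialization. Functions on
  the open subset \<open>\<Delta>_J\<close> of \<open>U(I)_\<complex>/U(J)_\<complex>\<close> are holomorphic if they are so on the tube domain.
\<close>

type_synonym 'N boundary_section = "'N cusp \<Rightarrow> (complex^'N) set \<Rightarrow> 'N tensor"

definition holomorphic_sections :: "int^'N^'N \<Rightarrow> (complex^'N) set \<Rightarrow> (complex^'N^'N) set \<Rightarrow>
    (complex^'N) set \<Rightarrow> nat list \<Rightarrow> int \<Rightarrow> nat \<Rightarrow> 'N boundary_section set" where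
  "holomorphic_sections G D Gam J lam k m = {\<phi>.
     (\<forall>c p. \<not> (c \<in> cusps G D Gam J \<and> p \<in> VJ D J) \<longrightarrow> \<phi> c p = (\<lambda>is. 0)) \<and>
     (\<forall>c\<in>cusps G D Gam J. \<forall>p\<in>VJ D J. \<phi> c p \<in> schur G lam (VI G c)) \<and>
     (\<forall>c\<in>cusps G D Gam J. \<forall>is.
        holomorphic_fun (tube_domain G D c) (\<lambda>z. \<phi> c (projJ J (tube_point G c z)) is)) \<and>
     (\<forall>c1\<in>cusps G D Gam J. \<forall>c2\<in>cusps G D Gam J. \<forall>w\<in>D.
        \<phi> c2 (projJ J w) = transition G lam k m c1 c2 (mat 1) w (\<phi> c1 (projJ J w)))}"

definition GamJ_invariant :: "int^'N^'N \<Rightarrow> (complex^'N) set \<Rightarrow> (complex^'N^'N) set \<Rightarrow>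
    (complex^'N) set \<Rightarrow> nat list \<Rightarrow> int \<Rightarrow> nat \<Rightarrow> 'N boundary_section \<Rightarrow> bool" where
  "GamJ_invariant G D Gam J lam k m \<phi> \<longleftrightarrow>
     (\<forall>g\<in>GamJ_Z G Gam J. \<forall>c\<in>cusps G D Gam J. \<forall>w\<in>D.
        \<phi> c (projJ J (g *v w)) = transition G lam k m c c g w (\<phi> c (projJ J w)))"

definition full_lattice :: "(complex^'N) set \<Rightarrow> (complex^'N) set \<Rightarrow> bool" where
  "full_lattice W \<Lambda> \<longleftrightarrow>
     (\<exists>B. finite B \<and> vec.independent B \<and> span_over \<rat> B = W \<and> span_over \<int> B = \<Lambda>)"

text \<open>The coefficients \<open>a l\<close> of the absolutely convergent Fourier expansion are unique.\<close>

definition holomorphic_at_cusp :: "int^'N^'N \<Rightarrow> (complex^'N) set \<Rightarrow> (complex^'N) set \<Rightarrow> nat \<Rightarrow>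
    'N boundary_section \<Rightarrow> 'N cusp \<Rightarrow> bool" where
  "holomorphic_at_cusp G D J m \<phi> c \<longleftrightarrow>
     (\<exists>\<Lambda> a. full_lattice (UJ_perp G J c) \<Lambda> \<and>
        (\<forall>z\<in>tube_domain G D c. \<forall>is.
           ((\<lambda>l. a l is * exp (2 * of_real pi * \<i> * bil G l z))
              has_sum \<phi> c (projJ J (tube_point G c z)) is) \<Lambda>) \<and>
        (\<forall>l\<in>\<Lambda>. a l \<noteq> (\<lambda>is. 0) \<longrightarrow>
           Re (bil G (of_nat m *s lvec c + l) (of_nat m *s lvec c + l)) \<ge> 0))"

definition jacobi_forms :: "int^'N^'N \<Rightarrow> (complex^'N) set \<Rightarrow> (complex^'N^'N) set \<Rightarrow>
    (complex^'N) set \<Rightarrow> nat list \<Rightarrow> int \<Rightarrow> nat \<Rightarrow> 'N boundary_section set" where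
  "jacobi_forms G D Gam J lam k m = {\<phi> \<in> holomorphic_sections G D Gam J lam k m.
     GamJ_invariant G D Gam J lam k m \<phi> \<and>
     (\<forall>c\<in>cusps G D Gam J. holomorphic_at_cusp G D J m \<phi> c)}"

end

theory Submission
  imports Defs
begin

text \<open>
  Let \<open>e\<close> generate a cusp \<open>I \<subset> J\<close>. Together with \<open>v = v_{J,\<Gamma>}\<close>, \<open>f = e'\<close> and \<open>l = l_{J,\<Gamma>}\<close> it spans
  a rational hyperbolic space of dimension \<open>4\<close>. The orthogonal complement is negative definite, of
  dimension \<open>p = n - 2\<close>, and has a rational orthogonal basis \<open>w 0, \<dots>, w (p - 1)\<close>. In these
  coordinates a point of \<open>D\<close> is given by \<open>\<tau>\<close> in the upper half plane, \<open>\<zeta> \<in> \<complex>\<^sup>p\<close> and a coordinate \<open>\<rho>\<close>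
  that the projection to \<open>\<Delta>_J\<close> forgets. The group \<open>SL_2(\<int>)\<close> rotates the basis \<open>e, v\<close> of \<open>J_\<rat>\<close>; it
  carries the cusps of \<open>J\<close> to each other, and a subgroup of finite index of it lies in \<open>\<Gamma>(J)_\<int>\<close>.
  
  From vector-valued to scalar forms. The values of a Jacobi form \<open>\<phi>\<close> are tensors, and their
  components in the frame are not modular one by one: a change of cusp acts on \<open>V(I)\<close> by an
  automorphism that is triangular for the filtration \<open>\<complex>v \<subset> v\<^sup>\<perp> \<subset> V(I)\<close> and acts on the three graded
  pieces by \<open>j\<close>, \<open>1\<close> and \<open>j\<^bsup>-1\<^esup>\<close>, where \<open>j\<close> is the factor of automorphy. Let the weight of a component
  be the number of factors paired with \<open>l\<close> minus the number of factors paired with \<open>v\<close>. If all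
  components of smaller weight vanish, then a component of weight \<open>t\<close> is a scalar Jacobi form of
  weight \<open>k + t\<close> and index \<open>m\<close> (\<open>transition_leading_coeff\<close>, \<open>jacobi_related_at_cusp\<close>). The
  antisymmetry in the columns of the Young tableau kills every component in which more than \<open>\<lambda>_1\<close>
  factors are paired with the same vector (\<open>tensor_coeff_schur_many_equal\<close>), so only weights
  \<open>t \<le> \<lambda>_1\<close> matter. An induction on \<open>t\<close> (\<open>coefficients_vanish\<close>) therefore reduces the claim to scalar
  Jacobi forms in \<open>p\<close> variables \<open>\<zeta>\<close> whose weight \<open>\<kappa> \<le> k + \<lambda>_1\<close> is smaller than the singular weight
  \<open>p/2\<close>.
  
  Scalar forms below the singular weight (\<open>low_weight_theta_expansion_vanishes\<close>). Put
  \<open>v = Im \<tau>\<close>, write \<open>\<zeta> = \<alpha>\<tau> + \<beta>\<close> with real \<open>\<alpha>\<close>, \<open>\<beta>\<close>, and consider the average of the Petersson norm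
  over all \<open>\<alpha>\<close>, \<open>\<beta>\<close> with coordinates in \<open>M\<^bsup>-1\<^esup>\<int>/\<int>\<close>.
  
  \<^item> \<open>SL_2(\<int>)\<close> permutes the torsion points \<open>(\<alpha>, \<beta>)\<close>, so the average does not change when \<open>\<tau>\<close> is
    moved by a matrix and \<open>f\<close> is replaced by the corresponding transform
    (\<open>petersson_grid_invariant\<close>); there are only finitely many transforms
    (\<open>finite_representatives\<close>).
  \<^item> Every \<open>\<tau>\<close> with \<open>Im \<tau> \<le> 1\<close> can be moved to \<open>Im \<tau> \<ge> 1/5\<close> (\<open>exists_reducing_matrix\<close>). There the
    condition of holomorphy at the cusps gives the Gaussian bound \<open>O(v\<^bsup>\<kappa>-p/2\<^esup>)\<close> for the average
    (\<open>petersson_grid_upper\<close>), which is bounded as \<open>\<kappa> < p/2\<close>.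
  \<^item> For \<open>v \<le> 1\<close>, Bessel's inequality in \<open>\<beta>\<close> bounds the average below by a constant times
    \<open>|f_r(\<tau>)|\<^sup>2 v\<^bsup>\<kappa>-p/2\<^esup>\<close>, for every coefficient \<open>f_r\<close> of \<open>f = \<Sum>_r f_r(\<tau>) exp(2\<pi>i r\<zeta>)\<close>
    (\<open>petersson_grid_lower\<close>): quasi-periodicity in \<open>\<zeta>\<close> makes about \<open>v\<^bsup>-p/2\<^esup>\<close> translates of \<open>r\<close>
    contribute comparably.
  
  Hence \<open>|f_r(\<tau>)|\<^sup>2 = O(v\<^bsup>p/2-\<kappa>\<^esup>)\<close> for \<open>v \<longrightarrow> 0\<close>, and as this tends to \<open>0\<close>, all Fourier coefficients of
  \<open>f_r\<close> vanish.
\<close>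

section \<open>Bilinear forms and coefficients of tensors\<close>

lemma bil_add_left: "bil G (x + y) z = bil G x z + bil G y z"
  by (simp add: bil_def ring_distribs sum.distrib)

lemma bil_add_right: "bil G z (x + y) = bil G z x + bil G z y"
  by (simp add: bil_def ring_distribs sum.distrib)

lemma bil_scale_left: "bil G (c *s x) z = c * bil G x z"
  by (simp add: bil_def sum_distrib_left mult_ac)

lemma bil_scale_right: "bil G z (c *s x) = c * bil G z x"
  by (simp add: bil_def sum_distrib_left mult_ac)

lemma bil_minus_left: "bil G (- x) z = - bil G x z"
  by (simp add: bil_def sum_negf)

lemma bil_minus_right: "bil G z (- x) = - bil G z x"
  by (simp add: bil_def sum_negf)

lemma bil_diff_left: "bil G (x - y) z = bil G x z - bil G y z"
  by (simp add: bil_def ring_distribs sum_subtractf)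

lemma bil_diff_right: "bil G z (x - y) = bil G z x - bil G z y"
  by (simp add: bil_def ring_distribs sum_subtractf)

lemma bil_zero [simp]: "bil G 0 z = 0" "bil G z 0 = 0"
  by (simp_all add: bil_def)

lemma bil_sum_left: "bil G (\<Sum>i\<in>I. x i) z = (\<Sum>i\<in>I. bil G (x i) z)"
  by (induction I rule: infinite_finite_induct) (auto simp: bil_add_left)

lemma bil_sum_right: "bil G z (\<Sum>i\<in>I. x i) = (\<Sum>i\<in>I. bil G z (x i))"
  by (induction I rule: infinite_finite_induct) (auto simp: bil_add_right)

lemmas bil_linear = bil_add_left bil_add_right bil_scale_left bil_scale_right bil_minus_left bil_minus_right
  bil_diff_left bil_diff_right bil_sum_left bil_sum_right

lemma bil_sym: "transpose G = G \<Longrightarrow> bil G x y = bil G y x"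
proof -
  assume "transpose G = G"
  then have "G $ i $ j = transpose G $ i $ j" for i j by simp
  then have "G $ i $ j = G $ j $ i" for i j by (simp add: transpose_def)
  then show ?thesis
    unfolding bil_def by (subst sum.swap) (simp add: mult_ac)
qed

lemma vec_expand: "(x :: complex^'N) = (\<Sum>i\<in>UNIV. x $ i *s axis i 1)"
  by (rule basis_expansion [symmetric])

lemma bil_expand_left: "bil G x z = (\<Sum>i\<in>UNIV. x $ i * bil G (axis i 1) z)" for x z :: "complex^'N"
  by (subst vec_expand [of x]) (simp add: bil_sum_left bil_scale_left)

lemma sum_lists_prod:
  fixes F :: "nat \<Rightarrow> 'n::finite \<Rightarrow> 'a::comm_semiring_1"
  shows "(\<Sum>is | length is = d. \<Prod>k<d. F k (is ! k)) = (\<Prod>k<d. \<Sum>i\<in>UNIV. F k i)"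
proof -
  have "(\<Prod>k<d. \<Sum>i\<in>UNIV. F k i) = (\<Sum>g\<in>PiE {..<d} (\<lambda>_. UNIV). \<Prod>k<d. F k (g k))"
    by (rule prod_sum_PiE) auto
  also have "\<dots> = (\<Sum>is | length is = d. \<Prod>k<d. F k (is ! k))"
    by (rule sum.reindex_bij_witness [where i = "\<lambda>is. restrict (\<lambda>k. is ! k) {..<d}" and j = "\<lambda>g. map g [0..<d]"])
       (auto simp: fun_eq_iff PiE_iff extensional_def intro!: nth_equalityI)
  finally show ?thesis by simp
qed

lemma finite_lists_of_length [simp]: "finite {is :: 'n::finite list. length is = d}"
  using finite_lists_length_eq [of "UNIV :: 'n set" d] by simp

text \<open>
  A tensor is studied through its pairings with families of \<open>d\<close> vectors, since a linear map applied to
  the tensor becomes its adjoint applied to the vectors (\<open>tensor_coeff_tensor_map\<close>) and a permutation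
  of the factors becomes a permutation of the vectors (\<open>tensor_coeff_perm_act\<close>).
\<close>

definition tensor_coeff :: "int^'N^'N \<Rightarrow> nat \<Rightarrow> 'N tensor \<Rightarrow> (nat \<Rightarrow> complex^'N) \<Rightarrow> complex" where
  "tensor_coeff G d T y = (\<Sum>is | length is = d. T is * (\<Prod>k<d. bil G (axis (is ! k) 1) (y k)))"

lemma tensor_coeff_cong: "(\<And>k. k < d \<Longrightarrow> y k = y' k) \<Longrightarrow> tensor_coeff G d T y = tensor_coeff G d T y'"
  by (simp add: tensor_coeff_def)

lemma tensor_coeff_zero [simp]: "tensor_coeff G d (\<lambda>is. 0) y = 0"
  by (simp add: tensor_coeff_def)

lemma tensor_coeff_scale: "tensor_coeff G d (\<lambda>is. c * T is) y = c * tensor_coeff G d T y"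
  by (simp add: tensor_coeff_def sum_distrib_left mult_ac)

lemma tensor_coeff_sum: "tensor_coeff G d (\<lambda>is. \<Sum>i\<in>I. T i is) y = (\<Sum>i\<in>I. tensor_coeff G d (T i) y)"
  unfolding tensor_coeff_def by (simp add: sum_distrib_right) (rule sum.swap)

lemma tensor_coeff_pure:
  assumes "length vs = d"
  shows "tensor_coeff G d (pure_tensor vs) y = (\<Prod>k<d. bil G (vs ! k) (y k))"
proof -
  have "tensor_coeff G d (pure_tensor vs) y = (\<Sum>is | length is = d. \<Prod>k<d. vs ! k $ (is ! k) * bil G (axis (is ! k) 1) (y k))"
    unfolding tensor_coeff_def by (intro sum.cong) (auto simp: pure_tensor_def assms prod.distrib)
  also have "\<dots> = (\<Prod>k<d. \<Sum>i\<in>UNIV. vs ! k $ i * bil G (axis i 1) (y k))"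
    by (rule sum_lists_prod)
  finally show ?thesis by (simp only: bil_expand_left [symmetric])
qed

lemma tensor_coeff_expand:
  fixes V :: "'s \<Rightarrow> complex^'N"
  assumes "finite S" "\<And>k. k < d \<Longrightarrow> y k = (\<Sum>s\<in>S. C k s *s V s)"
  shows "tensor_coeff G d T y = (\<Sum>\<sigma>\<in>PiE {..<d} (\<lambda>_. S). (\<Prod>k<d. C k (\<sigma> k)) * tensor_coeff G d T (\<lambda>k. V (\<sigma> k)))"
proof -
  have "tensor_coeff G d T y = (\<Sum>is | length is = d. T is * (\<Prod>k<d. \<Sum>s\<in>S. C k s * bil G (axis (is ! k) 1) (V s)))"
    unfolding tensor_coeff_def by (intro sum.cong prod.cong arg_cong2 [where f = "(*)"] refl) (simp add: assms bil_linear)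
  also have "\<dots> = (\<Sum>is | length is = d. T is * (\<Sum>\<sigma>\<in>PiE {..<d} (\<lambda>_. S). \<Prod>k<d. C k (\<sigma> k) * bil G (axis (is ! k) 1) (V (\<sigma> k))))"
    by (subst prod_sum_PiE) (auto simp: assms)
  also have "\<dots> = (\<Sum>is | length is = d. \<Sum>\<sigma>\<in>PiE {..<d} (\<lambda>_. S). (\<Prod>k<d. C k (\<sigma> k)) * (T is * (\<Prod>k<d. bil G (axis (is ! k) 1) (V (\<sigma> k)))))"
    by (simp add: sum_distrib_left prod.distrib mult_ac)
  also have "\<dots> = (\<Sum>\<sigma>\<in>PiE {..<d} (\<lambda>_. S). (\<Prod>k<d. C k (\<sigma> k)) * tensor_coeff G d T (\<lambda>k. V (\<sigma> k)))"
    unfolding tensor_coeff_def sum_distrib_left by (rule sum.swap)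
  finally show ?thesis .
qed

lemma tensor_coeff_tensor_map:
  assumes "\<And>x k. k < d \<Longrightarrow> bil G (A x) (y k) = bil G x (y' k)"
  shows "tensor_coeff G d (tensor_map d A T) y = tensor_coeff G d T y'"
proof -
  have "tensor_coeff G d (tensor_map d A T) y =
     (\<Sum>is | length is = d. \<Sum>js | length js = d. (\<Prod>k<d. A (axis (js ! k) 1) $ (is ! k) * bil G (axis (is ! k) 1) (y k)) * T js)"
    unfolding tensor_coeff_def tensor_map_def
    by (intro sum.cong refl) (simp add: sum_distrib_right sum_distrib_left prod.distrib mult_ac)
  also have "\<dots> = (\<Sum>js | length js = d. \<Sum>is | length is = d. (\<Prod>k<d. A (axis (js ! k) 1) $ (is ! k) * bil G (axis (is ! k) 1) (y k)) * T js)"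
    by (rule sum.swap)
  also have "\<dots> = (\<Sum>js | length js = d. (\<Prod>k<d. bil G (A (axis (js ! k) 1)) (y k)) * T js)"
    unfolding sum_distrib_right [symmetric]
    by (subst sum_lists_prod [where F = "\<lambda>k i. A (axis (_ ! k) 1) $ i * bil G (axis i 1) (y k)"]) (simp only: bil_expand_left [symmetric])
  also have "\<dots> = tensor_coeff G d T y'"
    unfolding tensor_coeff_def by (intro sum.cong refl) (simp add: assms mult.commute)
  finally show ?thesis .
qed

text \<open>
  Multilinearity applied to the coordinate vectors, which \<open>dual\<close> expresses in terms of the functionals
  \<open>(_, V s)\<close>.
\<close>

lemma tensor_eq_zero:
  fixes V :: "'s \<Rightarrow> complex^'N"
  assumes fin: "finite S" and supp: "\<And>is. length is \<noteq> d \<Longrightarrow> T is = 0"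
    and dual: "\<And>x j. x $ j = (\<Sum>s\<in>S. C j s * bil G x (V s))"
    and zero: "\<And>\<sigma>. \<sigma> \<in> PiE {..<d} (\<lambda>_. S) \<Longrightarrow> tensor_coeff G d T (\<lambda>k. V (\<sigma> k)) = 0"
  shows "T = (\<lambda>is. 0)"
proof
  fix js
  show "T js = 0"
  proof (cases "length js = d")
    case True
    have delta: "(\<Prod>k<d. (axis (is ! k) 1 :: complex^'N) $ (js ! k)) = (if is = js then 1 else 0)" if "length is = d" for "is"
    proof (cases "is = js")
      case True then show ?thesis by (simp add: axis_def)
    next
      case False
      then have "\<exists>k<d. is ! k \<noteq> js ! k" using that \<open>length js = d\<close> nth_equalityI [of "is" js] by auto
      then obtain k where "k < d" "is ! k \<noteq> js ! k" by blast
      then show ?thesis using False by (auto intro!: prod_zero bexI [of _ k] simp: axis_def)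
    qed
    have "T js = (\<Sum>is | length is = d. if is = js then T js else 0)"
      using True by simp
    also have "\<dots> = (\<Sum>is | length is = d. T is * (if is = js then 1 else 0))"
      by (intro sum.cong) auto
    also have "\<dots> = (\<Sum>is | length is = d. T is * (\<Prod>k<d. (axis (is ! k) 1 :: complex^'N) $ (js ! k)))"
      by (intro sum.cong refl) (simp add: delta)
    also have "\<dots> = (\<Sum>is | length is = d. T is * (\<Prod>k<d. \<Sum>s\<in>S. C (js ! k) s * bil G (axis (is ! k) 1) (V s)))"
      by (subst dual) (rule refl)
    also have "\<dots> = tensor_coeff G d T (\<lambda>k. \<Sum>s\<in>S. C (js ! k) s *s V s)"
      by (simp add: tensor_coeff_def bil_linear)
    also have "\<dots> = 0"
      by (subst tensor_coeff_expand [OF fin refl]) (simp add: zero)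
    finally show ?thesis .
  qed (simp add: supp)
qed

lemma tensor_coeff_power_zero:
  assumes "T \<in> tensor_power d V" "k < d" "\<And>x. x \<in> V \<Longrightarrow> bil G x (y k) = 0"
  shows "tensor_coeff G d T y = 0"
proof -
  from assms(1) obtain S c where S: "T = (\<lambda>is. \<Sum>t\<in>S. c t * t is)" "finite S"
    "S \<subseteq> pure_tensor ` {vs. length vs = d \<and> set vs \<subseteq> V}"
    unfolding tensor_power_def by blast
  have "tensor_coeff G d t y = 0" if "t \<in> S" for t
  proof -
    obtain vs where vs: "t = pure_tensor vs" "length vs = d" "set vs \<subseteq> V" using S(3) \<open>t \<in> S\<close> by blast
    then have "bil G (vs ! k) (y k) = 0" using assms(2,3) by (meson nth_mem subsetD)
    then show ?thesis using assms(2) vs by (auto simp: tensor_coeff_pure intro!: prod_zero)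
  qed
  then show ?thesis unfolding S(1) tensor_coeff_sum tensor_coeff_scale by simp
qed

lemma tensor_coeff_perm_act:
  assumes s: "s permutes {..<d}"
  shows "tensor_coeff G d (perm_act d s T) y = tensor_coeff G d T (\<lambda>k. y (s k))"
proof -
  have sd: "k < d \<Longrightarrow> s k < d" "k < d \<Longrightarrow> inv_into UNIV s k < d" for k
    using permutes_in_image [OF s] permutes_in_image [OF permutes_inv [OF s]] by auto
  have "tensor_coeff G d (perm_act d s T) y
      = (\<Sum>is | length is = d. T (map (\<lambda>j. is ! s j) [0..<d]) * (\<Prod>k<d. bil G (axis (is ! k) 1) (y k)))"
    unfolding tensor_coeff_def perm_act_def by (intro sum.cong) auto
  also have "\<dots> = (\<Sum>is | length is = d. T is * (\<Prod>k<d. bil G (axis (is ! k) 1) (y (s k))))"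
  proof (rule sum.reindex_bij_witness [where i = "\<lambda>is. map (\<lambda>j. is ! inv_into UNIV s j) [0..<d]" and j = "\<lambda>is. map (\<lambda>j. is ! s j) [0..<d]"])
    fix "is" :: "'a list" assume "is \<in> {is. length is = d}"
    then have len: "length is = d" by simp
    show "map (\<lambda>j. map (\<lambda>j. is ! s j) [0..<d] ! inv_into UNIV s j) [0..<d] = is"
      "map (\<lambda>j. map (\<lambda>j. is ! inv_into UNIV s j) [0..<d] ! s j) [0..<d] = is"
      using len sd permutes_inverses [OF s] by (auto intro!: nth_equalityI)
    have "(\<Prod>k<d. bil G (axis (is ! k) 1) (y k)) = (\<Prod>k<d. bil G (axis (is ! s k) 1) (y (s k)))"
      using permutes_imp_bij [OF s] by (intro prod.reindex_bij_betw [symmetric])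
    then show "T (map (\<lambda>j. is ! s j) [0..<d]) * (\<Prod>k<d. bil G (axis (map (\<lambda>j. is ! s j) [0..<d] ! k) 1) (y (s k)))
       = T (map (\<lambda>j. is ! s j) [0..<d]) * (\<Prod>k<d. bil G (axis (is ! k) 1) (y k))"
      by simp
  qed auto
  finally show ?thesis unfolding tensor_coeff_def .
qed

section \<open>Antisymmetry in the columns of the Young tableau\<close>

text \<open>
  Both sides count the boxes of the Young diagram, by columns and by rows.
\<close>

lemma sum_conj_part:
  assumes "\<And>i. i < length lam \<Longrightarrow> lam ! i \<le> L"
  shows "(\<Sum>j=1..L. conj_part lam j) = sum_list lam"
proof -
  have "(\<Sum>j=1..L. conj_part lam j) = (\<Sum>j=1..L. \<Sum>i<length lam. if j \<le> lam ! i then 1 else 0)"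
    by (intro sum.cong refl) (simp add: conj_part_def sum.If_cases Int_def lessThan_def)
  also have "\<dots> = (\<Sum>i<length lam. \<Sum>j=1..L. if j \<le> lam ! i then 1 else 0)"
    by (rule sum.swap)
  also have "\<dots> = (\<Sum>i<length lam. lam ! i)"
  proof (intro sum.cong refl)
    fix i assume "i \<in> {..<length lam}"
    then have "{1..L} \<inter> {j. j \<le> lam ! i} = {1..lam ! i}" using assms [of i] by auto
    then show "(\<Sum>j=1..L. if j \<le> lam ! i then 1 else 0) = lam ! i" by (simp add: sum.If_cases)
  qed
  also have "\<dots> = sum_list lam" by (simp add: sum_list_sum_nth atLeast0LessThan)
  finally show ?thesis .
qed

lemma exists_column:
  assumes "k < (\<Sum>j=1..L. conj_part lam j)"
  shows "\<exists>c<L. (\<Sum>j=1..c. conj_part lam j) \<le> k \<and> k < (\<Sum>j=1..Suc c. conj_part lam j)"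
  using assms
proof (induction L)
  case (Suc L)
  then show ?case
    by (cases "k < (\<Sum>j=1..L. conj_part lam j)") (auto intro: less_SucI)
qed simp

text \<open>
  In the column canonical tableau the boxes of a column carry consecutive numbers, so two positions lie
  in a common column if and only if they lie in a common interval between partial sums of column
  lengths.
\<close>

lemma column_eq:
  "{tableau lam r c | r. r < conj_part lam (Suc c)} = {(\<Sum>j=1..c. conj_part lam j)..<(\<Sum>j=1..Suc c. conj_part lam j)}"
  by (auto simp: tableau_def) (metis add.commute le_iff_add less_diff_conv2 add_diff_cancel_left' nat_add_left_cancel_less)

lemma transpose_image_column:
  assumes "a \<in> C \<longleftrightarrow> b \<in> C"
  shows "Transposition.transpose a b ` C = C"
  using assms by (cases "a \<in> C") (auto simp: image_iff Transposition.transpose_def)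

lemma column_group_transpose_comp:
  assumes a: "a < sum_list lam" "b < sum_list lam"
    and same: "(\<Sum>j=1..c. conj_part lam j) \<le> a" "a < (\<Sum>j=1..Suc c. conj_part lam j)"
      "(\<Sum>j=1..c. conj_part lam j) \<le> b" "b < (\<Sum>j=1..Suc c. conj_part lam j)"
    and s: "s \<in> column_group lam"
  shows "Transposition.transpose a b \<circ> s \<in> column_group lam"
proof -
  let ?S = "\<lambda>c. \<Sum>j=1..c. conj_part lam j"
  have mono: "?S x \<le> ?S y" if "x \<le> y" for x y
    by (rule sum_mono2) (use that in auto)
  have "Transposition.transpose a b ` {tableau lam r c' | r. r < conj_part lam (Suc c')} = {tableau lam r c' | r. r < conj_part lam (Suc c')}" for c'
  proof (rule transpose_image_column)
    show "a \<in> {tableau lam r c' | r. r < conj_part lam (Suc c')} \<longleftrightarrow> b \<in> {tableau lam r c' | r. r < conj_part lam (Suc c')}"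
      unfolding column_eq using same mono [of "Suc c'" c] mono [of "Suc c" c'] by (cases c' c rule: linorder_cases) auto
  qed
  moreover have "Transposition.transpose a b permutes {..<sum_list lam}"
    using a by (intro permutes_swap_id) auto
  ultimately show ?thesis
    using s unfolding column_group_def mem_Collect_eq image_comp [symmetric] by (auto intro: permutes_compose)
qed

text \<open>
  Composition with the transposition of two positions in the same column is a bijection of the column
  group that changes the sign; if the two vectors agree it leaves the coefficient unchanged.
\<close>

lemma tensor_coeff_young_b_zero:
  assumes a: "a < sum_list lam" "b < sum_list lam" "a \<noteq> b" "y a = y b"
    and same: "(\<Sum>j=1..c. conj_part lam j) \<le> a" "a < (\<Sum>j=1..Suc c. conj_part lam j)"
      "(\<Sum>j=1..c. conj_part lam j) \<le> b" "b < (\<Sum>j=1..Suc c. conj_part lam j)"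
  shows "tensor_coeff G (sum_list lam) (young_b lam S) y = 0"
proof -
  let ?d = "sum_list lam" and ?t = "Transposition.transpose a b"
  have perm: "s permutes {..<?d}" if "s \<in> column_group lam" for s
    using that by (simp add: column_group_def)
  have eq: "tensor_coeff G ?d (young_b lam S) y = (\<Sum>s\<in>column_group lam. of_int (sign s) * tensor_coeff G ?d S (\<lambda>k. y (s k)))"
    unfolding young_b_def tensor_coeff_sum tensor_coeff_scale
    by (intro sum.cong refl) (simp add: tensor_coeff_perm_act perm)
  have yt: "y (?t k) = y k" for k using a(4) by (simp add: Transposition.transpose_def)
  have closed: "?t \<circ> s \<in> column_group lam" if "s \<in> column_group lam" for s
    by (rule column_group_transpose_comp [OF a(1,2) same that])
  have sign: "sign (?t \<circ> s) = - sign s" if "s \<in> column_group lam" for s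
    using perm [OF that] a(3) by (subst sign_compose) (auto simp: sign_swap_id permutation_swap_id intro: permutation_permutes [THEN iffD2])
  have "(\<Sum>s\<in>column_group lam. of_int (sign s) * tensor_coeff G ?d S (\<lambda>k. y (s k)))
     = (\<Sum>s\<in>column_group lam. - (of_int (sign s) * tensor_coeff G ?d S (\<lambda>k. y (s k))))"
    by (rule sum.reindex_bij_witness [where i = "\<lambda>s. ?t \<circ> s" and j = "\<lambda>s. ?t \<circ> s"])
       (auto simp: closed sign yt fun_eq_iff)
  then show ?thesis unfolding eq by (simp add: sum_negf)
qed

lemma sorted_parts_le_first:
  fixes lam :: "nat list"
  assumes "sorted_wrt (\<ge>) lam" "i < length lam"
  shows "lam ! i \<le> lam ! 0"
proof (cases "i = 0")
  case False
  then show ?thesis using sorted_wrt_nth_less [OF assms(1), of 0 i] assms(2) by simp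
qed simp

text \<open>
  There are \<open>\<lambda>_1\<close> columns, so by the pigeonhole principle two of the positions in \<open>A\<close> lie in the same
  column. This is how \<open>\<lambda>_1\<close> enters the bound for the weight.
\<close>

lemma tensor_coeff_schur_many_equal:
  assumes lam: "sorted_wrt (\<ge>) lam" and T: "T \<in> schur G lam V"
    and A: "A \<subseteq> {..<sum_list lam}" "card A > lam ! 0" "\<And>k. k \<in> A \<Longrightarrow> y k = z"
  shows "tensor_coeff G (sum_list lam) T y = 0"
proof -
  let ?S = "\<lambda>c. \<Sum>j=1..c. conj_part lam j"
  have sum: "?S (lam ! 0) = sum_list lam"
    by (rule sum_conj_part) (rule sorted_parts_le_first [OF lam])
  have "\<exists>c<lam ! 0. ?S c \<le> k \<and> k < ?S (Suc c)" if "k \<in> A" for k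
    using that A(1) sum by (intro exists_column) auto
  then obtain col where col: "\<And>k. k \<in> A \<Longrightarrow> col k < lam ! 0 \<and> ?S (col k) \<le> k \<and> k < ?S (Suc (col k))"
    by metis
  have "\<not> inj_on col A"
  proof
    assume "inj_on col A"
    then have "card A \<le> card {..<lam ! 0}"
      using col by (intro card_inj_on_le [of col]) auto
    with A(2) show False by simp
  qed
  then obtain a b where ab: "a \<in> A" "b \<in> A" "a \<noteq> b" "col a = col b" by (auto simp: inj_on_def)
  obtain S where S: "T = young_b lam S" using T by (auto simp: schur_def)
  show ?thesis unfolding S
    by (rule tensor_coeff_young_b_zero [of a lam b y "col a"]) (use ab A col [of a] col [of b] in auto)
qed

text \<open>
  The Young symmetrizer only permutes the vectors, and some factor of every pure tensor over \<open>V\<close> is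
  then paired with a vector orthogonal to \<open>V\<close>.
\<close>

lemma tensor_coeff_schur_zero:
  assumes T: "T \<in> schur G lam V" and k: "k < sum_list lam" and y: "\<And>x. x \<in> V \<Longrightarrow> bil G x (y k) = 0"
  shows "tensor_coeff G (sum_list lam) T y = 0"
proof -
  let ?d = "sum_list lam"
  obtain S where S: "T = young_b lam (young_a lam S)" "S \<in> traceless G ?d V" using T by (auto simp: schur_def)
  then have S0: "tensor_coeff G ?d S y = 0" if "k < ?d" "\<And>x. x \<in> V \<Longrightarrow> bil G x (y k) = 0" for y k
    using that by (intro tensor_coeff_power_zero) (auto simp: traceless_def)
  have inv: "s (inv_into UNIV s k) = k" "inv_into UNIV s k < ?d" if "s permutes {..<?d}" "k < ?d" for s k
    using permutes_inverses(1) [OF that(1)] permutes_in_image [OF permutes_inv [OF that(1)], of k] that(2) by auto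
  have a0: "tensor_coeff G ?d (young_a lam S) y = 0" if "k < ?d" "\<And>x. x \<in> V \<Longrightarrow> bil G x (y k) = 0" for y k
  proof -
    have "tensor_coeff G ?d (perm_act ?d s S) y = 0" if "s \<in> row_group lam" for s
    proof -
      have s: "s permutes {..<?d}" using that by (simp add: row_group_def)
      show ?thesis unfolding tensor_coeff_perm_act [OF s]
        by (rule S0 [of "inv_into UNIV s k"]) (use inv [OF s \<open>k < ?d\<close>] \<open>\<And>x. x \<in> V \<Longrightarrow> bil G x (y k) = 0\<close> in auto)
    qed
    then show ?thesis unfolding young_a_def tensor_coeff_sum by simp
  qed
  have "tensor_coeff G ?d (perm_act ?d s (young_a lam S)) y = 0" if "s \<in> column_group lam" for s
  proof -
    have s: "s permutes {..<?d}" using that by (simp add: column_group_def)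
    show ?thesis unfolding tensor_coeff_perm_act [OF s]
      by (rule a0 [of "inv_into UNIV s k"]) (use inv [OF s k] y in auto)
  qed
  then show ?thesis unfolding S(1) young_b_def tensor_coeff_sum tensor_coeff_scale by simp
qed

lemma schur_support: "T \<in> schur G lam V \<Longrightarrow> length is \<noteq> sum_list lam \<Longrightarrow> T is = 0"
  by (auto simp: schur_def young_b_def perm_act_def)

lemma zero_in_schur:
  fixes V :: "(complex^'N) set"
  shows "(\<lambda>is. 0) \<in> schur G lam V"
proof -
  have "(\<lambda>is. 0) \<in> traceless G (sum_list lam) V"
    unfolding traceless_def tensor_power_def by (auto intro!: exI [of _ "{}"])
  moreover have "young_b lam (young_a lam (\<lambda>is. 0)) = ((\<lambda>is. 0) :: 'N tensor)"
    by (simp add: young_b_def young_a_def perm_act_def fun_eq_iff)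
  ultimately show ?thesis
    unfolding schur_def by (intro image_eqI [where x = "\<lambda>is. 0"]) auto
qed

section \<open>Rational vectors\<close>

lemma sum_in_Rats: "(\<And>i. i \<in> I \<Longrightarrow> x i \<in> \<rat>) \<Longrightarrow> sum x I \<in> (\<rat> :: complex set)"
  by (induction I rule: infinite_finite_induct) auto

lemma bil_in_Ints: "x \<in> coords \<int> \<Longrightarrow> y \<in> coords \<int> \<Longrightarrow> bil G x y \<in> \<int>"
  unfolding bil_def coords_def by (intro Ints_sum Ints_mult) auto

lemma bil_in_Rats: "x \<in> coords \<rat> \<Longrightarrow> y \<in> coords \<rat> \<Longrightarrow> bil G x y \<in> \<rat>"
  unfolding bil_def coords_def by (intro sum_in_Rats Rats_mult) auto

lemma coords_Rats_add: "x \<in> coords \<rat> \<Longrightarrow> y \<in> coords \<rat> \<Longrightarrow> x + y \<in> coords \<rat>"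
  by (simp add: coords_def)

lemma coords_Rats_diff: "x \<in> coords \<rat> \<Longrightarrow> y \<in> coords \<rat> \<Longrightarrow> x - y \<in> coords \<rat>"
  by (simp add: coords_def)

lemma coords_Rats_minus: "x \<in> coords \<rat> \<Longrightarrow> - x \<in> coords \<rat>"
  by (simp add: coords_def)

lemma coords_Rats_scale: "c \<in> \<rat> \<Longrightarrow> x \<in> coords \<rat> \<Longrightarrow> c *s x \<in> coords \<rat>"
  by (simp add: coords_def)

lemma coords_Rats_sum: "(\<And>i. i \<in> I \<Longrightarrow> x i \<in> coords \<rat>) \<Longrightarrow> (\<Sum>i\<in>I. x i) \<in> coords \<rat>"
  by (simp add: coords_def sum_in_Rats)

lemma coords_Rats_axis: "axis i 1 \<in> coords \<rat>"
  by (simp add: coords_def axis_def)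

lemmas coords_Rats_intros = coords_Rats_add coords_Rats_diff coords_Rats_minus coords_Rats_scale coords_Rats_sum

lemma coords_mono: "F \<subseteq> F' \<Longrightarrow> x \<in> coords F \<Longrightarrow> x \<in> coords F'"
  by (auto simp: coords_def)

lemma Ints_subset_Rats: "(\<int> :: complex set) \<subseteq> \<rat>"
  by (auto elim!: Ints_cases)

lemma Rats_subset_Reals: "(\<rat> :: complex set) \<subseteq> \<real>"
  by (auto elim!: Rats_cases')

lemma common_denominator:
  assumes "finite X" "X \<subseteq> (\<rat> :: complex set)"
  shows "\<exists>D::int. D > 0 \<and> (\<forall>x\<in>X. of_int D * x \<in> \<int>)"
  using assms
proof (induction X)
  case (insert x X)
  then obtain D :: int where D: "D > 0" "\<forall>x\<in>X. of_int D * x \<in> \<int>" by auto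
  obtain a b :: int where ab: "b > 0" "x = of_int a / of_int b"
    using insert.prems by (auto elim!: Rats_cases')
  have "of_int (b * D) * y \<in> \<int>" if "y \<in> insert x X" for y
  proof (cases "y = x")
    case True
    have "of_int (b * D) * x = of_int (D * a)" using ab by simp
    then show ?thesis unfolding True by (metis Ints_of_int)
  next
    case False
    then have "of_int D * y \<in> \<int>" using D that by auto
    then have "of_int b * (of_int D * y) \<in> \<int>" by (rule Ints_mult [OF Ints_of_int])
    then show ?thesis by (simp add: mult.assoc)
  qed
  then show ?case using D(1) ab(1) by (intro exI [of _ "b * D"]) auto
qed (auto intro: exI [of _ 1])

lemma coords_common_denominator:
  assumes "x \<in> coords \<rat>"
  obtains D :: int where "D > 0" "of_int D *s x \<in> coords \<int>"
proof -
  obtain D :: int where "D > 0" "\<forall>y\<in>range (($) x). of_int D * y \<in> \<int>"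
    using common_denominator [of "range (($) x)"] assms by (auto simp: coords_def)
  then show ?thesis using that by (auto simp: coords_def)
qed

definition real_part :: "complex^'N \<Rightarrow> real^'N" where
  "real_part x = (\<chi> i. Re (x $ i))"

lemma bil_real_part:
  assumes "x \<in> coords \<real>" "y \<in> coords \<real>"
  shows "bil G x y = of_real (bil G (real_part x) (real_part y))"
proof -
  have "x $ i = of_real (Re (x $ i))" "y $ i = of_real (Re (y $ i))" for i
    using assms by (auto simp: coords_def)
  then show ?thesis unfolding bil_def real_part_def by simp
qed

lemma bil_conj: "bil G (conj_vec x) (conj_vec y) = cnj (bil G x y)"
  by (simp add: bil_def conj_vec_def)

lemma conj_vec_real: "x \<in> coords \<real> \<Longrightarrow> conj_vec x = x"
  by (auto simp: conj_vec_def coords_def vec_eq_iff Reals_cnj_iff)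

lemma conj_vec_Rats: "x \<in> coords \<rat> \<Longrightarrow> conj_vec x = x"
  using conj_vec_real coords_mono [OF Rats_subset_Reals] by blast

lemma conj_vec_add: "conj_vec (x + y) = conj_vec x + conj_vec y"
  by (simp add: conj_vec_def vec_eq_iff)

lemma conj_vec_scale: "conj_vec (c *s y) = cnj c *s conj_vec y"
  by (simp add: conj_vec_def vec_eq_iff)

section \<open>Hyperbolic frames\<close>

text \<open>
  The frame attached to a cusp: \<open>e\<close> generates \<open>I\<close>, \<open>e\<close> and \<open>v\<close> span \<open>J_\<rat>\<close>, and \<open>f\<close>, \<open>l\<close> form the dual
  basis of a complementary isotropic plane.
\<close>

locale hyperbolic =
  fixes G :: "int^'N^'N" and e v f l :: "complex^'N"
  assumes sym: "transpose G = G"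
    and rational: "e \<in> coords \<rat>" "v \<in> coords \<rat>" "f \<in> coords \<rat>" "l \<in> coords \<rat>"
    and relations: "bil G e e = 0" "bil G e v = 0" "bil G e f = 1" "bil G e l = 0" "bil G v v = 0"
      "bil G v f = 0" "bil G v l = 1" "bil G f f = 0" "bil G f l = 0" "bil G l l = 0"
begin

lemma relations': "bil G v e = 0" "bil G f e = 1" "bil G l e = 0" "bil G f v = 0" "bil G l v = 1" "bil G l f = 0"
  by (simp_all only: relations bil_sym [OF sym, of v e] bil_sym [OF sym, of f e] bil_sym [OF sym, of l e]
      bil_sym [OF sym, of f v] bil_sym [OF sym, of l v] bil_sym [OF sym, of l f])

lemmas rels = relations relations'

definition frame_perp :: "complex^'N \<Rightarrow> bool" where
  "frame_perp x \<longleftrightarrow> bil G x e = 0 \<and> bil G x v = 0 \<and> bil G x f = 0 \<and> bil G x l = 0"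

text \<open>
  The vectors \<open>e + f\<close> and \<open>v + l\<close> already span a positive definite plane. If \<open>x\<close> had norm \<open>\<ge> 0\<close>, the
  form would be positive semidefinite on a three-dimensional space, which meets every negative definite
  space of codimension \<open>2\<close>.
\<close>

lemma frame_perp_negative:
  assumes sig: "has_signature G 2 n" and x: "x \<in> coords \<real>" "frame_perp x" "x \<noteq> 0"
  shows "Re (bil G x x) < 0"
proof (rule ccontr)
  assume neg: "\<not> Re (bil G x x) < 0"
  have real: "e \<in> coords \<real>" "v \<in> coords \<real>" "f \<in> coords \<real>" "l \<in> coords \<real>"
    using rational coords_mono [OF Rats_subset_Reals] by auto
  let ?r = real_part
  have R: "bil G (?r a) (?r b) = Re (bil G a b)" if "a \<in> coords \<real>" "b \<in> coords \<real>" for a b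
    using bil_real_part [OF that] by simp
  have rR: "bil G (?r e) (?r e) = 0" "bil G (?r e) (?r v) = 0" "bil G (?r e) (?r f) = 1" "bil G (?r e) (?r l) = 0"
    "bil G (?r v) (?r e) = 0" "bil G (?r v) (?r v) = 0" "bil G (?r v) (?r f) = 0" "bil G (?r v) (?r l) = 1"
    "bil G (?r f) (?r e) = 1" "bil G (?r f) (?r v) = 0" "bil G (?r f) (?r f) = 0" "bil G (?r f) (?r l) = 0"
    "bil G (?r l) (?r e) = 0" "bil G (?r l) (?r v) = 1" "bil G (?r l) (?r f) = 0" "bil G (?r l) (?r l) = 0"
    using real by (simp_all add: R rels)
  have xR: "bil G (?r x) (?r e) = 0" "bil G (?r x) (?r v) = 0" "bil G (?r x) (?r f) = 0" "bil G (?r x) (?r l) = 0"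
    using x real by (simp_all add: R frame_perp_def)
  have xR': "bil G (?r e) (?r x) = 0" "bil G (?r v) (?r x) = 0" "bil G (?r f) (?r x) = 0" "bil G (?r l) (?r x) = 0"
    using xR bil_sym [OF sym, of "?r x"] by auto
  have xx: "bil G (?r x) (?r x) \<ge> 0" using neg x by (simp add: R)
  have x0: "?r x \<noteq> 0"
  proof
    assume "?r x = 0"
    then have "Re (x $ i) = 0" for i by (simp add: real_part_def vec_eq_iff)
    then have "x = 0" using x(1) by (auto simp: coords_def vec_eq_iff complex_eq_iff complex_is_Real_iff)
    with x(3) show False by simp
  qed
  \<comment> \<open>an orthogonal basis of a positive definite plane orthogonal to the real vector \<open>x\<close>\<close>
  define a where "a = ?r e + ?r f"
  define b where "b = ?r v + ?r l"
  have rels: "bil G a a = 2" "bil G b b = 2" "bil G a b = 0" "bil G b a = 0" "bil G a (?r x) = 0" "bil G (?r x) a = 0"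
    "bil G b (?r x) = 0" "bil G (?r x) b = 0"
    by (simp_all add: a_def b_def bil_add_left bil_add_right rR xR xR')
  have sc: "c *\<^sub>R y = c *s y" for c and y :: "real^'N" by (simp add: vec_eq_iff)
  have ab: "b \<notin> span {a}"
  proof
    assume "b \<in> span {a}"
    then obtain t where "b = t *\<^sub>R a" by (auto simp: span_singleton)
    then have "bil G b a = t * bil G a a" by (simp add: sc bil_scale_left)
    then have "t = 0" using rels by simp
    with \<open>b = t *\<^sub>R a\<close> rels show False by simp
  qed
  have "a \<noteq> 0" using rels(1) by auto
  have xab: "?r x \<notin> span {b, a}"
  proof
    assume "?r x \<in> span {b, a}"
    then obtain t where "?r x - t *\<^sub>R b \<in> span {a}" using span_breakdown_eq by blast
    then obtain s where "?r x - t *\<^sub>R b = s *\<^sub>R a" by (auto simp: span_singleton)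
    then have eq: "?r x = t *s b + s *s a" by (simp add: sc algebra_simps)
    have "bil G (?r x) a = s * 2" "bil G (?r x) b = t * 2"
      unfolding eq by (simp_all add: bil_add_left bil_scale_left rels)
    with rels eq x0 show False by simp
  qed
  have ind: "independent {?r x, b, a}"
    using ab xab \<open>a \<noteq> 0\<close> by (intro independent_insertI independent_empty) auto
  have card: "card {?r x, b, a} = 3"
    using ab xab by (auto simp: card_insert_if intro: span_base)
  obtain P M :: "(real^'N) set" where PM: "subspace M" "dim M = n" "\<And>x. x \<in> M \<Longrightarrow> x \<noteq> 0 \<Longrightarrow> bil G x x < 0"
    and N: "2 + n = CARD('N)"
    using sig unfolding has_signature_def by blast
  define S where "S = span {?r x, b, a}"
  have "dim S = 3" unfolding S_def dim_span using dim_eq_card_independent [OF ind] card by simp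
  then have "dim (S \<inter> M) > 0"
    using dim_sums_Int [of S M] PM(1,2) N dim_subset_UNIV [of "{x + y | x y. x \<in> S \<and> y \<in> M}"] by (simp add: S_def)
  then obtain y where y: "y \<in> S" "y \<in> M" "y \<noteq> 0"
    by (metis Int_iff dim_eq_0 gr_implies_not_zero subsetI singleton_iff)
  then obtain t1 where "y - t1 *\<^sub>R ?r x \<in> span {b, a}" unfolding S_def using span_breakdown_eq by blast
  then obtain t2 where "y - t1 *\<^sub>R ?r x - t2 *\<^sub>R b \<in> span {a}" using span_breakdown_eq by blast
  then obtain t3 where "y - t1 *\<^sub>R ?r x - t2 *\<^sub>R b = t3 *\<^sub>R a" by (auto simp: span_singleton)
  then have "y = t1 *s ?r x + t2 *s b + t3 *s a" by (simp add: sc algebra_simps)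
  then have "bil G y y = t1\<^sup>2 * bil G (?r x) (?r x) + 2 * t2\<^sup>2 + 2 * t3\<^sup>2"
    by (simp add: bil_linear rels power2_eq_square)
  also have "\<dots> \<ge> 0" using xx by simp
  finally show False using PM(3) [OF y(2,3)] by simp
qed

text \<open>
  The matrix with rows \<open>(a, b)\<close> and \<open>(c, d)\<close> acts on the basis \<open>e, v\<close>, its contragredient acts on the dual
  basis \<open>f, l\<close>, and the orthogonal complement is fixed. For determinant \<open>1\<close> this is an isometry. The
  composition law is that of matrices with the factors in reversed order.
\<close>

definition rot :: "complex \<Rightarrow> complex \<Rightarrow> complex \<Rightarrow> complex \<Rightarrow> complex^'N \<Rightarrow> complex^'N" where
  "rot a b c d x = x + bil G x f *s ((a - 1) *s e + b *s v) + bil G x l *s (c *s e + (d - 1) *s v)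
     + bil G x e *s ((d - 1) *s f - c *s l) + bil G x v *s ((a - 1) *s l - b *s f)"

lemma rot_frame: "rot a b c d e = a *s e + b *s v" "rot a b c d v = c *s e + d *s v"
  "rot a b c d f = d *s f - c *s l" "rot a b c d l = a *s l - b *s f"
  by (simp_all add: rot_def rels vec_eq_iff algebra_simps)

lemma rot_frame_perp: "frame_perp x \<Longrightarrow> rot a b c d x = x"
  by (simp add: rot_def frame_perp_def)

lemma rot_pairings: "bil G (rot a b c d x) f = a * bil G x f + c * bil G x l"
  "bil G (rot a b c d x) l = b * bil G x f + d * bil G x l"
  "bil G (rot a b c d x) e = d * bil G x e - b * bil G x v"
  "bil G (rot a b c d x) v = a * bil G x v - c * bil G x e"
  by (simp_all add: rot_def bil_linear rels algebra_simps)

lemma rot_rot: "rot a b c d (rot a' b' c' d' x) = rot (a' * a + b' * c) (a' * b + b' * d) (c' * a + d' * c) (c' * b + d' * d) x"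
  by (subst rot_def, subst rot_pairings, subst rot_pairings, subst rot_pairings, subst rot_pairings)
     (simp add: rot_def vec_eq_iff algebra_simps)

lemma rot_id: "rot 1 0 0 1 x = x"
  by (simp add: rot_def)

lemma rot_isometry:
  assumes "a * d - b * c = 1"
  shows "bil G (rot a b c d x) (rot a b c d y) = bil G x y"
proof -
  let ?x1 = "bil G x f" and ?x2 = "bil G x l" and ?x3 = "bil G x e" and ?x4 = "bil G x v"
  let ?y1 = "bil G y f" and ?y2 = "bil G y l" and ?y3 = "bil G y e" and ?y4 = "bil G y v"
  have s: "bil G f y = ?y1" "bil G l y = ?y2" "bil G e y = ?y3" "bil G v y = ?y4"
    by (rule bil_sym [OF sym])+
  have "bil G (rot a b c d x) (rot a b c d y) - bil G x y =
     (a * d - b * c - 1) * (?x1 * ?y3 + ?x2 * ?y4 + ?x3 * ?y1 + ?x4 * ?y2)"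
    unfolding rot_def [of a b c d y] bil_add_right bil_scale_right bil_diff_right rot_pairings
    by (simp add: rot_def bil_linear rels s algebra_simps)
  then show ?thesis using assms by simp
qed

lemma rot_linear: "rot a b c d (x + y) = rot a b c d x + rot a b c d y" "rot a b c d (t *s x) = t *s rot a b c d x"
  by (simp_all add: rot_def bil_linear vec_eq_iff algebra_simps)

definition rotm :: "int \<Rightarrow> int \<Rightarrow> int \<Rightarrow> int \<Rightarrow> complex^'N^'N" where
  "rotm a b c d = matrix (rot (of_int a) (of_int b) (of_int c) (of_int d))"

lemma rotm_works: "rotm a b c d *v x = rot (of_int a) (of_int b) (of_int c) (of_int d) x"
  unfolding rotm_def
  by (rule matrix_works) (auto simp: Vector_Spaces.linear_iff rot_linear vec.vector_space_axioms)

lemma rotm_mult: "rotm a b c d ** rotm a' b' c' d' = rotm (a' * a + b' * c) (a' * b + b' * d) (c' * a + d' * c) (c' * b + d' * d)"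
  by (rule matrix_eq [THEN iffD2]) (simp add: matrix_vector_mul_assoc [symmetric] rotm_works rot_rot)

lemma rotm_id: "rotm 1 0 0 1 = mat 1"
  by (rule matrix_eq [THEN iffD2]) (simp add: rotm_works rot_id)

end

text \<open>
  The complement of the hyperbolic four-space is negative definite and is diagonalized over \<open>\<rat>\<close>. The
  norms are normalized to be integers, as the number \<open>q i\<close> becomes a coefficient of the quadratic form of
  the index of Jacobi forms.
\<close>

locale adapted_frame = hyperbolic G e v f l
  for G :: "int^'N^'N" and e v f l :: "complex^'N" +
  fixes w :: "nat \<Rightarrow> complex^'N" and p :: nat and q :: "nat \<Rightarrow> nat"
  assumes w_rational: "\<And>i. i < p \<Longrightarrow> w i \<in> coords \<rat>"
    and w_perp: "\<And>i. i < p \<Longrightarrow> frame_perp (w i)"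
    and w_orthogonal: "\<And>i j. i < p \<Longrightarrow> j < p \<Longrightarrow> bil G (w i) (w j) = (if i = j then - of_nat (q i) else 0)"
    and q_pos: "\<And>i. i < p \<Longrightarrow> q i > 0"
    and expand: "\<And>x. x = bil G x f *s e + bil G x l *s v + bil G x e *s f + bil G x v *s l
        - (\<Sum>i<p. (bil G x (w i) / of_nat (q i)) *s w i)"

text \<open>
  Enlarging the vectors \<open>w i\<close> makes their pairings with a given lattice integral; the frame can thus be
  adapted to finitely many Fourier expansions at once.
\<close>

lemma (in adapted_frame) rescale:
  assumes D: "D > (0::nat)"
  shows "adapted_frame G e v f l (\<lambda>i. of_nat D *s w i) p (\<lambda>i. D\<^sup>2 * q i)"
proof unfold_locales
  fix x
  have "(\<Sum>i<p. (bil G x (of_nat D *s w i) / of_nat (D\<^sup>2 * q i)) *s (of_nat D *s w i)) = (\<Sum>i<p. (bil G x (w i) / of_nat (q i)) *s w i)"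
    using D q_pos by (intro sum.cong refl) (simp add: bil_linear power2_eq_square)
  then show "x = bil G x f *s e + bil G x l *s v + bil G x e *s f + bil G x v *s l
        - (\<Sum>i<p. (bil G x (of_nat D *s w i) / of_nat (D\<^sup>2 * q i)) *s (of_nat D *s w i))"
    using expand by simp
qed (use D w_rational w_perp w_orthogonal q_pos in \<open>auto simp: frame_perp_def bil_linear power2_eq_square intro!: coords_Rats_scale\<close>)

context hyperbolic
begin

text \<open>
  A set of pairwise orthogonal integral vectors in the complement is linearly independent, as the
  vectors are anisotropic. In a set of maximal size the residual of every basis vector after orthogonal
  projection must vanish, since a multiple of it could otherwise be added to the set.
\<close>

lemma exists_adapted_frame:
  assumes sig: "has_signature G 2 n"
  obtains w p q where "adapted_frame G e v f l w p q" "n \<le> p + 2"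
proof -
  define Q where "Q S \<longleftrightarrow> finite S \<and> (\<forall>s\<in>S. s \<in> coords \<int> \<and> frame_perp s \<and> s \<noteq> 0) \<and> (\<forall>s\<in>S. \<forall>t\<in>S. s \<noteq> t \<longrightarrow> bil G s t = 0)" for S
  have norm: "\<exists>k>0. bil G s s = - of_nat k" if s: "s \<in> coords \<int>" "frame_perp s" "s \<noteq> 0" for s
  proof -
    have "s \<in> coords \<real>" using coords_mono [OF Ints_subset_Rats] coords_mono [OF Rats_subset_Reals] s by blast
    then have neg: "Re (bil G s s) < 0" using frame_perp_negative [OF sig] s by blast
    obtain z :: int where z: "bil G s s = of_int z" using bil_in_Ints [OF s(1) s(1)] by (auto elim: Ints_cases)
    then have "z < 0" using neg by simp
    then show ?thesis using z by (intro exI [of _ "nat (- z)"]) simp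
  qed
  have bound: "card S < CARD('N) + 1" if "Q S" for S
  proof -
    have "vec.independent S"
      unfolding vec.independent_explicit_finite_subsets
    proof (intro allI ballI impI)
      fix A u s assume A: "A \<subseteq> S" "finite A" and sum: "(\<Sum>x\<in>A. u x *s x) = 0" and s: "s \<in> A"
      have "0 = bil G (\<Sum>x\<in>A. u x *s x) s" by (simp add: sum)
      also have "\<dots> = (\<Sum>x\<in>A. if x = s then u s * bil G s s else 0)"
        unfolding bil_sum_left bil_scale_left by (intro sum.cong refl) (use \<open>Q S\<close> A s in \<open>auto simp: Q_def\<close>)
      also have "\<dots> = u s * bil G s s" using A s by simp
      finally have "u s * bil G s s = 0" by simp
      moreover have "bil G s s \<noteq> 0" using norm [of s] \<open>Q S\<close> A s by (auto simp: Q_def)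
      ultimately show "u s = 0" by simp
    qed
    then have "card S \<le> CARD('N)"
      using vec.independent_bound_general [of S] dim_subset_UNIV_cart_gen [of S] by simp
    then show ?thesis by simp
  qed
  have "Q {}" by (simp add: Q_def)
  from ex_has_greatest_nat [of Q, OF this, of card "CARD('N) + 1"] bound
  obtain S where S: "Q S" "\<And>S'. Q S' \<Longrightarrow> card S' \<le> card S" by (metis less_imp_le)
  define p where "p = card S"
  have fin: "finite S" using S by (simp add: Q_def)
  obtain w where w: "bij_betw w {..<p} S"
    using ex_bij_betw_nat_finite [OF fin] unfolding p_def atLeast0LessThan by blast
  define q where "q i = nat \<lfloor>- Re (bil G (w i) (w i))\<rfloor>" for i
  have wS: "w i \<in> S" if "i < p" for i using w that by (auto simp: bij_betw_def)
  have qn: "q i > 0 \<and> bil G (w i) (w i) = - of_nat (q i)" if "i < p" for i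
  proof -
    have "w i \<in> S" using wS that by blast
    then obtain k where "k > 0" "bil G (w i) (w i) = - of_nat k"
      using norm [of "w i"] S(1) by (auto simp: Q_def)
    then show ?thesis by (simp add: q_def)
  qed
  have ww: "bil G (w i) (w j) = (if i = j then - of_nat (q i) else 0)" if "i < p" "j < p" for i j
  proof (cases "i = j")
    case False
    then have "w i \<noteq> w j" using w that by (auto simp: bij_betw_def inj_on_def)
    then show ?thesis using False S(1) wS that by (auto simp: Q_def)
  qed (use qn that in auto)
  have wrat: "w i \<in> coords \<rat>" and wperp: "frame_perp (w i)" if "i < p" for i
    using wS [OF that] S(1) coords_mono [OF Ints_subset_Rats] by (auto simp: Q_def)
  \<comment> \<open>the residual of \<open>x\<close> after projection to the span of the frame and of the vectors \<open>w i\<close>\<close>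
  define res where "res x = x - (bil G x f *s e + bil G x l *s v + bil G x e *s f + bil G x v *s l
        - (\<Sum>i<p. (bil G x (w i) / of_nat (q i)) *s w i))" for x
  have res_add: "res (x + y) = res x + res y" for x y
    by (simp add: res_def bil_linear vec_eq_iff add_divide_distrib sum.distrib algebra_simps)
  have res_scale: "res (c *s x) = c *s res x" for c x
    by (simp add: res_def bil_linear vec_eq_iff algebra_simps sum_distrib_left)
  have res_sum: "res (\<Sum>i\<in>I. c i *s x i) = (\<Sum>i\<in>I. c i *s res (x i))" if "finite I" for I c x
  proof -
    have "res 0 = 0" by (simp add: res_def)
    with that show ?thesis by (induction I rule: finite_induct) (auto simp: res_add res_scale)
  qed
  have res_perp: "frame_perp (res x)" and res_w: "i < p \<Longrightarrow> bil G (res x) (w i) = 0" for x i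
  proof -
    have wz: "bil G (w i) e = 0" "bil G (w i) v = 0" "bil G (w i) f = 0" "bil G (w i) l = 0"
      "bil G e (w i) = 0" "bil G v (w i) = 0" "bil G f (w i) = 0" "bil G l (w i) = 0" if "i < p" for i
      using wperp [OF that] bil_sym [OF sym, of "w i"] by (auto simp: frame_perp_def)
    show "frame_perp (res x)" by (simp add: frame_perp_def res_def bil_linear rels wz)
    show "bil G (res x) (w i) = 0" if i: "i < p"
    proof -
      have "(\<Sum>j<p. bil G x (w j) / of_nat (q j) * bil G (w j) (w i)) = (\<Sum>j<p. if j = i then - bil G x (w i) else 0)"
        by (intro sum.cong refl) (use qn i in \<open>auto simp: ww\<close>)
      then show ?thesis using i by (simp add: res_def bil_linear wz)
    qed
  qed
  have "res (axis k 1) = 0" for k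
  proof (rule ccontr)
    assume nz: "res (axis k 1) \<noteq> 0"
    have "res (axis k 1) \<in> coords \<rat>"
      unfolding res_def using rational wrat
      by (intro coords_Rats_intros bil_in_Rats coords_Rats_axis Rats_divide) auto
    then obtain D :: int where D: "D > 0" "of_int D *s res (axis k 1) \<in> coords \<int>"
      by (rule coords_common_denominator)
    define s where "s = of_int D *s res (axis k 1)"
    have s: "s \<in> coords \<int>" "frame_perp s" "s \<noteq> 0"
      using D nz res_perp [of "axis k 1"] by (auto simp: s_def frame_perp_def bil_scale_left)
    have sS: "bil G s t = 0" if "t \<in> S" for t
    proof -
      have "t \<in> w ` {..<p}" using w that by (simp add: bij_betw_def)
      then obtain i where "i < p" "t = w i" by blast
      then show ?thesis using res_w by (simp add: s_def bil_scale_left)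
    qed
    have "s \<notin> S"
    proof
      assume "s \<in> S"
      then have "bil G s s = 0" by (rule sS)
      with norm [OF s] show False by auto
    qed
    moreover have "Q (insert s S)"
    proof -
      have "bil G t s = 0" if "t \<in> S" for t using sS [OF that] bil_sym [OF sym, of t s] by simp
      then show ?thesis using S(1) s sS by (auto simp: Q_def)
    qed
    ultimately show False using S(2) [of "insert s S"] fin by simp
  qed
  then have res0: "res x = 0" for x
    using res_sum [of UNIV "\<lambda>i. x $ i" "\<lambda>i. axis i 1"] by (simp add: basis_expansion)
  then have ex: "x = bil G x f *s e + bil G x l *s v + bil G x e *s f + bil G x v *s l
        - (\<Sum>i<p. (bil G x (w i) / of_nat (q i)) *s w i)" for x
    unfolding res_def by (simp only: right_minus_eq)
  have "adapted_frame G e v f l w p q"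
    by unfold_locales (use wrat wperp ww qn ex in auto)
  moreover have "n \<le> p + 2"
  proof -
    let ?B = "{e, v, f, l} \<union> S"
    have "x \<in> vec.span ?B" for x
      by (subst ex [of x]) (intro vec.span_diff vec.span_add vec.span_scale vec.span_sum vec.span_base; use wS in auto)
    then have "UNIV \<subseteq> vec.span ?B" by blast
    then have "vec.dim (UNIV :: (complex^'N) set) \<le> card ?B"
      using fin by (intro vec.dim_le_card) auto
    then have "CARD('N) \<le> card ?B" by (simp add: card_cart_basis)
    also have "\<dots> \<le> card {e, v, f, l} + card S" by (rule card_Un_le)
    also have "card {e, v, f, l} \<le> 4" using card_length [of "[e, v, f, l]"] by simp
    finally have "CARD('N) \<le> 4 + p" by (simp add: p_def)
    then show ?thesis using sig by (simp add: has_signature_def)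
  qed
  ultimately show ?thesis by (rule that)
qed

end

section \<open>Fourier analysis on the torsion grid\<close>

definition ee :: "complex \<Rightarrow> complex" where
  "ee z = exp (2 * of_real pi * \<i> * z)"

lemma ee_add: "ee (x + y) = ee x * ee y"
  by (simp add: ee_def ring_distribs exp_add)

lemma ee_0 [simp]: "ee 0 = 1"
  by (simp add: ee_def)

lemma ee_nonzero [simp]: "ee x \<noteq> 0"
  by (simp add: ee_def)

lemma ee_int [simp]: "ee (of_int k) = 1"
  unfolding ee_def exp_eq_1 by simp

lemma norm_ee: "norm (ee z) = exp (- 2 * pi * Im z)"
  by (simp add: ee_def)

lemma ee_eq_1_iff: "ee z = 1 \<longleftrightarrow> (\<exists>k::int. z = of_int k)"
  unfolding ee_def exp_eq_1
  by (auto simp: complex_eq_iff mult.commute)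

lemma ee_sum: "finite I \<Longrightarrow> ee (\<Sum>i\<in>I. x i) = (\<Prod>i\<in>I. ee (x i))"
  by (simp add: ee_def sum_distrib_left exp_sum)

lemma ee_of_nat_mult: "ee (of_nat n * x) = ee x ^ n"
  by (simp add: ee_def exp_of_nat_mult [symmetric] mult_ac)

text \<open>
  Representatives of \<open>(\<int>/M)\<^sup>p\<close>; divided by \<open>M\<close> they are the points of order \<open>M\<close> of the torus \<open>(\<real>/\<int>)\<^sup>p\<close>.
\<close>

definition grid :: "nat \<Rightarrow> int \<Rightarrow> (nat \<Rightarrow> int) set" where
  "grid p M = PiE {..<p} (\<lambda>_. {0..<M})"

lemma finite_grid [simp]: "finite (grid p M)"
  by (simp add: grid_def finite_PiE)

lemma card_grid: "M \<ge> 0 \<Longrightarrow> card (grid p M) = nat M ^ p"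
  by (simp add: grid_def card_PiE)

lemma grid_range: "y \<in> grid p M \<Longrightarrow> i < p \<Longrightarrow> 0 \<le> y i \<and> y i < M"
  by (auto simp: grid_def PiE_iff)

definition dotp :: "nat \<Rightarrow> (nat \<Rightarrow> int) \<Rightarrow> (nat \<Rightarrow> complex) \<Rightarrow> complex" where
  "dotp p r x = (\<Sum>i<p. of_int (r i) * x i)"

lemma dotp_add: "dotp p r (\<lambda>i. x i + y i) = dotp p r x + dotp p r y"
  by (simp add: dotp_def ring_distribs sum.distrib)

lemma dotp_diff: "dotp p (\<lambda>i. r i - s i) x = dotp p r x - dotp p s x"
  by (simp add: dotp_def ring_distribs sum_subtractf)

lemma sum_ee_cyclic:
  assumes "M > 0"
  shows "(\<Sum>y\<in>{0..<M::int}. ee (of_int s * (of_int y / of_int M))) = (if M dvd s then of_int M else 0)"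
proof -
  define \<omega> where "\<omega> = ee (of_int s / of_int M)"
  have "(\<Sum>y\<in>{0..<M}. ee (of_int s * (of_int y / of_int M)))
      = (\<Sum>y<nat M. ee (of_int s * (of_nat y / of_int M)))"
    by (rule sum.reindex_bij_witness [where i = int and j = nat]) auto
  also have "\<dots> = (\<Sum>y<nat M. \<omega> ^ y)"
    by (rule sum.cong) (simp_all add: \<omega>_def mult_ac flip: ee_of_nat_mult)
  finally have eq: "(\<Sum>y\<in>{0..<M}. ee (of_int s * (of_int y / of_int M))) = (\<Sum>y<nat M. \<omega> ^ y)" .
  show ?thesis
  proof (cases "M dvd s")
    case True
    then obtain t where "s = M * t" by blast
    then have "\<omega> = 1" using assms by (simp add: \<omega>_def)
    then show ?thesis using eq True assms by simp
  next
    case False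
    have "\<omega> \<noteq> 1"
    proof
      assume "\<omega> = 1"
      then obtain k where "complex_of_int s / of_int M = of_int k"
        unfolding \<omega>_def ee_eq_1_iff by blast
      then have "complex_of_int s = of_int (k * M)" using assms by (simp add: field_simps)
      then have "s = k * M" by (simp only: of_int_eq_iff)
      with False show False by simp
    qed
    moreover have "\<omega> ^ nat M = ee (of_nat (nat M) * (of_int s / of_int M))"
      unfolding \<omega>_def ee_of_nat_mult by simp
    then have "\<omega> ^ nat M = 1" using assms by simp
    ultimately show ?thesis using eq False by (simp add: geometric_sum)
  qed
qed

definition scaled :: "int \<Rightarrow> (nat \<Rightarrow> int) \<Rightarrow> nat \<Rightarrow> real" where
  "scaled M y i = of_int (y i) / of_int M"

abbreviation cscaled :: "int \<Rightarrow> (nat \<Rightarrow> int) \<Rightarrow> nat \<Rightarrow> complex" where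
  "cscaled M y i \<equiv> complex_of_real (scaled M y i)"

lemma sum_ee_grid:
  assumes "M > 0"
  shows "(\<Sum>y\<in>grid p M. ee (dotp p s (cscaled M y))) = (if \<forall>i<p. M dvd s i then of_int M ^ p else 0)"
proof -
  have "(\<Sum>y\<in>grid p M. ee (dotp p s (cscaled M y)))
      = (\<Sum>y\<in>grid p M. \<Prod>i<p. ee (of_int (s i) * (of_int (y i) / of_int M)))"
    by (simp add: dotp_def ee_sum scaled_def)
  also have "\<dots> = (\<Prod>i<p. \<Sum>y\<in>{0..<M}. ee (of_int (s i) * (of_int y / of_int M)))"
    unfolding grid_def by (rule prod_sum_PiE [symmetric]) auto
  also have "\<dots> = (\<Prod>i<p. if M dvd s i then of_int M else 0)"
    by (simp only: sum_ee_cyclic [OF assms])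
  also have "\<dots> = (if \<forall>i<p. M dvd s i then of_int M ^ p else 0)"
    by (auto intro: prod_zero)
  finally show ?thesis .
qed

lemma has_sum_finite_sum:
  fixes f :: "'i \<Rightarrow> 'l \<Rightarrow> 'b :: topological_comm_monoid_add"
  assumes "finite I" "\<And>i. i \<in> I \<Longrightarrow> (f i has_sum s i) X"
  shows "((\<lambda>l. \<Sum>i\<in>I. f i l) has_sum (\<Sum>i\<in>I. s i)) X"
  using assms by (induction I rule: finite_induct) (auto intro!: has_sum_add)

text \<open>
  The discrete Fourier coefficient of frequency \<open>r\<close> of \<open>u\<close> on the points of order \<open>M\<close>. Finite sums over
  the grid replace integrals over the torus throughout.
\<close>

definition grid_fourier :: "nat \<Rightarrow> int \<Rightarrow> (nat \<Rightarrow> int) \<Rightarrow> ((nat \<Rightarrow> complex) \<Rightarrow> complex) \<Rightarrow> complex" where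
  "grid_fourier p M r u = (\<Sum>y\<in>grid p M. u (cscaled M y) * ee (- dotp p r (cscaled M y))) / of_int M ^ p"

text \<open>
  Frequencies that are congruent modulo \<open>M\<close> cannot be distinguished on the grid, so the discrete Fourier
  coefficient collects all of them.
\<close>

lemma grid_fourier_has_sum:
  fixes R :: "'l \<Rightarrow> nat \<Rightarrow> int" and c :: "'l \<Rightarrow> complex"
  assumes M: "M > 0"
    and hs: "\<And>y. ((\<lambda>l. c l * ee (dotp p (R l) (\<lambda>i. of_real (y i)))) has_sum u (\<lambda>i. complex_of_real (y i))) X"
  shows "(c has_sum grid_fourier p M r u) {l \<in> X. \<forall>i<p. M dvd R l i - r i}"
proof -
  have "((\<lambda>l. c l * ee (dotp p (R l) (cscaled M y)) * ee (- dotp p r (cscaled M y)))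
      has_sum (u (cscaled M y) * ee (- dotp p r (cscaled M y)))) X" for y
    by (rule has_sum_cmult_left) (rule hs)
  then have "((\<lambda>l. \<Sum>y\<in>grid p M. c l * ee (dotp p (R l) (cscaled M y)) * ee (- dotp p r (cscaled M y)))
      has_sum (\<Sum>y\<in>grid p M. u (cscaled M y) * ee (- dotp p r (cscaled M y)))) X"
    by (intro has_sum_finite_sum) auto
  moreover have "(\<Sum>y\<in>grid p M. c l * ee (dotp p (R l) (cscaled M y)) * ee (- dotp p r (cscaled M y)))
      = c l * (if \<forall>i<p. M dvd R l i - r i then of_int M ^ p else 0)" for l
    by (subst sum_ee_grid [OF M, symmetric])
       (simp add: sum_distrib_left dotp_diff mult.assoc ee_add [symmetric])
  ultimately have "((\<lambda>l. c l * (if \<forall>i<p. M dvd R l i - r i then of_int M ^ p else 0))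
      has_sum (\<Sum>y\<in>grid p M. u (cscaled M y) * ee (- dotp p r (cscaled M y)))) X"
    by simp
  from has_sum_cmult_left [OF this, of "inverse (of_int M ^ p)"]
  have "((\<lambda>l. c l * (if \<forall>i<p. M dvd R l i - r i then of_int M ^ p else 0) * inverse (of_int M ^ p))
      has_sum grid_fourier p M r u) X"
    unfolding grid_fourier_def
    by (simp add: divide_inverse)
  then show ?thesis
    by (rule has_sum_cong_neutral [THEN iffD1, rotated -1]) (use M in \<open>auto split: if_splits\<close>)
qed

text \<open>
  Bessel's inequality for the characters \<open>r \<in> Rs\<close>, which are orthonormal for the average over the grid
  because they are incongruent modulo \<open>M\<close>.
\<close>

lemma bessel_grid:
  assumes M: "M > 0" and fin: "finite Rs"
    and inc: "\<And>r s. r \<in> Rs \<Longrightarrow> s \<in> Rs \<Longrightarrow> \<forall>i<p. M dvd r i - s i \<Longrightarrow> r = s"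
  shows "(\<Sum>r\<in>Rs. (norm (grid_fourier p M r u))\<^sup>2) * of_int M ^ p \<le> (\<Sum>y\<in>grid p M. (norm (u (cscaled M y)))\<^sup>2)"
proof -
  let ?N = "complex_of_int M ^ p"
  define x where "x y = cscaled M y" for y
  define T where "T r = grid_fourier p M r u" for r
  \<comment> \<open>the orthogonal projection of \<open>u\<close> to the span of the characters\<close>
  define P where "P y = (\<Sum>r\<in>Rs. T r * ee (dotp p r (x y)))" for y
  have cnj_ee: "cnj (ee (dotp p r (x y))) = ee (- dotp p r (x y))" for r y
    by (simp add: ee_def exp_cnj dotp_def x_def)
  have T: "(\<Sum>y\<in>grid p M. u (x y) * ee (- dotp p r (x y))) = T r * ?N" for r
    using M by (simp add: T_def grid_fourier_def x_def)
  have uP: "(\<Sum>y\<in>grid p M. u (x y) * cnj (P y)) = (\<Sum>r\<in>Rs. T r * cnj (T r)) * ?N"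
  proof -
    have "(\<Sum>y\<in>grid p M. u (x y) * cnj (P y)) = (\<Sum>y\<in>grid p M. \<Sum>r\<in>Rs. cnj (T r) * (u (x y) * ee (- dotp p r (x y))))"
      unfolding P_def cnj_sum complex_cnj_mult cnj_ee sum_distrib_left
      by (intro sum.cong refl) (simp add: mult_ac)
    also have "\<dots> = (\<Sum>r\<in>Rs. \<Sum>y\<in>grid p M. cnj (T r) * (u (x y) * ee (- dotp p r (x y))))"
      by (rule sum.swap)
    also have "\<dots> = (\<Sum>r\<in>Rs. cnj (T r) * (T r * ?N))"
      by (simp add: sum_distrib_left [symmetric] T)
    finally show ?thesis unfolding sum_distrib_right by (simp only: mult_ac)
  qed
  have PP: "(\<Sum>y\<in>grid p M. P y * cnj (P y)) = (\<Sum>r\<in>Rs. T r * cnj (T r)) * ?N"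
  proof -
    have "(\<Sum>y\<in>grid p M. P y * cnj (P y)) =
        (\<Sum>y\<in>grid p M. \<Sum>r\<in>Rs. \<Sum>s\<in>Rs. T r * cnj (T s) * ee (dotp p (\<lambda>i. r i - s i) (x y)))"
      by (simp add: P_def cnj_ee sum_product mult_ac dotp_diff ee_add [of _ "- _", simplified])
    also have "\<dots> = (\<Sum>r\<in>Rs. \<Sum>s\<in>Rs. \<Sum>y\<in>grid p M. T r * cnj (T s) * ee (dotp p (\<lambda>i. r i - s i) (x y)))"
      by (subst sum.swap, rule sum.cong [OF refl], subst sum.swap, rule refl)
    also have "\<dots> = (\<Sum>r\<in>Rs. \<Sum>s\<in>Rs. T r * cnj (T s) * (if \<forall>i<p. M dvd r i - s i then ?N else 0))"
      unfolding sum_distrib_left [symmetric] x_def by (simp only: sum_ee_grid [OF M])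
    also have "\<dots> = (\<Sum>r\<in>Rs. \<Sum>s\<in>Rs. if r = s then T r * cnj (T s) * ?N else 0)"
      by (intro sum.cong refl) (use inc in auto)
    also have "\<dots> = (\<Sum>r\<in>Rs. T r * cnj (T r) * ?N)"
      using fin by simp
    finally show ?thesis by (simp add: sum_distrib_right)
  qed
  define S where "S = (\<Sum>r\<in>Rs. (norm (T r))\<^sup>2) * of_int M ^ p"
  have S: "(\<Sum>r\<in>Rs. T r * cnj (T r)) * ?N = complex_of_real S"
    by (simp only: S_def complex_norm_square [symmetric] of_real_mult of_real_sum of_real_power of_real_of_int_eq)
  have "(\<Sum>y\<in>grid p M. complex_of_real ((norm (u (x y) - P y))\<^sup>2))
      = (\<Sum>y\<in>grid p M. u (x y) * cnj (u (x y)) - u (x y) * cnj (P y) - cnj (u (x y) * cnj (P y)) + P y * cnj (P y))"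
    by (intro sum.cong refl, subst complex_norm_square) (simp add: algebra_simps)
  also have "\<dots> = (\<Sum>y\<in>grid p M. complex_of_real ((norm (u (x y)))\<^sup>2)) - complex_of_real S"
    unfolding sum.distrib sum_subtractf cnj_sum [symmetric] uP PP S
    by (simp only: complex_norm_square) simp
  finally have "(\<Sum>y\<in>grid p M. (norm (u (x y) - P y))\<^sup>2) = (\<Sum>y\<in>grid p M. (norm (u (x y)))\<^sup>2) - S"
    by (simp only: of_real_sum [symmetric] of_real_diff [symmetric] of_real_eq_iff)
  moreover have "(\<Sum>y\<in>grid p M. (norm (u (x y) - P y))\<^sup>2) \<ge> 0"
    by (intro sum_nonneg) auto
  ultimately show ?thesis by (simp add: S_def T_def x_def)
qed

text \<open>
  For large \<open>M\<close> the frequencies congruent but not equal to \<open>r\<close> avoid any given finite set, so together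
  they contribute only a tail of the series. This bounds the aliasing error in discrete Fourier
  coefficients.
\<close>

lemma summable_tail_incongruent:
  fixes R :: "'l \<Rightarrow> nat \<Rightarrow> int" and P :: "'l \<Rightarrow> real"
  assumes P: "P summable_on X" "\<And>l. P l \<ge> 0" and fin: "finite Rs" and e: "\<epsilon> > 0"
  shows "\<exists>M0. \<forall>M\<ge>M0. \<forall>r\<in>Rs. infsum P {l \<in> X. (\<forall>i<p. M dvd R l i - r i) \<and> \<not> (\<forall>i<p. R l i = r i)} < \<epsilon>"
proof -
  have "(P has_sum infsum P X) X" using P by simp
  then have "\<forall>\<^sub>F F in finite_subsets_at_top X. dist (sum P F) (infsum P X) < \<epsilon>"
    unfolding has_sum_def by (rule tendstoD) (rule e)
  then obtain F where F: "finite F" "F \<subseteq> X" "dist (sum P F) (infsum P X) < \<epsilon>"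
    unfolding eventually_finite_subsets_at_top by (metis order_refl)
  define M0 where "M0 = (\<Sum>l\<in>F. \<Sum>r\<in>Rs. \<Sum>i<p. \<bar>R l i - r i\<bar>) + 1"
  show ?thesis
  proof (intro exI [of _ M0] allI impI ballI)
    fix M r assume M: "M0 \<le> M" and r: "r \<in> Rs"
    let ?B = "{l \<in> X. (\<forall>i<p. M dvd R l i - r i) \<and> \<not> (\<forall>i<p. R l i = r i)}"
    have "?B \<subseteq> X - F"
    proof (rule subsetI, rule ccontr)
      fix l assume "l \<in> ?B" "l \<notin> X - F"
      then obtain i where l: "l \<in> X" "\<forall>i<p. M dvd R l i - r i" "i < p" "R l i \<noteq> r i" and lF: "l \<in> F"
        by blast
      have "\<bar>R l i - r i\<bar> \<le> (\<Sum>i<p. \<bar>R l i - r i\<bar>)"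
        by (rule member_le_sum) (use l in auto)
      also have "\<dots> \<le> (\<Sum>r\<in>Rs. \<Sum>i<p. \<bar>R l i - r i\<bar>)"
        by (rule member_le_sum) (use r fin in \<open>auto intro!: sum_nonneg\<close>)
      also have "\<dots> \<le> (\<Sum>l\<in>F. \<Sum>r\<in>Rs. \<Sum>i<p. \<bar>R l i - r i\<bar>)"
        by (rule member_le_sum) (use lF F in \<open>auto intro!: sum_nonneg\<close>)
      finally have "\<bar>R l i - r i\<bar> < M" using M by (simp add: M0_def)
      moreover have "M dvd R l i - r i" using l by blast
      ultimately show False
        using l(4) dvd_imp_le_int [of "R l i - r i" M] by auto
    qed
    then have "infsum P ?B \<le> infsum P (X - F)"
      using P by (intro infsum_mono_neutral) (auto intro: summable_on_subset_banach)
    also have "infsum P (X - F) = infsum P X - sum P F"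
    proof -
      have "infsum P (F \<union> (X - F)) = infsum P F + infsum P (X - F)"
        using F P by (intro infsum_Un_disjoint) (auto intro: summable_on_subset_banach)
      moreover have "F \<union> (X - F) = X" using F by auto
      ultimately show ?thesis using F by simp
    qed
    also have "\<dots> < \<epsilon>" using F(3) by (simp add: dist_real_def)
    finally show "infsum P ?B < \<epsilon>" .
  qed
qed

section \<open>Theta expansions and an upper bound for the Petersson norm\<close>

lemma geometric_sum_int_le:
  fixes t :: real
  assumes "t > 0" "finite S"
  shows "(\<Sum>x\<in>S. exp (- t * \<bar>of_int (x - n)\<bar>)) \<le> 2 * (1 + 1 / t)"
proof -
  define r where "r = exp (- t)"
  have r: "0 < r" "r < 1" using assms(1) by (auto simp: r_def)
  have "1 + t \<le> exp t" by (rule exp_ge_add_one_self)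
  then have "r \<le> 1 / (1 + t)"
    using assms by (simp add: r_def exp_minus divide_inverse le_imp_inverse_le)
  then have "t / (1 + t) \<le> 1 - r" using assms by (simp add: field_simps)
  then have r': "1 / (1 - r) \<le> 1 + 1 / t" using assms r by (simp add: field_simps)
  have half: "(\<Sum>x\<in>T. r ^ nat \<bar>x - n\<bar>) \<le> 1 + 1 / t"
    if "finite T" "inj_on (\<lambda>x. nat \<bar>x - n\<bar>) T" for T
  proof -
    have "(\<Sum>x\<in>T. r ^ nat \<bar>x - n\<bar>) = (\<Sum>k\<in>(\<lambda>x. nat \<bar>x - n\<bar>) ` T. r ^ k)"
      by (simp add: sum.reindex that)
    also have "\<dots> \<le> (\<Sum>k. r ^ k)"
      by (rule sum_le_suminf) (use r that in \<open>auto intro: summable_geometric\<close>)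
    also have "\<dots> = 1 / (1 - r)" using r by (intro suminf_geometric) auto
    finally show ?thesis using r' by linarith
  qed
  have "(\<Sum>x\<in>S. exp (- t * \<bar>of_int (x - n)\<bar>)) = (\<Sum>x\<in>S. r ^ nat \<bar>x - n\<bar>)"
    by (intro sum.cong refl) (simp add: r_def exp_of_nat_mult [symmetric] mult.commute)
  also have "\<dots> = (\<Sum>x\<in>S \<inter> {x. n \<le> x}. r ^ nat \<bar>x - n\<bar>) + (\<Sum>x\<in>S \<inter> - {x. n \<le> x}. r ^ nat \<bar>x - n\<bar>)"
    using sum.Int_Diff [OF assms(2), of _ "{x. n \<le> x}"] unfolding Diff_eq .
  also have "\<dots> \<le> (1 + 1 / t) + (1 + 1 / t)"
    by (intro add_mono half) (use assms in \<open>auto simp: inj_on_def\<close>)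
  finally show ?thesis by simp
qed

text \<open>
  The inequality \<open>z\<^sup>2 \<ge> z - 1/4\<close> replaces the Gaussian by a geometric series with exponent
  \<open>t = sqrt (c v) / M\<close>, whose sum is of order \<open>1/t\<close>. The condition \<open>sqrt v \<le> M\<close> keeps \<open>t\<close> bounded, which
  is why the mesh of the grid has to be small compared with the width of the Gaussian.
\<close>

lemma gaussian_grid_sum_1d:
  fixes c v \<rho> :: real
  assumes "c > 0" "v > 0" "M > 0" "sqrt v \<le> of_int M"
  shows "(\<Sum>x\<in>{0..<M}. exp (- v * (c * (of_int x / of_int M + \<rho>)\<^sup>2)))
     \<le> 4 * exp (sqrt c) * (1 + sqrt c) / sqrt c * (of_int M / sqrt v)"
proof -
  define t where "t = sqrt (c * v) / of_int M"
  have t: "t > 0" "t \<le> sqrt c"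
    using assms by (auto simp: t_def real_sqrt_mult field_simps)
  \<comment> \<open>the integer next to the centre of the Gaussian, measured in units of the mesh\<close>
  define n where "n = \<lfloor>- \<rho> * of_int M\<rfloor>"
  have step: "exp (- v * (c * (of_int x / of_int M + \<rho>)\<^sup>2)) \<le> 2 * exp t * exp (- t * \<bar>of_int (x - n)\<bar>)" for x
  proof -
    define z where "z = t * \<bar>of_int x + \<rho> * of_int M\<bar>"
    have "v * (c * (of_int x / of_int M + \<rho>)\<^sup>2) = z\<^sup>2"
      using assms by (simp add: z_def t_def power_mult_distrib power_divide real_sqrt_mult field_simps power2_eq_square)
    moreover have "- z\<^sup>2 \<le> 1/4 - z"
      using sum_squares_ge_zero [of "z - 1/2" 0] by (simp add: power2_eq_square algebra_simps)
    moreover have "\<bar>of_int (x - n)\<bar> - 1 \<le> \<bar>of_int x + \<rho> * of_int M\<bar>"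
      unfolding n_def by linarith
    then have "t * (\<bar>of_int (x - n)\<bar> - 1) \<le> z"
      unfolding z_def using t by (intro mult_left_mono) auto
    ultimately have "- v * (c * (of_int x / of_int M + \<rho>)\<^sup>2) \<le> 1/4 + t + - t * \<bar>of_int (x - n)\<bar>"
      by (simp add: algebra_simps)
    then have "exp (- v * (c * (of_int x / of_int M + \<rho>)\<^sup>2)) \<le> exp (1/4) * exp t * exp (- t * \<bar>of_int (x - n)\<bar>)"
      by (simp only: exp_add [symmetric] exp_le_cancel_iff)
    also have "exp (1/4 :: real) \<le> 2"
      using exp_bound_half [of "1/4 :: real"] by simp
    finally show ?thesis by simp
  qed
  have "(\<Sum>x\<in>{0..<M}. exp (- v * (c * (of_int x / of_int M + \<rho>)\<^sup>2)))
      \<le> (\<Sum>x\<in>{0..<M}. 2 * exp t * exp (- t * \<bar>of_int (x - n)\<bar>))"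
    by (intro sum_mono step)
  also have "\<dots> \<le> 2 * exp t * (2 * (1 + 1 / t))"
    unfolding sum_distrib_left [symmetric] using t by (intro mult_left_mono geometric_sum_int_le) auto
  also have "\<dots> = 4 * exp t * (1 + t) / t" using t by (simp add: field_simps)
  also have "\<dots> \<le> 4 * exp (sqrt c) * (1 + sqrt c) / t"
    using t by (intro divide_right_mono mult_mono) auto
  also have "\<dots> = 4 * exp (sqrt c) * (1 + sqrt c) / sqrt c * (of_int M / sqrt v)"
    using assms by (simp add: t_def real_sqrt_mult)
  finally show ?thesis .
qed

lemma gaussian_grid_sum:
  fixes c :: "nat \<Rightarrow> real"
  assumes c: "\<And>i. i < p \<Longrightarrow> c i > 0"
  obtains C where "C > 0"
    "\<And>v M \<rho>. v > 0 \<Longrightarrow> M > 0 \<Longrightarrow> sqrt v \<le> of_int M \<Longrightarrow>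
       (\<Sum>x\<in>grid p M. exp (- v * (\<Sum>i<p. c i * (scaled M x i + \<rho> i)\<^sup>2))) \<le> C * (of_int M / sqrt v) ^ p"
proof
  let ?C = "\<lambda>i. 4 * exp (sqrt (c i)) * (1 + sqrt (c i)) / sqrt (c i)"
  show "(\<Prod>i<p. ?C i) > 0"
    by (intro prod_pos) (use c in \<open>auto intro!: mult_pos_pos divide_pos_pos add_pos_pos\<close>)
  fix v :: real and M :: int and \<rho> :: "nat \<Rightarrow> real"
  assume vM: "v > 0" "M > 0" "sqrt v \<le> of_int M"
  have "(\<Sum>x\<in>grid p M. exp (- v * (\<Sum>i<p. c i * (scaled M x i + \<rho> i)\<^sup>2)))
      = (\<Sum>x\<in>grid p M. \<Prod>i<p. exp (- v * (c i * (of_int (x i) / of_int M + \<rho> i)\<^sup>2)))"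
    by (simp add: sum_distrib_left exp_sum scaled_def flip: sum_negf)
  also have "\<dots> = (\<Prod>i<p. \<Sum>x\<in>{0..<M}. exp (- v * (c i * (of_int x / of_int M + \<rho> i)\<^sup>2)))"
    unfolding grid_def by (rule prod_sum_PiE [symmetric]) auto
  also have "\<dots> \<le> (\<Prod>i<p. ?C i * (of_int M / sqrt v))"
    by (intro prod_mono conjI sum_nonneg gaussian_grid_sum_1d) (use vM c in auto)
  also have "\<dots> = (\<Prod>i<p. ?C i) * (of_int M / sqrt v) ^ p"
    by (simp only: prod.distrib prod_constant card_lessThan)
  finally show "(\<Sum>x\<in>grid p M. exp (- v * (\<Sum>i<p. c i * (scaled M x i + \<rho> i)\<^sup>2)))
     \<le> (\<Prod>i<p. ?C i) * (of_int M / sqrt v) ^ p" .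
qed

text \<open>
  Since the form is negative definite on the span of the \<open>w i\<close>, \<open>qform\<close> is minus the norm of
  \<open>\<Sum>i<p. x i *s w i\<close>.
\<close>

definition qform :: "nat \<Rightarrow> (nat \<Rightarrow> nat) \<Rightarrow> (nat \<Rightarrow> 'a) \<Rightarrow> 'a::comm_semiring_1" where
  "qform p q x = (\<Sum>i<p. of_nat (q i) * (x i)\<^sup>2)"

text \<open>
  The Fourier expansion of a scalar Jacobi form, with exponents \<open>N l\<close> in \<open>\<tau>\<close> and integral exponents \<open>R l\<close>
  in \<open>\<zeta>\<close>, for the index form \<open>m/2 \<cdot> qform p q\<close>. The inequality is holomorphy at the cusp: the
  exponent has nonnegative norm. The index set \<open>'l\<close> of the series is left abstract, since the exponents
  at different cusps belong to different lattices.
\<close>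

definition theta_expansion :: "nat \<Rightarrow> (nat \<Rightarrow> nat) \<Rightarrow> nat \<Rightarrow> 'l set \<Rightarrow> ('l \<Rightarrow> real) \<Rightarrow> ('l \<Rightarrow> nat \<Rightarrow> int)
    \<Rightarrow> ('l \<Rightarrow> complex) \<Rightarrow> (complex \<Rightarrow> (nat \<Rightarrow> complex) \<Rightarrow> complex) \<Rightarrow> bool" where
  "theta_expansion p q m X N R a g \<longleftrightarrow>
     (\<forall>\<tau> \<zeta>. Im \<tau> > 0 \<longrightarrow> ((\<lambda>l. a l * ee (of_real (N l) * \<tau> + dotp p (R l) \<zeta>)) has_sum g \<tau> \<zeta>) X) \<and>
     (\<forall>l\<in>X. a l \<noteq> 0 \<longrightarrow> (\<Sum>i<p. (of_int (R l i))\<^sup>2 / real (q i)) \<le> 2 * real m * N l)"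

text \<open>
  The invariant norm of a Jacobi form of weight \<open>\<kappa>\<close> and index form \<open>m/2 \<cdot> qform p q\<close> at the point
  \<open>\<zeta> = \<alpha>\<tau> + \<beta>\<close>.
\<close>

definition petersson :: "nat \<Rightarrow> (nat \<Rightarrow> nat) \<Rightarrow> nat \<Rightarrow> real \<Rightarrow> (complex \<Rightarrow> (nat \<Rightarrow> complex) \<Rightarrow> complex)
    \<Rightarrow> complex \<Rightarrow> (nat \<Rightarrow> real) \<Rightarrow> (nat \<Rightarrow> real) \<Rightarrow> real" where
  "petersson p q m \<kappa> g \<tau> \<alpha> \<beta> =
     (norm (g \<tau> (\<lambda>i. of_real (\<alpha> i) * \<tau> + of_real (\<beta> i))) * exp (- (pi * real m * qform p q \<alpha> * Im \<tau>)))\<^sup>2 * Im \<tau> powr \<kappa>"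

definition rdotp :: "nat \<Rightarrow> (nat \<Rightarrow> int) \<Rightarrow> (nat \<Rightarrow> real) \<Rightarrow> real" where
  "rdotp p r x = (\<Sum>i<p. of_int (r i) * x i)"

lemma Im_dotp: "Im (dotp p r (\<lambda>i. of_real (\<alpha> i) * \<tau> + of_real (\<beta> i))) = rdotp p r \<alpha> * Im \<tau>"
  unfolding dotp_def rdotp_def Im_sum sum_distrib_right by (intro sum.cong refl) simp

text \<open>
  On the cube \<open>[0, B]\<^sup>p\<close> a linear function of \<open>\<alpha>\<close> is smallest at a vertex, so the sum over the vertices
  dominates the term \<open>l\<close> of the expansion at height \<open>s\<close>, uniformly in \<open>\<zeta> = \<alpha>\<tau> + \<beta>\<close> with \<open>\<alpha>\<close> in the cube.
\<close>

definition majorant :: "nat \<Rightarrow> nat \<Rightarrow> real \<Rightarrow> ('l \<Rightarrow> real) \<Rightarrow> ('l \<Rightarrow> nat \<Rightarrow> int) \<Rightarrow> ('l \<Rightarrow> complex) \<Rightarrow> 'l \<Rightarrow> real" where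
  "majorant p B s N R a l =
     (\<Sum>\<epsilon>\<in>grid p 2. norm (a l) * exp (- 2 * pi * s * (N l + rdotp p (R l) (\<lambda>i. of_nat B * of_int (\<epsilon> i)))))"

lemma majorant_nonneg: "majorant p B s N R a l \<ge> 0"
  by (simp add: majorant_def sum_nonneg)

lemma majorant_summable:
  assumes "theta_expansion p q m X N R a g" "s > 0"
  shows "majorant p B s N R a summable_on X"
proof -
  have "(\<lambda>l. norm (a l) * exp (- 2 * pi * s * (N l + rdotp p (R l) (\<lambda>i. of_nat B * of_int (\<epsilon> i))))) summable_on X" for \<epsilon> :: "nat \<Rightarrow> int"
  proof -
    let ?\<tau> = "\<i> * of_real s" and ?\<zeta> = "\<lambda>i. of_real (of_nat B * of_int (\<epsilon> i)) * (\<i> * of_real s) + of_real 0"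
    have "((\<lambda>l. a l * ee (of_real (N l) * ?\<tau> + dotp p (R l) ?\<zeta>)) has_sum g ?\<tau> ?\<zeta>) X"
      using assms unfolding theta_expansion_def by auto
    then have "(\<lambda>l. norm (a l * ee (of_real (N l) * ?\<tau> + dotp p (R l) ?\<zeta>))) summable_on X"
      by (intro summable_on_iff_abs_summable_on_complex [THEN iffD1] has_sum_imp_summable)
    moreover have "norm (a l * ee (of_real (N l) * ?\<tau> + dotp p (R l) ?\<zeta>))
        = norm (a l) * exp (- 2 * pi * s * (N l + rdotp p (R l) (\<lambda>i. of_nat B * of_int (\<epsilon> i))))" for l
      unfolding norm_mult norm_ee plus_complex.simps Im_dotp by (simp add: algebra_simps)
    ultimately show ?thesis by simp
  qed
  then show ?thesis
    unfolding majorant_def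
    by (intro has_sum_imp_summable [OF has_sum_finite_sum [OF finite_grid has_sum_infsum]])
qed

lemma le_majorant:
  assumes "s \<ge> 0" "\<And>i. i < p \<Longrightarrow> 0 \<le> \<alpha> i \<and> \<alpha> i \<le> of_nat B"
  shows "norm (a l) * exp (- 2 * pi * s * (N l + rdotp p (R l) \<alpha>)) \<le> majorant p B s N R a l"
proof -
  define \<epsilon> where "\<epsilon> = (\<lambda>i. if i < p then (if R l i < 0 then 1 else 0 :: int) else undefined)"
  have \<epsilon>: "\<epsilon> \<in> grid p 2" by (auto simp: grid_def \<epsilon>_def PiE_iff extensional_def)
  have "rdotp p (R l) (\<lambda>i. of_nat B * of_int (\<epsilon> i)) \<le> rdotp p (R l) \<alpha>"
    unfolding rdotp_def
  proof (rule sum_mono)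
    fix i assume "i \<in> {..<p}"
    then show "of_int (R l i) * (of_nat B * of_int (\<epsilon> i)) \<le> of_int (R l i) * \<alpha> i"
      using assms(2) [of i] by (auto simp: \<epsilon>_def mult_le_cancel_left mult_nonneg_nonneg)
  qed
  then have "norm (a l) * exp (- 2 * pi * s * (N l + rdotp p (R l) \<alpha>))
    \<le> norm (a l) * exp (- 2 * pi * s * (N l + rdotp p (R l) (\<lambda>i. of_nat B * of_int (\<epsilon> i))))"
    using assms(1) by (intro mult_left_mono) (auto intro!: mult_left_mono)
  also have "\<dots> \<le> majorant p B s N R a l"
    unfolding majorant_def using \<epsilon> by (intro member_le_sum [of \<epsilon>]) auto
  finally show ?thesis .
qed

lemma complete_square:
  assumes "\<And>i. i < p \<Longrightarrow> 0 < q i" "m > 0"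
  shows "rdotp p r \<alpha> + real m / 2 * qform p q \<alpha> =
    (real m / 2) * (\<Sum>i<p. real (q i) * (\<alpha> i + of_int (r i) / (real m * real (q i)))\<^sup>2)
     - (\<Sum>i<p. (of_int (r i))\<^sup>2 / real (q i)) / (2 * real m)"
  unfolding rdotp_def qform_def sum_distrib_left sum_divide_distrib sum.distrib [symmetric] sum_subtractf [symmetric]
  by (intro sum.cong refl) (use assms in \<open>simp add: power2_eq_square field_simps\<close>)

text \<open>
  At \<open>\<zeta> = \<alpha>\<tau> + \<beta>\<close> the term \<open>l\<close> of the expansion, times the exponential factor of the Petersson norm, has
  size \<open>exp (- 2 \<pi> v E)\<close> with \<open>E = N l + R l \<cdot> \<alpha> + m/2 \<cdot> qform p q \<alpha>\<close>. Completing the square, holomorphy at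
  the cusp gives \<open>E \<ge> m/2 \<cdot> \<Sum>i<p. q i * (\<alpha> i + R l i / (m * q i))\<^sup>2\<close>. The part \<open>s = v0/2\<close> of the height is
  spent on the convergence of the sum over \<open>l\<close>; the remaining height, at least \<open>v/2\<close>, gives a Gaussian in
  \<open>\<alpha>\<close>, whose sum over the grid is of order \<open>(M / sqrt v)\<^sup>p\<close>.
\<close>

lemma petersson_grid_upper:
  fixes q :: "nat \<Rightarrow> nat"
  assumes q: "\<And>i. i < p \<Longrightarrow> 0 < q i" and m: "m > 0"
    and g: "theta_expansion p q m X N R a g" and v0: "v0 > 0"
  obtains C where "C \<ge> 0"
    "\<And>\<tau> M. Im \<tau> \<ge> v0 \<Longrightarrow> M > 0 \<Longrightarrow> sqrt (Im \<tau>) \<le> of_int M \<Longrightarrow>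
       (\<Sum>x\<in>grid p M. \<Sum>y\<in>grid p M. petersson p q m \<kappa> g \<tau> (scaled M x) (scaled M y))
         \<le> C * Im \<tau> powr (\<kappa> - real p / 2) * of_int M ^ (2 * p)"
proof -
  define s where "s = v0 / 2"
  have s: "s > 0" using v0 by (simp add: s_def)
  define P where "P = majorant p 1 s N R a"
  have P: "P summable_on X" "\<And>l. P l \<ge> 0"
    unfolding P_def using majorant_summable [OF g s] majorant_nonneg by auto
  define K where "K = infsum P X"
  have K: "K \<ge> 0" unfolding K_def using P by (intro infsum_nonneg) auto
  obtain C where C: "C > 0"
    "\<And>v M \<rho>. v > 0 \<Longrightarrow> M > 0 \<Longrightarrow> sqrt v \<le> of_int M \<Longrightarrow>
       (\<Sum>x\<in>grid p M. exp (- v * (\<Sum>i<p. (pi / 2 * real m * real (q i)) * (scaled M x i + \<rho> i)\<^sup>2))) \<le> C * (of_int M / sqrt v) ^ p"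
    by (rule gaussian_grid_sum [of p "\<lambda>i. pi / 2 * real m * real (q i)"]) (use q m in auto)
  \<comment> \<open>the Gaussian in \<open>\<alpha>\<close> that the term \<open>l\<close> contributes\<close>
  define Y where "Y v \<alpha> l = exp (- v * (\<Sum>i<p. (pi / 2 * real m * real (q i)) * (\<alpha> i + of_int (R l i) / (real m * real (q i)))\<^sup>2))" for v \<alpha> l
  have Y: "0 \<le> Y v \<alpha> l" "v \<ge> 0 \<Longrightarrow> Y v \<alpha> l \<le> 1" for v \<alpha> l
    unfolding Y_def by (auto intro!: mult_nonneg_nonneg sum_nonneg)
  have PY: "(\<lambda>l. P l * Y v \<alpha> l) summable_on X" if "v \<ge> 0" for v \<alpha>
    by (rule summable_on_comparison_test [OF P(1)]) (use P Y that in \<open>auto intro: mult_left_le mult_nonneg_nonneg\<close>)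
  have bound: "petersson p q m \<kappa> g \<tau> \<alpha> \<beta> \<le> K * infsum (\<lambda>l. P l * Y (Im \<tau>) \<alpha> l) X * Im \<tau> powr \<kappa>"
    if \<tau>: "Im \<tau> \<ge> v0" and \<alpha>: "\<And>i. i < p \<Longrightarrow> 0 \<le> \<alpha> i \<and> \<alpha> i \<le> 1" for \<tau> \<alpha> \<beta>
  proof -
    define v where "v = Im \<tau>"
    have v: "v > 0" "v - s \<ge> v / 2" using \<tau> v0 by (auto simp: v_def s_def)
    let ?\<zeta> = "\<lambda>i. of_real (\<alpha> i) * \<tau> + of_real (\<beta> i)"
    define t where "t l = a l * ee (of_real (N l) * \<tau> + dotp p (R l) ?\<zeta>)" for l
    define W where "W = exp (- (pi * real m * qform p q \<alpha> * v))"
    have nt: "norm (t l) * W \<le> P l * Y v \<alpha> l" if l: "l \<in> X" for l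
    proof (cases "a l = 0")
      case True
      then show ?thesis using P Y by (simp add: t_def)
    next
      case False
      define d where "d = (\<Sum>i<p. real (q i) * (\<alpha> i + of_int (R l i) / (real m * real (q i)))\<^sup>2)"
      define E where "E = N l + rdotp p (R l) \<alpha> + real m / 2 * qform p q \<alpha>"
      have "d \<ge> 0" unfolding d_def by (intro sum_nonneg) auto
      have "(\<Sum>i<p. (of_int (R l i))\<^sup>2 / real (q i)) \<le> 2 * real m * N l"
        using g l False unfolding theta_expansion_def by auto
      then have "(\<Sum>i<p. (of_int (R l i))\<^sup>2 / real (q i)) / (2 * real m) \<le> N l"
        using m by (simp add: field_simps)
      then have Ed: "E \<ge> real m / 2 * d"
        using complete_square [where p = p and q = q and m = m, OF q m, where r = "R l" and \<alpha> = \<alpha>] unfolding E_def d_def by linarith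
      have Qn: "qform p q \<alpha> \<ge> 0" by (simp add: qform_def sum_nonneg)
      have "norm (t l) * W = norm (a l) * (exp (- 2 * pi * v * (N l + rdotp p (R l) \<alpha>)) * W)"
        unfolding t_def norm_mult norm_ee plus_complex.simps Im_dotp by (simp add: v_def algebra_simps)
      also have "exp (- 2 * pi * v * (N l + rdotp p (R l) \<alpha>)) * W = exp (- 2 * pi * v * E)"
        by (simp add: W_def E_def exp_add [symmetric] algebra_simps)
      also have "\<dots> = exp (- 2 * pi * s * E + - 2 * pi * (v - s) * E)"
        by (simp add: algebra_simps)
      also have "\<dots> \<le> exp (- 2 * pi * s * (N l + rdotp p (R l) \<alpha>) + - v * (pi / 2 * real m * d))"
      proof -
        have "s * (N l + rdotp p (R l) \<alpha>) \<le> s * E"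
          unfolding E_def using s Qn by (intro mult_left_mono) auto
        moreover have "(v / 2) * (real m / 2 * d) \<le> (v - s) * E"
          using v Ed \<open>d \<ge> 0\<close> by (intro mult_mono) auto
        ultimately have "s * (N l + rdotp p (R l) \<alpha>) + v * (real m * d) / 4 \<le> s * E + (v - s) * E"
          by simp
        from mult_left_mono [OF this, of "2 * pi"] show ?thesis by (simp add: algebra_simps)
      qed
      also have "\<dots> = exp (- 2 * pi * s * (N l + rdotp p (R l) \<alpha>)) * Y v \<alpha> l"
        unfolding exp_add Y_def d_def by (simp add: sum_distrib_left mult_ac)
      finally have "norm (t l) * W \<le> norm (a l) * (exp (- 2 * pi * s * (N l + rdotp p (R l) \<alpha>)) * Y v \<alpha> l)"
        by (simp add: mult_left_mono)
      also have "\<dots> \<le> P l * Y v \<alpha> l"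
        unfolding P_def mult.assoc [symmetric] using s \<alpha> Y by (intro mult_right_mono le_majorant) auto
      finally show ?thesis .
    qed
    have hs: "(t has_sum g \<tau> ?\<zeta>) X"
      using g v unfolding theta_expansion_def t_def v_def by blast
    have hsW: "((\<lambda>l. t l * of_real W) has_sum (g \<tau> ?\<zeta> * of_real W)) X"
      by (rule has_sum_cmult_left [OF hs])
    define S where "S = infsum (\<lambda>l. P l * Y v \<alpha> l) X"
    have W: "W \<ge> 0" by (simp add: W_def)
    have "norm (g \<tau> ?\<zeta> * of_real W) \<le> S"
      unfolding S_def using v
      by (intro norm_infsum_le [OF hsW has_sum_infsum [OF PY]]) (use nt W in \<open>auto simp: norm_mult\<close>)
    then have gS: "norm (g \<tau> ?\<zeta>) * W \<le> S" using W by (simp add: norm_mult)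
    have SK: "0 \<le> S" "S \<le> K"
      unfolding S_def K_def using P Y PY v
      by (auto intro!: infsum_nonneg infsum_mono mult_nonneg_nonneg mult_left_le)
    \<comment> \<open>one of the two factors of the square is bounded by the constant \<open>K\<close>, the other keeps the Gaussian\<close>
    have "(norm (g \<tau> ?\<zeta>) * W)\<^sup>2 \<le> S * S"
      unfolding power2_eq_square using gS W SK by (intro mult_mono) auto
    also have "\<dots> \<le> K * S" using SK by (intro mult_right_mono) auto
    finally show ?thesis
      unfolding petersson_def W_def S_def v_def by (rule mult_right_mono) auto
  qed
  show ?thesis
  proof
    show "K * (K * C) \<ge> 0" using K C by simp
    fix \<tau> :: complex and M :: int
    assume \<tau>: "Im \<tau> \<ge> v0" and M: "M > 0" "sqrt (Im \<tau>) \<le> of_int M"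
    define v where "v = Im \<tau>"
    have v: "v > 0" using \<tau> v0 by (simp add: v_def)
    have "((\<lambda>l. \<Sum>x\<in>grid p M. P l * Y v (scaled M x) l) has_sum (\<Sum>x\<in>grid p M. infsum (\<lambda>l. P l * Y v (scaled M x) l) X)) X"
      by (intro has_sum_finite_sum has_sum_infsum PY) (use v in auto)
    moreover have "((\<lambda>l. P l * (C * (of_int M / sqrt v) ^ p)) has_sum (K * (C * (of_int M / sqrt v) ^ p))) X"
      unfolding K_def using P by (intro has_sum_cmult_left) auto
    moreover have "(\<Sum>x\<in>grid p M. P l * Y v (scaled M x) l) \<le> P l * (C * (of_int M / sqrt v) ^ p)" for l
      unfolding sum_distrib_left [symmetric] Y_def by (intro mult_left_mono C P) (use v M in \<open>auto simp: v_def\<close>)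
    ultimately have *: "(\<Sum>x\<in>grid p M. infsum (\<lambda>l. P l * Y v (scaled M x) l) X) \<le> K * (C * (of_int M / sqrt v) ^ p)"
      by (rule has_sum_mono)
    have "(\<Sum>x\<in>grid p M. \<Sum>y\<in>grid p M. petersson p q m \<kappa> g \<tau> (scaled M x) (scaled M y))
       \<le> (\<Sum>x\<in>grid p M. \<Sum>y\<in>grid p M. K * infsum (\<lambda>l. P l * Y v (scaled M x) l) X * v powr \<kappa>)"
      unfolding v_def
    proof (intro sum_mono bound \<tau>)
      fix x y i assume "x \<in> grid p M" "i < p"
      from grid_range [OF this] M show "0 \<le> scaled M x i \<and> scaled M x i \<le> 1" by (simp add: scaled_def)
    qed
    also have "\<dots> = of_int M ^ p * (K * v powr \<kappa>) * (\<Sum>x\<in>grid p M. infsum (\<lambda>l. P l * Y v (scaled M x) l) X)"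
      using M by (simp add: card_grid sum_distrib_left mult_ac)
    also have "\<dots> \<le> of_int M ^ p * (K * v powr \<kappa>) * (K * (C * (of_int M / sqrt v) ^ p))"
      using M K by (intro mult_left_mono *) auto
    also have "\<dots> = K * (K * C) * (v powr \<kappa> / sqrt v ^ p) * of_int M ^ (2 * p)"
      unfolding mult_2 power_add by (simp add: power_divide)
    also have "sqrt v ^ p = v powr (real p / 2)"
      using v by (simp add: powr_half_sqrt [symmetric] powr_powr flip: powr_realpow)
    also have "v powr \<kappa> / v powr (real p / 2) = v powr (\<kappa> - real p / 2)"
      by (simp add: powr_diff)
    finally show "(\<Sum>x\<in>grid p M. \<Sum>y\<in>grid p M. petersson p q m \<kappa> g \<tau> (scaled M x) (scaled M y))
       \<le> K * (K * C) * Im \<tau> powr (\<kappa> - real p / 2) * of_int M ^ (2 * p)"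
      by (simp add: v_def)
  qed
qed

section \<open>Theta coefficients and a lower bound for the Petersson norm\<close>

text \<open>
  The coefficient \<open>f_r\<close> in \<open>f(\<tau>,\<zeta>) = \<Sum>_r f_r(\<tau>) exp(2\<pi>i r\<zeta>)\<close>.
\<close>

definition theta_coeff :: "nat \<Rightarrow> 'l set \<Rightarrow> ('l \<Rightarrow> real) \<Rightarrow> ('l \<Rightarrow> nat \<Rightarrow> int) \<Rightarrow> ('l \<Rightarrow> complex) \<Rightarrow> (nat \<Rightarrow> int) \<Rightarrow> complex \<Rightarrow> complex" where
  "theta_coeff p X N R a r \<tau> = infsum (\<lambda>l. a l * ee (of_real (N l) * \<tau>)) {l \<in> X. \<forall>i<p. R l i = r i}"

text \<open>
  The discrete Fourier coefficient in \<open>\<beta>\<close> differs from the true one by the aliased frequencies. The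
  majorant bounds these uniformly for \<open>\<alpha>\<close> in a cube, so a single \<open>M0\<close> serves for all \<open>\<alpha>\<close>.
\<close>

lemma grid_fourier_approx:
  assumes f: "theta_expansion p q m X N R a f" and \<tau>: "Im \<tau> > 0" and fin: "finite Rs" and e: "\<epsilon> > 0"
  shows "\<exists>M0>0. \<forall>M r \<alpha>. M \<ge> M0 \<longrightarrow> r \<in> Rs \<longrightarrow> (\<forall>i<p. 0 \<le> \<alpha> i \<and> \<alpha> i \<le> real B) \<longrightarrow>
       norm (grid_fourier p M r (\<lambda>\<zeta>. f \<tau> (\<lambda>i. of_real (\<alpha> i) * \<tau> + \<zeta> i))
             - theta_coeff p X N R a r \<tau> * ee (dotp p r (\<lambda>i. of_real (\<alpha> i) * \<tau>))) < \<epsilon>"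
proof -
  define P where "P = majorant p B (Im \<tau>) N R a"
  have P: "P summable_on X" "\<And>l. P l \<ge> 0"
    unfolding P_def using majorant_summable [OF f \<tau>] majorant_nonneg by auto
  obtain M1 where M1: "\<forall>M\<ge>M1. \<forall>r\<in>Rs. infsum P {l \<in> X. (\<forall>i<p. M dvd R l i - r i) \<and> \<not> (\<forall>i<p. R l i = r i)} < \<epsilon>"
    using summable_tail_incongruent [OF P fin e] by blast
  show ?thesis
  proof (intro exI [of _ "max M1 1"] conjI allI impI)
    show "max M1 1 > 0" by simp
    fix M r and \<alpha> :: "nat \<Rightarrow> real"
    assume M: "M \<ge> max M1 1" and r: "r \<in> Rs" and \<alpha>: "\<forall>i<p. 0 \<le> \<alpha> i \<and> \<alpha> i \<le> real B"
    define c where "c l = a l * ee (of_real (N l) * \<tau> + dotp p (R l) (\<lambda>i. of_real (\<alpha> i) * \<tau>))" for l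
    \<comment> \<open>the exponents of frequency \<open>r\<close>, and those aliased to it\<close>
    define G where "G = {l \<in> X. \<forall>i<p. R l i = r i}"
    define Bd where "Bd = {l \<in> X. (\<forall>i<p. M dvd R l i - r i) \<and> \<not> (\<forall>i<p. R l i = r i)}"
    define u where "u = (\<lambda>\<zeta>. f \<tau> (\<lambda>i. of_real (\<alpha> i) * \<tau> + \<zeta> i))"
    have hs: "((\<lambda>l. c l * ee (dotp p (R l) (\<lambda>i. of_real (y i)))) has_sum u (\<lambda>i. complex_of_real (y i))) X" for y
    proof -
      have "((\<lambda>l. a l * ee (of_real (N l) * \<tau> + dotp p (R l) (\<lambda>i. of_real (\<alpha> i) * \<tau> + of_real (y i)))) has_sum
             u (\<lambda>i. complex_of_real (y i))) X"
        using f \<tau> unfolding theta_expansion_def u_def by blast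
      then show ?thesis by (simp add: c_def dotp_add ee_add mult.assoc)
    qed
    have "(c has_sum grid_fourier p M r u) {l \<in> X. \<forall>i<p. M dvd R l i - r i}"
      using grid_fourier_has_sum [OF _ hs, of M r] M by simp
    moreover have "{l \<in> X. \<forall>i<p. M dvd R l i - r i} = G \<union> Bd"
      by (auto simp: G_def Bd_def)
    ultimately have hs1: "(c has_sum grid_fourier p M r u) (G \<union> Bd)" by simp
    have csum: "c summable_on A" if "A \<subseteq> X" for A
    proof -
      have "((\<lambda>l. c l) has_sum u (\<lambda>i. complex_of_real 0)) X" using hs [of "\<lambda>_. 0"] by (simp add: dotp_def)
      then show ?thesis using that has_sum_imp_summable summable_on_subset_banach by blast
    qed
    have "grid_fourier p M r u = infsum c (G \<union> Bd)" using hs1 by (simp add: infsumI)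
    also have "\<dots> = infsum c G + infsum c Bd"
      by (intro infsum_Un_disjoint csum) (auto simp: G_def Bd_def)
    finally have split: "grid_fourier p M r u = infsum c G + infsum c Bd" .
    have "infsum c G = infsum (\<lambda>l. a l * ee (of_real (N l) * \<tau>) * ee (dotp p r (\<lambda>i. of_real (\<alpha> i) * \<tau>))) G"
      by (intro infsum_cong) (simp add: c_def G_def ee_add dotp_def)
    also have "\<dots> = theta_coeff p X N R a r \<tau> * ee (dotp p r (\<lambda>i. of_real (\<alpha> i) * \<tau>))"
      unfolding theta_coeff_def G_def by (rule infsum_cmult_left')
    finally have G: "infsum c G = theta_coeff p X N R a r \<tau> * ee (dotp p r (\<lambda>i. of_real (\<alpha> i) * \<tau>))" .
    have "norm (infsum c Bd) \<le> infsum P Bd"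
    proof (rule norm_infsum_le [OF has_sum_infsum has_sum_infsum])
      show "c summable_on Bd" by (rule csum) (auto simp: Bd_def)
      show "P summable_on Bd" by (rule summable_on_subset_banach [OF P(1)]) (auto simp: Bd_def)
      fix l
      have "norm (c l) = norm (a l) * exp (- 2 * pi * Im \<tau> * (N l + rdotp p (R l) \<alpha>))"
        using Im_dotp [of p "R l" \<alpha> \<tau> "\<lambda>_. 0"] by (simp add: c_def norm_mult norm_ee algebra_simps)
      also have "\<dots> \<le> P l" unfolding P_def using \<tau> \<alpha> by (intro le_majorant) auto
      finally show "norm (c l) \<le> P l" .
    qed
    also have "\<dots> < \<epsilon>" using M1 M r unfolding Bd_def by auto
    finally show "norm (grid_fourier p M r (\<lambda>\<zeta>. f \<tau> (\<lambda>i. of_real (\<alpha> i) * \<tau> + \<zeta> i))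
             - theta_coeff p X N R a r \<tau> * ee (dotp p r (\<lambda>i. of_real (\<alpha> i) * \<tau>))) < \<epsilon>"
      using split G by (simp add: u_def)
  qed
qed

definition theta_quasiperiodic :: "nat \<Rightarrow> (nat \<Rightarrow> nat) \<Rightarrow> nat \<Rightarrow> (complex \<Rightarrow> (nat \<Rightarrow> complex) \<Rightarrow> complex) \<Rightarrow> bool" where
  "theta_quasiperiodic p q m f \<longleftrightarrow> (\<forall>\<tau> \<zeta> k. Im \<tau> > 0 \<longrightarrow>
     f \<tau> (\<lambda>i. of_int (k i) * \<tau> + \<zeta> i) =
       ee (- of_nat m * (\<Sum>i<p. of_nat (q i) * of_int (k i) * \<zeta> i) - of_nat m * \<tau> * qform p q (\<lambda>i. of_int (k i)) / 2) * f \<tau> \<zeta>)"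

text \<open>
  The comparison of Fourier coefficients on both sides of the functional equation for the translation by
  \<open>k\<tau>\<close> relates \<open>f_r\<close> and \<open>f_(r + m q k)\<close>. For the discrete Fourier coefficients the relation is exact;
  it passes to the limit by \<open>grid_fourier_approx\<close>.
\<close>

lemma theta_coeff_shift:
  assumes f: "theta_expansion p q m X N R a f" and qp: "theta_quasiperiodic p q m f"
    and \<tau>: "Im \<tau> > 0" and k: "\<And>i. i < p \<Longrightarrow> 0 \<le> k i"
    and r': "\<And>i. i < p \<Longrightarrow> r' i = r i + int m * int (q i) * k i"
  shows "theta_coeff p X N R a r \<tau> * ee (dotp p r (\<lambda>i. of_int (k i) * \<tau>)) =
         ee (- of_nat m * \<tau> * qform p q (\<lambda>i. of_int (k i)) / 2) * theta_coeff p X N R a r' \<tau>"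
proof -
  let ?w = "ee (- of_nat m * \<tau> * qform p q (\<lambda>i. of_int (k i)) / 2)"
  let ?L = "theta_coeff p X N R a r \<tau> * ee (dotp p r (\<lambda>i. of_int (k i) * \<tau>))"
  let ?J = "theta_coeff p X N R a r' \<tau>"
  define B where "B = (\<Sum>i<p. nat (k i))"
  have kB: "k i \<le> int B" if "i < p" for i
  proof -
    have "nat (k i) \<le> B" unfolding B_def using that member_le_sum [of i "{..<p}" "\<lambda>i. nat (k i)"] by simp
    then show ?thesis by linarith
  qed
  have eq: "grid_fourier p M r (\<lambda>\<zeta>. f \<tau> (\<lambda>i. of_real (of_int (k i)) * \<tau> + \<zeta> i))
      = ?w * grid_fourier p M r' (\<lambda>\<zeta>. f \<tau> (\<lambda>i. of_real 0 * \<tau> + \<zeta> i))" for M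
  proof -
    have d: "of_nat m * (\<Sum>i<p. of_nat (q i) * of_int (k i) * x i) + dotp p r x = dotp p r' x" for x
      unfolding dotp_def sum_distrib_left sum.distrib [symmetric]
      by (intro sum.cong refl) (simp add: r' algebra_simps)
    have "f \<tau> (\<lambda>i. of_real (of_int (k i)) * \<tau> + x i) * ee (- dotp p r x) = ?w * (f \<tau> x * ee (- dotp p r' x))" for x
    proof -
      define c1 where "c1 = of_nat m * (\<Sum>i<p. of_nat (q i) * of_int (k i) * x i)"
      have "f \<tau> (\<lambda>i. of_int (k i) * \<tau> + x i) =
        ee (- of_nat m * (\<Sum>i<p. of_nat (q i) * of_int (k i) * x i) - of_nat m * \<tau> * qform p q (\<lambda>i. of_int (k i)) / 2) * f \<tau> x"
        using qp \<tau> unfolding theta_quasiperiodic_def by blast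
      also have "- of_nat m * (\<Sum>i<p. of_nat (q i) * of_int (k i) * x i) - of_nat m * \<tau> * qform p q (\<lambda>i. of_int (k i)) / 2
        = - c1 + (- of_nat m * \<tau> * qform p q (\<lambda>i. of_int (k i)) / 2)"
        by (simp add: c1_def)
      finally have "f \<tau> (\<lambda>i. of_int (k i) * \<tau> + x i) = ee (- c1) * ?w * f \<tau> x"
        by (simp only: ee_add)
      moreover have "ee (- dotp p r' x) = ee (- c1) * ee (- dotp p r x)"
      proof -
        have "dotp p r' x = c1 + dotp p r x" using d [of x] by (simp only: c1_def)
        then have "- dotp p r' x = - c1 + - dotp p r x" by (simp only: minus_add_distrib)
        then show ?thesis by (simp only: ee_add)
      qed
      ultimately show ?thesis by simp
    qed
    then show ?thesis by (simp add: grid_fourier_def sum_distrib_left)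
  qed
  have "norm (?L - ?w * ?J) \<le> \<epsilon> + norm ?w * \<epsilon>" if e: "\<epsilon> > 0" for \<epsilon>
  proof -
    obtain M0 where M0: "M0 > 0"
      "\<And>M s \<alpha>. M \<ge> M0 \<Longrightarrow> s \<in> {r, r'} \<Longrightarrow> \<forall>i<p. 0 \<le> \<alpha> i \<and> \<alpha> i \<le> real B \<Longrightarrow>
         norm (grid_fourier p M s (\<lambda>\<zeta>. f \<tau> (\<lambda>i. of_real (\<alpha> i) * \<tau> + \<zeta> i))
             - theta_coeff p X N R a s \<tau> * ee (dotp p s (\<lambda>i. of_real (\<alpha> i) * \<tau>))) < \<epsilon>"
      using grid_fourier_approx [OF f \<tau> _ e, of "{r, r'}" B] by (auto simp del: insert_iff)
    let ?g = "grid_fourier p M0 r' (\<lambda>\<zeta>. f \<tau> (\<lambda>i. of_real 0 * \<tau> + \<zeta> i))"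
    have "norm (?g - ?J * ee (dotp p r' (\<lambda>i. of_real 0 * \<tau>))) < \<epsilon>"
      by (rule M0) auto
    then have 2: "norm (?g - ?J) \<le> \<epsilon>" by (simp add: dotp_def)
    have kb: "0 \<le> real_of_int (k i) \<and> real_of_int (k i) \<le> real B" if "i < p" for i
      using k [OF that] kB [OF that] by linarith
    have "norm (grid_fourier p M0 r (\<lambda>\<zeta>. f \<tau> (\<lambda>i. of_real (of_int (k i)) * \<tau> + \<zeta> i))
           - theta_coeff p X N R a r \<tau> * ee (dotp p r (\<lambda>i. of_real (of_int (k i)) * \<tau>))) < \<epsilon>"
      by (rule M0) (use kb in auto)
    then have 1: "norm (?w * ?g - ?L) \<le> \<epsilon>"
      unfolding eq by simp
    have "norm (?L - ?w * ?J) = norm (?w * (?g - ?J) - (?w * ?g - ?L))"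
      by (simp add: algebra_simps)
    also have "\<dots> \<le> norm ?w * norm (?g - ?J) + norm (?w * ?g - ?L)"
      unfolding norm_mult [symmetric] by (rule norm_triangle_ineq4)
    also have "\<dots> \<le> norm ?w * \<epsilon> + \<epsilon>"
      using 1 2 by (intro add_mono mult_left_mono) auto
    finally show ?thesis by simp
  qed
  then have bd: "norm (?L - ?w * ?J) \<le> \<epsilon> * (1 + norm ?w)" if "\<epsilon> > 0" for \<epsilon>
    using that by (simp add: algebra_simps)
  have pos: "1 + norm ?w > 0" by (simp add: add_pos_nonneg)
  have "norm (?L - ?w * ?J) \<le> 0 + \<epsilon>" if "\<epsilon> > 0" for \<epsilon>
    using bd [of "\<epsilon> / (1 + norm ?w)"] pos that by simp
  then have "norm (?L - ?w * ?J) \<le> 0" by (rule field_le_epsilon)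
  then show ?thesis by simp
qed

text \<open>
  In a fixed row \<open>\<alpha>\<close> the average over \<open>\<beta>\<close> is at least the sum of the squares of any set of Fourier
  coefficients. The set consists of the frequencies \<open>r0 + m q k\<close> with \<open>k \<in> {0..<K}\<^sup>p\<close>, where \<open>K\<close> is of
  order \<open>1 / sqrt v\<close>. By \<open>theta_coeff_shift\<close> each of them contributes \<open>|f_r0(\<tau>)| exp (- 2 \<pi> v S)\<close>, where \<open>S\<close>
  is a quadratic polynomial in \<open>k + \<alpha>\<close>, hence \<open>O(K\<^sup>2)\<close>. As \<open>v K\<^sup>2 \<le> 4\<close>, all \<open>K\<^sup>p \<ge> v\<^bsup>-p/2\<^esup>\<close> contributions
  are comparable to \<open>|f_r0(\<tau>)|\<close>.
\<close>

lemma petersson_grid_lower: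
  fixes q :: "nat \<Rightarrow> nat"
  assumes q: "\<And>i. i < p \<Longrightarrow> 0 < q i" and m: "m > 0"
    and f: "theta_expansion p q m X N R a f" and qp: "theta_quasiperiodic p q m f"
  obtains c where "c > 0"
    "\<And>\<tau>. 0 < Im \<tau> \<Longrightarrow> Im \<tau> \<le> 1 \<Longrightarrow> \<exists>M0>0. \<forall>M\<ge>M0.
       c * (norm (theta_coeff p X N R a r0 \<tau>))\<^sup>2 * Im \<tau> powr (\<kappa> - real p / 2) * of_int M ^ (2 * p)
       \<le> (\<Sum>x\<in>grid p M. \<Sum>y\<in>grid p M. petersson p q m \<kappa> f \<tau> (scaled M x) (scaled M y))"
proof -
  \<comment> \<open>a bound for \<open>S / K\<^sup>2\<close>\<close>
  define C1 where "C1 = (\<Sum>i<p. \<bar>real_of_int (r0 i)\<bar> + real m / 2 * real (q i))"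
  have C1: "C1 \<ge> 0" by (simp add: C1_def sum_nonneg)
  define c0 where "c0 = exp (- 8 * pi * C1)"
  have c0: "c0 > 0" by (simp add: c0_def)
  show ?thesis
  proof
    show "(c0 / 2)\<^sup>2 > 0" using c0 by simp
    fix \<tau> :: complex assume \<tau>: "0 < Im \<tau>" "Im \<tau> \<le> 1"
    define v where "v = Im \<tau>"
    have v: "0 < v" "v \<le> 1" using \<tau> by (auto simp: v_def)
    define F where "F = norm (theta_coeff p X N R a r0 \<tau>)"
    show "\<exists>M0>0. \<forall>M\<ge>M0.
       (c0 / 2)\<^sup>2 * (norm (theta_coeff p X N R a r0 \<tau>))\<^sup>2 * Im \<tau> powr (\<kappa> - real p / 2) * of_int M ^ (2 * p)
       \<le> (\<Sum>x\<in>grid p M. \<Sum>y\<in>grid p M. petersson p q m \<kappa> f \<tau> (scaled M x) (scaled M y))"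
    proof (cases "F = 0")
      case True
      then show ?thesis
        by (intro exI [of _ 1]) (auto simp: F_def petersson_def intro!: sum_nonneg)
    next
      case False
      then have F: "F > 0" by (simp add: F_def)
      define K where "K = \<lceil>1 / sqrt v\<rceil>"
      have Kge: "1 / sqrt v \<le> of_int K" by (simp add: K_def)
      have sv: "1 \<le> 1 / sqrt v" using v by simp
      have K1: "K \<ge> 1" using sv Kge by linarith
      have "of_int K \<le> 1 / sqrt v + 1" unfolding K_def by (rule of_int_ceiling_le_add_one)
      also have "\<dots> \<le> 2 * (1 / sqrt v)" using sv by linarith
      finally have "of_int K \<le> 2 / sqrt v" by simp
      then have "(of_int K)\<^sup>2 \<le> (2 / sqrt v)\<^sup>2" using K1 by (intro power_mono) auto
      then have vK: "v * (of_int K)\<^sup>2 \<le> 4" using v by (simp add: power_divide field_simps)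
      define rk where "rk k = (\<lambda>i. if i < p then r0 i + int m * int (q i) * k i else 0)" for k :: "nat \<Rightarrow> int"
      define Rs where "Rs = rk ` grid p K"
      have inj: "inj_on rk (grid p K)"
      proof (rule inj_onI)
        fix k k' assume kk: "k \<in> grid p K" "k' \<in> grid p K" "rk k = rk k'"
        show "k = k'"
        proof (rule PiE_ext [OF kk(1,2) [unfolded grid_def]])
          fix i assume "i \<in> {..<p}"
          then have "int m * int (q i) * k i = int m * int (q i) * k' i"
            using fun_cong [OF kk(3), of i] by (simp add: rk_def)
          then show "k i = k' i" using m q [of i] \<open>i \<in> {..<p}\<close> by simp
        qed
      qed
      have finRs: "finite Rs" by (simp add: Rs_def)
      have c0F: "c0 * F / 2 > 0" using c0 F by simp
      obtain M1 where M1: "M1 > 0"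
        "\<And>M r \<alpha>. M \<ge> M1 \<Longrightarrow> r \<in> Rs \<Longrightarrow> \<forall>i<p. 0 \<le> \<alpha> i \<and> \<alpha> i \<le> real 1 \<Longrightarrow>
         norm (grid_fourier p M r (\<lambda>\<zeta>. f \<tau> (\<lambda>i. of_real (\<alpha> i) * \<tau> + \<zeta> i))
             - theta_coeff p X N R a r \<tau> * ee (dotp p r (\<lambda>i. of_real (\<alpha> i) * \<tau>))) < c0 * F / 2"
        using grid_fourier_approx [OF f \<tau>(1) finRs c0F, of 1] by auto
      \<comment> \<open>larger than all coordinates of differences of frequencies in \<open>Rs\<close>, which are thus incongruent modulo \<open>M\<close>\<close>
      define M2 where "M2 = (\<Sum>i<p. int m * int (q i) * K) + 1"
      have M2: "M2 > int m * int (q i) * K" if "i < p" for i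
      proof -
        have "int m * int (q i) * K \<le> (\<Sum>i<p. int m * int (q i) * K)"
          by (rule member_le_sum [where f = "\<lambda>i. int m * int (q i) * K"]) (use that K1 in auto)
        then show ?thesis by (simp add: M2_def)
      qed
      show ?thesis
      proof (intro exI [of _ "max M1 M2"] conjI allI impI)
        show "max M1 M2 > 0" using M1 by simp
        fix M assume M: "max M1 M2 \<le> M"
        then have M0: "M > 0" using M1 by simp
        have inc: "r = s" if "r \<in> Rs" "s \<in> Rs" "\<forall>i<p. M dvd r i - s i" for r s
        proof -
          obtain k k' where k: "k \<in> grid p K" "k' \<in> grid p K" "r = rk k" "s = rk k'"
            using \<open>r \<in> Rs\<close> \<open>s \<in> Rs\<close> by (auto simp: Rs_def)
          have "rk k i = rk k' i" for i
          proof (cases "i < p")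
            case True
            have eq: "rk k i - rk k' i = int m * int (q i) * (k i - k' i)"
              using True by (simp add: rk_def algebra_simps)
            have "\<bar>k i - k' i\<bar> \<le> K" using grid_range [OF k(1) True] grid_range [OF k(2) True] by linarith
            then have "\<bar>rk k i - rk k' i\<bar> \<le> int m * int (q i) * K"
              unfolding eq abs_mult by (simp add: mult_left_mono)
            also have "\<dots> < M" using M2 [OF True] M by simp
            finally have "\<bar>rk k i - rk k' i\<bar> < M" .
            moreover have "M dvd rk k i - rk k' i" using that True k by blast
            ultimately have "rk k i - rk k' i = 0"
              using dvd_imp_le_int [of "rk k i - rk k' i" M] M0 by linarith
            then show ?thesis by simp
          qed (simp add: rk_def)
          then show ?thesis using k by auto
        qed
        have row: "(c0 / 2 * F)\<^sup>2 * of_int K ^ p * of_int M ^ p * v powr \<kappa>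
           \<le> (\<Sum>y\<in>grid p M. petersson p q m \<kappa> f \<tau> (scaled M x) (scaled M y))" if x: "x \<in> grid p M" for x
        proof -
          define \<alpha> where "\<alpha> = scaled M x"
          have \<alpha>: "0 \<le> \<alpha> i \<and> \<alpha> i \<le> 1" if "i < p" for i
            using grid_range [OF x that] M0 by (simp add: \<alpha>_def scaled_def)
          define u where "u = (\<lambda>\<zeta>. f \<tau> (\<lambda>i. of_real (\<alpha> i) * \<tau> + \<zeta> i))"
          define W where "W = exp (- (pi * real m * qform p q \<alpha> * v))"
          have W: "0 < W" "W \<le> 1" using v by (auto simp: W_def qform_def intro!: sum_nonneg mult_nonneg_nonneg)
          have lower: "c0 / 2 * F \<le> norm (grid_fourier p M r u) * W" if r: "r \<in> Rs" for r
          proof -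
            obtain k where k: "k \<in> grid p K" "r = rk k" using r by (auto simp: Rs_def)
            have k0: "0 \<le> k i" "k i + 1 \<le> K" if "i < p" for i
              using grid_range [OF k(1) that] by auto
            let ?J = "norm (theta_coeff p X N R a r \<tau>)"
            have "norm (theta_coeff p X N R a r0 \<tau> * ee (dotp p r0 (\<lambda>i. of_int (k i) * \<tau>))) =
                  norm (ee (- of_nat m * \<tau> * qform p q (\<lambda>i. of_int (k i)) / 2) * theta_coeff p X N R a r \<tau>)"
              by (subst theta_coeff_shift [OF f qp \<tau>(1), of k r]) (use k0 k in \<open>auto simp: rk_def\<close>)
            moreover have "Im (dotp p r0 (\<lambda>i. of_int (k i) * \<tau>)) = rdotp p r0 (\<lambda>i. of_int (k i)) * v"
              using Im_dotp [of p r0 "\<lambda>i. of_int (k i)" \<tau> "\<lambda>_. 0"] by (simp add: v_def)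
            moreover have "qform p q (\<lambda>i. complex_of_int (k i)) = of_real (qform p q (\<lambda>i. of_int (k i)))"
              by (simp add: qform_def)
            ultimately have J: "F * exp (- 2 * pi * (rdotp p r0 (\<lambda>i. of_int (k i)) * v))
                 = exp (pi * (real m * v * qform p q (\<lambda>i. of_int (k i)))) * ?J"
              by (simp add: norm_mult norm_ee F_def v_def)
            have "?J = exp (- (pi * (real m * v * qform p q (\<lambda>i. of_int (k i))))) * (exp (pi * (real m * v * qform p q (\<lambda>i. of_int (k i)))) * ?J)"
              by (simp add: exp_minus)
            also have "\<dots> = F * exp (- 2 * pi * (rdotp p r0 (\<lambda>i. of_int (k i)) * v) - pi * (real m * v * qform p q (\<lambda>i. of_int (k i))))"
              unfolding J [symmetric] by (simp add: exp_diff exp_minus field_simps)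
            finally have J: "?J = F * exp (- 2 * pi * (rdotp p r0 (\<lambda>i. of_int (k i)) * v) - pi * (real m * v * qform p q (\<lambda>i. of_int (k i))))" .
            define S where "S = (\<Sum>i<p. of_int (r0 i) * (of_int (k i) + \<alpha> i) + real m / 2 * real (q i) * (of_int (k i) + \<alpha> i)\<^sup>2)"
            \<comment> \<open>the square in \<open>k + \<alpha>\<close> combines the exponents coming from the shift, from \<open>\<zeta> = \<alpha>\<tau>\<close> and from the Petersson norm\<close>
            have Seq: "S = rdotp p r0 (\<lambda>i. of_int (k i)) + real m / 2 * qform p q (\<lambda>i. of_int (k i)) + rdotp p r \<alpha> + real m / 2 * qform p q \<alpha>"
              unfolding S_def rdotp_def qform_def sum_distrib_left sum.distrib [symmetric]
              by (intro sum.cong refl) (simp add: k rk_def power2_eq_square algebra_simps)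
            have "S \<le> (\<Sum>i<p. (\<bar>real_of_int (r0 i)\<bar> + real m / 2 * real (q i)) * (of_int K)\<^sup>2)"
              unfolding S_def
            proof (rule sum_mono)
              fix i assume "i \<in> {..<p}"
              then have i: "i < p" by simp
              define z where "z = of_int (k i) + \<alpha> i"
              have "of_int (k i) + 1 \<le> (of_int K :: real)" using k0 [OF i] by linarith
              then have z: "0 \<le> z" "z \<le> of_int K" using \<alpha> [OF i] k0 [OF i] by (auto simp: z_def)
              have zz: "z\<^sup>2 \<le> (of_int K)\<^sup>2" using z by (intro power_mono) auto
              have "1 \<le> real_of_int K" using K1 by linarith
              from self_le_power [OF this, of 2] have "z \<le> (of_int K)\<^sup>2" using z by linarith
              then have "of_int (r0 i) * z \<le> \<bar>real_of_int (r0 i)\<bar> * (of_int K)\<^sup>2"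
                using z by (intro mult_mono) auto
              moreover have "real m / 2 * real (q i) * z\<^sup>2 \<le> real m / 2 * real (q i) * (of_int K)\<^sup>2"
                using zz by (intro mult_left_mono) auto
              ultimately show "of_int (r0 i) * (of_int (k i) + \<alpha> i) + real m / 2 * real (q i) * (of_int (k i) + \<alpha> i)\<^sup>2
                 \<le> (\<bar>real_of_int (r0 i)\<bar> + real m / 2 * real (q i)) * (of_int K)\<^sup>2"
                unfolding z_def [symmetric] by (simp add: ring_distribs)
            qed
            also have "\<dots> = C1 * (of_int K)\<^sup>2" by (simp add: C1_def sum_distrib_right)
            finally have "v * S \<le> v * (C1 * (of_int K)\<^sup>2)" using v by simp
            also have "\<dots> = C1 * (v * (of_int K)\<^sup>2)" by simp
            also have "\<dots> \<le> C1 * 4" using C1 vK by (intro mult_left_mono) auto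
            finally have vS: "v * S \<le> C1 * 4" .
            have main: "?J * norm (ee (dotp p r (\<lambda>i. of_real (\<alpha> i) * \<tau>))) * W = F * exp (- 2 * pi * (v * S))"
            proof -
              have "Im (dotp p r (\<lambda>i. of_real (\<alpha> i) * \<tau>)) = rdotp p r \<alpha> * v"
                using Im_dotp [of p r \<alpha> \<tau> "\<lambda>_. 0"] by (simp add: v_def)
              then have n: "norm (ee (dotp p r (\<lambda>i. of_real (\<alpha> i) * \<tau>))) = exp (- 2 * pi * (rdotp p r \<alpha> * v))"
                by (simp only: norm_ee)
              have "?J * norm (ee (dotp p r (\<lambda>i. of_real (\<alpha> i) * \<tau>))) * W = F * exp ((- 2 * pi * (rdotp p r0 (\<lambda>i. of_int (k i)) * v)
                 - pi * (real m * v * qform p q (\<lambda>i. of_int (k i)))) + - 2 * pi * (rdotp p r \<alpha> * v) + - (pi * real m * qform p q \<alpha> * v))"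
                unfolding J n W_def by (simp only: exp_add mult.assoc)
              moreover have "(- 2 * pi * (rdotp p r0 (\<lambda>i. of_int (k i)) * v)
                 - pi * (real m * v * qform p q (\<lambda>i. of_int (k i)))) + - 2 * pi * (rdotp p r \<alpha> * v) + - (pi * real m * qform p q \<alpha> * v)
                 = - 2 * pi * (v * S)"
                unfolding Seq by (simp add: algebra_simps)
              ultimately show ?thesis by (simp only:)
            qed
            have "c0 * F \<le> F * exp (- 2 * pi * (v * S))"
            proof -
              have "c0 \<le> exp (- 2 * pi * (v * S))" unfolding c0_def using vS by (simp add: mult.commute)
              then show ?thesis using F by simp
            qed
            moreover have "norm (grid_fourier p M r u - theta_coeff p X N R a r \<tau> * ee (dotp p r (\<lambda>i. of_real (\<alpha> i) * \<tau>))) < c0 * F / 2"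
              unfolding u_def by (rule M1) (use M r \<alpha> in auto)
            then have "norm (theta_coeff p X N R a r \<tau> * ee (dotp p r (\<lambda>i. of_real (\<alpha> i) * \<tau>))) - c0 * F / 2 \<le> norm (grid_fourier p M r u)"
              using norm_triangle_ineq3 [of "grid_fourier p M r u" "theta_coeff p X N R a r \<tau> * ee (dotp p r (\<lambda>i. of_real (\<alpha> i) * \<tau>))"] by linarith
            then have "(?J * norm (ee (dotp p r (\<lambda>i. of_real (\<alpha> i) * \<tau>))) - c0 * F / 2) * W \<le> norm (grid_fourier p M r u) * W"
              using W by (simp add: norm_mult)
            moreover have "c0 * F / 2 * W \<le> c0 * F / 2" using W c0 F by (simp add: mult_left_le)
            ultimately show ?thesis using main by (simp add: left_diff_distrib)
          qed
          have "(c0 / 2 * F)\<^sup>2 * of_int K ^ p = (\<Sum>r\<in>Rs. (c0 / 2 * F)\<^sup>2)"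
            using K1 by (simp add: Rs_def card_image [OF inj] card_grid)
          also have "\<dots> \<le> (\<Sum>r\<in>Rs. (norm (grid_fourier p M r u) * W)\<^sup>2)"
            using c0 F by (intro sum_mono power_mono lower) auto
          also have "\<dots> = (\<Sum>r\<in>Rs. (norm (grid_fourier p M r u))\<^sup>2) * W\<^sup>2"
            by (simp only: power_mult_distrib sum_distrib_right)
          finally have "(c0 / 2 * F)\<^sup>2 * of_int K ^ p * of_int M ^ p \<le> (\<Sum>r\<in>Rs. (norm (grid_fourier p M r u))\<^sup>2) * W\<^sup>2 * of_int M ^ p"
            using M0 by (intro mult_right_mono) auto
          also have "\<dots> = (\<Sum>r\<in>Rs. (norm (grid_fourier p M r u))\<^sup>2) * of_int M ^ p * W\<^sup>2" by (simp only: mult_ac)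
          also have "\<dots> \<le> (\<Sum>y\<in>grid p M. (norm (u (cscaled M y)))\<^sup>2) * W\<^sup>2"
            by (intro mult_right_mono bessel_grid M0 finRs inc) auto
          finally have "(c0 / 2 * F)\<^sup>2 * of_int K ^ p * of_int M ^ p * v powr \<kappa> \<le> (\<Sum>y\<in>grid p M. (norm (u (cscaled M y)))\<^sup>2) * W\<^sup>2 * v powr \<kappa>"
            by (intro mult_right_mono) auto
          also have "\<dots> = (\<Sum>y\<in>grid p M. petersson p q m \<kappa> f \<tau> (scaled M x) (scaled M y))"
            by (simp add: petersson_def u_def W_def \<alpha>_def v_def power_mult_distrib sum_distrib_right)
          finally show ?thesis .
        qed
        have "v powr (- real p / 2) = (1 / sqrt v) ^ p"
        proof -
          have "1 / sqrt v = v powr (- (1 / 2))" using v by (simp add: powr_minus powr_half_sqrt inverse_eq_divide)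
          then have "(1 / sqrt v) ^ p = v powr (- (1 / 2) * real p)" using v by (simp add: powr_powr flip: powr_realpow)
          then show ?thesis by simp
        qed
        also have "\<dots> \<le> of_int K ^ p"
          using Kge v by (intro power_mono) auto
        finally have "v powr (- real p / 2) \<le> of_int K ^ p" .
        then have le: "((c0 / 2 * F)\<^sup>2 * of_int M ^ p * of_int M ^ p * v powr \<kappa>) * v powr (- real p / 2)
             \<le> ((c0 / 2 * F)\<^sup>2 * of_int M ^ p * of_int M ^ p * v powr \<kappa>) * of_int K ^ p"
          using M0 by (intro mult_left_mono) auto
        have "(c0 / 2)\<^sup>2 * F\<^sup>2 * v powr (\<kappa> - real p / 2) * of_int M ^ (2 * p)
            \<le> of_int M ^ p * ((c0 / 2 * F)\<^sup>2 * of_int K ^ p * of_int M ^ p * v powr \<kappa>)"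
        proof -

          have eq: "v powr (\<kappa> - real p / 2) = v powr \<kappa> * v powr (- real p / 2)" by (simp add: powr_add [symmetric])
          show ?thesis using le unfolding eq mult_2 power_add power_mult_distrib by (simp only: mult_ac)
        qed
        also have "\<dots> = (\<Sum>x\<in>grid p M. (c0 / 2 * F)\<^sup>2 * of_int K ^ p * of_int M ^ p * v powr \<kappa>)"
          using M0 by (simp add: card_grid)
        also have "\<dots> \<le> (\<Sum>x\<in>grid p M. \<Sum>y\<in>grid p M. petersson p q m \<kappa> f \<tau> (scaled M x) (scaled M y))"
          by (intro sum_mono row)
        finally show "(c0 / 2)\<^sup>2 * (norm (theta_coeff p X N R a r0 \<tau>))\<^sup>2 * Im \<tau> powr (\<kappa> - real p / 2) * of_int M ^ (2 * p)
          \<le> (\<Sum>x\<in>grid p M. \<Sum>y\<in>grid p M. petersson p q m \<kappa> f \<tau> (scaled M x) (scaled M y))"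
          by (simp add: F_def v_def)
      qed
    qed
  qed
qed

section \<open>Invariance of the averaged Petersson norm\<close>

text \<open>
  The transformation law of Jacobi forms of weight \<open>\<kappa>\<close>, for the action of \<open>SL_2(\<int>)\<close> on \<open>(e, v)\<close>, with two
  different functions on the two sides: \<open>g\<close> is the transform of \<open>f\<close> under the matrix.
\<close>

definition jacobi_related :: "nat \<Rightarrow> (nat \<Rightarrow> nat) \<Rightarrow> nat \<Rightarrow> int \<Rightarrow> int \<Rightarrow> int \<Rightarrow> int \<Rightarrow> int \<Rightarrow>
    (complex \<Rightarrow> (nat \<Rightarrow> complex) \<Rightarrow> complex) \<Rightarrow> (complex \<Rightarrow> (nat \<Rightarrow> complex) \<Rightarrow> complex) \<Rightarrow> bool" where
  "jacobi_related p q m \<kappa> a b c d f g \<longleftrightarrow> (\<forall>\<tau> \<zeta>. Im \<tau> > 0 \<longrightarrow>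
     f \<tau> \<zeta> = (of_int a + of_int b * \<tau>) powi (- \<kappa>)
       * ee (- of_nat m * of_int b * qform p q \<zeta> / (2 * (of_int a + of_int b * \<tau>)))
       * g ((of_int c + of_int d * \<tau>) / (of_int a + of_int b * \<tau>)) (\<lambda>i. \<zeta> i / (of_int a + of_int b * \<tau>)))"

lemma automorphy_nonzero:
  assumes "a * d - b * c = (1::int)" "Im \<tau> > 0"
  shows "of_int a + of_int b * \<tau> \<noteq> 0"
proof
  assume 0: "of_int a + of_int b * \<tau> = 0"
  from arg_cong [OF this, of Im] assms have "b = 0" by simp
  with 0 have "a = 0" by simp
  with \<open>b = 0\<close> assms show False by simp
qed

lemma Im_moebius:
  assumes "a * d - b * c = (1::int)" "Im \<tau> > 0"
  shows "Im ((of_int c + of_int d * \<tau>) / (of_int a + of_int b * \<tau>)) = Im \<tau> / (norm (of_int a + of_int b * \<tau>))\<^sup>2"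
proof -
  have 1: "real_of_int a * of_int d - of_int b * of_int c = 1"
    using assms(1) by (metis of_int_1 of_int_diff of_int_mult)
  have "Im (of_int c + of_int d * \<tau>) * Re (of_int a + of_int b * \<tau>) - Re (of_int c + of_int d * \<tau>) * Im (of_int a + of_int b * \<tau>)
      = Im \<tau> * (of_int a * of_int d - of_int b * of_int c)"
    by (simp add: algebra_simps)
  then show ?thesis using 1 by (simp add: Im_divide cmod_power2)
qed

lemma Im_of_real_mult: "Im (of_real r * z) = r * Im z"
  by simp

lemma imaginary_square_identity:
  fixes j x :: complex
  shows "(Im (j * x))\<^sup>2 - Im j * Im (j * x\<^sup>2) = (Im x)\<^sup>2 * (norm j)\<^sup>2"
  unfolding cmod_power2 by (cases j; cases x) (simp add: power2_eq_square algebra_simps)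

text \<open>
  The point \<open>\<zeta> / j\<close> has coordinates obtained from \<open>(\<alpha>, \<beta>)\<close> by an integral matrix, and the imaginary part of
  the exponent in the transformation law is the change of \<open>qform p q \<alpha> * Im \<tau>\<close>.
\<close>

lemma petersson_transform:
  assumes det: "a * d - b * c = (1::int)" and \<tau>: "Im \<tau> > 0"
    and rel: "jacobi_related p q m \<kappa> a b c d f g"
  shows "petersson p q m (of_int \<kappa>) f \<tau> \<alpha> \<beta> =
    petersson p q m (of_int \<kappa>) g ((of_int c + of_int d * \<tau>) / (of_int a + of_int b * \<tau>))
      (\<lambda>i. of_int a * \<alpha> i - of_int b * \<beta> i) (\<lambda>i. - of_int c * \<alpha> i + of_int d * \<beta> i)"
proof -
  define j where "j = of_int a + of_int b * \<tau>"
  define \<tau>' where "\<tau>' = (of_int c + of_int d * \<tau>) / j"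
  define v where "v = Im \<tau>"
  define \<alpha>' where "\<alpha>' i = of_int a * \<alpha> i - of_int b * \<beta> i" for i
  define \<beta>' where "\<beta>' i = - of_int c * \<alpha> i + of_int d * \<beta> i" for i
  define \<zeta> where "\<zeta> i = of_real (\<alpha> i) * \<tau> + of_real (\<beta> i)" for i
  have v: "v > 0" using \<tau> by (simp add: v_def)
  have j: "j \<noteq> 0" unfolding j_def by (rule automorphy_nonzero [OF det \<tau>])
  have v': "Im \<tau>' = v / (norm j)\<^sup>2" unfolding \<tau>'_def j_def v_def by (rule Im_moebius [OF det \<tau>])
  have v'0: "Im \<tau>' > 0" using v' v j by simp
  have det': "complex_of_int a * of_int d - of_int b * of_int c = 1"
    using det by (metis of_int_1 of_int_diff of_int_mult)
  have \<zeta>': "\<zeta> i / j = of_real (\<alpha>' i) * \<tau>' + of_real (\<beta>' i)" for i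
  proof -
    have "(of_real (\<alpha>' i) * \<tau>' + of_real (\<beta>' i)) * j = of_real (\<alpha>' i) * (of_int c + of_int d * \<tau>) + of_real (\<beta>' i) * j"
    proof -
      have "\<tau>' * j = of_int c + of_int d * \<tau>" using j by (simp add: \<tau>'_def)
      then show ?thesis unfolding distrib_right mult.assoc by simp
    qed
    also have "\<dots> = (complex_of_int a * of_int d - of_int b * of_int c) * \<zeta> i"
      by (simp add: \<alpha>'_def \<beta>'_def \<zeta>_def j_def algebra_simps)
    finally show ?thesis using det' j by (simp add: field_simps)
  qed
  have Imj: "Im j = of_int b * v" by (simp add: j_def v_def)
  have coord: "v * (\<alpha> i)\<^sup>2 - of_int b * Im ((\<zeta> i)\<^sup>2 / j) = Im \<tau>' * (\<alpha>' i)\<^sup>2" for i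
  proof -
    define x where "x = \<zeta> i / j"
    have jx: "j * x = \<zeta> i" "j * x\<^sup>2 = (\<zeta> i)\<^sup>2 / j" using j by (auto simp: x_def power2_eq_square)
    have "Im (\<zeta> i) = \<alpha> i * v" by (simp add: \<zeta>_def v_def)
    moreover have "Im x = \<alpha>' i * Im \<tau>'" unfolding x_def \<zeta>' by simp
    ultimately have "(\<alpha> i * v)\<^sup>2 - of_int b * v * Im ((\<zeta> i)\<^sup>2 / j) = (\<alpha>' i * Im \<tau>')\<^sup>2 * (norm j)\<^sup>2"
      using imaginary_square_identity [of j x] unfolding jx Imj by simp
    also have "\<dots> = v * (Im \<tau>' * (\<alpha>' i)\<^sup>2)"
      using j unfolding v' by (simp add: power2_eq_square)
    finally have "v * (v * (\<alpha> i)\<^sup>2 - of_int b * Im ((\<zeta> i)\<^sup>2 / j)) = v * (Im \<tau>' * (\<alpha>' i)\<^sup>2)"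
      by (simp add: power2_eq_square algebra_simps)
    then show ?thesis using v by simp
  qed
  have Q: "qform p q \<alpha> * v - of_int b * Im (qform p q \<zeta> / j) = qform p q \<alpha>' * Im \<tau>'"
  proof -
    have "qform p q \<alpha> * v - of_int b * Im (qform p q \<zeta> / j) = (\<Sum>i<p. real (q i) * (v * (\<alpha> i)\<^sup>2 - of_int b * Im ((\<zeta> i)\<^sup>2 / j)))"
      unfolding qform_def sum_divide_distrib Im_sum sum_distrib_left sum_distrib_right sum_subtractf [symmetric]
    proof (intro sum.cong refl)
      fix i
      have "Im (of_nat (q i) * (\<zeta> i)\<^sup>2 / j) = Im (of_real (real (q i)) * ((\<zeta> i)\<^sup>2 / j))" by simp
      also have "\<dots> = real (q i) * Im ((\<zeta> i)\<^sup>2 / j)" by (rule Im_of_real_mult)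
      finally show "of_nat (q i) * (\<alpha> i)\<^sup>2 * v - of_int b * Im (of_nat (q i) * (\<zeta> i)\<^sup>2 / j) =
          real (q i) * (v * (\<alpha> i)\<^sup>2 - of_int b * Im ((\<zeta> i)\<^sup>2 / j))"
        by (simp add: algebra_simps)
    qed
    then show ?thesis unfolding coord qform_def sum_distrib_right by (simp only: mult_ac of_nat_id)
  qed
  have "norm (f \<tau> \<zeta>) = norm j powi (- \<kappa>) * exp (pi * real m * of_int b * Im (qform p q \<zeta> / j)) * norm (g \<tau>' (\<lambda>i. \<zeta> i / j))"
  proof -
    have "f \<tau> \<zeta> = j powi (- \<kappa>) * ee (- of_nat m * of_int b * qform p q \<zeta> / (2 * j)) * g \<tau>' (\<lambda>i. \<zeta> i / j)"
      using rel \<tau> unfolding jacobi_related_def j_def \<tau>'_def by blast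
    moreover have "- of_nat m * of_int b * qform p q \<zeta> / (2 * j) = of_real (- real m * of_int b / 2) * (qform p q \<zeta> / j)"
      by simp
    moreover have "Im (of_real (- real m * of_int b / 2) * (qform p q \<zeta> / j)) = - real m * of_int b / 2 * Im (qform p q \<zeta> / j)"
      by (rule Im_of_real_mult)
    ultimately show ?thesis by (simp add: norm_mult norm_power_int norm_ee del: of_real_mult of_real_divide)
  qed
  then have "norm (f \<tau> \<zeta>) * exp (- (pi * real m * qform p q \<alpha> * v))
     = norm j powi (- \<kappa>) * norm (g \<tau>' (\<lambda>i. \<zeta> i / j)) * (exp (pi * real m * of_int b * Im (qform p q \<zeta> / j)) * exp (- (pi * real m * qform p q \<alpha> * v)))"
    by simp
  also have "exp (pi * real m * of_int b * Im (qform p q \<zeta> / j)) * exp (- (pi * real m * qform p q \<alpha> * v))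
     = exp (- (pi * real m * (qform p q \<alpha> * v - of_int b * Im (qform p q \<zeta> / j))))"
    by (simp add: exp_add [symmetric] algebra_simps)
  finally have 1: "norm (f \<tau> \<zeta>) * exp (- (pi * real m * qform p q \<alpha> * v))
     = norm j powi (- \<kappa>) * (norm (g \<tau>' (\<lambda>i. \<zeta> i / j)) * exp (- (pi * real m * qform p q \<alpha>' * Im \<tau>')))"
    unfolding Q by (simp add: mult_ac)
  have "(norm j powi (- \<kappa>))\<^sup>2 * v powr of_int \<kappa> = Im \<tau>' powr of_int \<kappa>"
  proof -
    have "(norm j powi (- \<kappa>))\<^sup>2 = norm j powr of_int (- 2 * \<kappa>)"
      using j by (simp add: powr_real_of_int' [symmetric] power2_eq_square powr_add [symmetric])
    also have "\<dots> = ((norm j)\<^sup>2) powr (- of_int \<kappa>)"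
      using j by (simp add: powr_powr flip: powr_numeral)
    finally show ?thesis unfolding v' using v j by (simp add: powr_divide powr_minus field_simps)
  qed
  then show ?thesis
    using 1 unfolding petersson_def j_def [symmetric] \<tau>'_def [symmetric] \<alpha>'_def [symmetric] \<beta>'_def [symmetric] \<zeta>_def [symmetric] \<zeta>' [symmetric] v_def [symmetric]
    by (simp add: power_mult_distrib mult_ac)
qed

text \<open>
  A matrix in \<open>SL_2(\<int>)\<close> permutes the pairs of elements of \<open>(\<int>/M)\<^sup>p\<close>.
\<close>

lemma sum_grid_SL2:
  fixes h :: "(nat \<Rightarrow> real) \<Rightarrow> (nat \<Rightarrow> real) \<Rightarrow> real"
  assumes det: "a * d - b * c = (1::int)" and M: "M > 0"
    and per: "\<And>x y x' y'. (\<And>i. i < p \<Longrightarrow> M dvd x i - x' i) \<Longrightarrow> (\<And>i. i < p \<Longrightarrow> M dvd y i - y' i) \<Longrightarrow>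
       h (scaled M x) (scaled M y) = h (scaled M x') (scaled M y')"
  shows "(\<Sum>x\<in>grid p M. \<Sum>y\<in>grid p M. h (\<lambda>i. of_int a * scaled M x i - of_int b * scaled M y i) (\<lambda>i. - of_int c * scaled M x i + of_int d * scaled M y i))
       = (\<Sum>x\<in>grid p M. \<Sum>y\<in>grid p M. h (scaled M x) (scaled M y))"
proof -
  define red where "red x = restrict (\<lambda>i. x i mod M) {..<p}" for x :: "nat \<Rightarrow> int"
  have red: "red x \<in> grid p M" for x using M by (auto simp: red_def grid_def)
  have red_id: "red x = x" if "x \<in> grid p M" for x
    using that M by (auto simp: red_def grid_def PiE_iff extensional_def fun_eq_iff)
  define F where "F = (\<lambda>(x, y). (red (\<lambda>i. a * x i - b * y i), red (\<lambda>i. - c * x i + d * y i)))"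
  \<comment> \<open>the inverse matrix\<close>
  define F' where "F' = (\<lambda>(x, y). (red (\<lambda>i. d * x i + b * y i), red (\<lambda>i. c * x i + a * y i)))"
  have modlin: "(s * (x mod M) + t * (y mod M)) mod M = (s * x + t * y) mod M" for s t x y
    by (intro mod_add_cong) (simp_all add: mod_mult_right_eq)
  have modlin': "(s * (x mod M) - t * (y mod M)) mod M = (s * x - t * y) mod M" for s t x y
    by (intro mod_diff_cong) (simp_all add: mod_mult_right_eq)
  have F'F: "F' (F (x, y)) = (x, y)" if "x \<in> grid p M" "y \<in> grid p M" for x y
  proof -
    have "d * (a * x i - b * y i) + b * (- c * x i + d * y i) = (a * d - b * c) * x i"
         "c * (a * x i - b * y i) + a * (- c * x i + d * y i) = (a * d - b * c) * y i" for i
      by (simp_all add: algebra_simps)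
    then have "F' (F (x, y)) = (red x, red y)"
      unfolding F_def F'_def using det by (auto simp: red_def fun_eq_iff modlin)
    then show ?thesis using red_id that by simp
  qed
  have FF': "F (F' (x, y)) = (x, y)" if "x \<in> grid p M" "y \<in> grid p M" for x y
  proof -
    have "a * (d * x i + b * y i) - b * (c * x i + a * y i) = (a * d - b * c) * x i"
         "- c * (d * x i + b * y i) + d * (c * x i + a * y i) = (a * d - b * c) * y i" for i
      by (simp_all add: algebra_simps)
    then have "F (F' (x, y)) = (red x, red y)"
      unfolding F_def F'_def using det by (auto simp: red_def fun_eq_iff modlin modlin')
    then show ?thesis using red_id that by simp
  qed
  have hF: "h (\<lambda>i. of_int a * scaled M x i - of_int b * scaled M y i) (\<lambda>i. - of_int c * scaled M x i + of_int d * scaled M y i)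
     = (case F (x, y) of (x', y') \<Rightarrow> h (scaled M x') (scaled M y'))" for x y
  proof -
    have e: "(\<lambda>i. of_int a * scaled M x i - of_int b * scaled M y i) = scaled M (\<lambda>i. a * x i - b * y i)"
         "(\<lambda>i. - of_int c * scaled M x i + of_int d * scaled M y i) = scaled M (\<lambda>i. - c * x i + d * y i)"
      by (auto simp: scaled_def fun_eq_iff diff_divide_distrib add_divide_distrib)
    show ?thesis unfolding e F_def prod.case
      by (rule per) (auto simp: red_def minus_mod_eq_mult_div)
  qed
  show ?thesis
    unfolding sum.cartesian_product hF
    by (rule sum.reindex_bij_witness [where i = F' and j = F])
       (use F'F FF' red in \<open>auto simp: F_def F'_def split: prod.splits\<close>)
qed

text \<open>
  Dirichlet approximation of \<open>Re \<tau>\<close> gives coprime \<open>h\<close>, \<open>k\<close> with \<open>k \<le> 2 / sqrt v\<close> and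
  \<open>\<bar>k Re \<tau> - h\<bar> \<le> sqrt v\<close>, hence \<open>\<bar>k\<tau> - h\<bar>\<^sup>2 \<le> v + 4 v\<close>.
\<close>

lemma exists_reducing_matrix:
  assumes \<tau>: "0 < Im \<tau>" "Im \<tau> \<le> 1"
  obtains a b c d :: int where "a * d - b * c = 1"
    "1 / 5 \<le> Im ((of_int c + of_int d * \<tau>) / (of_int a + of_int b * \<tau>))"
proof -
  define v where "v = Im \<tau>"
  have v: "0 < v" "v \<le> 1" using \<tau> by (auto simp: v_def)
  define N where "N = nat \<lceil>1 / sqrt v\<rceil>"
  have sv: "1 \<le> 1 / sqrt v" using v by simp
  have N1: "1 / sqrt v \<le> real N" unfolding N_def by linarith
  have "real N \<le> 1 / sqrt v + 1" using sv unfolding N_def by linarith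
  also have "\<dots> \<le> 2 * (1 / sqrt v)" using sv by linarith
  finally have N2: "real N \<le> 2 / sqrt v" by simp
  have N: "N > 0" using N1 sv by linarith
  obtain h k where hk: "coprime h k" "0 < k" "k \<le> int N" "\<bar>of_int k * Re \<tau> - of_int h\<bar> < 1 / N"
    using Dirichlet_approx_coprime [OF N] by metis
  obtain x y where xy: "x * h + y * k = 1"
    using hk(1) bezout_int [of h k] by auto
  have det: "(- h) * (- x) - k * (- y) = 1" using xy by (simp add: algebra_simps)
  have "1 / real N \<le> sqrt v" using N1 N v by (simp add: field_simps)
  then have r: "\<bar>of_int k * Re \<tau> - of_int h\<bar> \<le> sqrt v" using hk by linarith
  have "(of_int k * Re \<tau> - of_int h)\<^sup>2 \<le> (sqrt v)\<^sup>2"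
    using power_mono [OF r, of 2] by simp
  then have 1: "(of_int k * Re \<tau> - of_int h)\<^sup>2 \<le> v" using v by simp
  have "of_int k * v \<le> 2 / sqrt v * v" using N2 hk(3) v by (intro mult_right_mono) linarith+
  also have "\<dots> = 2 * sqrt v" using v by (simp add: field_simps)
  finally have "(of_int k * v)\<^sup>2 \<le> (2 * sqrt v)\<^sup>2" using v hk by (intro power_mono) auto
  then have 2: "(of_int k * v)\<^sup>2 \<le> 4 * v" using v by (simp add: power_mult_distrib)
  have n: "(norm (of_int (- h) + of_int k * \<tau>))\<^sup>2 = (of_int k * Re \<tau> - of_int h)\<^sup>2 + (of_int k * v)\<^sup>2"
    by (simp add: cmod_power2 v_def)
  have n0: "(norm (of_int (- h) + of_int k * \<tau>))\<^sup>2 > 0"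
    using automorphy_nonzero [OF det, of \<tau>] \<tau> by simp
  have "1 / 5 \<le> v / (norm (of_int (- h) + of_int k * \<tau>))\<^sup>2"
    using 1 2 n n0 by (simp add: field_simps)
  then show ?thesis
    using that [OF det] Im_moebius [OF det \<tau>(1)] by (simp add: v_def)
qed

text \<open>
  The Petersson norm of \<open>f\<close> depends on \<open>\<alpha>\<close> and \<open>\<beta>\<close> modulo integers only: for \<open>\<beta>\<close> because the exponents in \<open>\<zeta>\<close>
  are integral, for \<open>\<alpha>\<close> by quasi-periodicity. So the permutation of the torsion points does not change
  the sum.
\<close>

lemma petersson_grid_invariant:
  assumes det: "a * d - b * c = (1::int)" and \<tau>: "Im \<tau> > 0" and M: "M > 0"
    and rel: "jacobi_related p q m \<kappa> a b c d f g"
    and f: "theta_expansion p q m X N R A f" and qp: "theta_quasiperiodic p q m f"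
  shows "(\<Sum>x\<in>grid p M. \<Sum>y\<in>grid p M. petersson p q m (of_int \<kappa>) f \<tau> (scaled M x) (scaled M y)) =
    (\<Sum>x\<in>grid p M. \<Sum>y\<in>grid p M.
       petersson p q m (of_int \<kappa>) g ((of_int c + of_int d * \<tau>) / (of_int a + of_int b * \<tau>)) (scaled M x) (scaled M y))"
proof -
  define h where "h = petersson p q m (of_int \<kappa>) g ((of_int c + of_int d * \<tau>) / (of_int a + of_int b * \<tau>))"
  define F where "F = petersson p q m (of_int \<kappa>) f \<tau>"
  have Fh: "F \<alpha> \<beta> = h (\<lambda>i. of_int a * \<alpha> i - of_int b * \<beta> i) (\<lambda>i. - of_int c * \<alpha> i + of_int d * \<beta> i)" for \<alpha> \<beta>
    unfolding F_def h_def by (rule petersson_transform [OF det \<tau> rel])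
  have ext: "f \<tau> \<zeta> = f \<tau> \<zeta>'" if "\<And>i. i < p \<Longrightarrow> \<zeta> i - \<zeta>' i \<in> \<int>" for \<zeta> \<zeta>'
  proof -
    have "ee (of_real (N l) * \<tau> + dotp p (R l) \<zeta>) = ee (of_real (N l) * \<tau> + dotp p (R l) \<zeta>')" for l
    proof -
      have "dotp p (R l) \<zeta> - dotp p (R l) \<zeta>' = (\<Sum>i<p. of_int (R l i) * (\<zeta> i - \<zeta>' i))"
        by (simp add: dotp_def sum_subtractf ring_distribs)
      moreover have "\<dots> \<in> \<int>" using that by (intro Ints_sum Ints_mult) auto
      ultimately obtain n where "dotp p (R l) \<zeta> = dotp p (R l) \<zeta>' + of_int n"
        by (metis Ints_cases diff_eq_eq add.commute)
      then show ?thesis by (simp add: ee_add)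
    qed
    then have "((\<lambda>l. A l * ee (of_real (N l) * \<tau> + dotp p (R l) \<zeta>)) has_sum f \<tau> \<zeta>') X"
      using f \<tau> unfolding theta_expansion_def by simp
    moreover have "((\<lambda>l. A l * ee (of_real (N l) * \<tau> + dotp p (R l) \<zeta>)) has_sum f \<tau> \<zeta>) X"
      using f \<tau> unfolding theta_expansion_def by simp
    ultimately show ?thesis by (rule has_sum_unique [symmetric])
  qed
  have qcong: "qform p q \<alpha> = qform p q \<alpha>'" if "\<And>i. i < p \<Longrightarrow> \<alpha> i = \<alpha>' i" for \<alpha> \<alpha>' :: "nat \<Rightarrow> real"
    using that by (simp add: qform_def)
  have Fper: "F \<alpha> \<beta> = F \<alpha>' \<beta>'"
    if "\<And>i. i < p \<Longrightarrow> \<alpha> i - \<alpha>' i \<in> \<int>" "\<And>i. i < p \<Longrightarrow> \<beta> i - \<beta>' i \<in> \<int>" for \<alpha> \<beta> \<alpha>' \<beta>'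
  proof -
    define k where "k i = \<lfloor>\<alpha> i - \<alpha>' i\<rfloor>" for i
    have k: "\<alpha> i = \<alpha>' i + of_int (k i)" if "i < p" for i
      using \<open>\<And>i. i < p \<Longrightarrow> \<alpha> i - \<alpha>' i \<in> \<int>\<close> [OF that] by (auto simp: k_def elim!: Ints_cases)
    define \<zeta> where "\<zeta> i = of_real (\<alpha>' i) * \<tau> + of_real (\<beta> i)" for i
    have "f \<tau> (\<lambda>i. of_real (\<alpha> i) * \<tau> + of_real (\<beta> i)) = f \<tau> (\<lambda>i. of_int (k i) * \<tau> + \<zeta> i)"
      by (rule ext) (simp add: k \<zeta>_def algebra_simps)
    also have "norm \<dots> = exp (2 * pi * (real m * (\<Sum>i<p. real (q i) * of_int (k i) * \<alpha>' i) * Im \<tau> + real m * Im \<tau> * qform p q (\<lambda>i. of_int (k i)) / 2)) * norm (f \<tau> \<zeta>)"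
    proof -
      have "f \<tau> (\<lambda>i. of_int (k i) * \<tau> + \<zeta> i) =
        ee (- of_nat m * (\<Sum>i<p. of_nat (q i) * of_int (k i) * \<zeta> i) - of_nat m * \<tau> * qform p q (\<lambda>i. of_int (k i)) / 2) * f \<tau> \<zeta>"
        using qp \<tau> unfolding theta_quasiperiodic_def by blast
      moreover have "Im (\<Sum>i<p. of_nat (q i) * of_int (k i) * \<zeta> i) = (\<Sum>i<p. real (q i) * of_int (k i) * \<alpha>' i) * Im \<tau>"
        unfolding Im_sum sum_distrib_right by (intro sum.cong refl) (simp add: \<zeta>_def)
      moreover have "qform p q (\<lambda>i. complex_of_int (k i)) = of_real (qform p q (\<lambda>i. of_int (k i)))"
        by (simp add: qform_def)
      ultimately show ?thesis by (simp add: norm_mult norm_ee algebra_simps)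
    qed
    also have "f \<tau> \<zeta> = f \<tau> (\<lambda>i. of_real (\<alpha>' i) * \<tau> + of_real (\<beta>' i))"
      by (rule ext) (use that(2) in \<open>auto simp: \<zeta>_def elim!: Ints_cases simp flip: of_real_diff\<close>)
    finally have nf: "norm (f \<tau> (\<lambda>i. of_real (\<alpha> i) * \<tau> + of_real (\<beta> i))) =
       exp (2 * pi * (real m * (\<Sum>i<p. real (q i) * of_int (k i) * \<alpha>' i) * Im \<tau> + real m * Im \<tau> * qform p q (\<lambda>i. of_int (k i)) / 2))
        * norm (f \<tau> (\<lambda>i. of_real (\<alpha>' i) * \<tau> + of_real (\<beta>' i)))" .
    have Q: "qform p q \<alpha> = qform p q \<alpha>' + 2 * (\<Sum>i<p. real (q i) * of_int (k i) * \<alpha>' i) + qform p q (\<lambda>i. of_int (k i))"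
      unfolding qform_def sum_distrib_left sum.distrib [symmetric]
      by (intro sum.cong refl) (simp add: k power2_eq_square algebra_simps)
    have "norm (f \<tau> (\<lambda>i. of_real (\<alpha> i) * \<tau> + of_real (\<beta> i))) * exp (- (pi * real m * qform p q \<alpha> * Im \<tau>))
      = norm (f \<tau> (\<lambda>i. of_real (\<alpha>' i) * \<tau> + of_real (\<beta>' i))) * exp (- (pi * real m * qform p q \<alpha>' * Im \<tau>))"
      unfolding nf Q by (simp add: exp_add [symmetric] algebra_simps)
    then show ?thesis by (simp add: F_def petersson_def)
  qed
  have det': "real_of_int a * of_int d - of_int b * of_int c = 1"
    using det by (metis of_int_1 of_int_diff of_int_mult)
  \<comment> \<open>periodicity of \<open>h\<close> is inherited from that of \<open>F\<close> through the inverse matrix\<close>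
  have hF: "h \<alpha> \<beta> = F (\<lambda>i. of_int d * \<alpha> i + of_int b * \<beta> i) (\<lambda>i. of_int c * \<alpha> i + of_int a * \<beta> i)" for \<alpha> \<beta>
  proof -
    have "of_int a * (of_int d * x + of_int b * y) - of_int b * (of_int c * x + of_int a * y) = (real_of_int a * of_int d - of_int b * of_int c) * x"
      "- of_int c * (of_int d * x + of_int b * y) + of_int d * (of_int c * x + of_int a * y) = (real_of_int a * of_int d - of_int b * of_int c) * y" for x y :: real
      by (simp_all add: algebra_simps)
    then show ?thesis unfolding Fh using det' by simp
  qed
  have "(\<Sum>x\<in>grid p M. \<Sum>y\<in>grid p M. F (scaled M x) (scaled M y)) = (\<Sum>x\<in>grid p M. \<Sum>y\<in>grid p M. h (scaled M x) (scaled M y))"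
    unfolding Fh
  proof (rule sum_grid_SL2 [OF det M])
    fix x y x' y' :: "nat \<Rightarrow> int"
    assume dv: "\<And>i. i < p \<Longrightarrow> M dvd x i - x' i" "\<And>i. i < p \<Longrightarrow> M dvd y i - y' i"
    have int: "of_int s * scaled M x i + of_int t * scaled M y i - (of_int s * scaled M x' i + of_int t * scaled M y' i) \<in> \<int>" if "i < p" for s t i
    proof -
      have "M dvd x i - x' i" "M dvd y i - y' i" using dv that by auto
      then obtain u w where "x i - x' i = M * u" "y i - y' i = M * w"
        by (auto elim!: dvdE)
      then have "x i = x' i + M * u" "y i = y' i + M * w" by auto
      then have "of_int s * scaled M x i + of_int t * scaled M y i - (of_int s * scaled M x' i + of_int t * scaled M y' i) = of_int (s * u + t * w)"
        using M by (simp add: scaled_def field_simps)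
      then show ?thesis by (metis Ints_of_int)
    qed
    show "h (scaled M x) (scaled M y) = h (scaled M x') (scaled M y')"
      unfolding hF by (rule Fper) (use int in auto)
  qed
  then show ?thesis by (simp add: F_def h_def)
qed

section \<open>Vanishing below the singular weight\<close>

text \<open>
  The inversion \<open>\<tau> \<mapsto> -1/\<tau>\<close> turns the translation of \<open>\<zeta>\<close> by \<open>k\<tau>\<close> into the translation of \<open>\<zeta> / \<tau>\<close> by the integral
  vector \<open>k\<close>, under which the transform \<open>g\<close> is invariant.
\<close>

lemma theta_quasiperiodic_from_inversion:
  assumes rel: "jacobi_related p q m \<kappa> 0 1 (- 1) 0 f g" and g: "theta_expansion p q m X N R a g"
  shows "theta_quasiperiodic p q m f"
  unfolding theta_quasiperiodic_def
proof (intro allI impI)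
  fix \<tau> :: complex and \<zeta> and k :: "nat \<Rightarrow> int"
  assume \<tau>: "Im \<tau> > 0"
  define \<zeta>' where "\<zeta>' i = of_int (k i) * \<tau> + \<zeta> i" for i
  have \<tau>0: "\<tau> \<noteq> 0" using \<tau> by auto
  have Im': "Im (- 1 / \<tau>) > 0" using Im_moebius [of 0 0 1 "-1" \<tau>] \<tau> \<tau>0 by simp
  have f: "f \<tau> z = \<tau> powi (- \<kappa>) * ee (- of_nat m * qform p q z / (2 * \<tau>)) * g (- 1 / \<tau>) (\<lambda>i. z i / \<tau>)" for z
    using rel \<tau> unfolding jacobi_related_def by (auto dest!: spec [of _ \<tau>])
  have "g (- 1 / \<tau>) (\<lambda>i. \<zeta>' i / \<tau>) = g (- 1 / \<tau>) (\<lambda>i. \<zeta> i / \<tau>)"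
  proof -
    have e: "\<zeta>' i / \<tau> = of_int (k i) + \<zeta> i / \<tau>" for i using \<tau>0 by (simp add: \<zeta>'_def field_simps)
    have "dotp p (R l) (\<lambda>i. \<zeta>' i / \<tau>) = of_int (\<Sum>i<p. R l i * k i) + dotp p (R l) (\<lambda>i. \<zeta> i / \<tau>)" for l
      unfolding e dotp_add by (simp add: dotp_def)
    then have "\<And>l. ee (of_real (N l) * (- 1 / \<tau>) + dotp p (R l) (\<lambda>i. \<zeta>' i / \<tau>)) =
        ee (of_real (N l) * (- 1 / \<tau>) + dotp p (R l) (\<lambda>i. \<zeta> i / \<tau>))"
      by (simp only: ee_add ee_int mult_1_left)
    moreover have "((\<lambda>l. a l * ee (of_real (N l) * (- 1 / \<tau>) + dotp p (R l) (\<lambda>i. \<zeta> i / \<tau>))) has_sum g (- 1 / \<tau>) (\<lambda>i. \<zeta> i / \<tau>)) X"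
      using g Im' unfolding theta_expansion_def by blast
    ultimately have "((\<lambda>l. a l * ee (of_real (N l) * (- 1 / \<tau>) + dotp p (R l) (\<lambda>i. \<zeta>' i / \<tau>))) has_sum g (- 1 / \<tau>) (\<lambda>i. \<zeta> i / \<tau>)) X"
      by (simp only:)
    moreover have "((\<lambda>l. a l * ee (of_real (N l) * (- 1 / \<tau>) + dotp p (R l) (\<lambda>i. \<zeta>' i / \<tau>))) has_sum g (- 1 / \<tau>) (\<lambda>i. \<zeta>' i / \<tau>)) X"
      using g Im' unfolding theta_expansion_def by blast
    ultimately show ?thesis by (rule has_sum_unique [symmetric])
  qed
  moreover have "- of_nat m * qform p q \<zeta>' / (2 * \<tau>) =
     (- of_nat m * (\<Sum>i<p. of_nat (q i) * of_int (k i) * \<zeta> i) - of_nat m * \<tau> * qform p q (\<lambda>i. of_int (k i)) / 2)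
      + (- of_nat m * qform p q \<zeta> / (2 * \<tau>))"
  proof -
    have "qform p q \<zeta>' = \<tau>\<^sup>2 * qform p q (\<lambda>i. of_int (k i)) + 2 * \<tau> * (\<Sum>i<p. of_nat (q i) * of_int (k i) * \<zeta> i) + qform p q \<zeta>"
      unfolding qform_def sum_distrib_left sum.distrib [symmetric]
      by (intro sum.cong refl) (simp add: \<zeta>'_def power2_eq_square algebra_simps)
    then show ?thesis using \<tau>0 by (simp add: field_simps power2_eq_square)
  qed
  ultimately have "f \<tau> \<zeta>' = ee (- of_nat m * (\<Sum>i<p. of_nat (q i) * of_int (k i) * \<zeta> i) - of_nat m * \<tau> * qform p q (\<lambda>i. of_int (k i)) / 2) * f \<tau> \<zeta>"
    unfolding f by (simp only: ee_add) (simp only: mult_ac)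
  then show "f \<tau> (\<lambda>i. of_int (k i) * \<tau> + \<zeta> i) =
     ee (- of_nat m * (\<Sum>i<p. of_nat (q i) * of_int (k i) * \<zeta> i) - of_nat m * \<tau> * qform p q (\<lambda>i. of_int (k i)) / 2) * f \<tau> \<zeta>"
    by (simp only: \<zeta>'_def [abs_def])
qed

text \<open>
  The lower bound at \<open>\<tau>\<close>, the invariance of the average and the upper bound at a point with imaginary
  part at least \<open>1/5\<close>. As \<open>\<kappa> < p/2\<close>, the upper bound is a constant independent of this point.
\<close>

lemma theta_coeff_growth:
  fixes q :: "nat \<Rightarrow> nat" and XX :: "'j \<Rightarrow> 'l set"
  assumes q: "\<And>i. i < p \<Longrightarrow> 0 < q i" and m: "m > 0" and low: "2 * \<kappa> < int p"
    and f: "theta_expansion p q m X N R a f"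
    and fin: "finite Js"
    and good: "\<And>j. j \<in> Js \<Longrightarrow> theta_expansion p q m (XX j) (NN j) (RR j) (aa j) (g j)"
    and rel: "\<And>a b c d. a * d - b * c = 1 \<Longrightarrow> \<exists>j\<in>Js. jacobi_related p q m \<kappa> a b c d f (g j)"
  shows "\<exists>C\<ge>0. \<forall>\<tau>. 0 < Im \<tau> \<longrightarrow> Im \<tau> \<le> 1 \<longrightarrow>
     (norm (theta_coeff p X N R a r \<tau>))\<^sup>2 \<le> C * Im \<tau> powr (real p / 2 - \<kappa>)"
proof -
  define \<kappa>' where "\<kappa>' = real_of_int \<kappa>"
  define \<delta> where "\<delta> = \<kappa>' - real p / 2"
  have "of_int (2 * \<kappa>) < (of_int (int p) :: real)" using low by (simp only: of_int_less_iff)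
  then have \<delta>: "\<delta> < 0" by (simp add: \<delta>_def \<kappa>'_def)
  \<comment> \<open>the inversion, for the quasi-periodicity\<close>
  obtain j0 where j0: "j0 \<in> Js" "jacobi_related p q m \<kappa> 0 1 (- 1) 0 f (g j0)"
    using rel [of 0 0 1 "- 1"] by auto
  have qp: "theta_quasiperiodic p q m f"
    by (rule theta_quasiperiodic_from_inversion [OF j0(2) good [OF j0(1)]])
  have "\<exists>C\<ge>0. \<forall>\<tau> M. Im \<tau> \<ge> 1 / 5 \<longrightarrow> M > 0 \<longrightarrow> sqrt (Im \<tau>) \<le> of_int M \<longrightarrow>
       (\<Sum>x\<in>grid p M. \<Sum>y\<in>grid p M. petersson p q m \<kappa>' (g j) \<tau> (scaled M x) (scaled M y))
         \<le> C * Im \<tau> powr \<delta> * of_int M ^ (2 * p)" if "j \<in> Js" for j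
    unfolding \<delta>_def by (rule petersson_grid_upper [OF q m good [OF that], of "1 / 5" \<kappa>']) (simp, simp, blast)
  then obtain Cj where Cj: "\<And>j. j \<in> Js \<Longrightarrow> Cj j \<ge> 0"
    "\<And>j \<tau> M. j \<in> Js \<Longrightarrow> Im \<tau> \<ge> 1 / 5 \<Longrightarrow> M > 0 \<Longrightarrow> sqrt (Im \<tau>) \<le> of_int M \<Longrightarrow>
       (\<Sum>x\<in>grid p M. \<Sum>y\<in>grid p M. petersson p q m \<kappa>' (g j) \<tau> (scaled M x) (scaled M y))
         \<le> Cj j * Im \<tau> powr \<delta> * of_int M ^ (2 * p)"
    by metis
  define C where "C = (\<Sum>j\<in>Js. Cj j)"
  have C: "Cj j \<le> C" if "j \<in> Js" for j
    unfolding C_def using that fin Cj(1) by (intro member_le_sum [where f = Cj]) auto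
  have C0: "C \<ge> 0" unfolding C_def using Cj(1) by (intro sum_nonneg) auto
  obtain c where c: "c > 0"
    "\<And>\<tau>. 0 < Im \<tau> \<Longrightarrow> Im \<tau> \<le> 1 \<Longrightarrow> \<exists>M0>0. \<forall>M\<ge>M0.
       c * (norm (theta_coeff p X N R a r \<tau>))\<^sup>2 * Im \<tau> powr \<delta> * of_int M ^ (2 * p)
       \<le> (\<Sum>x\<in>grid p M. \<Sum>y\<in>grid p M. petersson p q m \<kappa>' f \<tau> (scaled M x) (scaled M y))"
    unfolding \<delta>_def by (rule petersson_grid_lower [OF q m f qp, of r \<kappa>']) (simp, blast)
  define B where "B = C * (1 / 5) powr \<delta>"
  have B0: "B \<ge> 0" using C0 by (simp add: B_def)
  show ?thesis
  proof (intro exI [of _ "B / c"] conjI allI impI)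
    show "B / c \<ge> 0" using B0 c by simp
    fix \<tau> :: complex assume \<tau>: "0 < Im \<tau>" "Im \<tau> \<le> 1"
    obtain a' b' c' d' :: int where det: "a' * d' - b' * c' = 1"
      and red: "1 / 5 \<le> Im ((of_int c' + of_int d' * \<tau>) / (of_int a' + of_int b' * \<tau>))"
      by (rule exists_reducing_matrix [OF \<tau>])
    define \<tau>' where "\<tau>' = (of_int c' + of_int d' * \<tau>) / (of_int a' + of_int b' * \<tau>)"
    obtain j where j: "j \<in> Js" "jacobi_related p q m \<kappa> a' b' c' d' f (g j)" using rel [OF det] by blast
    obtain M0 where M0: "M0 > 0" "\<And>M. M \<ge> M0 \<Longrightarrow>
       c * (norm (theta_coeff p X N R a r \<tau>))\<^sup>2 * Im \<tau> powr \<delta> * of_int M ^ (2 * p)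
       \<le> (\<Sum>x\<in>grid p M. \<Sum>y\<in>grid p M. petersson p q m \<kappa>' f \<tau> (scaled M x) (scaled M y))"
      using c(2) [OF \<tau>] by blast
    \<comment> \<open>the grid may depend on \<open>\<tau>\<close>, since all constants are independent of \<open>M\<close>\<close>
    define M where "M = max M0 \<lceil>sqrt (Im \<tau>')\<rceil>"
    have M: "M > 0" "M \<ge> M0" using M0(1) by (auto simp: M_def)
    have "sqrt (Im \<tau>') \<le> of_int \<lceil>sqrt (Im \<tau>')\<rceil>" by (rule le_of_int_ceiling)
    also have "\<dots> \<le> of_int M" unfolding M_def of_int_le_iff by simp
    finally have M3: "sqrt (Im \<tau>') \<le> of_int M" .
    have "c * (norm (theta_coeff p X N R a r \<tau>))\<^sup>2 * Im \<tau> powr \<delta> * of_int M ^ (2 * p)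
       \<le> (\<Sum>x\<in>grid p M. \<Sum>y\<in>grid p M. petersson p q m \<kappa>' f \<tau> (scaled M x) (scaled M y))"
      by (rule M0(2) [OF M(2)])
    also have "\<dots> = (\<Sum>x\<in>grid p M. \<Sum>y\<in>grid p M. petersson p q m \<kappa>' (g j) \<tau>' (scaled M x) (scaled M y))"
      unfolding \<kappa>'_def \<tau>'_def by (rule petersson_grid_invariant [OF det \<tau>(1) M(1) j(2) f qp])
    also have "\<dots> \<le> Cj j * Im \<tau>' powr \<delta> * of_int M ^ (2 * p)"
      by (rule Cj(2) [OF j(1) _ M(1) M3]) (use red in \<open>simp only: \<tau>'_def\<close>)
    also have "\<dots> \<le> C * (1 / 5) powr \<delta> * of_int M ^ (2 * p)"
      using \<delta> red C [OF j(1)] Cj(1) [OF j(1)] M(1) C0 unfolding \<tau>'_def [symmetric]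
      by (intro mult_right_mono mult_mono powr_mono2') auto
    finally have "c * (norm (theta_coeff p X N R a r \<tau>))\<^sup>2 * Im \<tau> powr \<delta> \<le> B"
      unfolding B_def using M(1) by simp
    then have "(c * (norm (theta_coeff p X N R a r \<tau>))\<^sup>2 * Im \<tau> powr \<delta>) * Im \<tau> powr (- \<delta>) \<le> B * Im \<tau> powr (- \<delta>)"
      by (intro mult_right_mono) auto
    moreover have "Im \<tau> powr \<delta> * Im \<tau> powr (- \<delta>) = 1"
      using \<tau> by (simp flip: powr_add)
    ultimately have "c * (norm (theta_coeff p X N R a r \<tau>))\<^sup>2 \<le> B * Im \<tau> powr (- \<delta>)"
      by (simp only: mult.assoc mult_1_right)
    then have "(norm (theta_coeff p X N R a r \<tau>))\<^sup>2 \<le> B / c * Im \<tau> powr (- \<delta>)"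
      using c(1) by (simp add: field_simps)
    then show "(norm (theta_coeff p X N R a r \<tau>))\<^sup>2 \<le> B / c * Im \<tau> powr (real p / 2 - \<kappa>)"
      by (simp add: \<delta>_def \<kappa>'_def)
  qed
qed

text \<open>
  By the growth estimate \<open>f_r\<close> tends to \<open>0\<close> uniformly as \<open>Im \<tau> \<longrightarrow> 0\<close>, so its Fourier coefficients, which do not
  depend on \<open>Im \<tau>\<close> up to an exponential factor tending to \<open>1\<close>, are zero. The functions \<open>g j\<close> are the
  transforms of \<open>f\<close> under \<open>SL_2(\<int>)\<close>. The denominator \<open>D\<close> makes \<open>f_r\<close> periodic, and by \<open>inj\<close> no two
  terms have the same exponents.
\<close>

lemma low_weight_theta_expansion_vanishes:
  fixes q :: "nat \<Rightarrow> nat" and XX :: "'j \<Rightarrow> 'l set"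
  assumes q: "\<And>i. i < p \<Longrightarrow> 0 < q i" and m: "m > 0" and low: "2 * \<kappa> < int p"
    and f: "theta_expansion p q m X N R a f"
    and D: "D > 0" "\<And>l. l \<in> X \<Longrightarrow> of_int D * N l \<in> \<int>"
    and inj: "\<And>l l'. l \<in> X \<Longrightarrow> l' \<in> X \<Longrightarrow> N l = N l' \<Longrightarrow> \<forall>i<p. R l i = R l' i \<Longrightarrow> l = l'"
    and fin: "finite Js"
    and good: "\<And>j. j \<in> Js \<Longrightarrow> theta_expansion p q m (XX j) (NN j) (RR j) (aa j) (g j)"
    and rel: "\<And>a b c d. a * d - b * c = 1 \<Longrightarrow> \<exists>j\<in>Js. jacobi_related p q m \<kappa> a b c d f (g j)"
    and l0: "l0 \<in> X"
  shows "a l0 = 0"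
proof -
  define r where "r = R l0"
  define \<eta> where "\<eta> = real p / 2 - of_int \<kappa>"
  have "of_int (2 * \<kappa>) < (of_int (int p) :: real)" using low by (simp only: of_int_less_iff)
  then have \<eta>: "\<eta> > 0" by (simp add: \<eta>_def)
  obtain C where C: "C \<ge> 0" "\<And>\<tau>. 0 < Im \<tau> \<Longrightarrow> Im \<tau> \<le> 1 \<Longrightarrow>
     (norm (theta_coeff p X N R a r \<tau>))\<^sup>2 \<le> C * Im \<tau> powr \<eta>"
    using theta_coeff_growth [OF q m low f fin good rel, of r] unfolding \<eta>_def by blast
  define G where "G = {l \<in> X. \<forall>i<p. R l i = r i}"
  define K where "K l i = \<lfloor>of_int D * N l\<rfloor>" for l and i :: nat
  have K: "of_int (K l i) = of_int D * N l" if "l \<in> X" for l i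
    using D(2) [OF that] by (auto simp: K_def elim!: Ints_cases)
  \<comment> \<open>the coefficient is a Fourier coefficient of \<open>theta_coeff\<close> in the real part of \<open>\<tau>\<close>\<close>
  have bound: "norm (a l0) * exp (- 2 * pi * N l0 * v) \<le> sqrt (C * v powr \<eta>)" if v: "0 < v" "v \<le> 1" for v
  proof -
    define c where "c l = a l * ee (of_real (N l) * (\<i> * of_real v))" for l
    \<comment> \<open>in the variable \<open>Re \<tau> / D\<close> the function \<open>theta_coeff\<close> has integral exponents \<open>K l\<close>\<close>
    define u where "u z = theta_coeff p X N R a r (of_int D * z 0 + \<i> * of_real v)" for z :: "nat \<Rightarrow> complex"
    have hs: "((\<lambda>l. c l * ee (dotp 1 (K l) (\<lambda>i. of_real (y i)))) has_sum u (\<lambda>i. complex_of_real (y i))) G" for y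
    proof -
      let ?\<tau> = "of_int D * of_real (y 0) + \<i> * of_real v"
      have "((\<lambda>l. a l * ee (of_real (N l) * ?\<tau> + dotp p (R l) (\<lambda>_. 0))) has_sum f ?\<tau> (\<lambda>_. 0)) X"
        using f v unfolding theta_expansion_def by simp
      then have "((\<lambda>l. a l * ee (of_real (N l) * ?\<tau>)) has_sum f ?\<tau> (\<lambda>_. 0)) X"
        by (simp add: dotp_def)
      then have "(\<lambda>l. a l * ee (of_real (N l) * ?\<tau>)) summable_on G"
        by (intro summable_on_subset_banach [OF has_sum_imp_summable]) (auto simp: G_def)
      then have "((\<lambda>l. a l * ee (of_real (N l) * ?\<tau>)) has_sum u (\<lambda>i. complex_of_real (y i))) G"
        unfolding u_def theta_coeff_def G_def [symmetric] by (rule has_sum_infsum)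
      moreover have "a l * ee (of_real (N l) * ?\<tau>) = c l * ee (dotp 1 (K l) (\<lambda>i. of_real (y i)))" if "l \<in> G" for l
      proof -
        have lX: "l \<in> X" using that by (simp add: G_def)
        have "complex_of_int (K l 0) = of_real (of_int (K l 0))" by simp
        also have "\<dots> = of_int D * of_real (N l)" unfolding K [OF lX] by simp
        finally have "dotp 1 (K l) (\<lambda>i. of_real (y i)) = of_real (N l) * (of_int D * of_real (y 0))"
          by (simp add: dotp_def)
        then show ?thesis by (simp only: c_def mult.assoc ee_add [symmetric] distrib_left add.commute)
      qed
      ultimately show ?thesis by (subst has_sum_cong) auto
    qed
    have small: "norm (grid_fourier 1 M (K l0) u) \<le> sqrt (C * v powr \<eta>)" if M: "M > 0" for M
    proof -
      have "norm (grid_fourier 1 M (K l0) u) \<le> (\<Sum>y\<in>grid 1 M. norm (u (cscaled M y) * ee (- dotp 1 (K l0) (cscaled M y)))) / of_int M"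
        using M by (simp add: grid_fourier_def norm_divide divide_right_mono sum_norm_le)
      also have "\<dots> \<le> (\<Sum>y\<in>grid 1 M. sqrt (C * v powr \<eta>)) / of_int M"
      proof (intro divide_right_mono sum_mono)
        fix y
        have "(norm (u (cscaled M y)))\<^sup>2 \<le> C * v powr \<eta>"
          using C(2) [of "of_int D * cscaled M y 0 + \<i> * of_real v"] v by (simp add: u_def)
        then have "norm (u (cscaled M y)) \<le> sqrt (C * v powr \<eta>)" by (rule real_le_rsqrt)
        moreover have "norm (ee (- dotp 1 (K l0) (cscaled M y))) = 1" by (simp add: norm_ee dotp_def)
        ultimately show "norm (u (cscaled M y) * ee (- dotp 1 (K l0) (cscaled M y))) \<le> sqrt (C * v powr \<eta>)"
          by (simp add: norm_mult)
      qed (use M in simp)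
      also have "\<dots> = sqrt (C * v powr \<eta>)" using M by (simp add: card_grid)
      finally show ?thesis .
    qed
    define P where "P l = norm (c l)" for l
    have "((\<lambda>l. c l) has_sum u (\<lambda>i. complex_of_real 0)) G" using hs [of "\<lambda>_. 0"] by (simp add: dotp_def)
    then have csum: "c summable_on G" by (rule has_sum_imp_summable)
    then have P: "P summable_on G" "\<And>l. P l \<ge> 0"
      unfolding P_def using summable_on_iff_abs_summable_on_complex by auto
    have "norm (c l0) \<le> sqrt (C * v powr \<eta>) + \<epsilon>" if e: "\<epsilon> > 0" for \<epsilon>
    proof -
      obtain M1 where M1: "\<forall>M\<ge>M1. \<forall>s\<in>{K l0}. infsum P {l \<in> G. (\<forall>i<1. M dvd K l i - s i) \<and> \<not> (\<forall>i<1. K l i = s i)} < \<epsilon>"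
        using summable_tail_incongruent [OF P _ e, of "{K l0}" 1 K] by auto
      define M where "M = max M1 1"
      have M: "M > 0" "M \<ge> M1" by (auto simp: M_def)
      define Bd where "Bd = {l \<in> G. (\<forall>i<1. M dvd K l i - K l0 i) \<and> \<not> (\<forall>i<1. K l i = K l0 i)}"
      have "{l \<in> G. \<forall>i<1. M dvd K l i - K l0 i} = {l0} \<union> Bd"
      proof -
        have "l = l0" if "l \<in> G" "K l 0 = K l0 0" for l
        proof (rule inj)
          show "l \<in> X" "l0 \<in> X" "\<forall>i<p. R l i = R l0 i" using that l0 by (auto simp: G_def r_def)
          have "of_int D * N l = of_int D * N l0"
            using K [of l 0] K [of l0 0] that l0 by (auto simp: G_def)
          then show "N l = N l0" using D(1) by auto
        qed
        moreover have "l0 \<in> G" using l0 by (simp add: G_def r_def)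
        ultimately show ?thesis by (auto simp: Bd_def)
      qed
      then have "(c has_sum grid_fourier 1 M (K l0) u) ({l0} \<union> Bd)"
        using grid_fourier_has_sum [OF M(1) hs, of "K l0"] by simp
      then have "grid_fourier 1 M (K l0) u = infsum c ({l0} \<union> Bd)" by (simp add: infsumI)
      also have "\<dots> = infsum c {l0} + infsum c Bd"
        by (intro infsum_Un_disjoint summable_on_subset_banach [OF csum]) (use l0 in \<open>auto simp: Bd_def G_def r_def\<close>)
      finally have "c l0 = grid_fourier 1 M (K l0) u - infsum c Bd" by simp
      then have "norm (c l0) \<le> norm (grid_fourier 1 M (K l0) u) + norm (infsum c Bd)"
        by (metis norm_triangle_ineq4)
      moreover have "norm (infsum c Bd) \<le> infsum P Bd"
        unfolding P_def by (rule norm_infsum_bound) (rule summable_on_subset_banach [OF P(1) [unfolded P_def]], auto simp: Bd_def)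
      moreover have "infsum P Bd < \<epsilon>" using M1 M unfolding Bd_def by auto
      ultimately show ?thesis using small [OF M(1)] by linarith
    qed
    then have "norm (c l0) \<le> sqrt (C * v powr \<eta>)" by (rule field_le_epsilon)
    then show ?thesis by (simp add: c_def norm_mult norm_ee mult_ac)
  qed
  have "((\<lambda>v. sqrt (C * v powr \<eta>)) \<longlongrightarrow> sqrt (C * 0)) (at_right 0)"
  proof (intro tendsto_intros)
    show "((\<lambda>v::real. v powr \<eta>) \<longlongrightarrow> 0) (at_right 0)"
      by (rule tendsto_zero_powrI [where b = \<eta>]) (use \<eta> in \<open>auto simp: eventually_at_filter\<close>)
  qed
  moreover have "((\<lambda>v. norm (a l0) * exp (- 2 * pi * N l0 * v)) \<longlongrightarrow> norm (a l0) * exp (- 2 * pi * N l0 * 0)) (at_right 0)"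
    by (intro tendsto_intros)
  moreover have "\<forall>\<^sub>F v in at_right 0. norm (a l0) * exp (- 2 * pi * N l0 * v) \<le> sqrt (C * v powr \<eta>)"
    using eventually_at_right_real [of 0 1, OF zero_less_one] by (rule eventually_mono) (use bound in auto)
  ultimately have "norm (a l0) * exp (- 2 * pi * N l0 * 0) \<le> sqrt (C * 0)"
    by (intro tendsto_le [of "at_right 0"]) auto
  then show ?thesis by simp
qed

section \<open>The period domain in frame coordinates\<close>

text \<open>
  Up to a positive factor the imaginary part of \<open>\<tau> = (x, v) / (x, e)\<close>; its sign distinguishes the two
  components of the period cone.
\<close>

definition height :: "int^'N^'N \<Rightarrow> complex^'N \<Rightarrow> complex^'N \<Rightarrow> complex^'N \<Rightarrow> real" where
  "height G e v x = Im (bil G x v * cnj (bil G x e))"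

lemma continuous_on_vec:
  fixes h :: "'a::topological_space \<Rightarrow> complex^'N"
  shows "(\<And>i. continuous_on S (\<lambda>t. h t $ i)) \<Longrightarrow> continuous_on S h"
  using continuous_on_vec_lambda [of S "\<lambda>i t. h t $ i"] by simp

lemma continuous_on_bil [continuous_intros]:
  fixes h :: "'a::topological_space \<Rightarrow> complex^'N"
  shows "continuous_on S h \<Longrightarrow> continuous_on S (\<lambda>t. bil G (h t) y)"
  unfolding bil_def by (intro continuous_intros)

lemma component_path:
  assumes D: "D \<in> components S" and \<gamma>: "continuous_on {0..1::real} \<gamma>" "\<gamma> ` {0..1} \<subseteq> S"
  shows "\<gamma> 0 \<in> D \<longleftrightarrow> \<gamma> 1 \<in> D"
proof -
  have conn: "connected (\<gamma> ` {0..1})" using \<gamma>(1) by (intro connected_continuous_image) auto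
  have "\<gamma> ` {0..1} \<subseteq> D" if "\<gamma> ` {0..1} \<inter> D \<noteq> {}"
    using components_maximal [OF D conn \<gamma>(2)] that by (simp add: Int_commute)
  moreover have "\<gamma> 0 \<in> \<gamma> ` {0..1}" "\<gamma> 1 \<in> \<gamma> ` {0..1}" by auto
  ultimately show ?thesis by blast
qed

lemma component_scale:
  assumes D: "D \<in> components (period_cone G)" and x: "x \<in> D" and t: "t \<noteq> 0"
  shows "t *s x \<in> D"
proof -
  have conj_sc: "conj_vec (s *s x) = cnj s *s conj_vec x" for s by (rule conj_vec_scale)
  have xS: "x \<in> period_cone G" using D x in_components_subset by blast
  have "(\<lambda>s. s *s x) ` (UNIV - {0}) \<subseteq> period_cone G"
  proof (rule image_subsetI)
    fix s :: complex assume "s \<in> UNIV - {0}"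
    then have "s \<noteq> 0" by simp
    have "bil G (s *s x) (conj_vec (s *s x)) = (norm s)\<^sup>2 * bil G x (conj_vec x)"
      unfolding conj_sc bil_scale_left bil_scale_right complex_norm_square by simp
    then have "Re (bil G (s *s x) (conj_vec (s *s x))) = (norm s)\<^sup>2 * Re (bil G x (conj_vec x))"
      by (simp flip: of_real_power)
    then show "s *s x \<in> period_cone G" using xS \<open>s \<noteq> 0\<close> by (simp add: period_cone_def bil_linear)
  qed
  moreover have "connected ((\<lambda>s. s *s x) ` (UNIV - {0 :: complex}))"
  proof (rule connected_continuous_image)
    show "continuous_on (UNIV - {0}) (\<lambda>s. s *s x)"
      by (rule continuous_on_vec) (simp, intro continuous_intros)
    have "connected (- {0 :: complex})" by (rule connected_punctured_universe) simp
    then show "connected (UNIV - {0 :: complex})" by (simp add: Compl_eq_Diff_UNIV)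
  qed
  moreover have "x \<in> (\<lambda>s. s *s x) ` (UNIV - {0})" by (rule image_eqI [of _ _ 1]) auto
  ultimately have "(\<lambda>s. s *s x) ` (UNIV - {0}) \<subseteq> D"
    using components_maximal [OF D] x by blast
  then show ?thesis using t by blast
qed

context adapted_frame
begin

text \<open>
  The point of the affine cone over \<open>\<D>\<close> normalized by \<open>(x, e) = 1\<close> whose tube coordinates are \<open>\<tau> = (x, v)\<close>,
  \<open>\<rho> = (x, l)\<close> and the coordinates \<open>\<zeta> i\<close> along \<open>w i\<close>; isotropy determines the coefficient of \<open>e\<close>.
\<close>

definition frame_point :: "complex \<Rightarrow> complex \<Rightarrow> (nat \<Rightarrow> complex) \<Rightarrow> complex^'N" where
  "frame_point \<tau> \<rho> \<zeta> = f + \<tau> *s l + \<rho> *s v + (\<Sum>i<p. \<zeta> i *s w i) - ((2 * \<tau> * \<rho> - qform p q \<zeta>) / 2) *s e"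

lemma w_rels: "i < p \<Longrightarrow> bil G (w i) e = 0" "i < p \<Longrightarrow> bil G (w i) v = 0" "i < p \<Longrightarrow> bil G (w i) f = 0" "i < p \<Longrightarrow> bil G (w i) l = 0"
  "i < p \<Longrightarrow> bil G e (w i) = 0" "i < p \<Longrightarrow> bil G v (w i) = 0" "i < p \<Longrightarrow> bil G f (w i) = 0" "i < p \<Longrightarrow> bil G l (w i) = 0"
  using w_perp [of i] bil_sym [OF sym, of "w i"] by (auto simp: frame_perp_def)

lemma sum_w: "j < p \<Longrightarrow> (\<Sum>i<p. \<zeta> i * bil G (w i) (w j)) = - (\<zeta> j * of_nat (q j))"
proof -
  assume j: "j < p"
  have "(\<Sum>i<p. \<zeta> i * bil G (w i) (w j)) = (\<Sum>i<p. if i = j then - (\<zeta> j * of_nat (q j)) else 0)"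
    by (intro sum.cong refl) (use j in \<open>auto simp: w_orthogonal\<close>)
  then show ?thesis using j by simp
qed

lemma frame_point_pairings: "bil G (frame_point \<tau> \<rho> \<zeta>) e = 1" "bil G (frame_point \<tau> \<rho> \<zeta>) v = \<tau>" "bil G (frame_point \<tau> \<rho> \<zeta>) l = \<rho>"
  "bil G (frame_point \<tau> \<rho> \<zeta>) f = - ((2 * \<tau> * \<rho> - qform p q \<zeta>) / 2)"
  "i < p \<Longrightarrow> bil G (frame_point \<tau> \<rho> \<zeta>) (w i) = - (\<zeta> i * of_nat (q i))"
  by (simp_all add: frame_point_def bil_linear rels w_rels sum_w)

lemma bil_coords: "bil G x y = bil G x f * bil G y e + bil G x l * bil G y v + bil G x e * bil G y f + bil G x v * bil G y l
   - (\<Sum>i<p. bil G x (w i) * bil G y (w i) / of_nat (q i))"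
  by (subst expand [of x]) (simp add: bil_linear bil_sym [OF sym, of _ y])

lemma conj_frame: "conj_vec e = e" "conj_vec v = v" "conj_vec f = f" "conj_vec l = l" "i < p \<Longrightarrow> conj_vec (w i) = w i"
  using rational w_rational conj_vec_Rats by auto

lemma bil_conj_frame: "bil G (conj_vec x) e = cnj (bil G x e)" "bil G (conj_vec x) v = cnj (bil G x v)"
  "bil G (conj_vec x) f = cnj (bil G x f)" "bil G (conj_vec x) l = cnj (bil G x l)"
  "i < p \<Longrightarrow> bil G (conj_vec x) (w i) = cnj (bil G x (w i))"
  using bil_conj [of G x e] bil_conj [of G x v] bil_conj [of G x f] bil_conj [of G x l] bil_conj [of G x "w i"]
  by (simp_all add: conj_frame)

text \<open>
  If \<open>(x, e)\<close> and \<open>(x, v)\<close> were proportional over the reals, the hyperbolic part of \<open>(x, x)\<close> would be a single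
  product \<open>2yz\<close> and that of the hermitian norm \<open>2 Re (y cnj z)\<close>. Isotropy bounds \<open>\<bar>2yz\<bar>\<close> by the definite part
  of the hermitian norm, which contradicts its positivity.
\<close>

lemma height_nonzero:
  assumes "x \<in> period_cone G"
  shows "height G e v x \<noteq> 0"
proof
  assume h: "height G e v x = 0"
  define x1 where "x1 = bil G x f"
  define x2 where "x2 = bil G x l"
  define x3 where "x3 = bil G x e"
  define x4 where "x4 = bil G x v"
  define Qc where "Qc = (\<Sum>i<p. bil G x (w i) * bil G x (w i) / of_nat (q i))"
  define Qn where "Qn = (\<Sum>i<p. (norm (bil G x (w i)))\<^sup>2 / real (q i))"
  have Q: "norm Qc \<le> Qn"
    unfolding Qc_def Qn_def by (rule order_trans [OF norm_sum]) (simp add: norm_divide norm_mult power2_eq_square)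
  have conj: "bil G x (conj_vec x) = x1 * cnj x3 + x2 * cnj x4 + x3 * cnj x1 + x4 * cnj x2 - of_real Qn"
  proof -
    have "(\<Sum>i<p. bil G x (w i) * bil G (conj_vec x) (w i) / of_nat (q i)) = of_real Qn"
      unfolding Qn_def of_real_sum by (intro sum.cong refl) (simp add: bil_conj_frame complex_norm_square [symmetric])
    then show ?thesis
      by (subst bil_coords) (simp add: bil_conj_frame x1_def x2_def x3_def x4_def)
  qed
  have "Re (bil G x (conj_vec x)) = 2 * Re (x1 * cnj x3 + x2 * cnj x4) - Qn"
    unfolding conj by (simp add: algebra_simps)
  then have pos: "2 * Re (x1 * cnj x3 + x2 * cnj x4) > Qn"
    using assms unfolding period_cone_def by (simp del: plus_complex.simps times_complex.simps)
  have "bil G x x = 2 * (x1 * x3 + x2 * x4) - Qc"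
    by (subst bil_coords) (simp add: x1_def x2_def x3_def x4_def Qc_def algebra_simps)
  then have zero: "2 * (x1 * x3 + x2 * x4) = Qc"
    using assms by (simp add: period_cone_def)
  have "\<exists>y z. x1 * x3 + x2 * x4 = y * z \<and> x1 * cnj x3 + x2 * cnj x4 = y * cnj z"
  proof (cases "x3 = 0")
    case True
    then show ?thesis by auto
  next
    case False
    define t where "t = Re (x4 / x3)"
    have "Im (x4 / x3) = 0"
      using h by (simp add: height_def x3_def [symmetric] x4_def [symmetric] Im_divide algebra_simps)
    then have "x4 / x3 = of_real t" by (simp add: t_def complex_eq_iff)
    then have "x4 = of_real t * x3" using False by (simp add: field_simps)
    then show ?thesis by (intro exI [of _ "x1 + of_real t * x2"] exI [of _ x3]) (simp add: algebra_simps)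
  qed
  then obtain y z where yz: "x1 * x3 + x2 * x4 = y * z" "x1 * cnj x3 + x2 * cnj x4 = y * cnj z" by blast
  have "2 * Re (y * cnj z) \<le> 2 * norm (y * cnj z)" using complex_Re_le_cmod [of "y * cnj z"] by linarith
  also have "\<dots> = norm (2 * (y * z))" by (simp add: norm_mult)
  also have "\<dots> = norm Qc" using zero yz(1) by simp
  finally show False using pos Q yz(2) by simp
qed

lemma frame_point_in_period_cone: "frame_point \<tau> \<rho> \<zeta> \<in> period_cone G \<longleftrightarrow> (\<Sum>i<p. real (q i) * (Im (\<zeta> i))\<^sup>2) < 2 * Im \<tau> * Im \<rho>"
proof -
  let ?x = "frame_point \<tau> \<rho> \<zeta>"
  have Q0: "(\<Sum>i<p. bil G ?x (w i) * bil G ?x (w i) / of_nat (q i)) = qform p q \<zeta>"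
    unfolding qform_def by (intro sum.cong refl) (use q_pos in \<open>simp add: frame_point_pairings power2_eq_square\<close>)
  have 0: "bil G ?x ?x = 0"
    by (subst bil_coords) (simp add: Q0, simp add: frame_point_pairings field_simps)
  have Q1: "(\<Sum>i<p. bil G ?x (w i) * bil G (conj_vec ?x) (w i) / of_nat (q i)) = of_real (\<Sum>i<p. real (q i) * (norm (\<zeta> i))\<^sup>2)"
    unfolding of_real_sum
  proof (intro sum.cong refl)
    fix i assume "i \<in> {..<p}"
    then have "bil G ?x (w i) * bil G (conj_vec ?x) (w i) / of_nat (q i) = of_nat (q i) * (\<zeta> i * cnj (\<zeta> i))"
      using q_pos [of i] by (simp add: frame_point_pairings bil_conj_frame)
    then show "bil G ?x (w i) * bil G (conj_vec ?x) (w i) / of_nat (q i) = of_real (real (q i) * (norm (\<zeta> i))\<^sup>2)"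
      unfolding complex_norm_square [symmetric] by simp
  qed
  have A1: "Re (bil G ?x (conj_vec ?x)) = - Re (2 * \<tau> * \<rho>) + Re (qform p q \<zeta>) + 2 * Re (\<rho> * cnj \<tau>) - (\<Sum>i<p. real (q i) * (norm (\<zeta> i))\<^sup>2)"
    unfolding bil_coords [of ?x "conj_vec ?x"] Q1
    by (simp add: bil_conj_frame frame_point_pairings algebra_simps diff_divide_distrib)
  have A2: "- Re (2 * \<tau> * \<rho>) + 2 * Re (\<rho> * cnj \<tau>) = 4 * Im \<tau> * Im \<rho>" by (simp add: algebra_simps)
  have A: "Re (bil G ?x (conj_vec ?x)) = 4 * Im \<tau> * Im \<rho> + (Re (qform p q \<zeta>) - (\<Sum>i<p. real (q i) * (norm (\<zeta> i))\<^sup>2))"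
    using A1 A2 by linarith
  have B: "Re (qform p q \<zeta>) - (\<Sum>i<p. real (q i) * (norm (\<zeta> i))\<^sup>2) = - 2 * (\<Sum>i<p. real (q i) * (Im (\<zeta> i))\<^sup>2)"
    unfolding qform_def Re_sum sum_subtractf [symmetric] sum_distrib_left
    unfolding cmod_power2 by (intro sum.cong refl) (simp add: power2_eq_square algebra_simps)
  show ?thesis using 0 unfolding period_cone_def mem_Collect_eq A B by (auto simp: mult_ac)
qed

lemma period_cone_frame_point:
  assumes "x \<in> period_cone G" "bil G x e \<noteq> 0"
  obtains \<rho> \<zeta> where "x = bil G x e *s frame_point (bil G x v / bil G x e) \<rho> \<zeta>"
proof -
  let ?t = "bil G x e"
  define \<zeta> where "\<zeta> i = - bil G x (w i) / of_nat (q i) / ?t" for i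
  have "?t * ?t * qform p q \<zeta> = (\<Sum>i<p. bil G x (w i) * bil G x (w i) / of_nat (q i))"
    unfolding qform_def sum_distrib_left
  proof (intro sum.cong refl)
    fix i assume "i \<in> {..<p}"
    then show "?t * ?t * (of_nat (q i) * (\<zeta> i)\<^sup>2) = bil G x (w i) * bil G x (w i) / of_nat (q i)"
      using q_pos [of i] assms(2) by (simp add: \<zeta>_def power2_eq_square field_simps)
  qed
  moreover have "bil G x x = 2 * (bil G x f * ?t + bil G x l * bil G x v) - (\<Sum>i<p. bil G x (w i) * bil G x (w i) / of_nat (q i))"
    by (subst bil_coords) (simp add: algebra_simps)
  ultimately have "?t * ?t * qform p q \<zeta> = 2 * (bil G x f * ?t + bil G x l * bil G x v)"
    using assms(1) by (simp add: period_cone_def)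
  then have f: "?t * - ((2 * (bil G x v / ?t) * (bil G x l / ?t) - qform p q \<zeta>) / 2) = bil G x f"
    using assms(2) by (simp add: field_simps)
  have "?t *s frame_point (bil G x v / ?t) (bil G x l / ?t) \<zeta> = ?t *s f + bil G x v *s l + bil G x l *s v
      + (\<Sum>i<p. (?t * \<zeta> i) *s w i) + (?t * - ((2 * (bil G x v / ?t) * (bil G x l / ?t) - qform p q \<zeta>) / 2)) *s e"
    using assms(2) by (simp add: frame_point_def vec_eq_iff algebra_simps sum_distrib_left)
  also have "(\<Sum>i<p. (?t * \<zeta> i) *s w i) = - (\<Sum>i<p. (bil G x (w i) / of_nat (q i)) *s w i)"
    unfolding sum_negf [symmetric] by (intro sum.cong refl) (use assms(2) in \<open>simp add: \<zeta>_def vec_eq_iff\<close>)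
  finally have "?t *s frame_point (bil G x v / ?t) (bil G x l / ?t) \<zeta> = x"
    unfolding f by (subst (5) expand [of x]) (simp add: add_ac)
  then show ?thesis by (intro that [of "bil G x l / ?t" \<zeta>]) simp
qed

lemma frame_point_continuous:
  assumes "continuous_on S \<tau>" "continuous_on S \<rho>" "\<And>i. continuous_on S (\<zeta> i)"
  shows "continuous_on S (\<lambda>t. frame_point (\<tau> t) (\<rho> t) (\<lambda>i. \<zeta> i t))"
  unfolding frame_point_def qform_def
  by (rule continuous_on_vec) (simp, intro continuous_intros assms, auto)

lemma height_frame_point: "height G e v (frame_point \<tau> \<rho> \<zeta>) = Im \<tau>"
  by (simp add: height_def frame_point_pairings)

lemma height_scale: "height G e v (t *s x) = (norm t)\<^sup>2 * height G e v x"
proof -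
  have "bil G (t *s x) v * cnj (bil G (t *s x) e) = (t * cnj t) * (bil G x v * cnj (bil G x e))"
    by (simp add: bil_scale_left)
  also have "t * cnj t = of_real ((norm t)\<^sup>2)" by (simp only: complex_norm_square)
  finally show ?thesis by (simp add: height_def)
qed

lemma domain_sign:
  assumes D: "D \<in> components (period_cone G)" and x: "x \<in> D" "y \<in> D"
  shows "height G e v x > 0 \<longleftrightarrow> height G e v y > 0"
proof -
  have sub: "D \<subseteq> period_cone G" by (rule in_components_subset [OF D])
  have "connected (height G e v ` D)"
    unfolding height_def
    by (intro connected_continuous_image in_components_connected [OF D] continuous_intros)
  moreover have "0 \<notin> height G e v ` D" using height_nonzero sub by force
  ultimately have "is_interval (height G e v ` D)" "0 \<notin> height G e v ` D" by (auto simp: is_interval_connected_1)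
  then show ?thesis
    using x unfolding is_interval_1 by (smt (verit) image_eqI)
qed

text \<open>
  The points with positive \<open>Im \<tau>\<close> can be joined to \<open>(\<tau>, \<rho>, \<zeta>) = (\<i>, \<i>, 0)\<close> inside the period cone, first
  contracting \<open>\<zeta>\<close> and then moving \<open>\<tau>\<close> and \<open>\<rho>\<close> on line segments.
\<close>

lemma domain_frame_point:
  assumes D: "D \<in> components (period_cone G)" and x0: "x0 \<in> D" "height G e v x0 > 0"
    and y: "0 < Im \<tau>" "(\<Sum>i<p. real (q i) * (Im (\<zeta> i))\<^sup>2) < 2 * Im \<tau> * Im \<rho>"
  shows "frame_point \<tau> \<rho> \<zeta> \<in> D"
proof -
  have base: "frame_point \<tau> \<rho> \<zeta> \<in> D \<longleftrightarrow> frame_point \<i> \<i> (\<lambda>_. 0) \<in> D"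
    if y: "0 < Im \<tau>" "(\<Sum>i<p. real (q i) * (Im (\<zeta> i))\<^sup>2) < 2 * Im \<tau> * Im \<rho>" for \<tau> \<rho> \<zeta>
  proof -
    have "(\<Sum>i<p. real (q i) * (Im (\<zeta> i))\<^sup>2) \<ge> 0" by (intro sum_nonneg) auto
    then have "0 < (2 * Im \<tau>) * Im \<rho>" using y by linarith
    then have \<rho>: "Im \<rho> > 0" using y(1) by (simp add: zero_less_mult_iff)
    have "frame_point \<tau> \<rho> (\<lambda>i. of_real (1 - 0) * \<zeta> i) \<in> D \<longleftrightarrow> frame_point \<tau> \<rho> (\<lambda>i. of_real (1 - 1) * \<zeta> i) \<in> D"
    proof (rule component_path [OF D, of "\<lambda>t. frame_point \<tau> \<rho> (\<lambda>i. of_real (1 - t) * \<zeta> i)"])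
      show "continuous_on {0..1} (\<lambda>t. frame_point \<tau> \<rho> (\<lambda>i. of_real (1 - t) * \<zeta> i))"
        by (intro frame_point_continuous continuous_intros)
      show "(\<lambda>t. frame_point \<tau> \<rho> (\<lambda>i. of_real (1 - t) * \<zeta> i)) ` {0..1} \<subseteq> period_cone G"
      proof clarify
        fix t :: real assume t: "t \<in> {0..1}"
        have "(\<Sum>i<p. real (q i) * (Im (of_real (1 - t) * \<zeta> i))\<^sup>2) \<le> (\<Sum>i<p. real (q i) * (Im (\<zeta> i))\<^sup>2)"
        proof (intro sum_mono mult_left_mono)
          fix i
          have "\<bar>Im (of_real (1 - t) * \<zeta> i)\<bar> \<le> \<bar>Im (\<zeta> i)\<bar>" using t by (simp add: abs_mult mult_left_le_one_le)
          then show "(Im (of_real (1 - t) * \<zeta> i))\<^sup>2 \<le> (Im (\<zeta> i))\<^sup>2" by (rule abs_le_square_iff [THEN iffD1])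
        qed auto
        then show "frame_point \<tau> \<rho> (\<lambda>i. of_real (1 - t) * \<zeta> i) \<in> period_cone G"
          unfolding frame_point_in_period_cone using y by linarith
      qed
    qed
    moreover have "frame_point (of_real (1 - 0) * \<tau> + of_real 0 * \<i>) (of_real (1 - 0) * \<rho> + of_real 0 * \<i>) (\<lambda>_. 0) \<in> D \<longleftrightarrow>
        frame_point (of_real (1 - 1) * \<tau> + of_real 1 * \<i>) (of_real (1 - 1) * \<rho> + of_real 1 * \<i>) (\<lambda>_. 0) \<in> D"
    proof (rule component_path [OF D, of "\<lambda>t. frame_point (of_real (1 - t) * \<tau> + of_real t * \<i>) (of_real (1 - t) * \<rho> + of_real t * \<i>) (\<lambda>_. 0)"])
      show "continuous_on {0..1} (\<lambda>t. frame_point (of_real (1 - t) * \<tau> + of_real t * \<i>) (of_real (1 - t) * \<rho> + of_real t * \<i>) (\<lambda>_. 0))"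
        by (intro frame_point_continuous continuous_intros)
      show "(\<lambda>t. frame_point (of_real (1 - t) * \<tau> + of_real t * \<i>) (of_real (1 - t) * \<rho> + of_real t * \<i>) (\<lambda>_. 0)) ` {0..1} \<subseteq> period_cone G"
      proof clarify
        fix t :: real assume t: "t \<in> {0..1}"
        have "0 < (1 - t) * s + t" if "s > 0" for s
          using that t by (cases "t = 1") (auto intro!: add_pos_nonneg)
        then show "frame_point (of_real (1 - t) * \<tau> + of_real t * \<i>) (of_real (1 - t) * \<rho> + of_real t * \<i>) (\<lambda>_. 0) \<in> period_cone G"
          unfolding frame_point_in_period_cone
          using mult_pos_pos [OF mult_pos_pos [OF zero_less_numeral
              \<open>\<And>s. s > 0 \<Longrightarrow> 0 < (1 - t) * s + t\<close> [OF y(1)]] \<open>\<And>s. s > 0 \<Longrightarrow> 0 < (1 - t) * s + t\<close> [OF \<rho>], of "num.Bit0 num.One"]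
          by simp
      qed
    qed
    ultimately show ?thesis by simp
  qed
  have x0S: "x0 \<in> period_cone G" using D x0 in_components_subset by blast
  have t0: "bil G x0 e \<noteq> 0" using x0 by (auto simp: height_def)
  obtain \<rho>0 \<zeta>0 where 0: "x0 = bil G x0 e *s frame_point (bil G x0 v / bil G x0 e) \<rho>0 \<zeta>0"
    by (rule period_cone_frame_point [OF x0S t0])
  have "inverse (bil G x0 e) *s x0 \<in> D" by (rule component_scale [OF D x0(1)]) (use t0 in simp)
  then have in0: "frame_point (bil G x0 v / bil G x0 e) \<rho>0 \<zeta>0 \<in> D"
    using t0 by (subst (asm) 0) (simp add: vector_smult_assoc)
  then have "frame_point (bil G x0 v / bil G x0 e) \<rho>0 \<zeta>0 \<in> period_cone G" using D in_components_subset by blast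
  moreover have "Im (bil G x0 v / bil G x0 e) > 0"
    using domain_sign [OF D x0(1) in0] x0(2) by (simp add: height_frame_point)
  ultimately have "frame_point \<i> \<i> (\<lambda>_. 0) \<in> D"
    using in0 by (intro base [THEN iffD1, OF _ _ in0]) (simp_all only: frame_point_in_period_cone)
  then show ?thesis by (rule base [OF y, THEN iffD2])
qed

lemma domain_iff:
  assumes D: "D \<in> components (period_cone G)" and x0: "x0 \<in> D" "height G e v x0 > 0"
  shows "x \<in> D \<longleftrightarrow> x \<in> period_cone G \<and> height G e v x > 0"
proof
  assume "x \<in> D"
  then show "x \<in> period_cone G \<and> height G e v x > 0"
    using D in_components_subset domain_sign [OF D x0(1), of x] x0(2) by blast
next
  assume x: "x \<in> period_cone G \<and> height G e v x > 0"
  then have t: "bil G x e \<noteq> 0" by (auto simp: height_def)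
  obtain \<rho> \<zeta> where eq: "x = bil G x e *s frame_point (bil G x v / bil G x e) \<rho> \<zeta>"
    using period_cone_frame_point [of x] x t by blast
  have h: "(norm (bil G x e))\<^sup>2 * Im (bil G x v / bil G x e) = height G e v x"
    by (subst (4) eq) (simp only: height_scale height_frame_point)
  then have "Im (bil G x v / bil G x e) > 0"
    using x t by (metis zero_less_mult_pos zero_less_norm_iff zero_less_power)
  moreover have "frame_point (bil G x v / bil G x e) \<rho> \<zeta> \<in> period_cone G"
  proof -
    have "Re (bil G x (conj_vec x)) = (norm (bil G x e))\<^sup>2 * Re (bil G (frame_point (bil G x v / bil G x e) \<rho> \<zeta>) (conj_vec (frame_point (bil G x v / bil G x e) \<rho> \<zeta>)))"
    proof -
      let ?y = "frame_point (bil G x v / bil G x e) \<rho> \<zeta>"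
      have "bil G x (conj_vec x) = bil G (bil G x e *s ?y) (conj_vec (bil G x e *s ?y))"
        using eq by simp
      also have "\<dots> = of_real ((norm (bil G x e))\<^sup>2) * bil G ?y (conj_vec ?y)"
        unfolding conj_vec_scale bil_scale_left bil_scale_right complex_norm_square by (simp only: mult_ac)
      finally show ?thesis by simp
    qed
    moreover have "bil G x x = (bil G x e)\<^sup>2 * bil G (frame_point (bil G x v / bil G x e) \<rho> \<zeta>) (frame_point (bil G x v / bil G x e) \<rho> \<zeta>)"
      by (subst (1 2) eq) (simp add: bil_scale_left bil_scale_right power2_eq_square)
    ultimately show ?thesis using x t by (auto simp: period_cone_def zero_less_mult_iff)
  qed
  ultimately have "frame_point (bil G x v / bil G x e) \<rho> \<zeta> \<in> D"
    by (intro domain_frame_point [OF D x0]) (auto simp: frame_point_in_period_cone)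
  then show "x \<in> D" by (subst eq) (rule component_scale [OF D _ t])
qed

end

section \<open>Leading coefficients under changes of trivialization\<close>

text \<open>
  Names of the vectors \<open>e, v, f, l, w i\<close> of a frame. The vectors \<open>e\<close> and \<open>f\<close> are orthogonal to \<open>V(I)\<close>, so only
  the indices \<open>SV\<close>, \<open>SL\<close> and \<open>SW i\<close> give nonzero coefficients of tensors over \<open>V(I)\<close>.
\<close>

datatype frame_index = SE | SV | SF | SL | SW nat

fun frame_vec :: "complex^'N \<Rightarrow> complex^'N \<Rightarrow> complex^'N \<Rightarrow> complex^'N \<Rightarrow> (nat \<Rightarrow> complex^'N) \<Rightarrow> frame_index \<Rightarrow> complex^'N" where
  "frame_vec e v f l w SE = e"
| "frame_vec e v f l w SV = v"
| "frame_vec e v f l w SF = f"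
| "frame_vec e v f l w SL = l"
| "frame_vec e v f l w (SW i) = w i"

text \<open>
  A pairing with \<open>l\<close> reads off the coordinate along \<open>v\<close>, and conversely. The weight is the exponent of the
  factor of automorphy by which the pairing transforms.
\<close>

fun frame_wt :: "frame_index \<Rightarrow> int" where
  "frame_wt SL = 1"
| "frame_wt SV = - 1"
| "frame_wt _ = 0"

definition frame_set :: "nat \<Rightarrow> frame_index set" where
  "frame_set p = {SE, SV, SF, SL} \<union> SW ` {..<p}"

lemma finite_frame_set [simp]: "finite (frame_set p)"
  by (simp add: frame_set_def)

lemma sum_frame_set: "(\<Sum>s\<in>frame_set p. F s) = F SE + F SV + F SF + F SL + (\<Sum>i<p. F (SW i))"
  for F :: "frame_index \<Rightarrow> 'a::comm_monoid_add"
proof -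
  have "(\<Sum>s\<in>frame_set p. F s) = sum F {SE, SV, SF, SL} + sum F (SW ` {..<p})"
    unfolding frame_set_def by (rule sum.union_disjoint) auto
  also have "sum F (SW ` {..<p}) = (\<Sum>i<p. F (SW i))"
    by (subst sum.reindex) (auto simp: inj_on_def)
  finally show ?thesis by (simp add: add.assoc)
qed

definition total_wt :: "nat \<Rightarrow> (nat \<Rightarrow> frame_index) \<Rightarrow> int" where
  "total_wt d \<sigma> = (\<Sum>k<d. frame_wt (\<sigma> k))"

context adapted_frame
begin

abbreviation V :: "frame_index \<Rightarrow> complex^'N" where
  "V \<equiv> frame_vec e v f l w"

text \<open>
  The coordinates of a vector in the frame.
\<close>

fun dcoord :: "complex^'N \<Rightarrow> frame_index \<Rightarrow> complex" where
  "dcoord y SE = bil G y f"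
| "dcoord y SV = bil G y l"
| "dcoord y SF = bil G y e"
| "dcoord y SL = bil G y v"
| "dcoord y (SW i) = - bil G y (w i) / of_nat (q i)"

lemma expand_frame: "y = (\<Sum>s\<in>frame_set p. dcoord y s *s V s)"
proof -
  have "(\<Sum>i<p. (bil G y (w i) / of_nat (q i)) *s w i) = - (\<Sum>i<p. (- bil G y (w i) / of_nat (q i)) *s w i)"
    unfolding sum_negf [symmetric] by (intro sum.cong refl) (simp add: vec_eq_iff)
  then show ?thesis unfolding sum_frame_set by (subst expand [of y]) (simp add: add_ac)
qed

fun dual_coeff :: "'N \<Rightarrow> frame_index \<Rightarrow> complex" where
  "dual_coeff j SE = f $ j"
| "dual_coeff j SV = l $ j"
| "dual_coeff j SF = e $ j"
| "dual_coeff j SL = v $ j"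
| "dual_coeff j (SW i) = - w i $ j / of_nat (q i)"

lemma component_frame: "x $ j = (\<Sum>s\<in>frame_set p. dual_coeff j s * bil G x (V s))"
  unfolding sum_frame_set by (subst expand [of x]) (simp add: sum_negf algebra_simps)

text \<open>
  If the vectors \<open>y k\<close> are triangular in the frame, with respect to the weight and with diagonal entries
  \<open>j powi frame_wt (\<sigma> k)\<close>, then every other term of the multilinear expansion has smaller weight or
  involves \<open>e\<close> or \<open>f\<close>.
\<close>

lemma leading_coeff:
  assumes \<sigma>: "\<And>k. k < d \<Longrightarrow> \<sigma> k \<in> frame_set p"
    and null: "\<And>\<sigma> k. \<sigma> \<in> PiE {..<d} (\<lambda>_. frame_set p) \<Longrightarrow> k < d \<Longrightarrow> \<sigma> k \<in> {SE, SF} \<Longrightarrow> tensor_coeff G d T (\<lambda>k. V (\<sigma> k)) = 0"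
    and low: "\<And>\<sigma>'. \<sigma>' \<in> PiE {..<d} (\<lambda>_. frame_set p) \<Longrightarrow> (\<And>k. k < d \<Longrightarrow> \<sigma>' k \<notin> {SE, SF}) \<Longrightarrow> total_wt d \<sigma>' < total_wt d \<sigma> \<Longrightarrow>
        tensor_coeff G d T (\<lambda>k. V (\<sigma>' k)) = 0"
    and diag: "\<And>k. k < d \<Longrightarrow> dcoord (y k) (\<sigma> k) = j powi frame_wt (\<sigma> k)"
    and tri: "\<And>k s. k < d \<Longrightarrow> s \<in> frame_set p \<Longrightarrow> dcoord (y k) s \<noteq> 0 \<Longrightarrow> s \<in> {SE, SF} \<or> s = \<sigma> k \<or> frame_wt s < frame_wt (\<sigma> k)"
    and j: "j \<noteq> 0"
  shows "tensor_coeff G d T y = j powi total_wt d \<sigma> * tensor_coeff G d T (\<lambda>k. V (\<sigma> k))"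
proof -
  define \<sigma>0 where "\<sigma>0 = restrict \<sigma> {..<d}"
  have \<sigma>0: "\<sigma>0 \<in> PiE {..<d} (\<lambda>_. frame_set p)" using \<sigma> by (auto simp: \<sigma>0_def)
  let ?t = "\<lambda>\<sigma>. (\<Prod>k<d. dcoord (y k) (\<sigma> k)) * tensor_coeff G d T (\<lambda>k. V (\<sigma> k))"
  have "tensor_coeff G d T y = (\<Sum>\<sigma>'\<in>PiE {..<d} (\<lambda>_. frame_set p). ?t \<sigma>')"
    by (rule tensor_coeff_expand) (auto intro: expand_frame)
  also have "\<dots> = (\<Sum>\<sigma>'\<in>{\<sigma>0}. ?t \<sigma>')"
  proof (rule sum.mono_neutral_right)
    show "finite (PiE {..<d} (\<lambda>_. frame_set p))" by (intro finite_PiE) auto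
    show "\<forall>\<sigma>'\<in>PiE {..<d} (\<lambda>_. frame_set p) - {\<sigma>0}. ?t \<sigma>' = 0"
    proof (intro ballI)
      fix \<sigma>' assume s: "\<sigma>' \<in> PiE {..<d} (\<lambda>_. frame_set p) - {\<sigma>0}"
      have mem: "\<sigma>' k \<in> frame_set p" if "k < d" for k using s that by auto
      consider k where "k < d" "dcoord (y k) (\<sigma>' k) = 0" | k where "k < d" "\<sigma>' k \<in> {SE, SF}"
        | "\<And>k. k < d \<Longrightarrow> dcoord (y k) (\<sigma>' k) \<noteq> 0 \<and> \<sigma>' k \<notin> {SE, SF}" by blast
      then show "?t \<sigma>' = 0"
      proof cases
        case 1 then show ?thesis by (auto intro: prod_zero)
      next
        case 2 then show ?thesis using null [of \<sigma>'] s by simp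
      next
        case 3
        have or: "\<sigma>' k = \<sigma> k \<or> frame_wt (\<sigma>' k) < frame_wt (\<sigma> k)" if "k < d" for k
          using tri [OF that mem [OF that]] 3 [OF that] by blast
        have "\<sigma>' \<noteq> \<sigma>0" using s by simp
        then obtain k where k: "k < d" "\<sigma>' k \<noteq> \<sigma> k"
          using s by (auto simp: \<sigma>0_def fun_eq_iff PiE_iff extensional_def split: if_splits)
        have "total_wt d \<sigma>' < total_wt d \<sigma>"
          unfolding total_wt_def
        proof (rule sum_strict_mono_ex1)
          show "\<forall>k\<in>{..<d}. frame_wt (\<sigma>' k) \<le> frame_wt (\<sigma> k)" using or by force
          show "\<exists>k\<in>{..<d}. frame_wt (\<sigma>' k) < frame_wt (\<sigma> k)" using or k by blast
        qed simp
        then have "tensor_coeff G d T (\<lambda>k. V (\<sigma>' k)) = 0" using s 3 by (intro low) auto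
        then show ?thesis by simp
      qed
    qed
  qed (use \<sigma>0 in auto)
  also have "\<dots> = ?t \<sigma>0" by simp
  also have "(\<Prod>k<d. dcoord (y k) (\<sigma>0 k)) = (\<Prod>k<d. j powi frame_wt (\<sigma> k))"
    by (intro prod.cong) (auto simp: \<sigma>0_def diag)
  also have "\<dots> = j powi total_wt d \<sigma>"
    unfolding total_wt_def using j by (induction d) (auto simp: power_int_add)
  also have "tensor_coeff G d T (\<lambda>k. V (\<sigma>0 k)) = tensor_coeff G d T (\<lambda>k. V (\<sigma> k))"
    by (rule tensor_coeff_cong) (simp add: \<sigma>0_def)
  finally show ?thesis .
qed

text \<open>
  The transposed map of the change of trivialization. On the right \<open>z\<close> is paired with a vector obtained
  from \<open>y'\<close> by first projecting along \<open>e'\<close> and then along \<open>x\<close>.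
\<close>

lemma trivialization_adjoint:
  assumes g: "\<And>x. bil G (g *v x) (gen c2) = bil G x e'" "\<And>x. bil G (g *v x) y2 = bil G x y'"
    and y2: "bil G (gen c2) y2 = 0" and c1: "gen c1 = e"
  shows "bil G (triv_E G c2 (g *v x) (g *v lift_E G c1 x z)) y2
     = bil G z ((y' - (bil G x y' / bil G x e') *s e')
         - (bil G e (y' - (bil G x y' / bil G x e') *s e') / bil G e x) *s x)"
  by (simp add: triv_E_def Let_def lift_E_def bil_linear y2 g c1 diff_divide_distrib add_divide_distrib algebra_simps)

text \<open>
  The frame of a rotated cusp, in terms of the given frame.
\<close>

fun rot_vec :: "complex \<Rightarrow> complex \<Rightarrow> complex \<Rightarrow> complex \<Rightarrow> frame_index \<Rightarrow> complex^'N" where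
  "rot_vec a b c d SE = a *s e + b *s v"
| "rot_vec a b c d SV = c *s e + d *s v"
| "rot_vec a b c d SF = d *s f - c *s l"
| "rot_vec a b c d SL = a *s l - b *s f"
| "rot_vec a b c d (SW i) = w i"

text \<open>
  The hypotheses \<open>g\<close> say that the adjoint of the isometry carries the frame of the target cusp to the frame
  rotated by the matrix. The adjoint \<open>Y s\<close> of the change of trivialization is computed for each frame vector
  and is triangular with diagonal entry \<open>j powi frame_wt s\<close>. With the factor \<open>j powi k\<close> from the line bundle
  \<open>\<L>\<^sup>k\<close>, multiplication by powers of \<open>omegaJ\<close> and of \<open>(x, e)\<close> turns the coefficient into a homogeneous
  function on the affine cone that agrees for the two trivializations.
\<close>

lemma transition_leading_coeff:
  assumes det: "a * d - b * c = 1"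
    and c1: "gen c1 = e"
    and g: "\<And>x s. s \<in> frame_set p \<Longrightarrow> bil G (g *v x) (frame_vec (gen c2) v2 (opp c2) (lvec c2) w s) = bil G x (rot_vec a b c d s)"
    and perp: "\<And>s. s \<in> frame_set p \<Longrightarrow> s \<noteq> SF \<Longrightarrow> bil G (gen c2) (frame_vec (gen c2) v2 (opp c2) (lvec c2) w s) = 0"
    and x: "bil G x e \<noteq> 0" "bil G x (a *s e + b *s v) \<noteq> 0"
    and \<sigma>: "\<And>i. i < sum_list lam \<Longrightarrow> \<sigma> i \<in> frame_set p" "\<And>i. i < sum_list lam \<Longrightarrow> \<sigma> i \<notin> {SE, SF}"
    and null: "\<And>\<sigma> i. \<sigma> \<in> PiE {..<sum_list lam} (\<lambda>_. frame_set p) \<Longrightarrow> i < sum_list lam \<Longrightarrow> \<sigma> i \<in> {SE, SF} \<Longrightarrow> tensor_coeff G (sum_list lam) T (\<lambda>i. V (\<sigma> i)) = 0"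
    and low: "\<And>\<sigma>'. \<sigma>' \<in> PiE {..<sum_list lam} (\<lambda>_. frame_set p) \<Longrightarrow> (\<And>i. i < sum_list lam \<Longrightarrow> \<sigma>' i \<notin> {SE, SF}) \<Longrightarrow>
        total_wt (sum_list lam) \<sigma>' < total_wt (sum_list lam) \<sigma> \<Longrightarrow> tensor_coeff G (sum_list lam) T (\<lambda>i. V (\<sigma>' i)) = 0"
  shows "tensor_coeff G (sum_list lam) (transition G lam k m c1 c2 g x T) (\<lambda>i. frame_vec (gen c2) v2 (opp c2) (lvec c2) w (\<sigma> i))
      * omegaJ G c2 (g *v x) ^ m * bil G (g *v x) (gen c2) powi (- (k + total_wt (sum_list lam) \<sigma>))
    = tensor_coeff G (sum_list lam) T (\<lambda>i. V (\<sigma> i)) * omegaJ G c1 x ^ m * bil G x e powi (- (k + total_wt (sum_list lam) \<sigma>))"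
proof -
  let ?d = "sum_list lam" and ?wt = "total_wt (sum_list lam) \<sigma>"
  let ?V2 = "frame_vec (gen c2) v2 (opp c2) (lvec c2) w"
  define e' where "e' = a *s e + b *s v"
  define \<tau> where "\<tau> = bil G x v / bil G x e"
  define j where "j = a + b * \<tau>"
  define Y where "Y s = (rot_vec a b c d s - (bil G x (rot_vec a b c d s) / bil G x e') *s e')
         - (bil G e (rot_vec a b c d s - (bil G x (rot_vec a b c d s) / bil G x e') *s e') / bil G e x) *s x" for s
  have xe': "bil G x e' = bil G x e * j"
    using x by (simp add: e'_def j_def \<tau>_def bil_linear field_simps)
  then have j0: "j \<noteq> 0" using x by (auto simp: e'_def)
  have xv: "bil G x v = \<tau> * bil G x e" using x by (simp add: \<tau>_def)
  have ge: "bil G (g *v z) (gen c2) = bil G z e'" for z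
    using g [of SE z] by (simp add: frame_set_def e'_def)
  have adj: "bil G (triv_E G c2 (g *v x) (g *v lift_E G c1 x z)) (?V2 (\<sigma> i)) = bil G z (Y (\<sigma> i))" if "i < ?d" for i z
    unfolding Y_def using that \<sigma> g perp by (intro trivialization_adjoint c1 ge) auto
  have ex: "bil G e x = bil G x e" by (rule bil_sym [OF sym])
  have YV: "Y SV = c *s e + d *s v - ((c + d * \<tau>) / j) *s e'"
  proof -
    have "bil G x (rot_vec a b c d SV) = bil G x e * (c + d * \<tau>)" by (simp add: bil_linear xv algebra_simps)
    then have r: "bil G x (rot_vec a b c d SV) / bil G x e' = (c + d * \<tau>) / j" using x by (simp add: xe')
    show ?thesis unfolding Y_def r by (simp add: bil_linear rels e'_def)
  qed
  have YW: "Y (SW i) = w i - (bil G x (w i) / (bil G x e * j)) *s e'" if "i < p" for i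
  proof -
    have "bil G e e' = 0" by (simp add: e'_def bil_linear rels)
    then show ?thesis unfolding Y_def using that by (simp add: bil_linear w_rels xe')
  qed
  \<comment> \<open>as \<open>e'\<close> is orthogonal to \<open>v\<close>, the coordinate along \<open>l\<close> is the same for every value of \<open>t\<close>\<close>
  obtain t where YL: "Y SL = a *s l - b *s f - t *s e' + (b / bil G x e) *s x"
    using x by (intro that [of "bil G x (rot_vec a b c d SL) / bil G x e'"]) (simp add: Y_def bil_linear rels ex e'_def)
  have e'p: "bil G e' e = 0" "bil G e' v = 0" "bil G e' f = a" "bil G e' l = b" "i < p \<Longrightarrow> bil G e' (w i) = 0" for i
    by (simp_all add: e'_def bil_linear rels w_rels)
  have dV: "dcoord (Y SV) SV = inverse j" "dcoord (Y SV) SL = 0" "i < p \<Longrightarrow> dcoord (Y SV) (SW i) = 0" for i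
  proof -
    have "dcoord (Y SV) SV = d - (c + d * \<tau>) / j * b" by (simp add: YV bil_linear rels e'p)
    also have "\<dots> = (a * d - b * c) / j" using j0 by (simp add: j_def field_simps)
    finally show "dcoord (Y SV) SV = inverse j" using det by (simp add: inverse_eq_divide)
  qed (simp_all add: YV bil_linear rels e'p w_rels)
  have dW: "dcoord (Y (SW i)) SL = 0" "r < p \<Longrightarrow> dcoord (Y (SW i)) (SW r) = (if r = i then 1 else 0)" if "i < p" for i r
    using that q_pos [of i] by (simp_all add: YW bil_linear w_rels e'p w_orthogonal)
  have dL: "dcoord (Y SL) SL = j"
    using x by (simp add: YL bil_linear rels e'p xv j_def)
  have "tensor_coeff G ?d (tensor_map ?d (\<lambda>z. triv_E G c2 (g *v x) (g *v lift_E G c1 x z)) T) (\<lambda>i. ?V2 (\<sigma> i))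
      = tensor_coeff G ?d T (\<lambda>i. Y (\<sigma> i))"
    by (rule tensor_coeff_tensor_map) (rule adj)
  also have "\<dots> = j powi ?wt * tensor_coeff G ?d T (\<lambda>i. V (\<sigma> i))"
  proof (rule leading_coeff [OF \<sigma>(1) null low _ _ j0])
    fix i assume i: "i < ?d"
    have mem: "\<sigma> i \<in> frame_set p" "\<sigma> i \<notin> {SE, SF}" using \<sigma> i by auto
    show "dcoord (Y (\<sigma> i)) (\<sigma> i) = j powi frame_wt (\<sigma> i)"
      using mem dV(1) dL dW(2) by (cases "\<sigma> i") (auto simp: frame_set_def power_int_minus)
    fix s assume s: "s \<in> frame_set p" "dcoord (Y (\<sigma> i)) s \<noteq> 0"
    show "s \<in> {SE, SF} \<or> s = \<sigma> i \<or> frame_wt s < frame_wt (\<sigma> i)"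
      using mem s dV(2,3) dW by (cases "\<sigma> i"; cases s) (auto simp: frame_set_def simp del: dcoord.simps split: if_splits)
  qed
  finally have main: "tensor_coeff G ?d (tensor_map ?d (\<lambda>z. triv_E G c2 (g *v x) (g *v lift_E G c1 x z)) T) (\<lambda>i. ?V2 (\<sigma> i))
     = j powi ?wt * tensor_coeff G ?d T (\<lambda>i. V (\<sigma> i))" .
  have gx: "bil G (g *v x) (gen c2) = bil G x e * j" by (simp add: ge xe')
  have om: "omegaJ G c2 (g *v x) \<noteq> 0" by (simp add: omegaJ_def)
  have "tensor_coeff G ?d (transition G lam k m c1 c2 g x T) (\<lambda>i. ?V2 (\<sigma> i))
     = j powi k * (omegaJ G c1 x / omegaJ G c2 (g *v x)) ^ m * (j powi ?wt * tensor_coeff G ?d T (\<lambda>i. V (\<sigma> i)))"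
    unfolding transition_def tensor_coeff_scale main gx c1 using x by simp
  also have "j powi k * (omegaJ G c1 x / omegaJ G c2 (g *v x)) ^ m * (j powi ?wt * tensor_coeff G ?d T (\<lambda>i. V (\<sigma> i)))
     = j powi (k + ?wt) * (omegaJ G c1 x / omegaJ G c2 (g *v x)) ^ m * tensor_coeff G ?d T (\<lambda>i. V (\<sigma> i))"
    using j0 by (simp add: power_int_add)
  finally have tc: "tensor_coeff G ?d (transition G lam k m c1 c2 g x T) (\<lambda>i. ?V2 (\<sigma> i))
     = j powi (k + ?wt) * (omegaJ G c1 x / omegaJ G c2 (g *v x)) ^ m * tensor_coeff G ?d T (\<lambda>i. V (\<sigma> i))" .
  have jj: "j powi (k + ?wt) * j powi (- (k + ?wt)) = 1"
    using j0 by (simp only: power_int_minus) (rule right_inverse, simp)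
  have omm: "(omegaJ G c1 x / omegaJ G c2 (g *v x)) ^ m * omegaJ G c2 (g *v x) ^ m = omegaJ G c1 x ^ m"
    using om by (simp add: power_divide)
  have "tensor_coeff G ?d (transition G lam k m c1 c2 g x T) (\<lambda>i. ?V2 (\<sigma> i)) * omegaJ G c2 (g *v x) ^ m
      * bil G (g *v x) (gen c2) powi (- (k + ?wt))
    = (j powi (k + ?wt) * j powi (- (k + ?wt))) * ((omegaJ G c1 x / omegaJ G c2 (g *v x)) ^ m * omegaJ G c2 (g *v x) ^ m)
       * (tensor_coeff G ?d T (\<lambda>i. V (\<sigma> i)) * bil G x e powi (- (k + ?wt)))"
    unfolding tc gx power_int_mult_distrib by (simp only: mult_ac)
  then show ?thesis unfolding jj omm by (simp only: mult_ac mult_1_left)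
qed

lemma omegaJ_eq:
  assumes "bil G (lvec c) (opp c) = 0" "bil G (lvec c) (gen c) = 0"
  shows "omegaJ G c x = ee (bil G x (lvec c) / bil G x (gen c))"
  using assms bil_sym [OF sym, of "lvec c" x]
  by (simp add: omegaJ_def ee_def tube_coord_def Let_def bil_linear)

end

section \<open>Rational spans and primitive vectors\<close>

lemma span_over_base: "x \<in> S \<Longrightarrow> 1 \<in> F \<Longrightarrow> x \<in> span_over F S"
  unfolding span_over_def by (intro CollectI exI [of _ "{x}"] exI [of _ "\<lambda>_. 1"]) auto

lemma span_over_scale:
  assumes "c \<in> F" "\<And>a b. a \<in> F \<Longrightarrow> b \<in> F \<Longrightarrow> a * b \<in> F" "x \<in> span_over F S"
  shows "c *s x \<in> span_over F S"
proof -
  obtain T k where T: "x = (\<Sum>y\<in>T. k y *s y)" "finite T" "T \<subseteq> S" "k ` T \<subseteq> F"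
    using assms(3) unfolding span_over_def by blast
  have "c *s x = (\<Sum>y\<in>T. (c * k y) *s y)"
    unfolding T(1) by (simp add: vec_eq_iff sum_distrib_left mult.assoc)
  then show ?thesis
    using T assms(1,2) unfolding span_over_def by (intro CollectI exI [of _ T] exI [of _ "\<lambda>y. c * k y"]) auto
qed

lemma span_over_add:
  assumes F: "0 \<in> F" "\<And>a b. a \<in> F \<Longrightarrow> b \<in> F \<Longrightarrow> a + b \<in> F" and x: "x \<in> span_over F S" "y \<in> span_over F S"
  shows "x + y \<in> span_over F S"
proof -
  obtain T k where T: "x = (\<Sum>y\<in>T. k y *s y)" "finite T" "T \<subseteq> S" "k ` T \<subseteq> F"
    using x(1) unfolding span_over_def by blast
  obtain T' k' where T': "y = (\<Sum>y\<in>T'. k' y *s y)" "finite T'" "T' \<subseteq> S" "k' ` T' \<subseteq> F"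
    using x(2) unfolding span_over_def by blast
  define h where "h z = (if z \<in> T then k z else 0) + (if z \<in> T' then k' z else 0)" for z
  have "x = (\<Sum>z\<in>T \<union> T'. (if z \<in> T then k z else 0) *s z)"
    unfolding T(1) using T(2) T'(2) by (intro sum.mono_neutral_cong_left) auto
  moreover have "y = (\<Sum>z\<in>T \<union> T'. (if z \<in> T' then k' z else 0) *s z)"
    unfolding T'(1) using T(2) T'(2) by (intro sum.mono_neutral_cong_left) auto
  ultimately have "x + y = (\<Sum>z\<in>T \<union> T'. h z *s z)"
    by (simp add: h_def sum.distrib [symmetric] vec_eq_iff distrib_right)
  moreover have "h ` (T \<union> T') \<subseteq> F"
    using T(4) T'(4) F(1) F(2) unfolding h_def by (intro image_subsetI F(2)) auto
  ultimately show ?thesis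
    using T T' unfolding span_over_def by (intro CollectI exI [of _ "T \<union> T'"] exI [of _ h]) auto
qed

lemma span_Rats_scale: "c \<in> \<rat> \<Longrightarrow> x \<in> span_over \<rat> S \<Longrightarrow> c *s x \<in> span_over \<rat> S"
  by (rule span_over_scale) auto

lemma span_Rats_add: "x \<in> span_over \<rat> S \<Longrightarrow> y \<in> span_over \<rat> S \<Longrightarrow> x + y \<in> span_over \<rat> S"
  by (rule span_over_add) auto

lemma bil_span_over_zero:
  assumes "\<And>y. y \<in> S \<Longrightarrow> bil G x y = 0" "z \<in> span_over F S"
  shows "bil G x z = 0"
proof -
  obtain T k where T: "z = (\<Sum>y\<in>T. k y *s y)" "T \<subseteq> S"
    using assms(2) unfolding span_over_def by blast
  have "bil G x y = 0" if "y \<in> T" for y using assms(1) T(2) that by blast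
  then show ?thesis unfolding T(1) bil_sum_right bil_scale_right by simp
qed

lemma span_over_rational:
  assumes "S \<subseteq> coords \<rat>" "z \<in> span_over \<rat> S"
  shows "z \<in> coords \<rat>"
proof -
  obtain T k where T: "z = (\<Sum>y\<in>T. k y *s y)" "T \<subseteq> S" "k ` T \<subseteq> \<rat>"
    using assms(2) unfolding span_over_def by blast
  then show ?thesis unfolding T(1) using assms(1) T by (intro coords_Rats_sum coords_Rats_scale) auto
qed

lemma span_Ints_integer_multiple:
  assumes J: "0 \<in> J" "\<And>x y. x \<in> J \<Longrightarrow> y \<in> J \<Longrightarrow> x - y \<in> J" and z: "z \<in> span_over \<rat> J"
  obtains D :: int where "D > 0" "of_int D *s z \<in> J"
proof -
  have neg: "- x \<in> J" if "x \<in> J" for x using J(2) [OF J(1) that] by simp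
  have add: "x + y \<in> J" if "x \<in> J" "y \<in> J" for x y using J(2) [OF that(1) neg [OF that(2)]] by simp
  have nat: "of_nat n *s x \<in> J" if "x \<in> J" for n x
  proof (induction n)
    case (Suc n)
    have "of_nat (Suc n) *s x = x + of_nat n *s x" by (simp add: vec_eq_iff distrib_right)
    then show ?case using add [OF that Suc] by simp
  qed (use J(1) in simp)
  have int: "of_int n *s x \<in> J" if "x \<in> J" for n x
  proof (cases "n \<ge> 0")
    case True then show ?thesis using nat [OF that, of "nat n"] by simp
  next
    case False
    then have "of_int n *s x = - (of_nat (nat (- n)) *s x)" by (simp add: vec_eq_iff)
    then show ?thesis using neg [OF nat [OF that, of "nat (- n)"]] by simp
  qed
  have sum: "sum h T \<in> J" if "finite T" "\<And>t. t \<in> T \<Longrightarrow> h t \<in> J" for T :: "(complex^'n) set" and h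
    using that by (induction T rule: finite_induct) (auto simp: J(1) add)
  obtain T k where T: "z = (\<Sum>y\<in>T. k y *s y)" "finite T" "T \<subseteq> J" "k ` T \<subseteq> \<rat>"
    using z unfolding span_over_def by blast
  obtain D :: int where D: "D > 0" "\<forall>x\<in>k ` T. of_int D * x \<in> \<int>"
    using common_denominator [of "k ` T"] T by auto
  have "of_int D *s z = (\<Sum>y\<in>T. (of_int D * k y) *s y)"
    unfolding T(1) by (simp add: vec_eq_iff sum_distrib_left mult.assoc)
  also have "\<dots> \<in> J"
  proof (rule sum [OF T(2)])
    fix y assume y: "y \<in> T"
    then have "of_int D * k y \<in> \<int>" using D(2) by blast
    then obtain a where "of_int D * k y = of_int a" by (rule Ints_cases)
    then show "(of_int D * k y) *s y \<in> J" using int T(3) y by auto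
  qed
  finally show ?thesis using that D(1) by blast
qed

text \<open>
  Among the integral multiples of \<open>u\<close>, one whose \<open>i\<close>-th coordinate has the least positive absolute value is
  primitive: an integral multiple by a noninteger \<open>s\<close> would give a smaller one by the fractional part of \<open>s\<close>.
\<close>

lemma exists_primitive_multiple:
  assumes u: "u \<in> coords \<rat>" "u \<noteq> 0"
  obtains t :: complex where "t \<in> \<rat>" "t \<noteq> 0" "t *s u \<in> coords \<int>"
    "\<And>s. s \<in> \<rat> \<Longrightarrow> s *s (t *s u) \<in> coords \<int> \<Longrightarrow> s \<in> \<int>"
proof -
  obtain i where i: "u $ i \<noteq> 0" using u(2) by (auto simp: vec_eq_iff)
  obtain D :: int where D: "D > 0" "of_int D *s u \<in> coords \<int>"
    using coords_common_denominator [OF u(1)] .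
  define A where "A = {n. n > 0 \<and> (\<exists>t\<in>\<rat>. t *s u \<in> coords \<int> \<and> norm (t * u $ i) = real n)}"
  have norm_nat: "\<exists>n. norm (z :: complex) = real n" if z: "z \<in> \<int>" for z
  proof -
    obtain a where "z = of_int a" using z by (rule Ints_cases)
    then show ?thesis by (intro exI [of _ "nat \<bar>a\<bar>"]) simp
  qed
  have inA: "\<exists>n\<in>A. norm (t * u $ i) = real n" if "t \<in> \<rat>" "t \<noteq> 0" "t *s u \<in> coords \<int>" for t
  proof -
    have "t * u $ i \<in> \<int>" using that(3) by (auto simp: coords_def)
    then obtain n where n: "norm (t * u $ i) = real n" using norm_nat by blast
    then have "n > 0" using i that(2) by (metis gr0I mult_eq_0_iff norm_eq_zero of_nat_0)
    then show ?thesis using n that by (auto simp: A_def)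
  qed
  have "A \<noteq> {}" using inA [of "of_int D"] D by auto
  then have LA: "(LEAST n. n \<in> A) \<in> A" by (meson LeastI_ex ex_in_conv)
  define n where "n = (LEAST n. n \<in> A)"
  obtain t where t: "t \<in> \<rat>" "t *s u \<in> coords \<int>" "norm (t * u $ i) = real n" "n > 0"
  proof -
    have "n \<in> A" using LA by (simp only: n_def)
    then show ?thesis using that unfolding A_def by blast
  qed
  show ?thesis
  proof (rule that [of t])
    show "t \<noteq> 0" using t by auto
    fix s assume s: "s \<in> \<rat>" "s *s (t *s u) \<in> coords \<int>"
    define r where "r = s - of_int \<lfloor>Re s\<rfloor>"
    have "s \<in> \<real>" using s(1) Rats_subset_Reals by blast
    then have sr: "s = of_real (Re s)" by simp
    have rr: "r = of_real (frac (Re s))" unfolding r_def frac_def by (subst sr) simp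
    show "s \<in> \<int>"
    proof (cases "r = 0")
      case True
      then have "s = of_int \<lfloor>Re s\<rfloor>" by (simp add: r_def)
      then show ?thesis by (metis Ints_of_int)
    next
      case False
      have "r *s (t *s u) = s *s (t *s u) - of_int \<lfloor>Re s\<rfloor> *s (t *s u)"
        by (simp add: r_def vec_eq_iff left_diff_distrib)
      then have "(r * t) *s u \<in> coords \<int>"
        using s(2) t(2) by (simp add: coords_def mult.assoc)
      then obtain n' where n': "n' \<in> A" "norm (r * t * u $ i) = real n'"
        using inA [of "r * t"] False t(1) s(1) \<open>t \<noteq> 0\<close> by (auto simp: r_def)
      have "norm (r * t * u $ i) = frac (Re s) * real n"
        using t(3) by (simp add: rr norm_mult mult.assoc)
      also have "\<dots> < real n" using t(4) frac_lt_1 [of "Re s"] by simp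
      finally have "n' < n" using n'(2) by simp
      then show ?thesis using not_less_Least [of n' "\<lambda>n. n \<in> A"] n'(1) by (simp add: n_def)
    qed
  qed (use t in auto)
qed

lemma primitive_isotropic_line:
  assumes x: "x \<in> coords \<int>" "x \<noteq> 0" "bil G x x = 0" and prim: "\<And>s. s \<in> \<rat> \<Longrightarrow> s *s x \<in> coords \<int> \<Longrightarrow> s \<in> \<int>"
  shows "primitive_isotropic G (span_over \<int> {x}) 1"
proof -
  have K: "span_over \<int> {x} = {of_int k *s x | k. True}"
  proof (intro equalityI subsetI)
    fix z assume "z \<in> span_over \<int> {x}"
    then obtain T c where T: "z = (\<Sum>y\<in>T. c y *s y)" "T \<subseteq> {x}" "c ` T \<subseteq> \<int>" unfolding span_over_def by blast
    then consider "T = {}" | "T = {x}" by blast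
    then show "z \<in> {of_int k *s x | k. True}"
    proof cases
      case 1 then show ?thesis using T by (auto intro: exI [of _ 0])
    next
      case 2
      then obtain k where "c x = of_int k" using T(3) by (auto elim: Ints_cases)
      then show ?thesis using T 2 by auto
    qed
  next
    fix z assume "z \<in> {of_int k *s x | k. True}"
    then obtain k where "z = of_int k *s x" by blast
    moreover have "x \<in> span_over \<int> {x}" by (rule span_over_base) auto
    ultimately show "z \<in> span_over \<int> {x}"
      using span_over_scale [of "of_int k" \<int> x "{x}"] by auto
  qed
  have dim: "vec.dim (span_over \<int> {x}) = 1"
  proof (rule vec.dim_unique [of "{x}"])
    show "{x} \<subseteq> span_over \<int> {x}" by (auto intro: span_over_base)
    show "span_over \<int> {x} \<subseteq> vec.span {x}" unfolding K by (auto intro: vec.span_scale vec.span_base)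
    show "vec.independent {x}" using x(2) by simp
  qed simp
  have prim': "z \<in> span_over \<int> {x}" if "z \<in> coords \<int>" "a \<noteq> 0" and az: "of_int a *s z \<in> span_over \<int> {x}" for z and a :: int
  proof -
    obtain k where k: "of_int a *s z = of_int k *s x" using az unfolding K by blast
    then have "of_int a * z $ i = of_int k * x $ i" for i by (simp add: vec_eq_iff)
    then have z: "z = (of_int k / of_int a) *s x" using that(2) by (simp add: vec_eq_iff field_simps)
    then have "of_int k / of_int a \<in> (\<int> :: complex set)" using that(1) by (intro prim) auto
    then obtain j where "complex_of_int k / of_int a = of_int j" by (rule Ints_cases)
    then show ?thesis unfolding K using z by auto
  qed
  have sub: "span_over \<int> {x} \<subseteq> coords \<int>" unfolding K using x(1) by (auto simp: coords_def)
  have zero: "0 \<in> span_over \<int> {x}" unfolding K by (auto intro: exI [of _ 0])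
  have diff: "y - z \<in> span_over \<int> {x}" if "y \<in> span_over \<int> {x}" "z \<in> span_over \<int> {x}" for y z
  proof -
    obtain k k' where "y = of_int k *s x" "z = of_int k' *s x" using \<open>y \<in> _\<close> \<open>z \<in> _\<close> unfolding K by blast
    then have "y - z = of_int (k - k') *s x" by (simp add: vec_eq_iff left_diff_distrib)
    then show ?thesis unfolding K by blast
  qed
  have iso: "bil G y z = 0" if "y \<in> span_over \<int> {x}" "z \<in> span_over \<int> {x}" for y z
    using that x(3) unfolding K by (auto simp: bil_linear)
  show ?thesis
    unfolding primitive_isotropic_def
  proof (intro conjI ballI allI impI)
    fix z and a :: int
    assume "z \<in> coords \<int>" "a \<noteq> 0" "of_int a *s z \<in> span_over \<int> {x}"
    then show "z \<in> span_over \<int> {x}" by (rule prim')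
  qed (fact sub zero dim | rule diff iso, assumption, assumption)+
qed

section \<open>The cusps in a given plane\<close>

lemma height_rotated:
  assumes "a \<in> \<rat>" "b \<in> \<rat>" "c \<in> \<rat>" "d \<in> \<rat>" "a * d - b * c = 1"
  shows "height G (a *s e + b *s v) (c *s e + d *s v) x = height G e v x"
proof -
  obtain a' b' c' d' where r: "a = of_real a'" "b = of_real b'" "c = of_real c'" "d = of_real d'"
    using assms Rats_subset_Reals by (metis Reals_cases subsetD)
  have det: "a' * d' - b' * c' = 1"
    using assms(5) unfolding r by (simp flip: of_real_mult of_real_diff)
  have "height G (a *s e + b *s v) (c *s e + d *s v) x = (a' * d' - b' * c') * height G e v x"
    unfolding height_def r by (simp add: bil_linear algebra_simps)
  then show ?thesis using det by simp
qed

lemma projJ_scale: "t \<noteq> 0 \<Longrightarrow> projJ J (t *s x) = projJ J x"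
proof -
  assume t: "t \<noteq> 0"
  have "vec.span (insert (t *s x) J) \<subseteq> vec.span (insert x J)"
    by (rule vec.span_minimal) (auto intro: vec.span_scale vec.span_base)
  moreover have "x \<in> vec.span (insert (t *s x) J)"
  proof -
    have "x = inverse t *s (t *s x)" using t by simp
    then show ?thesis by (metis insertI1 vec.span_base vec.span_scale)
  qed
  then have "vec.span (insert x J) \<subseteq> vec.span (insert (t *s x) J)"
    by (intro vec.span_minimal) (auto intro: vec.span_base)
  ultimately show ?thesis by (auto simp: projJ_def)
qed

context adapted_frame
begin

text \<open>
  The relations are preserved because the matrix and its contragredient act on dual bases.
\<close>

lemma rotated_frame:
  assumes r: "a \<in> \<rat>" "b \<in> \<rat>" "c \<in> \<rat>" "d \<in> \<rat>" and det: "a * d - b * c = 1"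
  shows "adapted_frame G (a *s e + b *s v) (c *s e + d *s v) (d *s f - c *s l) (a *s l - b *s f) w p q"
proof unfold_locales
  show "transpose G = G" by (rule sym)
  show "a *s e + b *s v \<in> coords \<rat>" "c *s e + d *s v \<in> coords \<rat>" "d *s f - c *s l \<in> coords \<rat>" "a *s l - b *s f \<in> coords \<rat>"
    using r rational by (auto intro!: coords_Rats_intros)
  have 1: "a * d - b * c = 1" "d * a - c * b = 1" using det by (auto simp: mult.commute)
  show "bil G (a *s e + b *s v) (d *s f - c *s l) = 1" "bil G (c *s e + d *s v) (a *s l - b *s f) = 1"
    using det by (simp_all add: bil_linear rels algebra_simps)
  show "hyperbolic.frame_perp G (a *s e + b *s v) (c *s e + d *s v) (d *s f - c *s l) (a *s l - b *s f) (w i)" if "i < p" for i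
  proof -
    have h: "hyperbolic G (a *s e + b *s v) (c *s e + d *s v) (d *s f - c *s l) (a *s l - b *s f)"
      using r rational det sym by unfold_locales (auto intro!: coords_Rats_intros simp: bil_linear rels algebra_simps)
    show ?thesis unfolding hyperbolic.frame_perp_def [OF h] using that by (simp add: bil_linear w_rels)
  qed
  show "x = bil G x (d *s f - c *s l) *s (a *s e + b *s v) + bil G x (a *s l - b *s f) *s (c *s e + d *s v)
      + bil G x (a *s e + b *s v) *s (d *s f - c *s l) + bil G x (c *s e + d *s v) *s (a *s l - b *s f)
      - (\<Sum>i<p. (bil G x (w i) / of_nat (q i)) *s w i)" for x
  proof -
    have "bil G x (d *s f - c *s l) *s (a *s e + b *s v) + bil G x (a *s l - b *s f) *s (c *s e + d *s v)
      + bil G x (a *s e + b *s v) *s (d *s f - c *s l) + bil G x (c *s e + d *s v) *s (a *s l - b *s f)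
      = (a * d - b * c) *s (bil G x f *s e + bil G x l *s v + bil G x e *s f + bil G x v *s l)"
      by (simp add: bil_linear vec_eq_iff algebra_simps)
    then show ?thesis using det expand [of x] by simp
  qed
qed (use w_rational w_orthogonal q_pos in \<open>simp_all add: bil_linear rels\<close>)

lemma tube_point_frame_point:
  assumes c: "gen c = e" "opp c = f" and z: "z \<in> VI G c"
  shows "tube_point G c z = frame_point (bil G z v) (bil G z l) (\<lambda>i. - bil G z (w i) / of_nat (q i))"
proof -
  let ?\<zeta> = "\<lambda>i. - bil G z (w i) / of_nat (q i)"
  have ze: "bil G z e = 0" "bil G z f = 0" using z c by (auto simp: VI_def)
  have Q: "qform p q ?\<zeta> = (\<Sum>i<p. bil G z (w i) * bil G z (w i) / of_nat (q i))"
    unfolding qform_def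
  proof (intro sum.cong refl)
    fix i assume "i \<in> {..<p}"
    then show "of_nat (q i) * (- bil G z (w i) / of_nat (q i))\<^sup>2 = bil G z (w i) * bil G z (w i) / of_nat (q i)"
      using q_pos [of i] by (simp add: power2_eq_square)
  qed
  have zz: "bil G z z = 2 * bil G z v * bil G z l - qform p q ?\<zeta>"
    unfolding Q by (subst bil_coords) (simp add: ze)
  have zx: "z = bil G z l *s v + bil G z v *s l + (\<Sum>i<p. ?\<zeta> i *s w i)"
  proof -
    have "(\<Sum>i<p. (bil G z (w i) / of_nat (q i)) *s w i) = - (\<Sum>i<p. ?\<zeta> i *s w i)"
      unfolding sum_negf [symmetric] by (intro sum.cong refl) (simp add: vec_eq_iff)
    then show ?thesis using expand [of z] ze by simp
  qed
  show ?thesis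
    unfolding tube_point_def c frame_point_def zz [symmetric] by (subst (1) zx) (simp add: algebra_simps)
qed

lemma frame_point_tube_point:
  assumes c: "gen c = e" "opp c = f"
  shows "\<tau> *s l + \<rho> *s v + (\<Sum>i<p. \<zeta> i *s w i) \<in> VI G c"
    "tube_point G c (\<tau> *s l + \<rho> *s v + (\<Sum>i<p. \<zeta> i *s w i)) = frame_point \<tau> \<rho> \<zeta>"
proof -
  let ?z = "\<tau> *s l + \<rho> *s v + (\<Sum>i<p. \<zeta> i *s w i)"
  show z: "?z \<in> VI G c" by (simp add: VI_def c bil_linear rels w_rels)
  have "- bil G ?z (w i) / of_nat (q i) = \<zeta> i" if "i < p" for i
    using that q_pos [OF that] by (simp add: bil_linear w_rels sum_w)
  then have e1: "(\<Sum>i<p. (- bil G ?z (w i) / of_nat (q i)) *s w i) = (\<Sum>i<p. \<zeta> i *s w i)"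
    "qform p q (\<lambda>i. - bil G ?z (w i) / of_nat (q i)) = qform p q \<zeta>"
    by (simp_all add: qform_def)
  have "bil G ?z v = \<tau>" "bil G ?z l = \<rho>" by (simp_all add: bil_linear rels w_rels)
  then show "tube_point G c ?z = frame_point \<tau> \<rho> \<zeta>"
    unfolding tube_point_frame_point [OF c z] by (simp only: frame_point_def e1)
qed

lemma v_in_closure_cone:
  assumes D: "D \<in> components (period_cone G)" and x0: "x0 \<in> D" "height G e v x0 > 0"
    and c: "gen c = e" "opp c = f"
  shows "v \<in> closure (cone_I G D c)"
proof -
  define h where "h \<epsilon> = v + complex_of_real \<epsilon> *s l" for \<epsilon>
  have real: "v $ i = of_real (Re (v $ i))" "l $ i = of_real (Re (l $ i))" for i
  proof -
    have "v \<in> coords \<real>" "l \<in> coords \<real>" using rational coords_mono [OF Rats_subset_Reals] by auto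
    then show "v $ i = of_real (Re (v $ i))" "l $ i = of_real (Re (l $ i))" by (auto simp: coords_def)
  qed
  have cone: "h \<epsilon> \<in> cone_I G D c" if "\<epsilon> > 0" for \<epsilon>
  proof -
    define z where "z = (\<i> * of_real \<epsilon>) *s l + \<i> *s v + (\<Sum>i<p. 0 *s w i)"
    have "frame_point (\<i> * of_real \<epsilon>) \<i> (\<lambda>_. 0) \<in> D"
      by (rule domain_frame_point [OF D x0]) (use that in auto)
    then have "z \<in> tube_domain G D c"
      unfolding tube_domain_def z_def using frame_point_tube_point [OF c, of "\<i> * of_real \<epsilon>" \<i> "\<lambda>_. 0"] by simp
    moreover have "(\<chi> i. complex_of_real (Im (z $ i))) = h \<epsilon>"
    proof -
      have "Im (z $ i) = \<epsilon> * Re (l $ i) + Re (v $ i)" for i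
        unfolding z_def by simp
      then have "complex_of_real (Im (z $ i)) = of_real \<epsilon> * of_real (Re (l $ i)) + of_real (Re (v $ i))" for i
        by simp
      then show ?thesis unfolding h_def by (simp add: vec_eq_iff real [symmetric])
    qed
    ultimately show ?thesis unfolding cone_I_def by (metis imageI)
  qed
  have "continuous_on UNIV h"
    unfolding h_def by (rule continuous_on_vec) (simp, intro continuous_intros)
  then have "(h \<longlongrightarrow> h 0) (at_right 0)"
    by (simp add: continuous_on_eq_continuous_within isCont_def) (meson tendsto_within_subset top_greatest)
  moreover have "\<forall>\<^sub>F \<epsilon> in at_right 0. h \<epsilon> \<in> closure (cone_I G D c)"
    using eventually_at_right_real [of 0 1, OF zero_less_one]
    by (rule eventually_mono) (use cone closure_subset in auto)
  ultimately have "h 0 \<in> closure (cone_I G D c)"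
    by (intro Lim_in_closed_set [OF closed_closure]) auto
  then show ?thesis by (simp add: h_def)
qed

text \<open>
  This recovers the choice of \<open>v\<close> among the two generators of \<open>U(J)_\<int>\<close> from the cone \<open>\<C>_I\<close>. If the height
  were negative on \<open>D\<close>, then \<open>Im \<rho> < 0\<close> on \<open>D\<close> and \<open>(_, l) \<le> 0\<close> on the closure of the cone, but \<open>(v, l) = 1\<close>.
\<close>

lemma positive_height_from_closure:
  assumes D: "D \<in> components (period_cone G)" and c: "gen c = e" "opp c = f"
    and v: "v \<in> closure (cone_I G D c)"
  shows "\<exists>x0\<in>D. height G e v x0 > 0"
proof (rule ccontr)
  assume no: "\<not> ?thesis"
  have real: "l $ i = of_real (Re (l $ i))" for i
  proof -
    have "l \<in> coords \<real>" using rational coords_mono [OF Rats_subset_Reals] by auto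
    then show ?thesis by (auto simp: coords_def)
  qed
  have neg: "Re (bil G y l) \<le> 0" if y: "y \<in> cone_I G D c" for y
  proof -
    obtain z where z: "z \<in> tube_domain G D c" "y = (\<chi> i. complex_of_real (Im (z $ i)))"
      using y unfolding cone_I_def by blast
    define \<tau> where "\<tau> = bil G z v"
    define \<rho> where "\<rho> = bil G z l"
    define \<zeta> where "\<zeta> i = - bil G z (w i) / of_nat (q i)" for i
    have zD: "frame_point \<tau> \<rho> \<zeta> \<in> D"
      using z(1) tube_point_frame_point [OF c] unfolding tube_domain_def \<tau>_def \<rho>_def \<zeta>_def by auto
    then have pc: "frame_point \<tau> \<rho> \<zeta> \<in> period_cone G" using D in_components_subset by blast
    have "Im \<tau> < 0"
      using no zD height_nonzero [OF pc] height_frame_point [of \<tau> \<rho> \<zeta>] by force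
    moreover have "(\<Sum>i<p. real (q i) * (Im (\<zeta> i))\<^sup>2) \<ge> 0" by (intro sum_nonneg) auto
    then have "0 < Im \<tau> * Im \<rho>" using pc unfolding frame_point_in_period_cone by simp
    ultimately have "Im \<rho> < 0" by (simp add: zero_less_mult_iff)
    moreover have "bil G y l = of_real (Im \<rho>)"
    proof -
      have "Im (z $ i * of_int (G $ i $ j) * l $ j) = Im (z $ i) * of_int (G $ i $ j) * Re (l $ j)" for i j
        by (subst real) simp
      then have "Im (\<Sum>i\<in>UNIV. \<Sum>j\<in>UNIV. z $ i * of_int (G $ i $ j) * l $ j)
          = (\<Sum>i\<in>UNIV. \<Sum>j\<in>UNIV. Im (z $ i) * of_int (G $ i $ j) * Re (l $ j))"
        by (simp only: Im_sum)
      moreover have "of_real (Im (z $ i)) * of_int (G $ i $ j) * l $ j = of_real (Im (z $ i) * of_int (G $ i $ j) * Re (l $ j))" for i j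
        by (subst real) simp
      ultimately show ?thesis
        unfolding \<rho>_def bil_def z(2) by (simp only: vec_lambda_beta of_real_sum)
    qed
    ultimately show ?thesis by simp
  qed
  have "closed {y. Re (bil G y l) \<le> 0}"
    by (intro closed_Collect_le continuous_intros)
  then have "closure (cone_I G D c) \<subseteq> {y. Re (bil G y l) \<le> 0}"
    using neg by (intro closure_minimal) auto
  then show False using v rels by auto
qed

end

text \<open>
  A reference cusp in \<open>J\<close>, given by its frame. The height condition says that \<open>v\<close> and not \<open>-v\<close> lies in the
  closure of the cone of the cusp.
\<close>

locale cusp_frame = adapted_frame G e v f l w p q
  for G :: "int^'N^'N" and e v f l :: "complex^'N" and w p q +
  fixes D J :: "(complex^'N) set" and Gam :: "(complex^'N^'N) set"
  assumes D: "D \<in> components (period_cone G)"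
    and J: "primitive_isotropic G J 2"
    and eJ: "e \<in> J" and vJ: "v \<in> span_over \<rat> J"
    and x0: "\<exists>x0\<in>D. height G e v x0 > 0"
    and UJ: "UJ_Z G Gam J = {translation G e (of_int s *s v) | s. True}"
    and sub: "subgroup Gam (Oplus G D)" and fin: "finite (rcosets\<^bsub>Oplus G D\<^esub> Gam)"
begin

lemma mem_D_iff: "x \<in> D \<longleftrightarrow> x \<in> period_cone G \<and> height G e v x > 0"
  using domain_iff [OF D] x0 by blast

lemma frame_point_mem_D_iff: "frame_point \<tau> \<rho> \<zeta> \<in> D \<longleftrightarrow> 0 < Im \<tau> \<and> (\<Sum>i<p. real (q i) * (Im (\<zeta> i))\<^sup>2) < 2 * Im \<tau> * Im \<rho>"
  unfolding mem_D_iff frame_point_in_period_cone height_frame_point by auto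

lemma J_subset: "J \<subseteq> coords \<int>" "J \<subseteq> coords \<rat>" "0 \<in> J" "x \<in> J \<Longrightarrow> y \<in> J \<Longrightarrow> x - y \<in> J" "x \<in> J \<Longrightarrow> y \<in> J \<Longrightarrow> bil G x y = 0"
proof -
  note J' = J [unfolded primitive_isotropic_def]
  show 1: "J \<subseteq> coords \<int>" using J' by (rule conjunct1)
  show "J \<subseteq> coords \<rat>" using 1 coords_mono [OF Ints_subset_Rats] by fast
  show "0 \<in> J" using J' by (elim conjE)
  have "\<forall>x\<in>J. \<forall>y\<in>J. x - y \<in> J" using J' by (elim conjE)
  then show "x \<in> J \<Longrightarrow> y \<in> J \<Longrightarrow> x - y \<in> J" by blast
  have "\<forall>x\<in>J. \<forall>y\<in>J. bil G x y = 0" using J' by (elim conjE)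
  then show "x \<in> J \<Longrightarrow> y \<in> J \<Longrightarrow> bil G x y = 0" by blast
qed

lemma eJQ: "e \<in> span_over \<rat> J"
  using eJ by (rule span_over_base) simp

text \<open>
  An element of \<open>J_\<rat>\<close> is isotropic and orthogonal to \<open>e\<close> and \<open>v\<close>, so its component in the definite space
  spanned by the \<open>w i\<close> is isotropic, hence zero.
\<close>

lemma span_J: "x \<in> span_over \<rat> J \<longleftrightarrow> (\<exists>a\<in>\<rat>. \<exists>b\<in>\<rat>. x = a *s e + b *s v)"
proof
  assume x: "x \<in> span_over \<rat> J"
  have iso: "bil G y z = 0" if "y \<in> span_over \<rat> J" "z \<in> span_over \<rat> J" for y z
  proof -
    have "bil G y z' = 0" if "z' \<in> J" for z'
      using bil_span_over_zero [of J G z' y \<rat>] J_subset(5) that \<open>y \<in> _\<close> bil_sym [OF sym, of y z'] by auto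
    then show ?thesis using bil_span_over_zero \<open>z \<in> _\<close> by blast
  qed
  have xr: "x \<in> coords \<rat>" by (rule span_over_rational [OF J_subset(2) x])
  have xx: "bil G x e = 0" "bil G x v = 0" "bil G x x = 0" using iso x eJQ vJ by auto
  have sq: "bil G x (w i) * bil G x (w i) / of_nat (q i) = of_real ((Re (bil G x (w i)))\<^sup>2 / real (q i))" if "i < p" for i
  proof -
    have "bil G x (w i) \<in> \<real>" using bil_in_Rats [OF xr w_rational [OF that]] Rats_subset_Reals by blast
    then have "bil G x (w i) = of_real (Re (bil G x (w i)))" by simp
    then show ?thesis by (metis of_real_divide of_real_mult of_real_of_nat_eq power2_eq_square)
  qed
  have "(\<Sum>i<p. bil G x (w i) * bil G x (w i) / of_nat (q i)) = 0"
    using bil_coords [of x x] xx by simp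
  then have "complex_of_real (\<Sum>i<p. (Re (bil G x (w i)))\<^sup>2 / real (q i)) = 0"
    unfolding of_real_sum by (subst sum.cong [OF refl sq [symmetric]]) auto
  then have "(\<Sum>i<p. (Re (bil G x (w i)))\<^sup>2 / real (q i)) = 0" by (simp only: of_real_eq_0_iff)
  then have z: "(Re (bil G x (w i)))\<^sup>2 / real (q i) = 0" if "i < p" for i
    using that by (subst (asm) sum_nonneg_eq_0_iff) auto
  have "bil G x (w i) = 0" if "i < p" for i
  proof -
    have "bil G x (w i) \<in> \<real>" using bil_in_Rats [OF xr w_rational [OF that]] Rats_subset_Reals by blast
    then show ?thesis using z [OF that] q_pos [OF that] by (auto simp: complex_is_Real_iff complex_eq_iff)
  qed
  then have "x = bil G x f *s e + bil G x l *s v" using expand [of x] xx by simp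
  then show "\<exists>a\<in>\<rat>. \<exists>b\<in>\<rat>. x = a *s e + b *s v"
    using bil_in_Rats [OF xr] rational by blast
next
  assume "\<exists>a\<in>\<rat>. \<exists>b\<in>\<rat>. x = a *s e + b *s v"
  then show "x \<in> span_over \<rat> J" using eJQ vJ by (auto intro!: span_Rats_add span_Rats_scale)
qed

text \<open>
  The translation attached to \<open>v \<otimes> e\<close> depends on the bivector \<open>e \<wedge> v\<close> only, so all cusps in \<open>J\<close> yield the same
  generator of \<open>U(J)_\<int>\<close>.
\<close>

lemma translation_rotated:
  assumes "a * d - b * c = 1"
  shows "translation G (a *s e + b *s v) (t *s (c *s e + d *s v)) = translation G e (t *s v)"
proof -
  have tr: "x - bil G (t *s (c *s e + d *s v)) x *s (a *s e + b *s v) + bil G (a *s e + b *s v) x *s (t *s (c *s e + d *s v))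
      - (bil G (t *s (c *s e + d *s v)) (t *s (c *s e + d *s v)) / 2 * bil G (a *s e + b *s v) x) *s (a *s e + b *s v)
     = x - ((a * d - b * c) * bil G (t *s v) x) *s e + ((a * d - b * c) * bil G e x) *s (t *s v) - (bil G (t *s v) (t *s v) / 2 * bil G e x) *s e" for x
    by (simp add: bil_linear rels vec_eq_iff algebra_simps)
  show ?thesis
    unfolding translation_def by (intro arg_cong [where f = matrix] ext) (simp only: tr assms mult_1_left)
qed

lemma cusp_rotated:
  assumes r: "a \<in> \<rat>" "b \<in> \<rat>" "c \<in> \<rat>" "d \<in> \<rat>" and det: "a * d - b * c = 1"
    and int: "a *s e + b *s v \<in> coords \<int>" and prim: "\<And>s. s \<in> \<rat> \<Longrightarrow> s *s (a *s e + b *s v) \<in> coords \<int> \<Longrightarrow> s \<in> \<int>"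
  shows "\<lparr>gen = a *s e + b *s v, opp = d *s f - c *s l, lvec = a *s l - b *s f\<rparr> \<in> cusps G D Gam J"
proof -
  let ?e = "a *s e + b *s v" and ?v = "c *s e + d *s v" and ?f = "d *s f - c *s l" and ?l = "a *s l - b *s f"
  let ?c = "\<lparr>gen = ?e, opp = ?f, lvec = ?l\<rparr>"
  interpret R: adapted_frame G ?e ?v ?f ?l w p q by (rule rotated_frame [OF r det])
  have eJ': "?e \<in> span_over \<rat> J" using span_J r by blast
  obtain k :: int where k: "k > 0" "of_int k *s ?e \<in> J"
    by (rule span_Ints_integer_multiple [OF J_subset(3,4) eJ'])
  have "?e \<in> J"
    using J int k unfolding primitive_isotropic_def by (metis less_irrefl)
  moreover have "?e \<noteq> 0" using R.relations(3) by auto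
  then have "primitive_isotropic G (span_over \<int> {?e}) 1"
    by (intro primitive_isotropic_line int prim R.relations)
  moreover have "is_vJ G D Gam J ?c ?v"
    unfolding is_vJ_def
  proof (intro conjI)
    show "?v \<in> UJ_line G J ?c"
      using r span_J by (auto simp: UJ_line_def VI_def R.rels)
    show "UJ_Z G Gam J = {translation G (gen ?c) (of_int s *s ?v) | s. True}"
      unfolding UJ cusp.select_convs translation_rotated [OF det] ..
    obtain x0 where "x0 \<in> D" "height G e v x0 > 0" using x0 by blast
    then show "?v \<in> closure (cone_I G D ?c)"
      by (intro R.v_in_closure_cone [OF D, of x0]) (simp_all add: height_rotated [OF r det])
  qed
  ultimately show ?thesis
    using R.rational R.rels unfolding cusps_def by (auto simp: VI_def)
qed

end

section \<open>Finitely many transforms\<close>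

lemma rotation_determinant:
  "wedge (\<alpha> *s (a *s e + b *s v) + \<beta> *s (c *s e + d *s v)) (\<gamma> *s (a *s e + b *s v) + \<delta> *s (c *s e + d *s v))
    = (\<chi> i j. (a * d - b * c) * (wedge (\<alpha> *s e + \<beta> *s v) (\<gamma> *s e + \<delta> *s v) $ i $ j))"
  by (simp add: wedge_def vec_eq_iff algebra_simps)

context adapted_frame
begin

lemma rotm_isometry:
  assumes "a * d - b * c = (1::int)"
  shows "bil G (rotm a b c d *v x) (rotm a b c d *v y) = bil G x y"
proof -
  have "complex_of_int a * of_int d - of_int b * of_int c = 1"
    using assms by (metis of_int_1 of_int_diff of_int_mult)
  then show ?thesis unfolding rotm_works by (rule rot_isometry)
qed

lemma rotm_inverse:
  assumes "a * d - b * c = (1::int)"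
  shows "rotm a b c d ** rotm d (- b) (- c) a = mat 1" "rotm d (- b) (- c) a ** rotm a b c d = mat 1"
  unfolding rotm_mult using assms by (simp_all add: rotm_id [symmetric] algebra_simps)

text \<open>
  The entries of the rotation minus the identity are integral combinations of \<open>a - 1, b, c, d - 1\<close> with
  coefficients from a finite set of rational numbers, whose common denominator is \<open>M\<close>.
\<close>

lemma rotm_congruence_integral:
  obtains M :: int where "M > 0"
    "\<And>a b c d i j. M dvd a - 1 \<Longrightarrow> M dvd b \<Longrightarrow> M dvd c \<Longrightarrow> M dvd d - 1 \<Longrightarrow> rotm a b c d $ i $ j \<in> \<int>"
proof -
  define X where "X = (\<lambda>(j, y, z, i). bil G (axis j 1) y * z $ i) ` (UNIV \<times> {e, v, f, l} \<times> {e, v, f, l} \<times> UNIV)"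
  have "finite X" unfolding X_def by (intro finite_imageI finite_cartesian_product) auto
  moreover have "X \<subseteq> \<rat>"
    unfolding X_def using rational by (auto intro!: Rats_mult bil_in_Rats coords_Rats_axis) (auto simp: coords_def)
  ultimately obtain M :: int where M: "M > 0" "\<forall>x\<in>X. of_int M * x \<in> \<int>" using common_denominator by blast
  have int: "of_int t * (bil G (axis j 1) y * z $ i) \<in> \<int>" if "M dvd t" "y \<in> {e, v, f, l}" "z \<in> {e, v, f, l}" for t j y z i
  proof -
    obtain s where "t = M * s" using \<open>M dvd t\<close> by blast
    moreover have "of_int M * (bil G (axis j 1) y * z $ i) \<in> \<int>"
      using M(2) that unfolding X_def by force
    ultimately show ?thesis by (simp add: mult.assoc mult.left_commute [of "of_int M"])
  qed
  have "rotm a b c d $ i $ j \<in> \<int>" if dv: "M dvd a - 1" "M dvd b" "M dvd c" "M dvd d - 1" for a b c d i j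
  proof -
    have "rotm a b c d $ i $ j = (rotm a b c d *v axis j 1) $ i"
      by (simp add: matrix_vector_mult_def axis_def if_distrib [of "\<lambda>x. _ * x"] cong: if_cong)
    also have "\<dots> = (if i = j then 1 else 0)
        + of_int (a - 1) * (bil G (axis j 1) f * e $ i) + of_int b * (bil G (axis j 1) f * v $ i)
        + of_int c * (bil G (axis j 1) l * e $ i) + of_int (d - 1) * (bil G (axis j 1) l * v $ i)
        + of_int (d - 1) * (bil G (axis j 1) e * f $ i) - of_int c * (bil G (axis j 1) e * l $ i)
        + of_int (a - 1) * (bil G (axis j 1) v * l $ i) - of_int b * (bil G (axis j 1) v * f $ i)"
      by (simp add: rotm_works rot_def axis_def algebra_simps)
    also have "\<dots> \<in> \<int>"
      by (intro Ints_add Ints_diff int dv) auto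
    finally show ?thesis .
  qed
  then show ?thesis using that M(1) by blast
qed

lemma rotm_height:
  assumes det: "a * d - b * c = (1::int)"
  shows "height G e v (rotm a b c d *v x) = height G e v x"
proof -
  have "real_of_int a * of_int d - of_int b * of_int c = 1"
    using det by (metis of_int_1 of_int_diff of_int_mult)
  moreover have "height G e v (rotm a b c d *v x) = (real_of_int a * of_int d - of_int b * of_int c) * height G e v x"
    by (simp add: height_def rotm_works rot_pairings algebra_simps)
  ultimately show ?thesis by simp
qed

lemma rotm_period_cone:
  assumes det: "a * d - b * c = (1::int)" and x: "x \<in> period_cone G"
  shows "rotm a b c d *v x \<in> period_cone G"
proof -
  have "conj_vec (rotm a b c d *v x) = rotm a b c d *v conj_vec x"
    by (simp add: rotm_works rot_def conj_vec_add conj_vec_scale bil_conj_frame conj_frame)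
       (simp add: conj_vec_def vec_eq_iff conj_frame [unfolded conj_vec_def vec_eq_iff, simplified])
  then show ?thesis using x by (simp add: period_cone_def rotm_isometry [OF det])
qed

end

context cusp_frame
begin

lemma rotm_domain:
  assumes det: "a * d - b * c = (1::int)"
  shows "(\<lambda>x. rotm a b c d *v x) ` D = D"
proof
  have sub: "rotm a b c d *v x \<in> D" if "x \<in> D" "a * d - b * c = (1::int)" for a b c d x
    using that rotm_period_cone rotm_height unfolding mem_D_iff by metis
  show "(\<lambda>x. rotm a b c d *v x) ` D \<subseteq> D" using sub det by blast
  show "D \<subseteq> (\<lambda>x. rotm a b c d *v x) ` D"
  proof
    fix x assume x: "x \<in> D"
    have "rotm d (- b) (- c) a *v x \<in> D" using sub [OF x, of d a "- b" "- c"] det by (simp add: mult.commute)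
    moreover have "rotm a b c d *v (rotm d (- b) (- c) a *v x) = x"
      by (simp add: matrix_vector_mul_assoc rotm_inverse [OF det])
    ultimately show "x \<in> (\<lambda>x. rotm a b c d *v x) ` D" by (metis imageI)
  qed
qed

text \<open>
  Rotations act on \<open>J\<close> with determinant \<open>1\<close> and fix the vectors \<open>w i\<close>, which represent a basis of \<open>J\<^sup>\<perp>/J\<close>.
\<close>

lemma rotm_GamJ:
  assumes det: "a * d - b * c = (1::int)" and int: "\<And>i j. rotm a b c d $ i $ j \<in> \<int>"
  shows "rotm a b c d \<in> GamJ G J \<rat>"
proof -
  let ?g = "rotm a b c d"
  have iso: "?g \<in> isometries G \<rat>"
    unfolding isometries_def using int Ints_subset_Rats rotm_isometry [OF det] by blast
  have comb: "?g *v (\<alpha> *s e + \<beta> *s v) = \<alpha> *s (of_int a *s e + of_int b *s v) + \<beta> *s (of_int c *s e + of_int d *s v)" for \<alpha> \<beta>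
    by (simp only: rotm_works rot_linear rot_frame)
  have sub: "rotm a b c d *v x \<in> span_over \<rat> J" if x: "x \<in> span_over \<rat> J" for a b c d x
  proof -
    obtain \<alpha> \<beta> where ab: "\<alpha> \<in> \<rat>" "\<beta> \<in> \<rat>" "x = \<alpha> *s e + \<beta> *s v" using x span_J by blast
    have "rotm a b c d *v x = (\<alpha> * of_int a + \<beta> * of_int c) *s e + (\<alpha> * of_int b + \<beta> * of_int d) *s v"
      unfolding ab rotm_works rot_linear rot_frame by (simp add: vec_eq_iff algebra_simps)
    moreover have "\<dots> \<in> span_over \<rat> J"
      by (intro span_Rats_add span_Rats_scale eJQ vJ) (use ab in auto)
    ultimately show ?thesis by (simp only:)
  qed
  have "(\<lambda>x. ?g *v x) ` span_over \<rat> J = span_over \<rat> J"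
  proof
    show "(\<lambda>x. ?g *v x) ` span_over \<rat> J \<subseteq> span_over \<rat> J" using sub by blast
    show "span_over \<rat> J \<subseteq> (\<lambda>x. ?g *v x) ` span_over \<rat> J"
    proof
      fix x assume x: "x \<in> span_over \<rat> J"
      have "?g *v (rotm d (- b) (- c) a *v x) = x"
        by (simp add: matrix_vector_mul_assoc rotm_inverse [OF det])
      then show "x \<in> (\<lambda>x. ?g *v x) ` span_over \<rat> J" using sub [OF x] by (metis imageI)
    qed
  qed
  moreover have "wedge (?g *v x) (?g *v y) = wedge x y" if x: "x \<in> span_over \<rat> J" and y: "y \<in> span_over \<rat> J" for x y
  proof -
    obtain \<alpha> \<beta> where 1: "x = \<alpha> *s e + \<beta> *s v" using x span_J by blast
    obtain \<gamma> \<delta> where 2: "y = \<gamma> *s e + \<delta> *s v" using y span_J by blast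
    have "complex_of_int a * of_int d - of_int b * of_int c = 1"
      using det by (metis of_int_1 of_int_diff of_int_mult)
    then show ?thesis unfolding 1 2 comb rotation_determinant by simp
  qed
  moreover have "?g *v x - x \<in> span_over \<rat> J" if x: "x \<in> perp G \<rat> J" for x
  proof -
    have xr: "x \<in> coords \<rat>" using x by (simp add: perp_def)
    have z: "\<And>y. y \<in> J \<Longrightarrow> bil G x y = 0" using x by (simp add: perp_def)
    have "bil G x e = 0" "bil G x v = 0"
      using z eJ bil_span_over_zero [OF z vJ] by auto
    then have "?g *v x - x = (bil G x f * (of_int a - 1) + bil G x l * of_int c) *s e + (bil G x f * of_int b + bil G x l * (of_int d - 1)) *s v"
      by (simp add: rotm_works rot_def vec_eq_iff algebra_simps)
    moreover have "\<dots> \<in> span_over \<rat> J"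
      by (intro span_Rats_add span_Rats_scale eJQ vJ) (use bil_in_Rats [OF xr] rational in auto)
    ultimately show ?thesis by (simp only:)
  qed
  ultimately show ?thesis using iso unfolding GamJ_def by blast
qed

text \<open>
  The rotations need not be integral, so the group \<open>SL_2(\<int>)\<close> does not act on \<open>L\<close>. Two matrices that are
  congruent modulo the denominator \<open>M\<close> differ by an integral rotation, an element of \<open>O\<^sup>+(L)\<close>. Each congruence
  class modulo \<open>M\<close> is thus identified with a subset of \<open>O\<^sup>+(L)\<close> by means of a chosen element, and is
  divided into finitely many parts according to the cosets of \<open>\<Gamma>\<close>. One matrix from every nonempty part
  suffices.
\<close>

lemma finite_representatives:
  obtains Rs :: "(int \<times> int \<times> int \<times> int) set" where "finite Rs"
    "\<And>a b c d. (a, b, c, d) \<in> Rs \<Longrightarrow> a * d - b * c = 1"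
    "\<And>a b c d. a * d - b * c = 1 \<Longrightarrow> \<exists>(a', b', c', d')\<in>Rs. rotm a' b' c' d' ** rotm d (- b) (- c) a \<in> GamJ_Z G Gam J"
proof -
  obtain M :: int where M: "M > 0"
    "\<And>a b c d i j. M dvd a - 1 \<Longrightarrow> M dvd b \<Longrightarrow> M dvd c \<Longrightarrow> M dvd d - 1 \<Longrightarrow> rotm a b c d $ i $ j \<in> \<int>"
    by (rule rotm_congruence_integral) blast
  define SL where "SL = {(a, b, c, d). a * d - b * c = (1::int)}"
  define red where "red = (\<lambda>(a, b, c, d). (a mod M, b mod M, c mod M, d mod M))"
  define rep where "rep k = (SOME \<gamma>. \<gamma> \<in> SL \<and> red \<gamma> = k)" for k
  define mt where "mt = (\<lambda>(a, b, c, d). rotm a b c d)"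
  define mi where "mi = (\<lambda>(a, b, c, d). rotm d (- b) (- c) a)"
  have rep: "rep (red \<gamma>) \<in> SL \<and> red (rep (red \<gamma>)) = red \<gamma>" if "\<gamma> \<in> SL" for \<gamma>
    unfolding rep_def by (rule someI [where x = \<gamma>]) (use that in simp)
  have quot: "mt \<gamma> ** mi \<delta> \<in> carrier (Oplus G D) \<and> mt \<gamma> ** mi \<delta> \<in> GamJ G J \<rat>"
    if "\<gamma> \<in> SL" "\<delta> \<in> SL" "red \<gamma> = red \<delta>" for \<gamma> \<delta>
  proof -
    obtain a b c d where g: "\<gamma> = (a, b, c, d)" by (cases \<gamma>) auto
    obtain a' b' c' d' where h: "\<delta> = (a', b', c', d')" by (cases \<delta>) auto
    have det: "a * d - b * c = 1" "a' * d' - b' * c' = 1" using that by (auto simp: SL_def g h)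
    have dv: "M dvd a - a'" "M dvd b - b'" "M dvd c - c'" "M dvd d - d'"
      using that(3) by (auto simp: red_def g h mod_eq_dvd_iff)
    define A where "A = d' * a + (- b') * c"
    define B where "B = d' * b + (- b') * d"
    define C where "C = (- c') * a + a' * c"
    define E where "E = (- c') * b + a' * d"
    have eq: "mt \<gamma> ** mi \<delta> = rotm A B C E"
      by (simp add: mt_def mi_def g h rotm_mult A_def B_def C_def E_def)
    have det': "A * E - B * C = 1"
    proof -
      have "A * E - B * C = (a * d - b * c) * (a' * d' - b' * c')" by (simp add: A_def B_def C_def E_def algebra_simps)
      then show ?thesis using det by simp
    qed
    have "A - 1 = d' * (a - a') - b' * (c - c')" "B = d' * (b - b') - b' * (d - d')"
      "C = a' * (c - c') - c' * (a - a')" "E - 1 = a' * (d - d') - c' * (b - b')"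
      using det(2) by (simp_all add: A_def B_def C_def E_def algebra_simps)
    then have int: "rotm A B C E $ i $ j \<in> \<int>" for i j
      using dv by (intro M(2)) (auto intro!: dvd_diff dvd_mult)
    have "rotm A B C E \<in> carrier (Oplus G D)"
      unfolding Oplus_def isometries_def using int rotm_isometry [OF det'] rotm_domain [OF det'] by auto
    then show ?thesis unfolding eq using rotm_GamJ [OF det' int] by blast
  qed
  \<comment> \<open>the congruence class, and the coset of the quotient by the chosen element of the class\<close>
  define key where "key \<gamma> = (red \<gamma>, Gam #>\<^bsub>Oplus G D\<^esub> (mt \<gamma> ** mi (rep (red \<gamma>))))" for \<gamma>
  have "key ` SL \<subseteq> ({0..<M} \<times> {0..<M} \<times> {0..<M} \<times> {0..<M}) \<times> (rcosets\<^bsub>Oplus G D\<^esub> Gam)"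
  proof (rule image_subsetI)
    fix \<gamma> assume g: "\<gamma> \<in> SL"
    have "mt \<gamma> ** mi (rep (red \<gamma>)) \<in> carrier (Oplus G D)" using quot g rep [OF g] by metis
    then have "Gam #>\<^bsub>Oplus G D\<^esub> (mt \<gamma> ** mi (rep (red \<gamma>))) \<in> rcosets\<^bsub>Oplus G D\<^esub> Gam"
      unfolding RCOSETS_def by blast
    then show "key \<gamma> \<in> ({0..<M} \<times> {0..<M} \<times> {0..<M} \<times> {0..<M}) \<times> (rcosets\<^bsub>Oplus G D\<^esub> Gam)"
      using M(1) by (auto simp: key_def red_def split: prod.splits)
  qed
  then have "finite (key ` SL)"
    by (rule finite_subset) (use fin in auto)
  then obtain Rs where Rs: "Rs \<subseteq> SL" "finite Rs" "key ` SL = key ` Rs"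
    using finite_subset_image [of "key ` SL" key SL] by auto
  have "\<exists>\<delta>\<in>Rs. mt \<delta> ** mi \<gamma> \<in> GamJ_Z G Gam J" if g: "\<gamma> \<in> SL" for \<gamma>
  proof -
    have "key \<gamma> \<in> key ` Rs" using g Rs(3) by (metis imageI)
    then obtain \<delta> where "\<delta> \<in> Rs" "key \<gamma> = key \<delta>" by (rule imageE)
    then have d: "\<delta> \<in> Rs" "key \<delta> = key \<gamma>" by simp_all
    have dSL: "\<delta> \<in> SL" using d Rs by blast
    have red: "red \<delta> = red \<gamma>" using d by (simp add: key_def)
    define \<rho> where "\<rho> = rep (red \<gamma>)"
    have coset: "Gam #>\<^bsub>Oplus G D\<^esub> (mt \<delta> ** mi \<rho>) = Gam #>\<^bsub>Oplus G D\<^esub> (mt \<gamma> ** mi \<rho>)"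
      using d(2) red by (simp add: key_def \<rho>_def)
    have "mat 1 \<in> Gam" using subgroup.one_closed [OF sub] by (simp add: Oplus_def)
    then have "mt \<delta> ** mi \<rho> \<in> Gam #>\<^bsub>Oplus G D\<^esub> (mt \<delta> ** mi \<rho>)"
      unfolding r_coset_def by (auto simp: Oplus_def intro!: bexI [of _ "mat 1"])
    then have "mt \<delta> ** mi \<rho> \<in> Gam #>\<^bsub>Oplus G D\<^esub> (mt \<gamma> ** mi \<rho>)" by (simp only: coset)
    then obtain h where h: "h \<in> Gam" "mt \<delta> ** mi \<rho> = h ** (mt \<gamma> ** mi \<rho>)"
      unfolding r_coset_def by (auto simp: Oplus_def)
    have \<rho>SL: "\<rho> \<in> SL" using rep [OF g] by (simp add: \<rho>_def)
    have inv: "mi \<rho> ** mt \<rho> = mat 1" "mt \<gamma> ** mi \<gamma> = mat 1"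
      using \<rho>SL g rotm_inverse by (auto simp: SL_def mi_def mt_def)
    have "mt \<delta> = mt \<delta> ** mi \<rho> ** mt \<rho>" by (simp add: matrix_mul_assoc [symmetric] inv)
    also have "\<dots> = h ** mt \<gamma>" unfolding h(2) by (simp add: matrix_mul_assoc [symmetric] inv)
    finally have "mt \<delta> ** mi \<gamma> = h" by (simp add: matrix_mul_assoc [symmetric] inv)
    then have "mt \<delta> ** mi \<gamma> \<in> Gam" using h(1) by simp
    then show ?thesis using d(1) quot [OF dSL g red] unfolding GamJ_Z_def by blast
  qed
  note ex = this
  show ?thesis
  proof (rule that [of Rs])
    show "finite Rs" by fact
    show "a * d - b * c = 1" if "(a, b, c, d) \<in> Rs" for a b c d using that Rs(1) by (auto simp: SL_def)
    fix a b c d :: int assume "a * d - b * c = 1"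
    then show "\<exists>(a', b', c', d')\<in>Rs. rotm a' b' c' d' ** rotm d (- b) (- c) a \<in> GamJ_Z G Gam J"
      using ex [of "(a, b, c, d)"] by (auto simp: SL_def mt_def mi_def)
  qed
qed

end

section \<open>Coefficients as scalar Jacobi forms\<close>

definition theta_value :: "nat \<Rightarrow> 'l set \<Rightarrow> ('l \<Rightarrow> real) \<Rightarrow> ('l \<Rightarrow> nat \<Rightarrow> int) \<Rightarrow> ('l \<Rightarrow> complex) \<Rightarrow> complex \<Rightarrow> (nat \<Rightarrow> complex) \<Rightarrow> complex" where
  "theta_value p X N R a \<tau> \<zeta> = infsum (\<lambda>l. a l * ee (of_real (N l) * \<tau> + dotp p (R l) \<zeta>)) X"

lemma theta_value_cong: "(\<And>i. i < p \<Longrightarrow> \<zeta> i = \<zeta>' i) \<Longrightarrow> theta_value p X N R a \<tau> \<zeta> = theta_value p X N R a \<tau> \<zeta>'"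
  by (simp add: theta_value_def dotp_def)

lemma tensor_coeff_has_sum:
  assumes "\<And>is. ((\<lambda>l. A l is * E l) has_sum T is) X"
  shows "((\<lambda>l. tensor_coeff G d (A l) y * E l) has_sum tensor_coeff G d T y) X"
proof -
  have "((\<lambda>l. \<Sum>is | length is = d. A l is * E l * (\<Prod>k<d. bil G (axis (is ! k) 1) (y k))) has_sum
        (\<Sum>is | length is = d. T is * (\<Prod>k<d. bil G (axis (is ! k) 1) (y k)))) X"
    by (intro has_sum_finite_sum has_sum_cmult_left assms) simp
  then show ?thesis unfolding tensor_coeff_def sum_distrib_right by (simp only: mult_ac)
qed

context adapted_frame
begin

lemma UJ_perp_members:
  assumes c: "gen c = e" "opp c = f" and v: "v \<in> UJ_line G J c" and x: "x \<in> UJ_perp G J c"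
  shows "x \<in> coords \<rat>" "bil G x e = 0" "bil G x f = 0" "bil G x v = 0"
  using x v c by (auto simp: UJ_perp_def perp_def VI_def)

text \<open>
  A coefficient of \<open>\<phi>\<close> inherits the Fourier expansion, with exponents \<open>(x, l)\<close> in \<open>\<tau>\<close> and \<open>(x, w i)\<close> in \<open>\<zeta> i\<close>. The
  generator of a rotated cusp is \<open>t (a e + b v)\<close> with a rational \<open>t\<close> that makes it primitive, while
  the rotated frame without the factor \<open>t\<close> is the one in which the transformation law takes its standard
  form. Passing between the two substitutes \<open>t\<^sup>2 \<tau>\<close> for \<open>\<tau>\<close> and \<open>t \<zeta>\<close> for \<open>\<zeta>\<close> and multiplies the coefficient by
  \<open>t powi \<kappa>\<close>.
\<close>

lemma boundary_expansion:
  fixes a :: "complex^'N \<Rightarrow> 'N tensor"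
  assumes c: "gen c = e" "opp c = f" "lvec c = l" and v: "v \<in> UJ_line G J c"
    and tpD: "\<And>\<tau> \<rho> \<zeta>. frame_point \<tau> \<rho> \<zeta> \<in> D \<longleftrightarrow> 0 < Im \<tau> \<and> (\<Sum>i<p. real (q i) * (Im (\<zeta> i))\<^sup>2) < 2 * Im \<tau> * Im \<rho>"
    and \<Lambda>: "\<Lambda> \<subseteq> UJ_perp G J c"
    and hs: "\<And>z is. z \<in> tube_domain G D c \<Longrightarrow> ((\<lambda>x. a x is * exp (2 * of_real pi * \<i> * bil G x z)) has_sum
               \<phi> (projJ J (tube_point G c z)) is) \<Lambda>"
    and pos: "\<And>x. x \<in> \<Lambda> \<Longrightarrow> a x \<noteq> (\<lambda>is. 0) \<Longrightarrow> Re (bil G (of_nat m *s lvec c + x) (of_nat m *s lvec c + x)) \<ge> 0"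
    and t: "t \<noteq> 0" and int: "\<And>x i. x \<in> \<Lambda> \<Longrightarrow> i < p \<Longrightarrow> bil G x (w i) / of_real t \<in> \<int>"
    and N: "N = (\<lambda>x. Re (bil G x l) / t\<^sup>2)" and R: "R = (\<lambda>x i. \<lfloor>Re (bil G x (w i) / of_real t)\<rfloor>)"
    and b: "b = (\<lambda>x. of_real t powi (- \<kappa>) * tensor_coeff G d (a x) (\<lambda>i. V (\<sigma> i)))"
  shows "theta_expansion p q m \<Lambda> N R b (theta_value p \<Lambda> N R b)"
    and "\<And>\<tau> \<rho> \<zeta>. frame_point \<tau> \<rho> \<zeta> \<in> D \<Longrightarrow> tensor_coeff G d (\<phi> (projJ J (frame_point \<tau> \<rho> \<zeta>))) (\<lambda>i. V (\<sigma> i))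
       = of_real t powi \<kappa> * theta_value p \<Lambda> N R b (of_real (t\<^sup>2) * \<tau>) (\<lambda>i. of_real t * \<zeta> i)"
proof -
  have R': "of_int (R x i) = bil G x (w i) / of_real t" if "x \<in> \<Lambda>" "i < p" for x i
  proof -
    have "bil G x (w i) / of_real t \<in> \<int>" using int that by blast
    then obtain z where z: "bil G x (w i) / of_real t = of_int z" by (rule Ints_cases)
    then show ?thesis unfolding R z by simp
  qed
  have Rr: "of_int (R x i) = Re (bil G x (w i)) / t" if "x \<in> \<Lambda>" "i < p" for x i
    using arg_cong [OF R' [OF that], of Re] by simp
  have xl: "bil G x l = of_real (Re (bil G x l))" if "x \<in> \<Lambda>" for x
  proof -
    have "bil G x l \<in> \<real>"
      using bil_in_Rats [OF UJ_perp_members(1) [OF c(1,2) v] rational(4)] that \<Lambda> Rats_subset_Reals by blast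
    then show ?thesis by simp
  qed
  have hs_frame_point: "((\<lambda>x. b x * ee (of_real (N x) * (of_real (t\<^sup>2) * \<tau>) + dotp p (R x) (\<lambda>i. of_real t * \<zeta> i))) has_sum
      of_real t powi (- \<kappa>) * tensor_coeff G d (\<phi> (projJ J (frame_point \<tau> \<rho> \<zeta>))) (\<lambda>i. V (\<sigma> i))) \<Lambda>"
    if frame_point: "frame_point \<tau> \<rho> \<zeta> \<in> D" for \<tau> \<rho> \<zeta>
  proof -
    define z where "z = \<tau> *s l + \<rho> *s v + (\<Sum>i<p. \<zeta> i *s w i)"
    have z: "z \<in> tube_domain G D c" "tube_point G c z = frame_point \<tau> \<rho> \<zeta>"
      using frame_point_tube_point [OF c(1,2), of \<tau> \<rho> \<zeta>] frame_point by (auto simp: z_def tube_domain_def)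
    have "((\<lambda>x. tensor_coeff G d (a x) (\<lambda>i. V (\<sigma> i)) * exp (2 * of_real pi * \<i> * bil G x z)) has_sum
       tensor_coeff G d (\<phi> (projJ J (frame_point \<tau> \<rho> \<zeta>))) (\<lambda>i. V (\<sigma> i))) \<Lambda>"
      by (rule tensor_coeff_has_sum) (use hs [OF z(1)] z(2) in simp)
    from has_sum_cmult_right [OF this, of "of_real t powi (- \<kappa>)"]
    have "((\<lambda>x. b x * ee (bil G x z)) has_sum
      of_real t powi (- \<kappa>) * tensor_coeff G d (\<phi> (projJ J (frame_point \<tau> \<rho> \<zeta>))) (\<lambda>i. V (\<sigma> i))) \<Lambda>"
      by (simp only: b ee_def mult.assoc)
    moreover have "bil G x z = of_real (N x) * (of_real (t\<^sup>2) * \<tau>) + dotp p (R x) (\<lambda>i. of_real t * \<zeta> i)" if x: "x \<in> \<Lambda>" for x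
    proof -
      have "bil G x v = 0" using UJ_perp_members(4) [OF c(1,2) v] x \<Lambda> by blast
      then have "bil G x z = \<tau> * bil G x l + (\<Sum>i<p. \<zeta> i * bil G x (w i))"
        by (simp add: z_def bil_linear)
      also have "(\<Sum>i<p. \<zeta> i * bil G x (w i)) = dotp p (R x) (\<lambda>i. of_real t * \<zeta> i)"
        unfolding dotp_def by (intro sum.cong refl) (use t x in \<open>simp add: R'\<close>)
      also have "\<tau> * bil G x l = of_real (N x) * (of_real (t\<^sup>2) * \<tau>)"
        using t by (subst xl [OF x]) (simp add: N)
      finally show ?thesis .
    qed
    ultimately show ?thesis by (subst (asm) has_sum_cong) auto
  qed
  show "theta_expansion p q m \<Lambda> N R b (theta_value p \<Lambda> N R b)"
    unfolding theta_expansion_def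
  proof (intro conjI allI impI ballI)
    fix \<tau> :: complex and \<zeta> :: "nat \<Rightarrow> complex" assume \<tau>: "Im \<tau> > 0"
    define \<tau>' where "\<tau>' = \<tau> / of_real (t\<^sup>2)"
    define \<zeta>' where "\<zeta>' i = \<zeta> i / of_real t" for i
    define S where "S = (\<Sum>i<p. real (q i) * (Im (\<zeta>' i))\<^sup>2)"
    have \<tau>': "Im \<tau>' > 0" using \<tau> t by (simp add: \<tau>'_def Im_divide_of_real del: of_real_power)
    \<comment> \<open>a choice of \<open>\<rho>\<close> for which the point lies in \<open>D\<close>; along the line in direction \<open>v\<close> the section is constant\<close>
    have "frame_point \<tau>' (\<i> * of_real ((S + 1) / (2 * Im \<tau>'))) \<zeta>' \<in> D"
      unfolding tpD S_def [symmetric] using \<tau>' by simp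
    from hs_frame_point [OF this]
    have "(\<lambda>x. b x * ee (of_real (N x) * (of_real (t\<^sup>2) * \<tau>') + dotp p (R x) (\<lambda>i. of_real t * \<zeta>' i))) summable_on \<Lambda>"
      by (rule has_sum_imp_summable)
    moreover have "of_real (t\<^sup>2) * \<tau>' = \<tau>" "(\<lambda>i. of_real t * \<zeta>' i) = \<zeta>"
      using t by (auto simp: \<tau>'_def \<zeta>'_def)
    ultimately show "((\<lambda>l. b l * ee (of_real (N l) * \<tau> + dotp p (R l) \<zeta>)) has_sum theta_value p \<Lambda> N R b \<tau> \<zeta>) \<Lambda>"
      unfolding theta_value_def by simp
  next
    fix x assume x: "x \<in> \<Lambda>" and bx: "b x \<noteq> 0"
    have "a x \<noteq> (\<lambda>is. 0)" using bx by (auto simp: b)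
    then have ge: "Re (bil G (of_nat m *s l + x) (of_nat m *s l + x)) \<ge> 0" using pos [OF x] c by simp
    have x0: "bil G x e = 0" "bil G x f = 0" "bil G x v = 0"
      using UJ_perp_members [OF c(1,2) v] x \<Lambda> by blast+
    have xx: "bil G x x = - of_real (t\<^sup>2 * (\<Sum>i<p. (of_int (R x i))\<^sup>2 / real (q i)))"
    proof -
      have sq: "bil G x (w i) * bil G x (w i) / of_nat (q i) = of_real (t\<^sup>2 * ((of_int (R x i))\<^sup>2 / real (q i)))" if "i < p" for i
      proof -
        have "bil G x (w i) = of_real t * of_int (R x i)" using R' [OF x that] t by simp
        then show ?thesis by (simp add: power2_eq_square)
      qed
      have "(\<Sum>i<p. bil G x (w i) * bil G x (w i) / of_nat (q i)) = of_real (t\<^sup>2 * (\<Sum>i<p. (of_int (R x i))\<^sup>2 / real (q i)))"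
        unfolding sum_distrib_left of_real_sum by (intro sum.cong refl sq) simp
      then show ?thesis using bil_coords [of x x] x0 by simp
    qed
    have "bil G (of_nat m *s l + x) (of_nat m *s l + x) = 2 * of_nat m * bil G x l + bil G x x"
      using bil_sym [OF sym, of l x] by (simp add: bil_linear rels algebra_simps)
    then have "0 \<le> 2 * real m * Re (bil G x l) - t\<^sup>2 * (\<Sum>i<p. (of_int (R x i))\<^sup>2 / real (q i))"
      using ge unfolding xx by simp
    then have "t\<^sup>2 * (\<Sum>i<p. (of_int (R x i))\<^sup>2 / real (q i)) \<le> t\<^sup>2 * (2 * real m * N x)"
      using t by (simp add: N)
    then show "(\<Sum>i<p. (of_int (R x i))\<^sup>2 / real (q i)) \<le> 2 * real m * N x"
      using t by simp
  qed
  fix \<tau> \<rho> \<zeta> assume frame_point: "frame_point \<tau> \<rho> \<zeta> \<in> D"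
  have "theta_value p \<Lambda> N R b (of_real (t\<^sup>2) * \<tau>) (\<lambda>i. of_real t * \<zeta> i)
     = of_real t powi (- \<kappa>) * tensor_coeff G d (\<phi> (projJ J (frame_point \<tau> \<rho> \<zeta>))) (\<lambda>i. V (\<sigma> i))"
    unfolding theta_value_def by (rule infsumI [OF hs_frame_point [OF frame_point]])
  then show "tensor_coeff G d (\<phi> (projJ J (frame_point \<tau> \<rho> \<zeta>))) (\<lambda>i. V (\<sigma> i))
       = of_real t powi \<kappa> * theta_value p \<Lambda> N R b (of_real (t\<^sup>2) * \<tau>) (\<lambda>i. of_real t * \<zeta> i)"
    using t by (simp add: power_int_minus)
qed

end

lemma full_lattice_denominator:
  assumes \<Lambda>: "full_lattice W \<Lambda>" "W \<subseteq> coords \<rat>" and y: "y \<in> coords \<rat>"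
  shows "\<exists>D::nat. D > 0 \<and> (\<forall>x\<in>\<Lambda>. of_nat D * bil G x y \<in> \<int>)"
proof -
  obtain B where B: "finite B" "span_over \<rat> B = W" "span_over \<int> B = \<Lambda>" using \<Lambda>(1) unfolding full_lattice_def by blast
  have BW: "B \<subseteq> coords \<rat>" using B(2) \<Lambda>(2) span_over_base [of _ B \<rat>] by auto
  obtain D :: int where D: "D > 0" "\<forall>z\<in>(\<lambda>x. bil G x y) ` B. of_int D * z \<in> \<int>"
    using common_denominator [of "(\<lambda>x. bil G x y) ` B"] B(1) BW y bil_in_Rats by blast
  have "of_nat (nat D) * bil G x y \<in> \<int>" if x: "x \<in> \<Lambda>" for x
  proof -
    obtain T c where T: "x = (\<Sum>z\<in>T. c z *s z)" "T \<subseteq> B" "c ` T \<subseteq> \<int>" using x unfolding B(3) [symmetric] span_over_def by blast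
    have "of_nat (nat D) * bil G x y = (\<Sum>z\<in>T. c z * (of_int D * bil G z y))"
      unfolding T(1) using D(1) by (simp add: bil_linear sum_distrib_left mult_ac)
    also have "\<dots> \<in> \<int>"
    proof (rule Ints_sum)
      fix z assume "z \<in> T"
      then have "c z \<in> \<int>" "of_int D * bil G z y \<in> \<int>" using T D(2) by auto
      then show "c z * (of_int D * bil G z y) \<in> \<int>" by (rule Ints_mult)
    qed
    finally show ?thesis .
  qed
  then show ?thesis using D(1) by (intro exI [of _ "nat D"]) auto
qed

lemma finite_common_multiple:
  assumes "finite I" "\<And>i. i \<in> I \<Longrightarrow> \<exists>D::nat. D > 0 \<and> P i D" "\<And>i D k. i \<in> I \<Longrightarrow> P i D \<Longrightarrow> P i (k * D)"
  shows "\<exists>D::nat. D > 0 \<and> (\<forall>i\<in>I. P i D)"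
  using assms
proof (induction I rule: finite_induct)
  case (insert i I)
  obtain D where D: "D > 0" "\<forall>j\<in>I. P j D" using insert.IH insert.prems by blast
  obtain D' where D': "D' > 0" "P i D'" using insert.prems(1) by blast
  have "P j (D * D')" if "j \<in> insert i I" for j
    using that insert.prems(2) [of j] D(2) D'(2) by (metis insert_iff mult.commute)
  then show ?case using D(1) D'(1) by (intro exI [of _ "D * D'"]) auto
qed (auto intro: exI [of _ 1])

context adapted_frame
begin

lemma UJ_perp_determined:
  assumes "bil G x e = 0" "bil G x f = 0" "bil G x v = 0" "bil G y e = 0" "bil G y f = 0" "bil G y v = 0"
    and "bil G x l = bil G y l" "\<And>i. i < p \<Longrightarrow> bil G x (w i) = bil G y (w i)"
  shows "x = y"
  using expand [of x] expand [of y] assms by simp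

end

context cusp_frame
begin

lemma rotm_pairing_rot_vec:
  assumes "s \<in> frame_set p"
  shows "bil G (rotm a b c d *v x) (V s) = bil G x (rot_vec (of_int d) (- of_int b) (- of_int c) (of_int a) s)"
  using assms
proof (cases s)
  case (SW i)
  then have "i < p" using assms by (auto simp: frame_set_def)
  then show ?thesis using SW by (simp add: rotm_works rot_def bil_linear w_rels)
qed (simp_all add: rotm_works rot_pairings bil_linear algebra_simps)

text \<open>
  The invariance under the rotation \<open>g\<close> compares the trivialization at \<open>c0\<close> over \<open>x\<close> with that over \<open>y = g x\<close>, and
  the change of trivialization over \<open>y\<close> compares \<open>c0\<close> with \<open>c2\<close>.
\<close>

lemma invariant_leading_coeff:
  assumes \<phi>: "\<phi> \<in> jacobi_forms G D Gam J lam k m"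
    and c0: "c0 \<in> cusps G D Gam J" "gen c0 = e" "opp c0 = f" "lvec c0 = l"
    and c2: "c2 \<in> cusps G D Gam J" "gen c2 = A *s e + B *s v" "opp c2 = E *s f - C *s l" "lvec c2 = A *s l - B *s f"
    and r: "A \<in> \<rat>" "B \<in> \<rat>" "C \<in> \<rat>" "E \<in> \<rat>" and det: "A * E - B * C = 1"
    and g: "rotm a b c d \<in> GamJ_Z G Gam J" "a * d - b * c = (1::int)"
    and x: "x \<in> D"
    and \<sigma>: "\<And>i. i < sum_list lam \<Longrightarrow> \<sigma> i \<in> frame_set p" "\<And>i. i < sum_list lam \<Longrightarrow> \<sigma> i \<notin> {SE, SF}"
    and low: "\<And>\<sigma>' y. y \<in> D \<Longrightarrow> \<sigma>' \<in> PiE {..<sum_list lam} (\<lambda>_. frame_set p) \<Longrightarrow> (\<And>i. i < sum_list lam \<Longrightarrow> \<sigma>' i \<notin> {SE, SF}) \<Longrightarrow>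
        total_wt (sum_list lam) \<sigma>' < total_wt (sum_list lam) \<sigma> \<Longrightarrow> tensor_coeff G (sum_list lam) (\<phi> c0 (projJ J y)) (\<lambda>i. V (\<sigma>' i)) = 0"
  defines "y \<equiv> rotm a b c d *v x" and "\<kappa> \<equiv> k + total_wt (sum_list lam) \<sigma>"
  shows "tensor_coeff G (sum_list lam) (\<phi> c2 (projJ J y)) (\<lambda>i. rot_vec A B C E (\<sigma> i)) * omegaJ G c2 y ^ m * bil G y (gen c2) powi (- \<kappa>)
     = tensor_coeff G (sum_list lam) (\<phi> c0 (projJ J x)) (\<lambda>i. V (\<sigma> i)) * omegaJ G c0 x ^ m * bil G x e powi (- \<kappa>)"
proof -
  let ?d = "sum_list lam"
  have hol: "\<phi> \<in> holomorphic_sections G D Gam J lam k m" and inv: "GamJ_invariant G D Gam J lam k m \<phi>"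
    using \<phi> by (auto simp: jacobi_forms_def)
  have yD: "y \<in> D" unfolding y_def using rotm_domain [OF g(2)] x by (metis imageI)
  interpret R: adapted_frame G "A *s e + B *s v" "C *s e + E *s v" "E *s f - C *s l" "A *s l - B *s f" w p q
    by (rule rotated_frame [OF r det])
  have in_schur: "\<phi> c0 (projJ J z) \<in> schur G lam (VI G c0)" if "z \<in> D" for z
    using hol c0 that unfolding holomorphic_sections_def VJ_def by blast
  have null: "tensor_coeff G ?d (\<phi> c0 (projJ J z)) (\<lambda>i. V (\<sigma>' i)) = 0"
    if "z \<in> D" "i < ?d" "\<sigma>' i \<in> {SE, SF}" for z \<sigma>' i
    by (rule tensor_coeff_schur_zero [OF in_schur [OF \<open>z \<in> D\<close>] \<open>i < ?d\<close>])
       (use that c0 in \<open>auto simp: VI_def\<close>)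
  have nz: "bil G z e \<noteq> 0" "bil G z (A *s e + B *s v) \<noteq> 0" if "z \<in> D" for z
  proof -
    have "height G e v z > 0" using that mem_D_iff by blast
    then show "bil G z e \<noteq> 0" by (auto simp: height_def)
    have "height G (A *s e + B *s v) (C *s e + E *s v) z > 0"
      using that mem_D_iff by (simp add: height_rotated [OF r det])
    then show "bil G z (A *s e + B *s v) \<noteq> 0" by (auto simp: height_def simp del: bil_add_right)
  qed
  have fv: "frame_vec (A *s e + B *s v) (C *s e + E *s v) (E *s f - C *s l) (A *s l - B *s f) w s = rot_vec A B C E s" for s
    by (cases s) auto
  have det': "complex_of_int d * of_int a - (- of_int b) * (- of_int c) = 1"
    using g(2) by (simp flip: of_int_mult of_int_diff) (simp add: mult.commute)
  have gx: "bil G y e \<noteq> 0" using nz(1) [OF yD] .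
  have 1: "tensor_coeff G ?d (transition G lam k m c0 c0 (rotm a b c d) x (\<phi> c0 (projJ J x))) (\<lambda>i. frame_vec (gen c0) v (opp c0) (lvec c0) w (\<sigma> i))
      * omegaJ G c0 (rotm a b c d *v x) ^ m * bil G (rotm a b c d *v x) (gen c0) powi (- (k + total_wt ?d \<sigma>))
    = tensor_coeff G ?d (\<phi> c0 (projJ J x)) (\<lambda>i. V (\<sigma> i)) * omegaJ G c0 x ^ m * bil G x e powi (- (k + total_wt ?d \<sigma>))"
  proof (rule transition_leading_coeff [OF det' c0(2)])
    show "bil G (rotm a b c d *v z) (frame_vec (gen c0) v (opp c0) (lvec c0) w s) = bil G z (rot_vec (of_int d) (- of_int b) (- of_int c) (of_int a) s)"
      if "s \<in> frame_set p" for z s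
      unfolding c0(2-4) by (rule rotm_pairing_rot_vec [OF that])
    show "bil G (gen c0) (frame_vec (gen c0) v (opp c0) (lvec c0) w s) = 0" if "s \<in> frame_set p" "s \<noteq> SF" for s
      using that unfolding c0(2-4) by (cases s) (auto simp: rels w_rels frame_set_def)
    show "bil G x e \<noteq> 0" by (rule nz(1) [OF x])
    show "bil G x (of_int d *s e + (- of_int b) *s v) \<noteq> 0"
      using gx rotm_pairing_rot_vec [of SE a b c d x] by (simp add: y_def frame_set_def)
  qed (use \<sigma> null [OF x] low [OF x] in auto)
  have 2: "tensor_coeff G ?d (transition G lam k m c0 c2 (mat 1) y (\<phi> c0 (projJ J y))) (\<lambda>i. frame_vec (gen c2) (C *s e + E *s v) (opp c2) (lvec c2) w (\<sigma> i))
      * omegaJ G c2 (mat 1 *v y) ^ m * bil G (mat 1 *v y) (gen c2) powi (- (k + total_wt ?d \<sigma>))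
    = tensor_coeff G ?d (\<phi> c0 (projJ J y)) (\<lambda>i. V (\<sigma> i)) * omegaJ G c0 y ^ m * bil G y e powi (- (k + total_wt ?d \<sigma>))"
  proof (rule transition_leading_coeff [OF det c0(2)])
    show "bil G (mat 1 *v z) (frame_vec (gen c2) (C *s e + E *s v) (opp c2) (lvec c2) w s) = bil G z (rot_vec A B C E s)" for z s
      unfolding c2(2-4) fv by simp
    show "bil G (gen c2) (frame_vec (gen c2) (C *s e + E *s v) (opp c2) (lvec c2) w s) = 0" if "s \<in> frame_set p" "s \<noteq> SF" for s
      using that R.rels R.w_rels unfolding c2(2-4) by (cases s) (auto simp: frame_set_def simp del: bil_add_left)
  qed (use \<sigma> null [OF yD] low [OF yD] nz [OF yD] in auto)
  have t1: "transition G lam k m c0 c0 (rotm a b c d) x (\<phi> c0 (projJ J x)) = \<phi> c0 (projJ J y)"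
    unfolding y_def by (rule inv [unfolded GamJ_invariant_def, rule_format, OF g(1) c0(1) x, symmetric])
  have t2: "transition G lam k m c0 c2 (mat 1) y (\<phi> c0 (projJ J y)) = \<phi> c2 (projJ J y)"
  proof -
    have "\<forall>c1\<in>cusps G D Gam J. \<forall>c2\<in>cusps G D Gam J. \<forall>w\<in>D.
        \<phi> c2 (projJ J w) = transition G lam k m c1 c2 (mat 1) w (\<phi> c1 (projJ J w))"
      using hol unfolding holomorphic_sections_def by (elim CollectE conjE)
    from this [rule_format, OF c0(1) c2(1) yD] show ?thesis by simp
  qed
  show ?thesis
    using 1 2 unfolding t1 t2 c0(2-4) c2(2-4) fv \<kappa>_def y_def [symmetric] matrix_vector_mul_lid by (simp only:)
qed

end

context cusp_frame
begin

text \<open>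
  The cusp generated by \<open>t (a e + b v)\<close>, where \<open>t\<close> is to be chosen such that this vector is primitive. The
  remaining vectors are scaled such that the relations of a frame are preserved.
\<close>

definition cusp_at :: "int \<times> int \<times> int \<times> int \<Rightarrow> real \<Rightarrow> 'N cusp" where
  "cusp_at \<gamma> t = (case \<gamma> of (a, b, c, d) \<Rightarrow>
     \<lparr>gen = (of_real t * of_int a) *s e + (of_real t * of_int b) *s v,
      opp = (of_int d / of_real t) *s f - (of_int c / of_real t) *s l,
      lvec = (of_real t * of_int a) *s l - (of_real t * of_int b) *s f\<rparr>)"

definition frame_at :: "int \<times> int \<times> int \<times> int \<Rightarrow> real \<Rightarrow> frame_index \<Rightarrow> complex^'N" where
  "frame_at \<gamma> t = (case \<gamma> of (a, b, c, d) \<Rightarrow>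
     rot_vec (of_real t * of_int a) (of_real t * of_int b) (of_int c / of_real t) (of_int d / of_real t))"

lemma total_wt_le: "total_wt d \<sigma> \<le> int (card {i. i < d \<and> \<sigma> i = SL})"
proof -
  have "frame_wt s \<le> (if s = SL then 1 else 0)" for s by (cases s) auto
  then have "total_wt d \<sigma> \<le> (\<Sum>i<d. if \<sigma> i = SL then 1 else 0)"
    unfolding total_wt_def by (intro sum_mono) auto
  also have "\<dots> = int (card {i. i < d \<and> \<sigma> i = SL})"
    by (simp add: sum.If_cases Int_def lessThan_def)
  finally show ?thesis .
qed

lemma total_wt_ge: "- int d \<le> total_wt d \<sigma>"
proof -
  have "- 1 \<le> frame_wt s" for s by (cases s) auto
  then have "(\<Sum>i<d. - 1) \<le> total_wt d \<sigma>" unfolding total_wt_def by (intro sum_mono) auto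
  then show ?thesis by simp
qed

text \<open>
  The functions \<open>h0\<close> and \<open>h\<close> are the values of the coefficient at the reference cusp and at the cusp
  obtained from the matrix \<open>(a', b', c', d')\<close>, which represents the class of \<open>(a, b, c, d)\<close>. At \<open>y = g x\<close> the
  frame of the second cusp has the pairings that the frame rotated by \<open>(a, b, c, d)\<close> has at \<open>x\<close>; so, up
  to the scaling by \<open>t\<close>, its tube coordinates are \<open>(c + d\<tau>) / j\<close> and \<open>\<zeta> / j\<close>. The exponential factor in the transformation law is the
  quotient of the two values of \<open>omegaJ\<close>.
\<close>

lemma jacobi_related_at_cusp:
  assumes \<phi>: "\<phi> \<in> jacobi_forms G D Gam J lam k m"
    and c0: "c0 \<in> cusps G D Gam J" "gen c0 = e" "opp c0 = f" "lvec c0 = l"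
    and t: "t \<noteq> 0" "complex_of_real t \<in> \<rat>"
    and c2: "cusp_at (a', b', c', d') t \<in> cusps G D Gam J" and det': "a' * d' - b' * c' = 1"
    and g: "rotm a' b' c' d' ** rotm d (- b) (- c) a \<in> GamJ_Z G Gam J" and det: "a * d - b * c = 1"
    and \<sigma>: "\<And>i. i < sum_list lam \<Longrightarrow> \<sigma> i \<in> frame_set p" "\<And>i. i < sum_list lam \<Longrightarrow> \<sigma> i \<notin> {SE, SF}"
    and low: "\<And>\<sigma>' y. y \<in> D \<Longrightarrow> \<sigma>' \<in> PiE {..<sum_list lam} (\<lambda>_. frame_set p) \<Longrightarrow> (\<And>i. i < sum_list lam \<Longrightarrow> \<sigma>' i \<notin> {SE, SF}) \<Longrightarrow>
        total_wt (sum_list lam) \<sigma>' < total_wt (sum_list lam) \<sigma> \<Longrightarrow> tensor_coeff G (sum_list lam) (\<phi> c0 (projJ J y)) (\<lambda>i. V (\<sigma>' i)) = 0"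
    and \<kappa>: "\<kappa> = k + total_wt (sum_list lam) \<sigma>"
    and val0: "\<And>\<tau> \<rho> \<zeta>. frame_point \<tau> \<rho> \<zeta> \<in> D \<Longrightarrow>
        tensor_coeff G (sum_list lam) (\<phi> c0 (projJ J (frame_point \<tau> \<rho> \<zeta>))) (\<lambda>i. V (\<sigma> i)) = h0 \<tau> \<zeta>"
    and val: "\<And>\<tau> \<rho> \<zeta>. adapted_frame.frame_point e2 v2 f2 l2 w p q \<tau> \<rho> \<zeta> \<in> D \<Longrightarrow>
        tensor_coeff G (sum_list lam) (\<phi> (cusp_at (a', b', c', d') t) (projJ J (adapted_frame.frame_point e2 v2 f2 l2 w p q \<tau> \<rho> \<zeta>)))
          (\<lambda>i. frame_at (a', b', c', d') t (\<sigma> i)) = of_real t powi \<kappa> * h (of_real (t\<^sup>2) * \<tau>) (\<lambda>i. of_real t * \<zeta> i)"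
    and hcong: "\<And>\<tau> \<zeta> \<zeta>'. (\<And>i. i < p \<Longrightarrow> \<zeta> i = \<zeta>' i) \<Longrightarrow> h \<tau> \<zeta> = h \<tau> \<zeta>'"
    and F2: "e2 = (of_real t * of_int a') *s e + (of_real t * of_int b') *s v"
      "v2 = (of_int c' / of_real t) *s e + (of_int d' / of_real t) *s v"
      "f2 = (of_int d' / of_real t) *s f - (of_int c' / of_real t) *s l"
      "l2 = (of_real t * of_int a') *s l - (of_real t * of_int b') *s f"
  shows "jacobi_related p q m \<kappa> a b c d h0 h"
  unfolding jacobi_related_def
proof (intro allI impI)
  fix \<tau> :: complex and \<zeta> :: "nat \<Rightarrow> complex" assume \<tau>: "Im \<tau> > 0"
  let ?d = "sum_list lam"
  define c2 where "c2 = cusp_at (a', b', c', d') t"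
  define S where "S = (\<Sum>i<p. real (q i) * (Im (\<zeta> i))\<^sup>2)"
  \<comment> \<open>a choice of \<open>\<rho>\<close> for which the point lies in \<open>D\<close>; along the line in direction \<open>v\<close> the section is constant\<close>
  define \<rho> where "\<rho> = \<i> * of_real ((S + 1) / (2 * Im \<tau>))"
  define x where "x = frame_point \<tau> \<rho> \<zeta>"
  have xD: "x \<in> D" unfolding x_def frame_point_mem_D_iff S_def [symmetric] \<rho>_def using \<tau> by simp
  have xp: "bil G x e = 1" "bil G x v = \<tau>" "bil G x l = \<rho>" "bil G x f = - ((2 * \<tau> * \<rho> - qform p q \<zeta>) / 2)"
    "i < p \<Longrightarrow> bil G x (w i) = - (\<zeta> i * of_nat (q i))" for i
    unfolding x_def by (rule frame_point_pairings | rule frame_point_pairings(5), assumption)+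
  define u where "u = rotm d (- b) (- c) a *v x"
  define y where "y = rotm a' b' c' d' *v u"
  define j where "j = of_int a + of_int b * \<tau>"
  have up: "bil G u e = j" "bil G u v = of_int c + of_int d * \<tau>" "bil G u l = - of_int b * bil G x f + of_int a * \<rho>"
    unfolding u_def rotm_works rot_pairings by (simp_all add: xp j_def)
  have uw: "bil G u (w i) = bil G x (w i)" if "i < p" for i
    unfolding u_def rotm_works by (simp add: rot_def bil_linear w_rels that)
  have j0: "j \<noteq> 0" unfolding j_def by (rule automorphy_nonzero [OF det \<tau>])
  have detc': "complex_of_int a' * of_int d' - of_int b' * of_int c' = 1"
    using det' by (metis of_int_1 of_int_diff of_int_mult)
  have yp: "bil G y (rotm a' b' c' d' *v z) = bil G u z" for z
    unfolding y_def rotm_works by (rule rot_isometry [OF detc'])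
  have r2: "e2 = of_real t *s (rotm a' b' c' d' *v e)" "v2 = (1 / of_real t) *s (rotm a' b' c' d' *v v)"
     "l2 = of_real t *s (rotm a' b' c' d' *v l)"
    unfolding F2 rotm_works rot_frame by (simp_all add: vec_eq_iff algebra_simps)
  have ye: "bil G y e2 = of_real t * j" "bil G y v2 = (of_int c + of_int d * \<tau>) / of_real t" "bil G y l2 = of_real t * bil G u l"
    unfolding r2 bil_scale_right yp up by simp_all
  have yw: "bil G y (w i) = - (\<zeta> i * of_nat (q i))" if "i < p" for i
  proof -
    have "rotm a' b' c' d' *v w i = w i" unfolding rotm_works by (rule rot_frame_perp [OF w_perp [OF that]])
    then show ?thesis using yp [of "w i"] uw [OF that] xp(5) [OF that] by simp
  qed
  define S1 where "S1 = d * a' + (- b) * c'"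
  define S2 where "S2 = d * b' + (- b) * d'"
  define S3 where "S3 = (- c) * a' + a * c'"
  define S4 where "S4 = (- c) * b' + a * d'"
  have hm: "rotm a' b' c' d' ** rotm d (- b) (- c) a = rotm S1 S2 S3 S4"
    unfolding rotm_mult S1_def S2_def S3_def S4_def ..
  have detS: "S1 * S4 - S2 * S3 = 1"
  proof -
    have "S1 * S4 - S2 * S3 = (a * d - b * c) * (a' * d' - b' * c')"
      by (simp add: S1_def S2_def S3_def S4_def algebra_simps)
    then show ?thesis using det det' by simp
  qed
  have yx: "y = rotm S1 S2 S3 S4 *v x"
    unfolding hm [symmetric] y_def u_def by (simp add: matrix_vector_mul_assoc)
  have yD: "y \<in> D" unfolding yx using rotm_domain [OF detS] xD by (metis imageI)
  have rat: "complex_of_real t * of_int a' \<in> \<rat>" "complex_of_real t * of_int b' \<in> \<rat>" "of_int c' / complex_of_real t \<in> \<rat>" "of_int d' / complex_of_real t \<in> \<rat>"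
    using t by auto
  have det2: "(complex_of_real t * of_int a') * (of_int d' / of_real t) - (complex_of_real t * of_int b') * (of_int c' / of_real t) = 1"
    using t detc' by simp
  have c2f: "gen c2 = e2" "opp c2 = f2" "lvec c2 = l2"
    by (simp_all add: c2_def cusp_at_def F2)
  have inv: "tensor_coeff G ?d (\<phi> c2 (projJ J y)) (\<lambda>i. frame_at (a', b', c', d') t (\<sigma> i)) * omegaJ G c2 y ^ m * bil G y (gen c2) powi (- \<kappa>)
     = tensor_coeff G ?d (\<phi> c0 (projJ J x)) (\<lambda>i. V (\<sigma> i)) * omegaJ G c0 x ^ m * bil G x e powi (- \<kappa>)"
    unfolding frame_at_def prod.case yx \<kappa>
    by (rule invariant_leading_coeff [OF \<phi> c0 _ _ _ _ rat det2 g [unfolded hm] detS xD \<sigma> low])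
       (use c2 in \<open>simp_all add: c2_def [symmetric] c2f F2\<close>)
  interpret R: adapted_frame G e2 v2 f2 l2 w p q
    unfolding F2 by (rule rotated_frame [OF rat det2])
  define s where "s = of_real t * j"
  have s0: "s \<noteq> 0" using t j0 by (simp add: s_def)
  obtain \<rho>' \<zeta>' where ytp: "y = bil G y e2 *s R.frame_point (bil G y v2 / bil G y e2) \<rho>' \<zeta>'"
    using R.period_cone_frame_point [of y] yD mem_D_iff s0 unfolding s_def ye(1) by blast
  define \<tau>' where "\<tau>' = bil G y v2 / bil G y e2"
  have ytp': "y = s *s R.frame_point \<tau>' \<rho>' \<zeta>'" using ytp unfolding \<tau>'_def ye(1) s_def .
  have \<zeta>': "\<zeta>' i = \<zeta> i / s" if "i < p" for i
  proof -
    have "bil G y (w i) = s * (- (\<zeta>' i * of_nat (q i)))"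
      by (subst ytp') (simp only: bil_scale_left R.frame_point_pairings(5) [OF that])
    then show ?thesis using yw [OF that] q_pos [OF that] s0 by (simp add: field_simps)
  qed
  have tpD: "R.frame_point \<tau>' \<rho>' \<zeta>' \<in> D"
  proof -
    have "inverse s *s y \<in> D" by (rule component_scale [OF D yD]) (use s0 in simp)
    moreover have "inverse s *s y = R.frame_point \<tau>' \<rho>' \<zeta>'" using s0 by (subst ytp') (simp add: vector_smult_assoc)
    ultimately show ?thesis by simp
  qed
  have "projJ J y = projJ J (R.frame_point \<tau>' \<rho>' \<zeta>')" by (subst ytp') (rule projJ_scale [OF s0])
  then have "tensor_coeff G ?d (\<phi> c2 (projJ J y)) (\<lambda>i. frame_at (a', b', c', d') t (\<sigma> i))
      = of_real t powi \<kappa> * h (of_real (t\<^sup>2) * \<tau>') (\<lambda>i. of_real t * \<zeta>' i)"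
    using val [OF tpD] by (simp add: c2_def)
  also have "of_real (t\<^sup>2) * \<tau>' = (of_int c + of_int d * \<tau>) / j"
    unfolding \<tau>'_def ye using t by (simp add: power2_eq_square)
  also have "h ((of_int c + of_int d * \<tau>) / j) (\<lambda>i. of_real t * \<zeta>' i) = h ((of_int c + of_int d * \<tau>) / j) (\<lambda>i. \<zeta> i / j)"
    by (rule hcong) (use t in \<open>simp add: \<zeta>' s_def\<close>)
  finally have co2: "tensor_coeff G ?d (\<phi> c2 (projJ J y)) (\<lambda>i. frame_at (a', b', c', d') t (\<sigma> i))
      = of_real t powi \<kappa> * h ((of_int c + of_int d * \<tau>) / j) (\<lambda>i. \<zeta> i / j)" .
  have om0: "omegaJ G c0 x = ee \<rho>"
    by (subst omegaJ_eq) (simp_all add: c0 rels xp)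
  have om2: "omegaJ G c2 y = ee (\<rho> + (- of_int b * qform p q \<zeta> / (2 * j)))"
  proof -
    have "omegaJ G c2 y = ee (bil G y l2 / bil G y e2)"
      by (subst omegaJ_eq) (simp_all add: c2f R.rels)
    also have "bil G y l2 / bil G y e2 = bil G u l / j" unfolding ye using t by simp
    also have "\<dots> = \<rho> + (- of_int b * qform p q \<zeta> / (2 * j))"
      unfolding up xp using j0 by (simp add: field_simps) (simp add: j_def algebra_simps)
    finally show ?thesis .
  qed
  have ct: "complex_of_real t powi \<kappa> * complex_of_real t powi (- \<kappa>) = 1"
    using t(1) by (simp add: power_int_minus)
  have "h0 \<tau> \<zeta> * ee \<rho> ^ m = of_real t powi \<kappa> * h ((of_int c + of_int d * \<tau>) / j) (\<lambda>i. \<zeta> i / j)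
     * (ee \<rho> * ee (- of_int b * qform p q \<zeta> / (2 * j))) ^ m * (of_real t * j) powi (- \<kappa>)"
  proof -
    have v0: "tensor_coeff G ?d (\<phi> c0 (projJ J x)) (\<lambda>i. V (\<sigma> i)) = h0 \<tau> \<zeta>"
      unfolding x_def by (rule val0) (use xD in \<open>simp only: x_def\<close>)
    show ?thesis using inv unfolding v0 co2 om0 om2 c2f ye(1) xp(1) ee_add by simp
  qed
  also have "\<dots> = (complex_of_real t powi \<kappa> * complex_of_real t powi (- \<kappa>)) * (j powi (- \<kappa>) * ee (- of_int b * qform p q \<zeta> / (2 * j)) ^ m
      * h ((of_int c + of_int d * \<tau>) / j) (\<lambda>i. \<zeta> i / j)) * ee \<rho> ^ m"
    unfolding power_int_mult_distrib power_mult_distrib by (simp only: mult_ac)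
  finally have "h0 \<tau> \<zeta> = j powi (- \<kappa>) * ee (- of_int b * qform p q \<zeta> / (2 * j)) ^ m * h ((of_int c + of_int d * \<tau>) / j) (\<lambda>i. \<zeta> i / j)"
    unfolding ct by simp
  also have "ee (- of_int b * qform p q \<zeta> / (2 * j)) ^ m = ee (- of_nat m * of_int b * qform p q \<zeta> / (2 * j))"
    by (simp add: ee_of_nat_mult [symmetric] mult.assoc)
  finally show "h0 \<tau> \<zeta> = (of_int a + of_int b * \<tau>) powi (- \<kappa>) * ee (- of_nat m * of_int b * qform p q \<zeta> / (2 * (of_int a + of_int b * \<tau>)))
       * h ((of_int c + of_int d * \<tau>) / (of_int a + of_int b * \<tau>)) (\<lambda>i. \<zeta> i / (of_int a + of_int b * \<tau>))"
    unfolding j_def .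
qed

end

section \<open>Vanishing of all coefficients\<close>

context cusp_frame
begin

text \<open>
  Induction on the weight of \<open>\<sigma>\<close>. If more than \<open>\<lambda>_1\<close> factors are paired with \<open>l\<close>, the coefficient vanishes by
  antisymmetry. Otherwise its weight is at most \<open>\<lambda>_1\<close>; the coefficients of smaller weight vanish by
  induction, so the coefficient is a scalar Jacobi form below the singular weight. The families indexed
  by \<open>Rs\<close> are the Fourier expansions at the cusps of the finitely many representatives; the integrality
  conditions hold after rescaling of the \<open>w i\<close>.
\<close>

lemma coefficients_vanish:
  fixes \<Lambda> :: "int \<times> int \<times> int \<times> int \<Rightarrow> (complex^'N) set" and A :: "int \<times> int \<times> int \<times> int \<Rightarrow> complex^'N \<Rightarrow> 'N tensor"
  assumes m: "m > 0" and lam: "sorted_wrt (\<ge>) lam" and low: "2 * (k + int (lam ! 0)) < int p"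
    and \<phi>: "\<phi> \<in> jacobi_forms G D Gam J lam k m"
    and c0: "c0 \<in> cusps G D Gam J" "gen c0 = e" "opp c0 = f" "lvec c0 = l"
    and Rs: "finite Rs" "\<And>a b c d. (a, b, c, d) \<in> Rs \<Longrightarrow> a * d - b * c = 1"
      "\<And>a b c d. a * d - b * c = 1 \<Longrightarrow> \<exists>(a', b', c', d')\<in>Rs. rotm a' b' c' d' ** rotm d (- b) (- c) a \<in> GamJ_Z G Gam J"
    and t: "\<And>\<gamma>. \<gamma> \<in> Rs \<Longrightarrow> t \<gamma> \<noteq> 0" "\<And>\<gamma>. \<gamma> \<in> Rs \<Longrightarrow> complex_of_real (t \<gamma>) \<in> \<rat>"
      "\<And>\<gamma>. \<gamma> \<in> Rs \<Longrightarrow> cusp_at \<gamma> (t \<gamma>) \<in> cusps G D Gam J"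
    and \<Lambda>: "\<And>\<gamma>. \<gamma> \<in> Rs \<Longrightarrow> \<Lambda> \<gamma> \<subseteq> UJ_perp G J (cusp_at \<gamma> (t \<gamma>))"
    and hs: "\<And>\<gamma> z is. \<gamma> \<in> Rs \<Longrightarrow> z \<in> tube_domain G D (cusp_at \<gamma> (t \<gamma>)) \<Longrightarrow>
       ((\<lambda>x. A \<gamma> x is * exp (2 * of_real pi * \<i> * bil G x z)) has_sum
               \<phi> (cusp_at \<gamma> (t \<gamma>)) (projJ J (tube_point G (cusp_at \<gamma> (t \<gamma>)) z)) is) (\<Lambda> \<gamma>)"
    and pos: "\<And>\<gamma> x. \<gamma> \<in> Rs \<Longrightarrow> x \<in> \<Lambda> \<gamma> \<Longrightarrow> A \<gamma> x \<noteq> (\<lambda>is. 0) \<Longrightarrow>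
       Re (bil G (of_nat m *s lvec (cusp_at \<gamma> (t \<gamma>)) + x) (of_nat m *s lvec (cusp_at \<gamma> (t \<gamma>)) + x)) \<ge> 0"
    and int: "\<And>\<gamma> x i. \<gamma> \<in> Rs \<Longrightarrow> x \<in> \<Lambda> \<gamma> \<Longrightarrow> i < p \<Longrightarrow> bil G x (w i) / of_real (t \<gamma>) \<in> \<int>"
    and \<Lambda>0: "\<Lambda>0 \<subseteq> UJ_perp G J c0"
    and hs0: "\<And>z is. z \<in> tube_domain G D c0 \<Longrightarrow>
       ((\<lambda>x. A0 x is * exp (2 * of_real pi * \<i> * bil G x z)) has_sum \<phi> c0 (projJ J (tube_point G c0 z)) is) \<Lambda>0"
    and pos0: "\<And>x. x \<in> \<Lambda>0 \<Longrightarrow> A0 x \<noteq> (\<lambda>is. 0) \<Longrightarrow> Re (bil G (of_nat m *s lvec c0 + x) (of_nat m *s lvec c0 + x)) \<ge> 0"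
    and int0: "\<And>x i. x \<in> \<Lambda>0 \<Longrightarrow> i < p \<Longrightarrow> bil G x (w i) \<in> \<int>"
    and D0: "D0 > 0" "\<And>x. x \<in> \<Lambda>0 \<Longrightarrow> of_nat D0 * bil G x l \<in> \<int>"
    and \<sigma>: "\<And>i. i < sum_list lam \<Longrightarrow> \<sigma> i \<in> frame_set p" "\<And>i. i < sum_list lam \<Longrightarrow> \<sigma> i \<notin> {SE, SF}"
    and x: "x \<in> D"
  shows "tensor_coeff G (sum_list lam) (\<phi> c0 (projJ J x)) (\<lambda>i. V (\<sigma> i)) = 0"
  using \<sigma> x
proof (induction "nat (total_wt (sum_list lam) \<sigma> + int (sum_list lam))" arbitrary: \<sigma> x rule: less_induct)
  case less
  let ?d = "sum_list lam"
  note \<sigma> = less.prems(1,2) and x = less.prems(3)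
  have IH: "tensor_coeff G ?d (\<phi> c0 (projJ J y)) (\<lambda>i. V (\<sigma>' i)) = 0"
    if "y \<in> D" "\<sigma>' \<in> PiE {..<?d} (\<lambda>_. frame_set p)" "\<And>i. i < ?d \<Longrightarrow> \<sigma>' i \<notin> {SE, SF}" "total_wt ?d \<sigma>' < total_wt ?d \<sigma>" for \<sigma>' y
    by (rule less.hyps) (use that total_wt_ge [of ?d \<sigma>'] in auto)
  have in_schur: "\<phi> c0 (projJ J x) \<in> schur G lam (VI G c0)" if "x \<in> D" for x
    using \<phi> c0 that unfolding jacobi_forms_def holomorphic_sections_def VJ_def by blast
  show ?case
  proof (cases "card {i. i < ?d \<and> \<sigma> i = SL} > lam ! 0")
    case True
    then show ?thesis
      by (intro tensor_coeff_schur_many_equal [OF lam in_schur [OF x], of "{i. i < ?d \<and> \<sigma> i = SL}" _ l]) auto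
  next
    case False
    define \<kappa> where "\<kappa> = k + total_wt ?d \<sigma>"
    have "total_wt ?d \<sigma> \<le> int (lam ! 0)" using total_wt_le [of ?d \<sigma>] False by linarith
    then have low': "2 * \<kappa> < int p" using low by (simp add: \<kappa>_def)
    \<comment> \<open>the expansion at the reference cusp is the case \<open>t = 1\<close>\<close>
    define N0 where "N0 = (\<lambda>x. Re (bil G x l) / 1\<^sup>2)"
    define R0 where "R0 = (\<lambda>x i. \<lfloor>Re (bil G x (w i) / of_real 1)\<rfloor>)"
    define b0 where "b0 = (\<lambda>x. of_real 1 powi (- \<kappa>) * tensor_coeff G ?d (A0 x) (\<lambda>i. V (\<sigma> i)))"
    define h0 where "h0 = theta_value p \<Lambda>0 N0 R0 b0"
    have vU: "v \<in> UJ_line G J c0" using vJ by (simp add: UJ_line_def VI_def c0 rels)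
    note exp0 = boundary_expansion [OF c0(2-4) vU frame_point_mem_D_iff \<Lambda>0 _ _ one_neq_zero _ N0_def R0_def b0_def]
    have int0': "bil G x (w i) / of_real 1 \<in> \<int>" if "x \<in> \<Lambda>0" "i < p" for x i using int0 [OF that] by simp
    have th0: "theta_expansion p q m \<Lambda>0 N0 R0 b0 h0" unfolding h0_def by (rule exp0(1)) (rule hs0 pos0 int0'; assumption)+
    have val0: "tensor_coeff G ?d (\<phi> c0 (projJ J (frame_point \<tau> \<rho> \<zeta>))) (\<lambda>i. V (\<sigma> i)) = h0 \<tau> \<zeta>" if "frame_point \<tau> \<rho> \<zeta> \<in> D" for \<tau> \<rho> \<zeta>
    proof -
      have "tensor_coeff G ?d (\<phi> c0 (projJ J (frame_point \<tau> \<rho> \<zeta>))) (\<lambda>i. V (\<sigma> i))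
          = of_real 1 powi \<kappa> * theta_value p \<Lambda>0 N0 R0 b0 (of_real (1\<^sup>2) * \<tau>) (\<lambda>i. of_real 1 * \<zeta> i)"
        by (rule exp0(2)) (rule hs0 pos0 int0' that; assumption)+
      then show ?thesis by (simp add: h0_def)
    qed
    define N where "N \<gamma> = (\<lambda>x. Re (bil G x (lvec (cusp_at \<gamma> (t \<gamma>)))) / (t \<gamma>)\<^sup>2)" for \<gamma>
    define R where "R \<gamma> = (\<lambda>x i. \<lfloor>Re (bil G x (w i) / of_real (t \<gamma>))\<rfloor>)" for \<gamma>
    define b where "b \<gamma> = (\<lambda>x. of_real (t \<gamma>) powi (- \<kappa>) * tensor_coeff G ?d (A \<gamma> x) (\<lambda>i. frame_at \<gamma> (t \<gamma>) (\<sigma> i)))" for \<gamma>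
    define h where "h \<gamma> = theta_value p (\<Lambda> \<gamma>) (N \<gamma>) (R \<gamma>) (b \<gamma>)" for \<gamma>
    have hcong: "h \<gamma> \<tau> \<zeta> = h \<gamma> \<tau> \<zeta>'" if "\<And>i. i < p \<Longrightarrow> \<zeta> i = \<zeta>' i" for \<gamma> \<tau> \<zeta> \<zeta>'
      unfolding h_def by (rule theta_value_cong [OF that])
    have exp: "theta_expansion p q m (\<Lambda> \<gamma>) (N \<gamma>) (R \<gamma>) (b \<gamma>) (h \<gamma>) \<and>
      (a * d - b' * c = 1 \<longrightarrow> (\<forall>a1 b1 c1 d1. a1 * d1 - b1 * c1 = 1 \<longrightarrow> rotm a b' c d ** rotm d1 (- b1) (- c1) a1 \<in> GamJ_Z G Gam J \<longrightarrow>
         jacobi_related p q m \<kappa> a1 b1 c1 d1 h0 (h \<gamma>)))" if \<gamma>: "\<gamma> \<in> Rs" "\<gamma> = (a, b', c, d)" for \<gamma> a b' c d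
    proof -
      let ?t = "complex_of_real (t \<gamma>)"
      let ?c = "cusp_at \<gamma> (t \<gamma>)"
      note t0 = t(1) [OF \<gamma>(1)]
      define e2 where "e2 = (?t * of_int a) *s e + (?t * of_int b') *s v"
      define v2 where "v2 = (of_int c / ?t) *s e + (of_int d / ?t) *s v"
      define f2 where "f2 = (of_int d / ?t) *s f - (of_int c / ?t) *s l"
      define l2 where "l2 = (?t * of_int a) *s l - (?t * of_int b') *s f"
      note F2 = e2_def v2_def f2_def l2_def
      have det: "a * d - b' * c = 1" using Rs(2) \<gamma> by blast
      have "complex_of_int a * of_int d - of_int b' * of_int c = 1"
        using det by (metis of_int_1 of_int_diff of_int_mult)
      then have det2: "(?t * of_int a) * (of_int d / ?t) - (?t * of_int b') * (of_int c / ?t) = 1"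
        using t0 by simp
      have rat: "?t * of_int a \<in> \<rat>" "?t * of_int b' \<in> \<rat>" "of_int c / ?t \<in> \<rat>" "of_int d / ?t \<in> \<rat>"
        using t(2) [OF \<gamma>(1)] by auto
      interpret R: adapted_frame G e2 v2 f2 l2 w p q
        unfolding F2 by (rule rotated_frame [OF rat det2])
      have c2: "gen ?c = e2" "opp ?c = f2" "lvec ?c = l2"
        by (simp_all add: cusp_at_def F2 \<gamma>(2))
      have v2U: "v2 \<in> UJ_line G J ?c"
        unfolding UJ_line_def VI_def c2 using span_J rat by (auto simp: R.rels) (auto simp: v2_def)
      have tpD: "R.frame_point \<tau> \<rho> \<zeta> \<in> D \<longleftrightarrow> 0 < Im \<tau> \<and> (\<Sum>i<p. real (q i) * (Im (\<zeta> i))\<^sup>2) < 2 * Im \<tau> * Im \<rho>" for \<tau> \<rho> \<zeta>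
      proof -
        have "height G e v (R.frame_point \<tau> \<rho> \<zeta>) = Im \<tau>"
          using R.height_frame_point [of \<tau> \<rho> \<zeta>] height_rotated [OF rat det2, of G e v] by (simp add: e2_def v2_def)
        then show ?thesis unfolding mem_D_iff R.frame_point_in_period_cone by auto
      qed
      have fv: "frame_at \<gamma> (t \<gamma>) s = R.V s" for s
        by (cases s) (simp_all add: frame_at_def \<gamma>(2) F2)
      note ex = R.boundary_expansion [OF c2 v2U tpD \<Lambda> [OF \<gamma>(1)] _ _ t0 _
          N_def [of \<gamma>, unfolded c2] R_def [of \<gamma>] b_def [of \<gamma>, unfolded fv]]
      have th: "theta_expansion p q m (\<Lambda> \<gamma>) (N \<gamma>) (R \<gamma>) (b \<gamma>) (h \<gamma>)"
        unfolding h_def by (rule ex(1)) (rule hs [OF \<gamma>(1)] pos [OF \<gamma>(1)] int [OF \<gamma>(1)]; assumption)+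
      have val: "tensor_coeff G ?d (\<phi> ?c (projJ J (R.frame_point \<tau> \<rho> \<zeta>))) (\<lambda>i. frame_at \<gamma> (t \<gamma>) (\<sigma> i))
         = ?t powi \<kappa> * h \<gamma> (of_real ((t \<gamma>)\<^sup>2) * \<tau>) (\<lambda>i. ?t * \<zeta> i)" if "R.frame_point \<tau> \<rho> \<zeta> \<in> D" for \<tau> \<rho> \<zeta>
        unfolding h_def fv by (rule ex(2)) (rule hs [OF \<gamma>(1)] pos [OF \<gamma>(1)] int [OF \<gamma>(1)] that; assumption)+
      have rel: "jacobi_related p q m \<kappa> a1 b1 c1 d1 h0 (h \<gamma>)"
        if "a1 * d1 - b1 * c1 = 1" "rotm a b' c d ** rotm d1 (- b1) (- c1) a1 \<in> GamJ_Z G Gam J" for a1 b1 c1 d1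
      proof -
        have cg: "cusp_at (a, b', c, d) (t \<gamma>) = ?c" "frame_at (a, b', c, d) (t \<gamma>) = frame_at \<gamma> (t \<gamma>)"
          unfolding \<gamma>(2) [symmetric] by (rule refl)+
        show ?thesis
          by (rule jacobi_related_at_cusp [where t = "t \<gamma>" and h = "h \<gamma>" and h0 = h0 and \<sigma> = \<sigma> and lam = lam
                and a' = a and b' = b' and c' = c and d' = d,
                unfolded cg, OF \<phi> c0 t0 t(2) [OF \<gamma>(1)] t(3) [OF \<gamma>(1)] det that(2,1) _ _ _ \<kappa>_def _ _ _ F2])
             (rule \<sigma> IH val0 val hcong; assumption)+
      qed
      show ?thesis using th rel by blast
    qed
    have good: "theta_expansion p q m (\<Lambda> \<gamma>) (N \<gamma>) (R \<gamma>) (b \<gamma>) (h \<gamma>)" if "\<gamma> \<in> Rs" for \<gamma>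
      using exp that by (cases \<gamma>) blast
    have rel: "\<exists>\<gamma>\<in>Rs. jacobi_related p q m \<kappa> a1 b1 c1 d1 h0 (h \<gamma>)" if det: "a1 * d1 - b1 * c1 = 1" for a1 b1 c1 d1
    proof -
      obtain a b c d where abcd: "(a, b, c, d) \<in> Rs" "rotm a b c d ** rotm d1 (- b1) (- c1) a1 \<in> GamJ_Z G Gam J"
        using Rs(3) [OF det] by auto
      then show ?thesis using exp [OF abcd(1) refl] Rs(2) [OF abcd(1)] det by blast
    qed
    have members0: "bil G y e = 0" "bil G y f = 0" "bil G y v = 0" "y \<in> coords \<rat>" if "y \<in> \<Lambda>0" for y
      using UJ_perp_members [OF c0(2,3) vU, of y] \<Lambda>0 that by auto
    have real0: "bil G y l = of_real (Re (bil G y l))" if "y \<in> \<Lambda>0" for y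
    proof -
      have "bil G y l \<in> \<real>" using bil_in_Rats [OF members0(4) [OF that] rational(4)] Rats_subset_Reals by blast
      then show ?thesis by simp
    qed
    have R0': "of_int (R0 y i) = bil G y (w i)" if "y \<in> \<Lambda>0" "i < p" for y i
      using int0 [OF that] by (auto simp: R0_def elim!: Ints_cases)
    have b0: "b0 y = 0" if y: "y \<in> \<Lambda>0" for y
    proof (rule low_weight_theta_expansion_vanishes [where p = p and q = q and m = m and \<kappa> = \<kappa> and f = h0 and X = \<Lambda>0 and N = N0 and R = R0
            and a = b0 and Js = Rs and XX = \<Lambda> and NN = N and RR = R and aa = b and g = h and D = "int D0" and ?l0.0 = y])
      show "of_int (int D0) * N0 z \<in> \<int>" if z: "z \<in> \<Lambda>0" for z
      proof -
        obtain k' where k': "of_nat D0 * bil G z l = of_int k'" using D0(2) [OF z] by (rule Ints_cases)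
        have "Re (of_nat D0 * bil G z l) = of_int k'" unfolding k' by simp
        then have "of_int (int D0) * N0 z = of_int k'" by (simp add: N0_def)
        then show ?thesis by simp
      qed
      show "y1 = y2" if "y1 \<in> \<Lambda>0" "y2 \<in> \<Lambda>0" "N0 y1 = N0 y2" "\<forall>i<p. R0 y1 i = R0 y2 i" for y1 y2
      proof (rule UJ_perp_determined)
        show "bil G y1 l = bil G y2 l" using that(3) real0 [OF that(1)] real0 [OF that(2)] by (simp add: N0_def)
        show "bil G y1 (w i) = bil G y2 (w i)" if "i < p" for i
          using R0' [OF \<open>y1 \<in> \<Lambda>0\<close> that] R0' [OF \<open>y2 \<in> \<Lambda>0\<close> that] \<open>\<forall>i<p. R0 y1 i = R0 y2 i\<close> that by simp
      qed (use members0 that in auto)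
    qed (use q_pos m low' th0 D0(1) Rs(1) good rel y in auto)
    have h0: "h0 \<tau> \<zeta> = 0" for \<tau> \<zeta>
      unfolding h0_def theta_value_def by (subst infsum_cong [where g = "\<lambda>_. 0"]) (simp_all add: b0)
    have xe: "bil G x e \<noteq> 0" using x unfolding mem_D_iff by (auto simp: height_def)
    have xpc: "x \<in> period_cone G" using x mem_D_iff by blast
    obtain \<rho> \<zeta> where xt: "x = bil G x e *s frame_point (bil G x v / bil G x e) \<rho> \<zeta>"
      using period_cone_frame_point [OF xpc xe] by blast
    have "inverse (bil G x e) *s x = frame_point (bil G x v / bil G x e) \<rho> \<zeta>"
      using xe by (subst (2) xt) (simp add: vector_smult_assoc)
    moreover have "inverse (bil G x e) *s x \<in> D" by (rule component_scale [OF D x]) (use xe in simp)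
    ultimately have tD: "frame_point (bil G x v / bil G x e) \<rho> \<zeta> \<in> D" by simp
    have "projJ J x = projJ J (frame_point (bil G x v / bil G x e) \<rho> \<zeta>)" by (subst xt) (rule projJ_scale [OF xe])
    then show ?thesis using val0 [OF tD] h0 by simp
  qed
qed

end

lemma full_lattice_subset: "full_lattice W \<Lambda> \<Longrightarrow> \<Lambda> \<subseteq> W"
proof
  fix x assume "full_lattice W \<Lambda>" "x \<in> \<Lambda>"
  then obtain B where "span_over \<rat> B = W" "x \<in> span_over \<int> B" unfolding full_lattice_def by blast
  then show "x \<in> W" unfolding span_over_def using Ints_subset_Rats by blast
qed

context cusp_frame
begin

text \<open>
  The vectors \<open>v\<close> and \<open>w i\<close> are a rational basis of \<open>U(J)_\<rat>\<^sup>\<perp>\<close>. So the zero section has a Fourier expansion in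
  the sense of \<open>holomorphic_at_cusp\<close>.
\<close>

lemma full_lattice_exists:
  assumes c: "gen c = e" "opp c = f"
  shows "\<exists>\<Lambda>. full_lattice (UJ_perp G J c) \<Lambda>"
proof -
  let ?B = "insert v (w ` {..<p})"
  have vU: "v \<in> UJ_line G J c" using vJ by (simp add: UJ_line_def VI_def c rels)
  have vw: "bil G v (w i) = 0" if "i < p" for i
    using w_rels(2) [OF that] by (simp add: bil_sym [OF sym, of v])
  have "vec.independent ?B"
    unfolding vec.independent_explicit_finite_subsets
  proof (intro allI ballI impI)
    fix A u s assume A: "A \<subseteq> ?B" "finite A" and sum: "(\<Sum>x\<in>A. u x *s x) = 0" and s: "s \<in> A"
    \<comment> \<open>a vector pairing nontrivially with \<open>s\<close> only\<close>
    obtain t where t: "bil G s t \<noteq> 0" "\<And>x. x \<in> ?B \<Longrightarrow> x \<noteq> s \<Longrightarrow> bil G x t = 0"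
    proof (cases "s = v")
      case True
      show ?thesis by (rule that [of l]) (use True in \<open>auto simp: rels w_rels\<close>)
    next
      case False
      then obtain i where i: "i < p" "s = w i" using A s by blast
      show ?thesis
      proof (rule that [of "w i"])
        show "bil G s (w i) \<noteq> 0" using i q_pos w_orthogonal by simp
        show "bil G x (w i) = 0" if "x \<in> ?B" "x \<noteq> s" for x
          using that i vw w_orthogonal by auto
      qed
    qed
    have "0 = bil G (\<Sum>x\<in>A. u x *s x) t" by (simp add: sum)
    also have "\<dots> = (\<Sum>x\<in>A. if x = s then u s * bil G s t else 0)"
      unfolding bil_sum_left bil_scale_left by (intro sum.cong refl) (use A t(2) in auto)
    also have "\<dots> = u s * bil G s t" using A s by simp
    finally show "u s = 0" using t(1) by simp
  qed
  moreover have "span_over \<rat> ?B = UJ_perp G J c"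
  proof (intro equalityI subsetI)
    fix z assume z: "z \<in> span_over \<rat> ?B"
    have "?B \<subseteq> coords \<rat>" using rational w_rational by auto
    then have "z \<in> coords \<rat>" using z by (rule span_over_rational)
    moreover have zero: "bil G z y = 0" if "\<And>x. x \<in> ?B \<Longrightarrow> bil G x y = 0" for y
    proof -
      have "bil G y z = 0" by (rule bil_span_over_zero [OF _ z]) (use that bil_sym [OF sym, of y] in auto)
      then show ?thesis by (simp add: bil_sym [OF sym, of z])
    qed
    moreover have "bil G z e = 0" "bil G z f = 0" "bil G z v = 0"
      by (rule zero; auto simp: rels w_rels)+
    moreover have "bil G z y = 0" if y: "y \<in> UJ_line G J c" for y
    proof -
      obtain a b where "y = a *s e + b *s v" using y span_J [of y] unfolding UJ_line_def by blast
      then show ?thesis using \<open>bil G z e = 0\<close> \<open>bil G z v = 0\<close> by (simp add: bil_linear)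
    qed
    ultimately show "z \<in> UJ_perp G J c" by (simp add: UJ_perp_def perp_def VI_def c)
  next
    fix x assume "x \<in> UJ_perp G J c"
    note x = UJ_perp_members [OF c vU this]
    have "(\<Sum>i<k. (- bil G x (w i) / of_nat (q i)) *s w i) \<in> span_over \<rat> ?B" if "k \<le> p" for k
      using that
    proof (induction k)
      case 0
      have "0 *s v \<in> span_over \<rat> ?B" by (intro span_Rats_scale span_over_base) auto
      then show ?case by simp
    next
      case (Suc k)
      then have "(- bil G x (w k) / of_nat (q k)) *s w k \<in> span_over \<rat> ?B"
        using bil_in_Rats [OF x(1) w_rational, of k] by (intro span_Rats_scale span_over_base) auto
      with Suc show ?case unfolding sum.lessThan_Suc by (intro span_Rats_add) auto
    qed
    from this [OF order_refl]
    have "bil G x l *s v + (\<Sum>i<p. (- bil G x (w i) / of_nat (q i)) *s w i) \<in> span_over \<rat> ?B"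
      by (rule span_Rats_add [rotated]) (intro span_Rats_scale span_over_base bil_in_Rats [OF x(1) rational(4)], auto)
    also have "bil G x l *s v + (\<Sum>i<p. (- bil G x (w i) / of_nat (q i)) *s w i) = x"
      by (subst (3) expand [of x]) (simp add: x sum_negf [symmetric] vec_eq_iff)
    finally show "x \<in> span_over \<rat> ?B" .
  qed
  ultimately have "full_lattice (UJ_perp G J c) (span_over \<int> ?B)"
    unfolding full_lattice_def by (intro exI [of _ ?B]) simp
  then show ?thesis ..
qed

text \<open>
  It remains to choose the data of \<open>coefficients_vanish\<close>: representatives, scaling factors, Fourier
  expansions, and a common denominator of their exponents.
\<close>

lemma section_vanishes:
  assumes m: "m > 0" and lam: "sorted_wrt (\<ge>) lam" and low: "2 * (k + int (lam ! 0)) < int p"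
    and \<phi>: "\<phi> \<in> jacobi_forms G D Gam J lam k m"
    and c0: "c0 \<in> cusps G D Gam J" "gen c0 = e" "opp c0 = f" "lvec c0 = l"
    and x: "x \<in> D"
  shows "\<phi> c0 (projJ J x) = (\<lambda>is. 0)"
proof -
  let ?d = "sum_list lam"
  obtain Rs :: "(int \<times> int \<times> int \<times> int) set" where Rs: "finite Rs"
    "\<And>a b c d. (a, b, c, d) \<in> Rs \<Longrightarrow> a * d - b * c = 1"
    "\<And>a b c d. a * d - b * c = 1 \<Longrightarrow> \<exists>(a', b', c', d')\<in>Rs. rotm a' b' c' d' ** rotm d (- b) (- c) a \<in> GamJ_Z G Gam J"
    by (rule finite_representatives) blast
  \<comment> \<open>every rotated frame belongs to a cusp, once its first vector is scaled to be primitive\<close>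
  have "\<exists>t::real. t \<noteq> 0 \<and> complex_of_real t \<in> \<rat> \<and> cusp_at \<gamma> t \<in> cusps G D Gam J" if \<gamma>: "\<gamma> \<in> Rs" for \<gamma>
  proof -
    obtain a b c d where abcd: "\<gamma> = (a, b, c, d)" by (cases \<gamma>)
    have det: "complex_of_int a * of_int d - of_int b * of_int c = 1"
      using Rs(2) [of a b c d] \<gamma> abcd by (metis of_int_1 of_int_diff of_int_mult)
    let ?u = "of_int a *s e + of_int b *s v"
    have "bil G ?u (of_int d *s f - of_int c *s l) = 1" using det by (simp add: bil_linear rels mult.commute)
    moreover have "bil G 0 (of_int d *s f - of_int c *s l) = 0" by (simp add: bil_def)
    ultimately have "?u \<noteq> 0" by (metis zero_neq_one)
    moreover have "?u \<in> coords \<rat>" using rational by (intro coords_Rats_intros) auto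
    ultimately obtain t :: complex where t: "t \<in> \<rat>" "t \<noteq> 0" "t *s ?u \<in> coords \<int>"
        "\<And>s. s \<in> \<rat> \<Longrightarrow> s *s (t *s ?u) \<in> coords \<int> \<Longrightarrow> s \<in> \<int>"
      using exists_primitive_multiple by metis
    have tu: "t *s ?u = (t * of_int a) *s e + (t * of_int b) *s v" by (simp add: vec_eq_iff algebra_simps)
    have tr: "complex_of_real (Re t) = t" using t(1) Rats_subset_Reals by (auto simp: complex_is_Real_iff complex_eq_iff)
    have det2: "(t * of_int a) * (of_int d / t) - (t * of_int b) * (of_int c / t) = 1" using det t(2) by simp
    have "cusp_at \<gamma> (Re t) \<in> cusps G D Gam J"
      unfolding abcd cusp_at_def prod.case tr
      by (rule cusp_rotated [OF _ _ _ _ det2 t(3,4) [unfolded tu]]) (use t(1) in auto)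
    then show ?thesis using t tr by (intro exI [of _ "Re t"]) auto
  qed
  then obtain t :: "int \<times> int \<times> int \<times> int \<Rightarrow> real" where t: "\<And>\<gamma>. \<gamma> \<in> Rs \<Longrightarrow> t \<gamma> \<noteq> 0"
      "\<And>\<gamma>. \<gamma> \<in> Rs \<Longrightarrow> complex_of_real (t \<gamma>) \<in> \<rat>" "\<And>\<gamma>. \<gamma> \<in> Rs \<Longrightarrow> cusp_at \<gamma> (t \<gamma>) \<in> cusps G D Gam J"
    by metis
  define expansion where "expansion c \<Lambda> a \<longleftrightarrow> full_lattice (UJ_perp G J c) \<Lambda> \<and>
      (\<forall>z\<in>tube_domain G D c. \<forall>is. ((\<lambda>x. a x is * exp (2 * of_real pi * \<i> * bil G x z)) has_sum \<phi> c (projJ J (tube_point G c z)) is) \<Lambda>) \<and>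
      (\<forall>x\<in>\<Lambda>. a x \<noteq> (\<lambda>is. 0) \<longrightarrow> Re (bil G (of_nat m *s lvec c + x) (of_nat m *s lvec c + x)) \<ge> 0)" for c \<Lambda> and a :: "complex^'N \<Rightarrow> 'N tensor"
  have "\<forall>c\<in>cusps G D Gam J. \<exists>\<Lambda> a. expansion c \<Lambda> a"
    using \<phi> by (simp add: jacobi_forms_def holomorphic_at_cusp_def expansion_def)
  then obtain \<Lambda> where "\<forall>c\<in>cusps G D Gam J. \<exists>a. expansion c (\<Lambda> c) a" by (rule bchoice [THEN exE])
  then obtain A where ex: "\<forall>c\<in>cusps G D Gam J. expansion c (\<Lambda> c) (A c)" by (rule bchoice [THEN exE])
  have full: "\<And>c. c \<in> cusps G D Gam J \<Longrightarrow> full_lattice (UJ_perp G J c) (\<Lambda> c)"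
    and hs: "\<And>c z is. c \<in> cusps G D Gam J \<Longrightarrow> z \<in> tube_domain G D c \<Longrightarrow>
       ((\<lambda>x. A c x is * exp (2 * of_real pi * \<i> * bil G x z)) has_sum \<phi> c (projJ J (tube_point G c z)) is) (\<Lambda> c)"
    and pos: "\<And>c x. c \<in> cusps G D Gam J \<Longrightarrow> x \<in> \<Lambda> c \<Longrightarrow> A c x \<noteq> (\<lambda>is. 0) \<Longrightarrow>
       Re (bil G (of_nat m *s lvec c + x) (of_nat m *s lvec c + x)) \<ge> 0"
    using ex unfolding expansion_def by blast+
  have \<Lambda>: "\<Lambda> c \<subseteq> UJ_perp G J c" if "c \<in> cusps G D Gam J" for c
    using full_lattice_subset [OF full [OF that]] .
  have rat: "UJ_perp G J c \<subseteq> coords \<rat>" for c by (auto simp: UJ_perp_def perp_def)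
  \<comment> \<open>pairs of a cusp and a scaling factor, with the index of a vector \<open>w i\<close>: all exponents in \<open>\<zeta>\<close> that have to become integral\<close>
  define I where "I = insert (c0, 1) ((\<lambda>\<gamma>. (cusp_at \<gamma> (t \<gamma>), t \<gamma>)) ` Rs) \<times> {..<p}"
  obtain N :: nat where N: "N > 0" "\<And>j. j \<in> I \<Longrightarrow> (case j of ((c, s), i) \<Rightarrow> \<forall>x\<in>\<Lambda> c. of_nat N * (bil G x (w i) / of_real s) \<in> \<int>)"
  proof -
    have "\<exists>N::nat. N > 0 \<and> (\<forall>j\<in>I. case j of ((c, s), i) \<Rightarrow> \<forall>x\<in>\<Lambda> c. of_nat N * (bil G x (w i) / of_real s) \<in> \<int>)"
    proof (rule finite_common_multiple)
      show "finite I" using Rs(1) by (simp add: I_def)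
      fix j assume j: "j \<in> I"
      obtain c s i where csi: "j = ((c, s), i)" by (metis surj_pair)
      have c: "c \<in> cusps G D Gam J" "complex_of_real s \<in> \<rat>" "i < p" using j t c0 by (auto simp: I_def csi)
      have "(1 / of_real s) *s w i \<in> coords \<rat>" using c w_rational by (intro coords_Rats_scale) auto
      from full_lattice_denominator [OF full [OF c(1)] rat this]
      show "\<exists>N::nat. N > 0 \<and> (case j of ((c, s), i) \<Rightarrow> \<forall>x\<in>\<Lambda> c. of_nat N * (bil G x (w i) / of_real s) \<in> \<int>)"
        by (simp add: csi bil_linear)
    next
      fix j and N k :: nat
      assume *: "case j of ((c, s), i) \<Rightarrow> \<forall>x\<in>\<Lambda> c. of_nat N * (bil G x (w i) / of_real s) \<in> \<int>"
      obtain c s i where csi: "j = ((c, s), i)" by (metis surj_pair)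
      have "of_nat (k * N) * (bil G x (w i) / of_real s) \<in> \<int>" if "x \<in> \<Lambda> c" for x
      proof -
        have "of_nat k * (of_nat N * (bil G x (w i) / of_real s)) \<in> \<int>" using * that unfolding csi prod.case by (intro Ints_mult [OF Ints_of_nat bspec [of "\<Lambda> c"]])
        then show ?thesis by (simp add: mult.assoc)
      qed
      then show "case j of ((c, s), i) \<Rightarrow> \<forall>x\<in>\<Lambda> c. of_nat (k * N) * (bil G x (w i) / of_real s) \<in> \<int>"
        by (simp add: csi)
    qed
    then show ?thesis using that by blast
  qed
  obtain D0 :: nat where D0: "D0 > 0" "\<And>x. x \<in> \<Lambda> c0 \<Longrightarrow> of_nat D0 * bil G x l \<in> \<int>"
    using full_lattice_denominator [OF full [OF c0(1)] rat rational(4)] by blast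
  let ?w = "\<lambda>i. of_nat N *s w i"
  interpret S: cusp_frame G e v f l ?w p "\<lambda>i. N\<^sup>2 * q i" D J Gam
    by (intro cusp_frame.intro cusp_frame_axioms.intro rescale N(1) D J eJ vJ x0 UJ sub fin)
  have int: "bil G x (?w i) / of_real s \<in> \<int>" if "(c, s) \<in> insert (c0, 1) ((\<lambda>\<gamma>. (cusp_at \<gamma> (t \<gamma>), t \<gamma>)) ` Rs)" "x \<in> \<Lambda> c" "i < p" for c s x i
  proof -
    have "((c, s), i) \<in> I" using that by (simp add: I_def)
    from N(2) [OF this] show ?thesis using that(2) by (simp add: bil_linear)
  qed
  have schur: "\<phi> c0 (projJ J x) \<in> schur G lam (VI G c0)"
    using \<phi> c0 x unfolding jacobi_forms_def holomorphic_sections_def VJ_def by blast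
  show ?thesis
  proof (rule tensor_eq_zero [OF finite_frame_set [of p] _ S.component_frame])
    show "\<phi> c0 (projJ J x) is = 0" if "length is \<noteq> ?d" for "is" using schur_support [OF schur that] .
    fix \<sigma> assume \<sigma>: "\<sigma> \<in> PiE {..<?d} (\<lambda>_. frame_set p)"
    show "tensor_coeff G ?d (\<phi> c0 (projJ J x)) (\<lambda>i. S.V (\<sigma> i)) = 0"
    proof (cases "\<exists>i<?d. \<sigma> i \<in> {SE, SF}")
      case True
      then obtain i where "i < ?d" "\<sigma> i \<in> {SE, SF}" by blast
      then show ?thesis by (intro tensor_coeff_schur_zero [OF schur]) (auto simp: VI_def c0)
    next
      case False
      show ?thesis
      proof (rule S.coefficients_vanish [OF m lam low \<phi> c0 Rs t, where \<Lambda> = "\<lambda>\<gamma>. \<Lambda> (cusp_at \<gamma> (t \<gamma>))" and A = "\<lambda>\<gamma>. A (cusp_at \<gamma> (t \<gamma>))"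
            and ?\<Lambda>0.0 = "\<Lambda> c0" and ?A0.0 = "A c0" and ?D0.0 = D0])
        show "bil G x (?w i) / of_real (t \<gamma>) \<in> \<int>" if "\<gamma> \<in> Rs" "x \<in> \<Lambda> (cusp_at \<gamma> (t \<gamma>))" "i < p" for \<gamma> x i
          by (rule int [OF _ that(2,3)]) (use that in auto)
        show "bil G x (?w i) \<in> \<int>" if "x \<in> \<Lambda> c0" "i < p" for x i
          using int [of c0 1 x i] that by simp
        show "\<sigma> i \<in> frame_set p" "\<sigma> i \<notin> {SE, SF}" if "i < ?d" for i using \<sigma> False that by auto
      qed (assumption | rule \<Lambda> hs pos c0 t D0 x)+
    qed
  qed
qed

end

lemma cusp_frame_exists:
  assumes lat: "is_lattice G" and sig: "has_signature G 2 n"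
    and D: "D \<in> components (period_cone G)"
    and sub: "subgroup Gam (Oplus G D)" and fin: "finite (rcosets\<^bsub>Oplus G D\<^esub> Gam)"
    and J: "primitive_isotropic G J 2" and c: "c \<in> cusps G D Gam J"
  obtains v w p q where "cusp_frame G (gen c) v (opp c) (lvec c) w p q D J Gam" "n \<le> p + 2"
proof -
  have sym: "transpose G = G" using lat by (simp add: is_lattice_def)
  obtain v where v: "is_vJ G D Gam J c v" "bil G v (lvec c) = 1" using c by (auto simp: cusps_def)
  have JZ: "J \<subseteq> coords \<int>" and J0: "\<And>x y. x \<in> J \<Longrightarrow> y \<in> J \<Longrightarrow> bil G x y = 0"
    using J by (auto simp: primitive_isotropic_def)
  have JQ: "J \<subseteq> coords \<rat>" using JZ coords_mono [OF Ints_subset_Rats] by blast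
  have g: "gen c \<in> J" using c by (simp add: cusps_def)
  have vJ: "v \<in> span_over \<rat> J" and vI: "v \<in> VI G c" and cl: "v \<in> closure (cone_I G D c)"
    and UJ: "UJ_Z G Gam J = {translation G (gen c) (of_int s *s v) | s. True}"
    using v(1) by (auto simp: is_vJ_def UJ_line_def)
  have Jv: "bil G x v = 0" if "x \<in> J" for x by (rule bil_span_over_zero [OF J0 [OF that] vJ])
  have vv: "bil G v v = 0"
    by (rule bil_span_over_zero [OF _ vJ]) (simp add: Jv bil_sym [OF sym, of v])
  have cc: "opp c \<in> coords \<rat>" "bil G (opp c) (opp c) = 0" "bil G (gen c) (opp c) = 1"
      "lvec c \<in> coords \<rat>" "lvec c \<in> VI G c" "bil G (lvec c) (lvec c) = 0"
    using c by (auto simp: cusps_def)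
  interpret H: hyperbolic G "gen c" v "opp c" "lvec c"
  proof unfold_locales
    show "bil G (gen c) (lvec c) = 0" "bil G (opp c) (lvec c) = 0"
      using cc(5) by (simp_all add: VI_def bil_sym [OF sym, of "gen c"] bil_sym [OF sym, of "opp c"])
  qed (use sym JQ g cc v J0 Jv vv vI span_over_rational [OF JQ vJ] in \<open>auto simp: VI_def\<close>)
  obtain w p q where A: "adapted_frame G (gen c) v (opp c) (lvec c) w p q" "n \<le> p + 2"
    by (rule H.exists_adapted_frame [OF sig])
  have "\<exists>x0\<in>D. height G (gen c) v x0 > 0"
    by (rule adapted_frame.positive_height_from_closure [OF A(1) D refl refl cl])
  then have "cusp_frame G (gen c) v (opp c) (lvec c) w p q D J Gam"
    by (intro cusp_frame.intro cusp_frame_axioms.intro A D J g vJ UJ sub fin)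
  then show ?thesis using that A(2) by blast
qed

lemma zero_jacobi_form:
  fixes G :: "int^'N^'N"
  assumes "\<And>c. c \<in> cusps G D Gam J \<Longrightarrow> \<exists>\<Lambda>. full_lattice (UJ_perp G J c) \<Lambda>"
  shows "(\<lambda>c p is. 0) \<in> jacobi_forms G D Gam J lam k m"
proof -
  have tr: "transition G lam k m c1 c2 g x (\<lambda>is. 0) = (\<lambda>is. 0)" for c1 c2 g x
    by (simp add: transition_def tensor_map_def cong: if_cong)
  have "holomorphic_fun S (\<lambda>z. 0)" for S :: "(complex^'N) set"
    unfolding holomorphic_fun_def by (auto intro!: exI [of _ "\<lambda>_. 0"])
  then have "(\<lambda>c p is. 0) \<in> holomorphic_sections G D Gam J lam k m"
    by (simp add: holomorphic_sections_def tr zero_in_schur)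
  moreover have "holomorphic_at_cusp G D J m (\<lambda>c p is. 0) c" if c: "c \<in> cusps G D Gam J" for c
  proof -
    obtain \<Lambda> where "full_lattice (UJ_perp G J c) \<Lambda>" using assms [OF c] by blast
    then show ?thesis
      unfolding holomorphic_at_cusp_def by (intro exI [of _ \<Lambda>] exI [of _ "\<lambda>x is. 0"]) simp
  qed
  ultimately show ?thesis by (simp add: jacobi_forms_def GamJ_invariant_def tr)
qed

theorem corollary8p18:
  fixes G :: "int^'N^'N" and D J :: "(complex^'N) set" and Gam :: "(complex^'N^'N) set"
    and n m :: nat and lam :: "nat list" and k :: int
  assumes "is_lattice G" and "has_signature G 2 n" and "n \<ge> 3"
    and "D \<in> components (period_cone G)"
    and "subgroup Gam (Oplus G D)" and "finite (rcosets\<^bsub>Oplus G D\<^esub> Gam)"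
    and "primitive_isotropic G J 2"
    and "length lam = n" and "sorted_wrt (\<ge>) lam"
    and "conj_part lam 1 + conj_part lam 2 \<le> n" and "lam \<noteq> replicate n 1"
    and "m > 0"
    and "real_of_int k + real (lam ! 0) < real n / 2 - 1"
  shows "jacobi_forms G D Gam J lam k m = {\<lambda>c p is. 0}"
proof (intro equalityI subsetI)
  note frame = cusp_frame_exists [OF assms(1,2,4,5,6,7)]
  fix \<phi> assume \<phi>: "\<phi> \<in> jacobi_forms G D Gam J lam k m"
  have "\<phi> c P = (\<lambda>is. 0)" for c P
  proof (cases "c \<in> cusps G D Gam J \<and> P \<in> VJ D J")
    case True
    then obtain x where x: "x \<in> D" "P = projJ J x" and c: "c \<in> cusps G D Gam J" by (auto simp: VJ_def)
    obtain v w p q where F: "cusp_frame G (gen c) v (opp c) (lvec c) w p q D J Gam" "n \<le> p + 2"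
      by (rule frame [OF c])
    have "real n \<le> real p + 2" using F(2) by linarith
    then have "2 * (real_of_int k + real (lam ! 0)) < real p" using assms(13) by argo
    then have "real_of_int (2 * (k + int (lam ! 0))) < real_of_int (int p)" by simp
    then have "2 * (k + int (lam ! 0)) < int p" by (simp only: of_int_less_iff)
    then show ?thesis
      unfolding x(2) by (rule cusp_frame.section_vanishes [OF F(1) assms(12,9) _ \<phi> c refl refl refl x(1)])
  next
    case False
    then show ?thesis using \<phi> unfolding jacobi_forms_def holomorphic_sections_def by blast
  qed
  then show "\<phi> \<in> {\<lambda>c p is. 0}" by (simp add: fun_eq_iff)
next
  fix \<phi> :: "'N boundary_section" assume "\<phi> \<in> {\<lambda>c p is. 0}"
  moreover have "\<exists>\<Lambda>. full_lattice (UJ_perp G J c) \<Lambda>" if "c \<in> cusps G D Gam J" for c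
    by (rule cusp_frame_exists [OF assms(1,2,4,5,6,7) that]) (rule cusp_frame.full_lattice_exists; (assumption | rule refl))
  ultimately show "\<phi> \<in> jacobi_forms G D Gam J lam k m" using zero_jacobi_form by blast
qed

end
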